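(* Let $d\in\mathbb N$, let $(t_k)_{k=1}^\infty\subset\mathbb C$ satisfy $t_1=0$, $|t_2|<\frac12$ and $t_k=0$ for $k>d+1$, and let $D\subset\mathbb C$ be a compact domain containing the origin as an interior point such that the function $$U(z)=|z|^2-2\,\mathrm{Re}\sum_{k=2}^{d+1}t_kz^k$$ is positive on $D\setminus\{0\}$. Then there exists $\delta>0$ such that for all $0<t_0<\delta$ the following holds: there is a unique positively oriented polynomial curve $\gamma$ of degree at most $d$ which encircles the origin, encloses area $\pi t_0$ and has exterior harmonic moments $(t_k)_{k=1}^\infty$; and the equilibrium measure $\mu$ for the potential $V=\frac1{t_0}U$ on $D$ is $$\mu=\frac1{\pi t_0}\lambda_{D_+},$$ where $D_+$ is the interior domain of $\gamma$ and $\lambda_{D_+}$ is the Lebesgue measure on $D_+$.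
   Context: A polynomial curve of degree $d$ is a smooth simple closed curve in $\mathbb C$ with a parametrisation $h:S^1\to\mathbb C$ of the form $h(w)=rw+\sum_{j=0}^d a_jw^{-j}$, $|w|=1$, with $r>0$ and $a_d\neq0$; "degree at most $d$" means that a parametrisation of this form exists with $a_d=0$ allowed. It is positively oriented if the orientation induced by the counterclockwise orientation of $S^1$ is counterclockwise. The exterior harmonic moments of a polynomial curve $\gamma$ encircling the origin are $t_k=\frac1{2\pi \mathrm i k}\oint_\gamma \bar z z^{-k}\,dz$, $k\ge1$. For a continuous real function $V$ on a compact $D\subset\mathbb C$, let $\mathcal M(D)$ be the set of Borel probability measures on $D$ without point masses and, for $\mu\in\mathcal M(D)$, $I_V(\mu)=\int V(z)\,d\mu(z)+\iint_{z\ne\zeta}\log|z-\zeta|^{-1}\,d\mu(\zeta)\,d\mu(z)$. The equilibrium measure for $V$ on $D$ is the (unique) $\mu_0\in\mathcal M(D)$ with $I_V(\mu_0)=\inf_{\mu\in\mathcal M(D)}I_V(\mu)$. *)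

theory Defs
  imports "HOL-Complex_Analysis.Complex_Analysis" "HOL-Probability.Probability"
begin

definition laurent_map :: "nat \<Rightarrow> real \<Rightarrow> (nat \<Rightarrow> complex) \<Rightarrow> complex \<Rightarrow> complex"
  where "laurent_map d r a w = of_real r * w + (\<Sum>j=0..d. a j / w ^ j)"

text \<open>
  The unit circle is traversed counterclockwise by \<^term>\<open>circlepath 0 1\<close>, and a curve
  parametrised by \<open>h\<close> on the circle is represented by the path \<open>h \<circ> circlepath 0 1\<close>.  A smooth
  simple closed curve is a simple closed path whose velocity vanishes nowhere.  The
  coefficient \<open>a d\<close> may be zero, so the degree is at most \<open>d\<close>.
\<close>

definition polynomial_parametrisation :: "nat \<Rightarrow> (real \<Rightarrow> complex) \<Rightarrow> bool"
  where "polynomial_parametrisation d p \<longleftrightarrow>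
    (\<exists>r a. r > 0 \<and> p = laurent_map d r a \<circ> circlepath 0 1) \<and>
    simple_path p \<and> (\<forall>s\<in>{0..1}. vector_derivative p (at s) \<noteq> 0)"

definition positively_oriented :: "(real \<Rightarrow> complex) \<Rightarrow> bool"
  where "positively_oriented p \<longleftrightarrow> (\<forall>z \<in> inside (path_image p). winding_number p z = 1)"

definition exterior_moment :: "(real \<Rightarrow> complex) \<Rightarrow> nat \<Rightarrow> complex"
  where "exterior_moment p k =
    1 / (2 * of_real pi * \<i> * of_nat k) * contour_integral p (\<lambda>z. cnj z / z ^ k)"

text \<open>
  A curve is a set of points \<open>\<gamma>\<close>; its interior domain is \<^term>\<open>inside \<gamma>\<close>.  Positive
  orientation is a property of the parametrisation: an ellipse, for instance, has
  parametrisations of the above form with either orientation.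
\<close>

definition polynomial_curve_with_moments ::
    "nat \<Rightarrow> real \<Rightarrow> (nat \<Rightarrow> complex) \<Rightarrow> complex set \<Rightarrow> bool"
  where "polynomial_curve_with_moments d t0 t \<gamma> \<longleftrightarrow>
    (\<exists>p. polynomial_parametrisation d p \<and> path_image p = \<gamma> \<and> positively_oriented p \<and>
         0 \<in> inside \<gamma> \<and> measure lebesgue (inside \<gamma>) = pi * t0 \<and>
         (\<forall>k\<ge>1. exterior_moment p k = t k))"

definition compact_domain :: "complex set \<Rightarrow> bool"
  where "compact_domain D \<longleftrightarrow>
    compact D \<and> (\<exists>W. open W \<and> connected W \<and> W \<noteq> {} \<and> D = closure W)"

text \<open>
  A Borel measure on \<open>D\<close> is represented by the Borel measure on the whole plane that gives no
  mass to the complement of \<open>D\<close>.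
\<close>

definition admissible_measures :: "complex set \<Rightarrow> complex measure set"
  where "admissible_measures D =
    {\<mu>. sets \<mu> = sets borel \<and> prob_space \<mu> \<and> emeasure \<mu> (- D) = 0 \<and>
         (\<forall>z. emeasure \<mu> {z} = 0)}"

definition log_kernel :: "complex \<Rightarrow> complex \<Rightarrow> real"
  where "log_kernel z \<zeta> = (if z \<noteq> \<zeta> then ln (inverse (cmod (z - \<zeta>))) else 0)"

text \<open>
  The double integral may be \<open>\<infinity>\<close>, so it is formed as the difference of the integrals of the
  positive and negative parts of the kernel (\<^term>\<open>ennreal\<close> sends negative reals to \<open>0\<close>).  For
  a bounded \<open>D\<close> the negative part has a finite integral.
\<close>

definition log_energy :: "complex measure \<Rightarrow> ereal"
  where "log_energy \<mu> =
    enn2ereal (\<integral>\<^sup>+z. (\<integral>\<^sup>+\<zeta>. ennreal (log_kernel z \<zeta>) \<partial>\<mu>) \<partial>\<mu>) -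
    enn2ereal (\<integral>\<^sup>+z. (\<integral>\<^sup>+\<zeta>. ennreal (- log_kernel z \<zeta>) \<partial>\<mu>) \<partial>\<mu>)"

definition weighted_energy ::
    "complex set \<Rightarrow> (complex \<Rightarrow> real) \<Rightarrow> complex measure \<Rightarrow> ereal"
  where "weighted_energy D V \<mu> = ereal (LINT z:D|\<mu>. V z) + log_energy \<mu>"

definition is_equilibrium_measure ::
    "complex set \<Rightarrow> (complex \<Rightarrow> real) \<Rightarrow> complex measure \<Rightarrow> bool"
  where "is_equilibrium_measure D V \<mu> \<longleftrightarrow>
    \<mu> \<in> admissible_measures D \<and>
    weighted_energy D V \<mu> = (INF \<nu>\<in>admissible_measures D. weighted_energy D V \<nu>) \<and>
    (\<forall>\<mu>'\<in>admissible_measures D.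
       weighted_energy D V \<mu>' = (INF \<nu>\<in>admissible_measures D. weighted_energy D V \<nu>) \<longrightarrow>
       \<mu>' = \<mu>)"

definition moment_potential :: "nat \<Rightarrow> (nat \<Rightarrow> complex) \<Rightarrow> complex \<Rightarrow> real"
  where "moment_potential d t z = (cmod z)\<^sup>2 - 2 * Re (\<Sum>k=2..d+1. t k * z ^ k)"

end

theory Submission
  imports Defs
begin

text \<open>
  Let \<open>P\<close> be the sum of the \<open>t\<^sub>k z\<^sup>k\<close>, let \<open>\<Omega>\<close> be the interior of a curve with moments \<open>t\<^sub>k\<close>, and let \<open>C\<close> be
  the Cauchy transform of Lebesgue measure on \<open>\<Omega>\<close> divided by \<open>\<pi>\<close>.  The moment conditions say that
  \<open>cnj z - C z = P' z\<close> on \<open>\<Omega>\<close>.  Green's formula, which this needs, is obtained from Fubini's theorem: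
  on a large disc \<open>cnj\<close> is itself the Cauchy transform of the disc, so that path integrals of \<open>cnj\<close>
  become area integrals of winding numbers.  As \<open>|C|\<close> is at most twice the square root of \<open>t0\<close> while
  \<open>|cnj z - P' z|\<close> is comparable to \<open>|z|\<close> near the origin, \<open>\<Omega>\<close> is small, and so are the coefficients of
  the parametrisation \<open>h\<close>.  Comparing coefficients of \<open>cnj h = P'(h) + C(h)\<close> on the unit circle gives a
  fixed point equation for them.  It is a contraction because \<open>2 |t\<^sub>2| < 1\<close>; it produces a curve for every
  small area, and it shows that every curve is close to an ellipse.

  The gradient of the effective potential \<open>f\<close> (the external potential plus twice the logarithmic
  potential of \<open>\<Omega>\<close>, up to normalisation) is \<open>cnj z - P' z - C z\<close>.  It vanishes on \<open>\<Omega>\<close>, and at an exterior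
  point \<open>h w\<close> it is the conjugate of \<open>h w - h (1 / cnj w)\<close>, so for a near-ellipse \<open>f\<close> increases along the
  images of rays.  Far away positivity of the potential takes over.  Hence \<open>f\<close> is minimal on \<open>\<Omega>\<close>, which
  together with the strict convexity of the logarithmic energy makes normalised Lebesgue measure on \<open>\<Omega>\<close>
  the unique equilibrium measure.  As that measure determines the curve, the curve is unique.
\<close>

section \<open>Lebesgue measure in the plane\<close>

text \<open>The fixed point equation yields a curve for each small leading coefficient
  \<open>r\<close>, and the intermediate value theorem in \<open>r\<close> prescribes the area.
  Hence every smallness constant is chosen from \<open>t\<close>, \<open>d\<close> and
  \<open>D\<close> alone and serves all curves with the given moments and area at once. All lengths
  scale like \<open>sqrt t0\<close>: positivity of the potential controls the points beyond a fixed
  multiple of \<open>sqrt t0\<close>, the ray argument controls the remaining ones. The energy of a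
  competing measure may be infinite, so strict convexity is not formulated for signed measures but
  as 2 I(mu,nu) <= I(mu,mu) + I(nu,nu) in the extended non-negative reals, after the kernel has been
  shifted by \<open>ln M\<close> to be non-negative on \<open>D\<close>. Frullani's integral writes
  this kernel as a superposition of Gaussians, and a Gaussian is a convolution square of Gaussians.
  This reduces the inequality and its equality case to those for two real numbers.\<close>

lemma lborel_complex_vec:
  "distr lborel borel (\<lambda>v :: real^2. Complex (v $ 1) (v $ 2)) = lborel"
proof (rule lborel_eqI[symmetric])
  have m [measurable]: "(\<lambda>v :: real^2. Complex (v $ 1) (v $ 2)) \<in> borel_measurable borel"
    by (intro borel_measurable_continuous_onI continuous_intros)
  fix l u :: complex assume le: "\<And>b. b \<in> Basis \<Longrightarrow> l \<bullet> b \<le> u \<bullet> b"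
  have b2: "(Basis :: (real^2) set) = {axis 1 1, axis 2 1}"
    by (auto simp: Basis_vec_def UNIV_2)
  have ne: "axis 1 1 \<noteq> (axis 2 1 :: real^2)" by (simp add: axis_eq_axis)
  have eq: "(\<lambda>v :: real^2. Complex (v $ 1) (v $ 2)) -` box l u =
      box (vector [Re l, Im l]) (vector [Re u, Im u])"
    by (auto simp: box_def b2 Basis_complex_def inner_axis)
  have le': "Re l \<le> Re u" "Im l \<le> Im u" using le[of 1] le[of \<i>] by (auto simp: Basis_complex_def)
  have "emeasure (distr lborel borel (\<lambda>v :: real^2. Complex (v $ 1) (v $ 2))) (box l u) =
    emeasure lborel (box (vector [Re l, Im l]) (vector [Re u, Im u]) :: (real^2) set)"
    by (subst emeasure_distr) (auto simp: eq)
  also have "\<dots> = (\<Prod>b\<in>Basis. (u - l) \<bullet> b)"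
    using le' ne by (subst emeasure_lborel_box_eq)
      (auto simp: b2 Basis_complex_def inner_axis ennreal_mult' complex_eq_iff)
  finally show "emeasure (distr lborel borel (\<lambda>v :: real^2. Complex (v $ 1) (v $ 2))) (box l u) =
    (\<Prod>b\<in>Basis. (u - l) \<bullet> b)" .
qed simp

text \<open>The preimage under multiplication by \<open>e\<close> is the image under multiplication
  by \<open>cnj e\<close>, an orthogonal map of \<open>real^2\<close>. Invariance of Lebesgue
  measure under such maps is carried to the complex plane by
  \<open>lborel_complex_vec\<close>.\<close>

lemma lborel_complex_rotate:
  assumes "cmod e = 1"
  shows "distr lborel borel (\<lambda>z. e * z) = (lborel :: complex measure)"
proof (rule lborel_eqI[symmetric])
  let ?T = "\<lambda>v :: real^2. Complex (v $ 1) (v $ 2)"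
  let ?R = "\<lambda>v :: real^2. (vector [Re (cnj e * ?T v), Im (cnj e * ?T v)] :: real^2)"
  have m [measurable]: "?T \<in> borel_measurable borel"
    by (intro borel_measurable_continuous_onI continuous_intros)
  have ee: "e * cnj e = 1" using assms by (simp add: complex_norm_square[symmetric])
  have orth: "orthogonal_transformation ?R"
    unfolding orthogonal_transformation
  proof (intro conjI allI)
    show "linear ?R"
      by (intro linearI) (auto simp: vec_eq_iff forall_2 algebra_simps)
    fix v :: "real^2"
    have "(Re (cnj e * ?T v))^2 + (Im (cnj e * ?T v))^2 = (cmod (cnj e * ?T v))^2"
      by (simp add: cmod_power2)
    also have "\<dots> = (v $ 1)^2 + (v $ 2)^2" using assms by (simp add: norm_mult cmod_power2)
    finally show "norm (?R v) = norm v"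
      by (simp add: norm_vec_def L2_set_def sum_2)
  qed
  fix l u :: complex assume le: "\<And>b. b \<in> Basis \<Longrightarrow> l \<bullet> b \<le> u \<bullet> b"
  have TR: "?T (?R v) = cnj e * ?T v" for v by (simp add: complex_eq_iff)
  have bi: "bij ?R" using orth orthogonal_transformation_bij by blast
  have im: "?R ` (?T -` box l u) = ?T -` ((\<lambda>z. e * z) -` box l u)"
  proof (intro equalityI subsetI)
    fix w assume "w \<in> ?R ` (?T -` box l u)"
    then obtain v where v: "w = ?R v" "?T v \<in> box l u" by auto
    then have "e * ?T w = ?T v" using TR[of v] ee by (simp add: mult.assoc[symmetric])
    then show "w \<in> ?T -` ((\<lambda>z. e * z) -` box l u)" using v by simp
  next
    fix w assume w: "w \<in> ?T -` ((\<lambda>z. e * z) -` box l u)"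
    obtain v where v: "w = ?R v" using surjD[OF bij_is_surj[OF bi], of w] by blast
    then have "e * ?T w = ?T v" using TR[of v] ee by (simp add: mult.assoc[symmetric])
    then have "?T v \<in> box l u" using w by simp
    then show "w \<in> ?R ` (?T -` box l u)" using v by blast
  qed
  have sb: "?T -` box l u \<in> sets borel"
    using measurable_sets[OF m, of "box l u"] by simp
  have sb2: "?T -` ((\<lambda>z. e * z) -` box l u) \<in> sets borel"
  proof -
    have "(\<lambda>v. e * ?T v) \<in> borel_measurable borel" by measurable
    from measurable_sets[OF this, of "box l u"] show ?thesis by (simp add: vimage_def)
  qed
  have emb: "emeasure lborel (?T -` A) = emeasure lborel A" if "A \<in> sets borel" for A
    using emeasure_distr[of ?T lborel borel A] that by (simp add: lborel_complex_vec)
  have fin: "emeasure lborel (?T -` box l u) < \<infinity>"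
    using emb[of "box l u"] by (simp add: emeasure_lborel_box_eq)
  then have lm: "?T -` box l u \<in> lmeasurable"
    using sb by (auto simp: fmeasurable_def)
  have "emeasure (distr lborel borel (\<lambda>z. e * z)) (box l u) = emeasure lborel ((\<lambda>z. e * z) -` box l u)"
    by (subst emeasure_distr) auto
  also have "\<dots> = emeasure lborel (?T -` ((\<lambda>z. e * z) -` box l u))"
    by (rule emb[symmetric]) (use measurable_sets[of "\<lambda>z. e * z" borel borel "box l u"] in simp)
  also have "\<dots> = emeasure lebesgue (?R ` (?T -` box l u))"
    using sb2 im by simp
  also have "\<dots> = emeasure lebesgue (?T -` box l u)"
    using measure_orthogonal_image[OF orth lm] measurable_orthogonal_image[OF orth lm] lm
    by (simp add: emeasure_eq_measure2)
  also have "\<dots> = emeasure lborel (box l u)" using emb[of "box l u"] sb by simp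
  also have "\<dots> = (\<Prod>b\<in>Basis. (u - l) \<bullet> b)" using le by (simp add: emeasure_lborel_box_eq)
  finally show "emeasure (distr lborel borel (\<lambda>z. e * z)) (box l u) = (\<Prod>b\<in>Basis. (u - l) \<bullet> b)" .
qed simp

text \<open>Layer-cake estimate: the set where \<open>1 / cmod (z - \<zeta>)\<close> exceeds
  \<open>t\<close> is a disc of area \<open>pi / t^2\<close>, and its part in \<open>E\<close> has
  area at most \<open>pi * \<epsilon>^2\<close>. The two bounds agree at
  \<open>t = 1 / \<epsilon>\<close>, and each side of that level contributes
  \<open>pi * \<epsilon>\<close>. The disc of radius \<open>\<epsilon>\<close> about
  \<open>z\<close> attains the bound.\<close>

lemma nn_integral_inverse_dist_le:
  fixes E :: "complex set"
  assumes E: "E \<in> sets borel" "emeasure lborel E \<le> ennreal (pi * \<epsilon>^2)" and "\<epsilon> > 0"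
  shows "(\<integral>\<^sup>+\<zeta>. ennreal (indicator E \<zeta> / cmod (z - \<zeta>)) \<partial>lborel) \<le> ennreal (2 * pi * \<epsilon>)"
proof -
  have [measurable]: "E \<in> sets borel" by fact
  \<comment> \<open>At \<open>\<zeta> = z\<close> the quotient is 0 by convention, whereas for
    \<open>z\<close> in \<open>E\<close> the integral over levels is infinite; the point is
    discarded as a null set.\<close>
  have lc: "ennreal (indicator E \<zeta> / cmod (z - \<zeta>)) =
      (\<integral>\<^sup>+t. indicator {(t, \<zeta>). 0 \<le> t \<and> t * cmod (z - \<zeta>) < 1 \<and> \<zeta> \<in> E} (t, \<zeta>) \<partial>(lborel :: real measure))"
      if "\<zeta> \<noteq> z" for \<zeta>
  proof -
    have "(\<integral>\<^sup>+t. indicator {(t, \<zeta>). 0 \<le> t \<and> t * cmod (z - \<zeta>) < 1 \<and> \<zeta> \<in> E} (t, \<zeta>) \<partial>(lborel :: real measure))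
      = (\<integral>\<^sup>+t. indicator {0 ..< indicator E \<zeta> / cmod (z - \<zeta>)} t \<partial>(lborel :: real measure))"
      using that by (intro nn_integral_cong) (cases "\<zeta> \<in> E", auto simp: indicator_def field_simps mult_less_0_iff)
    then show ?thesis by (simp add: emeasure_lborel_Ico)
  qed
  have "(\<integral>\<^sup>+\<zeta>. ennreal (indicator E \<zeta> / cmod (z - \<zeta>)) \<partial>lborel) =
    (\<integral>\<^sup>+\<zeta>. (\<integral>\<^sup>+t. indicator {(t, \<zeta>). 0 \<le> t \<and> t * cmod (z - \<zeta>) < 1 \<and> \<zeta> \<in> E} (t, \<zeta>) \<partial>(lborel :: real measure)) \<partial>lborel)"
    by (intro nn_integral_cong_AE) (use AE_lborel_singleton[of z] lc in \<open>auto elim!: eventually_mono\<close>)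
  also have "\<dots> = (\<integral>\<^sup>+t. (\<integral>\<^sup>+\<zeta>. indicator {(t, \<zeta>). 0 \<le> t \<and> t * cmod (z - \<zeta>) < 1 \<and> \<zeta> \<in> E} (t, \<zeta>) \<partial>lborel) \<partial>(lborel :: real measure))"
    by (rule lborel_pair.Fubini') measurable
  also have "\<dots> \<le> (\<integral>\<^sup>+t. ennreal (pi * \<epsilon>^2) * indicator {0..1/\<epsilon>} t + ennreal (pi * (1 / t^2)) * indicator {1/\<epsilon>..} t \<partial>(lborel :: real measure))"
  proof (rule nn_integral_mono)
    fix t :: real
    have "(\<integral>\<^sup>+\<zeta>. indicator {(t, \<zeta>). 0 \<le> t \<and> t * cmod (z - \<zeta>) < 1 \<and> \<zeta> \<in> E} (t, \<zeta>) \<partial>lborel)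
       \<le> (\<integral>\<^sup>+\<zeta>. indicator E \<zeta> \<partial>lborel)" by (intro nn_integral_mono) (auto simp: indicator_def)
    then have 1: "(\<integral>\<^sup>+\<zeta>. indicator {(t, \<zeta>). 0 \<le> t \<and> t * cmod (z - \<zeta>) < 1 \<and> \<zeta> \<in> E} (t, \<zeta>) \<partial>lborel) \<le> ennreal (pi * \<epsilon>^2)"
      using E(2) by simp
    have 2: "(\<integral>\<^sup>+\<zeta>. indicator {(t, \<zeta>). 0 \<le> t \<and> t * cmod (z - \<zeta>) < 1 \<and> \<zeta> \<in> E} (t, \<zeta>) \<partial>lborel) \<le> ennreal (pi * (1 / t^2))" if "t > 0"
    proof -
      have "(\<integral>\<^sup>+\<zeta>. indicator {(t, \<zeta>). 0 \<le> t \<and> t * cmod (z - \<zeta>) < 1 \<and> \<zeta> \<in> E} (t, \<zeta>) \<partial>lborel)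
       \<le> (\<integral>\<^sup>+\<zeta>. indicator (ball z (1/t)) \<zeta> \<partial>lborel)" using that
        by (intro nn_integral_mono) (auto simp: indicator_def dist_norm field_simps)
      also have "\<dots> = ennreal (pi * (1 / t^2))"
        using that by (simp add: emeasure_ball unit_ball_vol_2 power_divide ennreal_mult'[symmetric])
      finally show ?thesis .
    qed
    show "(\<integral>\<^sup>+\<zeta>. indicator {(t, \<zeta>). 0 \<le> t \<and> t * cmod (z - \<zeta>) < 1 \<and> \<zeta> \<in> E} (t, \<zeta>) \<partial>lborel)
      \<le> ennreal (pi * \<epsilon>^2) * indicator {0..1/\<epsilon>} t + ennreal (pi * (1 / t^2)) * indicator {1/\<epsilon>..} t"
    proof (cases "t < 0")
      case True
      then have "(\<integral>\<^sup>+\<zeta>. indicator {(t, \<zeta>). 0 \<le> t \<and> t * cmod (z - \<zeta>) < 1 \<and> \<zeta> \<in> E} (t, \<zeta>) \<partial>lborel) = 0"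
        by simp
      then show ?thesis by simp
    next
      case False
      show ?thesis
      proof (cases "t \<le> 1/\<epsilon>")
        case True
        then have "indicator {0..1/\<epsilon>} t = (1::ennreal)" using False by simp
        then show ?thesis by (intro order.trans[OF 1]) simp
      next
        case f: False
        then have "indicator {1/\<epsilon>..} t = (1::ennreal)" by simp
        moreover have "t > 0" using f assms by (smt (verit) divide_pos_pos)
        ultimately show ?thesis by (intro order.trans[OF 2]) simp_all
      qed
    qed
  qed
  also have "\<dots> = (\<integral>\<^sup>+t. ennreal (pi * \<epsilon>^2) * indicator {0..1/\<epsilon>} t \<partial>(lborel :: real measure)) + (\<integral>\<^sup>+t. ennreal (pi * (1 / t^2)) * indicator {1/\<epsilon>..} t \<partial>(lborel :: real measure))"
    by (rule nn_integral_add) auto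
  also have "(\<integral>\<^sup>+t. ennreal (pi * \<epsilon>^2) * indicator {0..1/\<epsilon>} t \<partial>(lborel :: real measure)) = ennreal (pi * \<epsilon>)"
    using \<open>\<epsilon> > 0\<close> by (simp add: nn_integral_cmult_indicator emeasure_lborel_Icc ennreal_mult'[symmetric] power2_eq_square)
  also have "(\<integral>\<^sup>+t. ennreal (pi * (1 / t^2)) * indicator {1/\<epsilon>..} t \<partial>(lborel :: real measure)) = ennreal (0 - (- pi / (1/\<epsilon>)))"
  proof (rule nn_integral_FTC_atLeast)
    show "((\<lambda>t. - pi / t) \<longlongrightarrow> 0) at_top" by real_asymp
    fix x assume "1/\<epsilon> \<le> x"
    then have "x > 0" using assms by (smt (verit) divide_pos_pos)
    then show "((\<lambda>t. - pi / t) has_real_derivative pi * (1 / x\<^sup>2)) (at x)"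
      by (auto intro!: derivative_eq_intros simp: power2_eq_square)
  qed auto
  also have "ennreal (pi * \<epsilon>) + ennreal (0 - (- pi / (1/\<epsilon>))) = ennreal (2 * pi * \<epsilon>)"
    using assms by (simp add: ennreal_plus[symmetric] del: ennreal_plus)
  finally show ?thesis .
qed

section \<open>Means over the unit circle\<close>

definition circle_point :: "real \<Rightarrow> complex"
  where "circle_point x = exp (2 * of_real pi * \<i> * of_real x)"

text \<open>Mean with respect to normalised arc length. A Bochner integral is taken so that Fubini's
  theorem against area integrals applies directly; \<open>circle_mean_eq_integral\<close> leads back
  to contour integrals.\<close>

definition circle_mean :: "(complex \<Rightarrow> complex) \<Rightarrow> complex"
  where "circle_mean f = (LINT x:{0..1}|lborel. f (circle_point x))"

lemma circlepath_eq_circle_point: "circlepath 0 1 = circle_point"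
  by (simp add: fun_eq_iff circlepath circle_point_def)

lemma norm_circle_point [simp]: "cmod (circle_point x) = 1"
  by (simp add: circle_point_def)

lemma circle_point_nonzero [simp]: "circle_point x \<noteq> 0"
  by (simp add: circle_point_def)

lemma continuous_circle_point [continuous_intros]: "continuous_on A circle_point"
  unfolding circle_point_def by (intro continuous_intros)

lemma circle_point_has_vector_derivative:
  "(circle_point has_vector_derivative (2 * of_real pi * \<i> * circle_point x)) (at x within A)"
  using has_vector_derivative_circlepath[of 0 1 x A]
  by (simp add: circlepath_eq_circle_point circle_point_def)

lemma circle_point_minus: "circle_point (1 - x) = cnj (circle_point x)"
  by (simp add: circle_point_def exp_cnj algebra_simps exp_diff exp_minus inverse_eq_divide)

lemma cnj_circle_point: "cnj (circle_point x) = inverse (circle_point x)"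
  by (simp add: circle_point_def exp_cnj exp_minus)

lemma circle_point_surj:
  assumes "cmod w = 1"
  obtains x where "0 \<le> x" "x < 1" "w = circle_point x"
proof -
  obtain t where t: "0 \<le> t" "t < 2 * pi" "w = exp (\<i> * of_real t)"
    using complex_unimodular_polar assms cis_conv_exp
    by (metis Arg2pi complex_split_polar Arg2pi_eq mult_1 of_real_1)
  show ?thesis
    by (rule that[of "t / (2 * pi)"]) (use t in \<open>auto simp: circle_point_def field_simps\<close>)
qed

lemma circle_mean_set_integrable:
  fixes f :: "complex \<Rightarrow> complex"
  assumes "continuous_on (sphere 0 1) f"
  shows "set_integrable lborel {0..1} (\<lambda>x. f (circle_point x))"
  by (rule borel_integrable_atLeastAtMost')
     (rule continuous_on_compose2[OF assms], auto intro!: continuous_intros)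

lemma circle_mean_eq_integral:
  assumes "continuous_on (sphere 0 1) f"
  shows "circle_mean f = integral {0..1} (\<lambda>x. f (circle_point x))"
  unfolding circle_mean_def
  by (rule set_borel_integral_eq_integral(2)[OF circle_mean_set_integrable[OF assms]])

lemma circle_mean_cong:
  "(\<And>w. cmod w = 1 \<Longrightarrow> f w = g w) \<Longrightarrow> circle_mean f = circle_mean g"
  unfolding circle_mean_def by (rule set_lebesgue_integral_cong) auto

lemma circle_mean_cnj_arg: "circle_mean (\<lambda>w. f (cnj w)) = circle_mean f"
proof -
  have "circle_mean f = (\<integral>x. indicator {0..1} (1 - x) *\<^sub>R f (circle_point (1 - x)) \<partial>lborel)"
    unfolding circle_mean_def set_lebesgue_integral_def
    by (subst lborel_integral_real_affine[where c = "-1" and t = 1]) auto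
  also have "\<dots> = circle_mean (\<lambda>w. f (cnj w))"
    unfolding circle_mean_def set_lebesgue_integral_def
    by (intro Bochner_Integration.integral_cong) (auto simp: indicator_def circle_point_minus)
  finally show ?thesis ..
qed

text \<open>On the unit circle \<open>1 / w\<close> is \<open>cnj w\<close>, which merely reverses
  the parametrisation. Functions analytic outside the circle thereby become functions analytic
  inside, where Cauchy's theorem applies.\<close>

lemma circle_mean_inverse_arg: "circle_mean (\<lambda>w. f (1 / w)) = circle_mean f"
proof -
  have "circle_mean (\<lambda>w. f (1 / w)) = circle_mean (\<lambda>w. f (cnj w))"
    unfolding circle_mean_def
    by (rule set_lebesgue_integral_cong) (auto simp: cnj_circle_point divide_inverse)
  then show ?thesis by (simp add: circle_mean_cnj_arg)
qed

lemma circle_mean_cnj: "circle_mean (\<lambda>w. cnj (f w)) = cnj (circle_mean f)"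
  unfolding circle_mean_def set_lebesgue_integral_def
  by (subst Bochner_Integration.integral_cnj[symmetric]) (simp del: Bochner_Integration.integral_cnj)

lemma circle_mean_add:
  assumes "continuous_on (sphere 0 1) f" "continuous_on (sphere 0 1) g"
  shows "circle_mean (\<lambda>w. f w + g w) = circle_mean f + circle_mean g"
  unfolding circle_mean_def
  by (intro set_integral_add circle_mean_set_integrable assms)

lemma circle_mean_diff:
  assumes "continuous_on (sphere 0 1) f" "continuous_on (sphere 0 1) g"
  shows "circle_mean (\<lambda>w. f w - g w) = circle_mean f - circle_mean g"
  unfolding circle_mean_def
  by (intro set_integral_diff circle_mean_set_integrable assms)

lemma circle_mean_mult_left: "circle_mean (\<lambda>w. c * f w) = c * circle_mean f"
  unfolding circle_mean_def by simp

lemma circle_mean_zero [simp]: "circle_mean (\<lambda>w. 0) = 0"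
  unfolding circle_mean_def by simp

lemma circle_mean_sum:
  assumes "finite I" "\<And>i. i \<in> I \<Longrightarrow> continuous_on (sphere 0 1) (f i)"
  shows "circle_mean (\<lambda>w. \<Sum>i\<in>I. f i w) = (\<Sum>i\<in>I. circle_mean (f i))"
  using assms
proof (induction I rule: finite_induct)
  case (insert i I)
  then show ?case
    by (simp add: circle_mean_add continuous_on_sum)
qed simp

lemma norm_circle_mean_le:
  assumes "continuous_on (sphere 0 1) f" "\<And>w. cmod w = 1 \<Longrightarrow> cmod (f w) \<le> B"
  shows "cmod (circle_mean f) \<le> B"
proof -
  have "((\<lambda>x. f (circle_point x)) has_integral circle_mean f) (cbox 0 1)"
    using set_borel_integral_eq_integral(1)[OF circle_mean_set_integrable[OF assms(1)]]
    unfolding circle_mean_eq_integral[OF assms(1)] by (simp add: has_integral_integral)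
  moreover have "0 \<le> B" using order_trans[OF norm_ge_zero assms(2)[of 1]] by simp
  ultimately have "cmod (circle_mean f) \<le> B * measure lborel (cbox 0 (1::real))"
    by (intro has_integral_bound) (auto intro: assms(2))
  then show ?thesis by simp
qed

text \<open>The extra factor \<open>\<sigma>\<close> is the Jacobian: along the circle, d sigma is 2
  pi i sigma dx.\<close>

lemma circle_mean_Cauchy:
  assumes "continuous_on (cball 0 1) F" "F holomorphic_on ball 0 1" "cmod s < 1"
  shows "circle_mean (\<lambda>\<sigma>. F \<sigma> * \<sigma> / (\<sigma> - s)) = F s"
proof -
  have "((\<lambda>u. F u / (u - s)) has_contour_integral (2 * of_real pi * \<i> * F s)) (circlepath 0 1)"
    by (rule Cauchy_integral_circlepath) (use assms in auto)
  then have "((\<lambda>x. F (circle_point x) / (circle_point x - s) * (2 * of_real pi * \<i> * circle_point x))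
      has_integral (2 * of_real pi * \<i> * F s)) {0..1}"
    unfolding has_contour_integral_def circlepath_eq_circle_point
    using has_integral_cong vector_derivative_within_cbox
    by (smt (verit, best) atLeastAtMost_iff box_real(2) circle_point_has_vector_derivative
        has_integral_eq vector_derivative_within_cbox zero_less_one)
  then have "((\<lambda>x. F (circle_point x) / (circle_point x - s) * (2 * of_real pi * \<i> * circle_point x) / (2 * of_real pi * \<i>))
      has_integral (2 * of_real pi * \<i> * F s / (2 * of_real pi * \<i>))) {0..1}"
    by (rule has_integral_divide)
  moreover have "F (circle_point x) / (circle_point x - s) * (2 * of_real pi * \<i> * circle_point x) / (2 * of_real pi * \<i>)
      = F (circle_point x) * circle_point x / (circle_point x - s)" for x by simp
  ultimately have 1: "((\<lambda>x. F (circle_point x) * circle_point x / (circle_point x - s)) has_integral F s) {0..1}"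
    by simp
  have "continuous_on (sphere 0 1) (\<lambda>\<sigma>. F \<sigma> * \<sigma> / (\<sigma> - s))"
    using assms(3) by (intro continuous_intros continuous_on_subset[OF assms(1)]) auto
  from circle_mean_eq_integral[OF this] 1 show ?thesis
    by (simp add: integral_unique)
qed

lemma circle_mean_Cauchy_0:
  assumes "continuous_on (cball 0 1) F" "F holomorphic_on ball 0 1"
  shows "circle_mean F = F 0"
proof -
  have "circle_mean F = circle_mean (\<lambda>\<sigma>. F \<sigma> * \<sigma> / (\<sigma> - 0))"
    by (rule circle_mean_cong) auto
  then show ?thesis using circle_mean_Cauchy[OF assms, of 0] by simp
qed

lemma circle_mean_power [simp]: "circle_mean (\<lambda>w. w ^ n) = (if n = 0 then 1 else 0)"
  by (subst circle_mean_Cauchy_0) (auto intro!: continuous_intros holomorphic_intros)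

section \<open>The Cauchy transform of a plane set\<close>

text \<open>Normalised so that the d-bar derivative is the indicator of \<open>E\<close>: in the
  interior of \<open>E\<close> the transform differs from \<open>cnj\<close> by a holomorphic
  function.\<close>

definition cauchy_transform :: "complex set \<Rightarrow> complex \<Rightarrow> complex"
  where "cauchy_transform E z = of_real (1 / pi) * (LINT \<zeta>:E|lborel. 1 / (z - \<zeta>))"

lemma set_integrable_cauchy_kernel:
  fixes E :: "complex set"
  assumes "E \<in> sets borel" "emeasure lborel E \<le> ennreal (pi * \<epsilon>^2)" "\<epsilon> > 0"
  shows "set_integrable lborel E (\<lambda>\<zeta>. 1 / (z - \<zeta>))"
  unfolding set_integrable_def
proof (rule integrableI_bounded)
  have [measurable]: "E \<in> sets borel" by fact
  have [measurable]: "(\<lambda>\<zeta>. 1 / (z - \<zeta>)) \<in> borel_measurable borel"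
    by (rule borel_measurable_divide) auto
  show "(\<lambda>\<zeta>. indicator E \<zeta> *\<^sub>R (1 / (z - \<zeta>))) \<in> borel_measurable lborel" by measurable
  have "(\<integral>\<^sup>+\<zeta>. ennreal (norm (indicator E \<zeta> *\<^sub>R (1 / (z - \<zeta>)))) \<partial>lborel) =
        (\<integral>\<^sup>+\<zeta>. ennreal (indicator E \<zeta> / cmod (z - \<zeta>)) \<partial>lborel)"
    by (intro nn_integral_cong) (simp add: norm_divide divide_inverse norm_inverse)
  also have "\<dots> \<le> ennreal (2 * pi * \<epsilon>)" by (rule nn_integral_inverse_dist_le[OF assms])
  finally show "(\<integral>\<^sup>+\<zeta>. ennreal (norm (indicator E \<zeta> *\<^sub>R (1 / (z - \<zeta>)))) \<partial>lborel) < \<infinity>"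
    using le_less_trans[OF _ ennreal_less_top] by simp
qed

lemma norm_cauchy_integral_le:
  fixes E :: "complex set"
  assumes "E \<in> sets borel" "emeasure lborel E \<le> ennreal (pi * \<epsilon>^2)" "\<epsilon> > 0"
  shows "cmod (LINT \<zeta>:E|lborel. 1 / (z - \<zeta>)) \<le> 2 * pi * \<epsilon>"
proof -
  have "ennreal (cmod (LINT \<zeta>:E|lborel. 1 / (z - \<zeta>))) \<le>
     (\<integral>\<^sup>+\<zeta>. ennreal (norm (indicator E \<zeta> *\<^sub>R (1 / (z - \<zeta>)))) \<partial>lborel)"
    unfolding set_lebesgue_integral_def
    by (rule integral_norm_bound_ennreal) (use set_integrable_cauchy_kernel[OF assms] in \<open>simp add: set_integrable_def\<close>)
  also have "\<dots> = (\<integral>\<^sup>+\<zeta>. ennreal (indicator E \<zeta> / cmod (z - \<zeta>)) \<partial>lborel)"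
    by (intro nn_integral_cong) (simp add: norm_divide divide_inverse norm_inverse)
  also have "\<dots> \<le> ennreal (2 * pi * \<epsilon>)" by (rule nn_integral_inverse_dist_le[OF assms])
  finally show ?thesis using assms(3) by simp
qed

lemma norm_cauchy_transform_le:
  fixes E :: "complex set"
  assumes "E \<in> sets borel" "emeasure lborel E \<le> ennreal (pi * \<epsilon>^2)" "\<epsilon> > 0"
  shows "cmod (cauchy_transform E z) \<le> 2 * \<epsilon>"
  using norm_cauchy_integral_le[OF assms, of z] pi_gt_zero
  by (simp add: cauchy_transform_def norm_mult norm_divide field_simps)

text \<open>The kernel is singular only near the point under consideration. A small disc about it
  contributes little by \<open>norm_cauchy_integral_le\<close>, and on the rest of \<open>E\<close>
  the kernel is Lipschitz in \<open>z\<close>.\<close>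

lemma continuous_cauchy_transform:
  fixes E :: "complex set"
  assumes E: "E \<in> sets borel" "emeasure lborel E \<le> ennreal (pi * \<epsilon>^2)" "\<epsilon> > 0"
  shows "continuous_on A (cauchy_transform E)"
proof -
  let ?I = "\<lambda>E z. LINT \<zeta>:E|lborel. 1 / (z - \<zeta>)"
  have [measurable]: "E \<in> sets borel" by fact
  \<comment> \<open>\<open>4 * pi * \<eta>\<close> is twice the bound for the part of
    \<open>E\<close> within distance \<open>\<eta>\<close> of \<open>z0\<close>. Beyond it,
    \<open>z0\<close> and \<open>z\<close> are at least \<open>\<eta>\<close> and
    \<open>\<eta> / 2\<close> away from the integration point, whence the factor
    \<open>2 / \<eta>^2\<close>.\<close>
  have key: "cmod (?I E z - ?I E z0) \<le> 4 * pi * \<eta> + cmod (z - z0) * (2 / \<eta>^2 * (pi * \<epsilon>^2))"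
    if "\<eta> > 0" "cmod (z - z0) \<le> \<eta> / 2" for z z0 \<eta>
  proof -
    let ?B = "E \<inter> ball z0 \<eta>" and ?O = "E - ball z0 \<eta>"
    have eB: "emeasure lborel ?B \<le> ennreal (pi * \<eta>^2)"
    proof -
      have "emeasure lborel ?B \<le> emeasure lborel (ball z0 \<eta>)" by (rule emeasure_mono) auto
      also have "\<dots> = ennreal (pi * \<eta>^2)"
        using that(1) by (simp add: emeasure_ball unit_ball_vol_2)
      finally show ?thesis .
    qed
    have eO: "emeasure lborel ?O \<le> ennreal (pi * \<epsilon>^2)"
      by (rule order.trans[OF emeasure_mono E(2)]) auto
    have Bb: "?B \<in> sets borel" and Ob: "?O \<in> sets borel" by auto
    note iB = set_integrable_cauchy_kernel[OF Bb eB \<open>\<eta> > 0\<close>]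
    note iO = set_integrable_cauchy_kernel[OF Ob eO \<open>\<epsilon> > 0\<close>]
    have split: "?I E w = ?I ?B w + ?I ?O w" for w
    proof -
      have "?I (?B \<union> ?O) w = ?I ?B w + ?I ?O w"
        by (rule set_integral_Un[OF _ iB iO]) auto
      moreover have "?B \<union> ?O = E" by auto
      ultimately show ?thesis by simp
    qed
    have "?I ?O z - ?I ?O z0 = (LINT \<zeta>:?O|lborel. 1 / (z - \<zeta>) - 1 / (z0 - \<zeta>))"
      by (rule set_integral_diff(2)[OF iO iO, symmetric])
    also have "cmod \<dots> \<le> (LINT \<zeta>|lborel. indicator ?O \<zeta> *\<^sub>R (cmod (z - z0) * (2 / \<eta>^2)))"
      unfolding set_lebesgue_integral_def
    proof (rule Bochner_Integration.integral_norm_bound_integral)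
      show "integrable lborel (\<lambda>\<zeta>. indicat_real ?O \<zeta> *\<^sub>R (cmod (z - z0) * (2 / \<eta>\<^sup>2)))"
        by (intro integrable_scaleR_left integrable_real_indicator)
           (use eO in \<open>auto intro: le_less_trans[OF _ ennreal_less_top]\<close>)
      show "integrable lborel (\<lambda>\<zeta>. indicat_real ?O \<zeta> *\<^sub>R (1 / (z - \<zeta>) - 1 / (z0 - \<zeta>)))"
        using set_integral_diff(1)[OF iO iO, of z z0] by (simp add: set_integrable_def)
      fix \<zeta>
      show "norm (indicat_real ?O \<zeta> *\<^sub>R (1 / (z - \<zeta>) - 1 / (z0 - \<zeta>)))
          \<le> indicat_real ?O \<zeta> *\<^sub>R (cmod (z - z0) * (2 / \<eta>\<^sup>2))"
      proof (cases "\<zeta> \<in> ?O")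
        case True
        then have 1: "cmod (z0 - \<zeta>) \<ge> \<eta>" by (auto simp: dist_norm)
        then have 2: "cmod (z - \<zeta>) \<ge> \<eta> / 2"
          using that(2) norm_triangle_ineq2[of "z0 - \<zeta>" "z0 - z"] by (simp add: norm_minus_commute)
        have nz: "z - \<zeta> \<noteq> 0" "z0 - \<zeta> \<noteq> 0" using 1 2 that(1) by auto
        have "1 / (z - \<zeta>) - 1 / (z0 - \<zeta>) = (z0 - z) / ((z - \<zeta>) * (z0 - \<zeta>))"
          using nz by (simp add: field_simps)
        then have "cmod (1 / (z - \<zeta>) - 1 / (z0 - \<zeta>)) = cmod (z - z0) / (cmod (z - \<zeta>) * cmod (z0 - \<zeta>))"
          by (simp add: norm_divide norm_mult norm_minus_commute)
        also have "\<dots> \<le> cmod (z - z0) / (\<eta> / 2 * \<eta>)"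
          using 1 2 that(1) by (intro divide_left_mono mult_mono mult_pos_pos) auto
        finally show ?thesis using True that(1) by (simp add: power2_eq_square field_simps)
      qed auto
    qed
    also have "\<dots> = measure lborel ?O * (cmod (z - z0) * (2 / \<eta>\<^sup>2))"
      by simp
    also have "\<dots> \<le> (pi * \<epsilon>^2) * (cmod (z - z0) * (2 / \<eta>\<^sup>2))"
      using eO by (intro mult_right_mono) (auto simp: measure_def enn2real_leI)
    finally have 1: "cmod (?I ?O z - ?I ?O z0) \<le> cmod (z - z0) * (2 / \<eta>^2 * (pi * \<epsilon>^2))"
      by (simp add: mult_ac)
    have 2: "cmod (?I ?B w) \<le> 2 * pi * \<eta>" for w
      by (rule norm_cauchy_integral_le[OF Bb eB \<open>\<eta> > 0\<close>])
    have eq: "?I E z - ?I E z0 = (?I ?B z - ?I ?B z0) + (?I ?O z - ?I ?O z0)"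
      by (simp add: split)
    show ?thesis
      unfolding eq using 1 2[of z] 2[of z0] norm_triangle_ineq[of "?I ?B z - ?I ?B z0" "?I ?O z - ?I ?O z0"]
        norm_triangle_ineq4[of "?I ?B z" "?I ?B z0"] by linarith
  qed
  have "isCont (?I E) z0" for z0
    unfolding isCont_def LIM_def
  proof (intro allI impI)
    fix e :: real assume e: "e > 0"
    define \<eta> where "\<eta> = e / (8 * pi)"
    have \<eta>: "\<eta> > 0" "4 * pi * \<eta> = e / 2" using e by (auto simp: \<eta>_def)
    define K where "K = 2 / \<eta>^2 * (pi * \<epsilon>^2)"
    have K: "K > 0" using \<eta> E(3) by (auto simp: K_def intro!: divide_pos_pos mult_pos_pos)
    show "\<exists>s>0. \<forall>x. x \<noteq> z0 \<and> dist x z0 < s \<longrightarrow> dist (?I E x) (?I E z0) < e"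
    proof (intro exI conjI allI impI)
      show "min (\<eta> / 2) (e / (2 * K)) > 0" using \<eta> e K by auto
      fix z assume "z \<noteq> z0 \<and> dist z z0 < min (\<eta> / 2) (e / (2 * K))"
      then have z: "cmod (z - z0) \<le> \<eta> / 2" "cmod (z - z0) < e / (2 * K)" by (auto simp: dist_norm)
      then have "cmod (z - z0) * K < e / 2" using K by (simp add: field_simps)
      then show "dist (?I E z) (?I E z0) < e"
        using key[OF \<eta>(1) z(1)] \<eta>(2) unfolding K_def dist_norm by linarith
    qed
  qed
  then have "continuous_on A (?I E)" by (simp add: continuous_at_imp_continuous_on)
  then show ?thesis unfolding cauchy_transform_def[abs_def] by (intro continuous_intros)
qed

text \<open>The curve may run through \<open>E\<close>: joint integrability holds because the area
  integral of the modulus of the kernel is at most \<open>2 * pi * \<epsilon>\<close> wherever the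
  pole lies.\<close>

lemma fubini_cauchy_kernel:
  fixes p \<phi> :: "real \<Rightarrow> complex"
  assumes p: "continuous_on UNIV p" and \<phi>: "continuous_on UNIV \<phi>"
    and E: "E \<in> sets borel" "emeasure lborel E \<le> ennreal (pi * \<epsilon>^2)" "\<epsilon> > 0"
  shows "set_integrable lborel E (\<lambda>\<zeta>. LINT t:{a..b}|lborel. \<phi> t / (p t - \<zeta>))"
    and "(LINT t:{a..b}|lborel. \<phi> t * (LINT \<zeta>:E|lborel. 1 / (p t - \<zeta>))) =
         (LINT \<zeta>:E|lborel. (LINT t:{a..b}|lborel. \<phi> t / (p t - \<zeta>)))"
proof -
  have [measurable]: "E \<in> sets borel" "p \<in> borel_measurable borel" "\<phi> \<in> borel_measurable borel"
    using E p \<phi> by (auto intro: borel_measurable_continuous_onI)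
  let ?f = "\<lambda>t \<zeta>. (indicator {a..b} t * indicator E \<zeta>) *\<^sub>R (\<phi> t / (p t - \<zeta>))"
  obtain B where B: "\<And>t. t \<in> {a..b} \<Longrightarrow> cmod (\<phi> t) \<le> B" "B \<ge> 0"
  proof -
    have "compact (\<phi> ` {a..b})"
      by (intro compact_continuous_image continuous_on_subset[OF \<phi>]) auto
    then obtain B where "B > 0" "\<forall>x\<in>\<phi> ` {a..b}. norm x \<le> B"
      using compact_imp_bounded bounded_pos by metis
    then show ?thesis by (intro that[of B]) auto
  qed
  have int: "integrable (lborel \<Otimes>\<^sub>M lborel) (case_prod ?f)"
  proof (rule integrableI_bounded)
    show "case_prod ?f \<in> borel_measurable (lborel \<Otimes>\<^sub>M lborel)" by measurable
    have "(\<integral>\<^sup>+x. ennreal (norm (case_prod ?f x)) \<partial>(lborel \<Otimes>\<^sub>M lborel)) =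
      (\<integral>\<^sup>+t. \<integral>\<^sup>+\<zeta>. ennreal (norm (?f t \<zeta>)) \<partial>lborel \<partial>lborel)"
      by (subst lborel.nn_integral_fst[symmetric]) auto
    also have "\<dots> \<le> (\<integral>\<^sup>+t. ennreal (B * (2 * pi * \<epsilon>)) * indicator {a..b} t \<partial>lborel)"
    proof (rule nn_integral_mono)
      fix t
      have "(\<integral>\<^sup>+\<zeta>. ennreal (norm (?f t \<zeta>)) \<partial>lborel) \<le>
         (\<integral>\<^sup>+\<zeta>. (ennreal B * indicator {a..b} t) * ennreal (indicator E \<zeta> / cmod (p t - \<zeta>)) \<partial>lborel)"
      proof (rule nn_integral_mono)
        fix \<zeta>
        show "ennreal (norm (?f t \<zeta>)) \<le> (ennreal B * indicator {a..b} t) * ennreal (indicator E \<zeta> / cmod (p t - \<zeta>))"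
          using B by (auto simp: indicator_def norm_divide ennreal_mult'[symmetric] intro!: ennreal_leI divide_right_mono)
      qed
      also have "\<dots> = (ennreal B * indicator {a..b} t) * (\<integral>\<^sup>+\<zeta>. ennreal (indicator E \<zeta> / cmod (p t - \<zeta>)) \<partial>lborel)"
        by (rule nn_integral_cmult) auto
      also have "\<dots> \<le> (ennreal B * indicator {a..b} t) * ennreal (2 * pi * \<epsilon>)"
        by (intro mult_left_mono nn_integral_inverse_dist_le[OF E]) auto
      also have "\<dots> = ennreal (B * (2 * pi * \<epsilon>)) * indicator {a..b} t"
        using B(2) by (simp add: ennreal_mult' mult_ac)
      finally show "(\<integral>\<^sup>+\<zeta>. ennreal (norm (?f t \<zeta>)) \<partial>lborel) \<le> ennreal (B * (2 * pi * \<epsilon>)) * indicator {a..b} t" .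
    qed
    also have "\<dots> < \<infinity>"
      by (subst nn_integral_cmult_indicator) (auto simp: ennreal_mult_less_top emeasure_lborel_Icc_eq)
    finally show "(\<integral>\<^sup>+x. ennreal (norm (case_prod ?f x)) \<partial>(lborel \<Otimes>\<^sub>M lborel)) < \<infinity>" .
  qed
  have e1: "(LINT t|lborel. ?f t \<zeta>) = indicator E \<zeta> *\<^sub>R (LINT t:{a..b}|lborel. \<phi> t / (p t - \<zeta>))" for \<zeta>
    unfolding set_lebesgue_integral_def
    by (subst integral_scaleR_right[symmetric]) (simp add: mult.commute)
  have e2: "(LINT \<zeta>|lborel. ?f t \<zeta>) = indicator {a..b} t *\<^sub>R (\<phi> t * (LINT \<zeta>:E|lborel. 1 / (p t - \<zeta>)))" for t
    unfolding set_lebesgue_integral_def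
    by (subst integral_mult_right_zero[symmetric], subst integral_scaleR_right[symmetric]) (simp add: scaleR_conv_of_real mult_ac)
  show "set_integrable lborel E (\<lambda>\<zeta>. LINT t:{a..b}|lborel. \<phi> t / (p t - \<zeta>))"
    using lborel_pair.integrable_snd[OF int] unfolding e1 set_integrable_def .
  show "(LINT t:{a..b}|lborel. \<phi> t * (LINT \<zeta>:E|lborel. 1 / (p t - \<zeta>))) =
         (LINT \<zeta>:E|lborel. (LINT t:{a..b}|lborel. \<phi> t / (p t - \<zeta>)))"
    using lborel_pair.Fubini_integral[OF int] unfolding e1 e2 by (simp add: set_lebesgue_integral_def)
qed

lemma lborel_sphere_null: "sphere (a::complex) r \<in> null_sets lborel"
proof -
  have "sphere a r \<in> null_sets lebesgue"
    using negligible_sphere negligible_iff_null_sets by blast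
  then show ?thesis by (auto simp: null_sets_def)
qed

lemma emeasure_ball_complex:
  "R \<ge> 0 \<Longrightarrow> emeasure lborel (ball (a::complex) R) = ennreal (pi * R^2)"
  by (simp add: emeasure_ball unit_ball_vol_2)

text \<open>By rotation invariance the kernel can be averaged over the circles about the origin.\<close>

lemma cauchy_transform_ball:
  assumes "cmod \<zeta> < R"
  shows "cauchy_transform (ball 0 R) \<zeta> = cnj \<zeta>"
proof -
  let ?E = "ball (0::complex) R"
  let ?J = "LINT z:?E|lborel. 1 / (\<zeta> - z)"
  have R: "R > 0" using assms norm_ge_zero[of \<zeta>] by linarith
  have E [measurable]: "?E \<in> sets borel" "ball (0::complex) (cmod \<zeta>) \<in> sets borel" by auto
  have EM: "emeasure lborel ?E \<le> ennreal (pi * R^2)" using R by (simp add: emeasure_ball_complex)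
  have rot: "?J = cnj (circle_point t) * (LINT z:?E|lborel. 1 / (cnj (circle_point t) * \<zeta> - z))" for t
  proof -
    let ?e = "circle_point t"
    have m: "(\<lambda>z. indicat_real ?E z *\<^sub>R (1 / (\<zeta> - z))) \<in> borel_measurable borel" by measurable
    have "?J = (\<integral>z. indicat_real ?E z *\<^sub>R (1 / (\<zeta> - z)) \<partial>distr lborel borel (\<lambda>z. ?e * z))"
      unfolding set_lebesgue_integral_def by (simp add: lborel_complex_rotate)
    also have "\<dots> = (\<integral>z. indicat_real ?E (?e * z) *\<^sub>R (1 / (\<zeta> - ?e * z)) \<partial>lborel)"
      by (rule integral_distr) (use m in auto)
    also have "\<dots> = (\<integral>z. cnj ?e * (indicat_real ?E z *\<^sub>R (1 / (cnj ?e * \<zeta> - z))) \<partial>lborel)"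
    proof (intro Bochner_Integration.integral_cong refl)
      fix z
      have "indicat_real ?E (?e * z) = indicat_real ?E z" by (simp add: indicator_def norm_mult)
      moreover have "\<zeta> - ?e * z = ?e * (cnj ?e * \<zeta> - z)"
        by (simp add: cnj_circle_point algebra_simps)
      ultimately show "indicat_real ?E (?e * z) *\<^sub>R (1 / (\<zeta> - ?e * z)) =
          cnj ?e * (indicat_real ?E z *\<^sub>R (1 / (cnj ?e * \<zeta> - z)))"
        by (simp add: cnj_circle_point divide_inverse inverse_mult_distrib mult_ac)
    qed
    also have "\<dots> = cnj ?e * (LINT z:?E|lborel. 1 / (cnj ?e * \<zeta> - z))"
      unfolding set_lebesgue_integral_def by (rule integral_mult_right_zero)
    finally show ?thesis .
  qed
  \<comment> \<open>For non-zero \<open>\<zeta>\<close> the averaged function has its only pole at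
    \<open>z / \<zeta>\<close>; Cauchy's formula gives \<open>1 / \<zeta>\<close> or 0 according to
    the side of the unit circle on which this pole lies.\<close>
  have inner: "(LINT t:{0..1}|lborel. cnj (circle_point t) / (cnj (circle_point t) * \<zeta> - z)) =
      (if cmod z < cmod \<zeta> then 1 / \<zeta> else 0)" if "cmod z \<noteq> cmod \<zeta>" for z
  proof -
    have "(LINT t:{0..1}|lborel. cnj (circle_point t) / (cnj (circle_point t) * \<zeta> - z)) =
       circle_mean (\<lambda>w. cnj w / (cnj w * \<zeta> - z))" by (simp add: circle_mean_def)
    also have "\<dots> = circle_mean (\<lambda>w. w / (w * \<zeta> - z))"
      by (rule circle_mean_cnj_arg[of "\<lambda>w. w / (w * \<zeta> - z)"])
    also have "\<dots> = (if cmod z < cmod \<zeta> then 1 / \<zeta> else 0)"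
    proof (cases "cmod z < cmod \<zeta>")
      case True
      then have \<zeta>: "\<zeta> \<noteq> 0" by auto
      have "circle_mean (\<lambda>w. w / (w * \<zeta> - z)) = circle_mean (\<lambda>w. (1 / \<zeta>) * w / (w - z / \<zeta>))"
        using \<zeta> by (intro circle_mean_cong) (simp add: field_simps)
      also have "\<dots> = 1 / \<zeta>"
        by (rule circle_mean_Cauchy) (use True \<zeta> in \<open>auto intro!: holomorphic_intros simp: norm_divide field_simps\<close>)
      finally show ?thesis using True by simp
    next
      case False
      then have "cmod \<zeta> < cmod z" using that by simp
      have nz: "w * \<zeta> - z \<noteq> 0" if "cmod w \<le> 1" for w
      proof
        assume "w * \<zeta> - z = 0"
        then have "cmod z = cmod w * cmod \<zeta>" by (metis eq_iff_diff_eq_0 norm_mult)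
        also have "\<dots> \<le> 1 * cmod \<zeta>" by (intro mult_right_mono that) auto
        finally show False using \<open>cmod \<zeta> < cmod z\<close> by simp
      qed
      have "circle_mean (\<lambda>w. w / (w * \<zeta> - z)) = 0"
        by (subst circle_mean_Cauchy_0) (use nz in \<open>auto intro!: continuous_intros holomorphic_intros\<close>)
      then show ?thesis using False by simp
    qed
    finally show ?thesis .
  qed
  have c1: "continuous_on UNIV (\<lambda>t. cnj (circle_point t) * \<zeta>)"
    and c2: "continuous_on UNIV (\<lambda>t. cnj (circle_point t))" by (intro continuous_intros)+
  have "?J = (LINT t:{0..1::real}|lborel. ?J)" by (simp add: set_lebesgue_integral_def)
  also have "\<dots> = (LINT t:{0..1}|lborel. cnj (circle_point t) * (LINT z:?E|lborel. 1 / (cnj (circle_point t) * \<zeta> - z)))"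
    by (subst rot[symmetric]) simp
  also have "\<dots> = (LINT z:?E|lborel. (LINT t:{0..1}|lborel. cnj (circle_point t) / (cnj (circle_point t) * \<zeta> - z)))"
    by (rule fubini_cauchy_kernel(2)[OF c1 c2 E(1) EM R])
  \<comment> \<open>Up to a null circle only the disc of radius \<open>cmod \<zeta>\<close>
    survives; its area is pi times \<open>\<zeta> * cnj \<zeta>\<close>, and the factor
    \<open>\<zeta>\<close> cancels.\<close>
  also have "\<dots> = (LINT z|lborel. indicator (ball (0::complex) (cmod \<zeta>)) z *\<^sub>R (1 / \<zeta>))"
    unfolding set_lebesgue_integral_def[of _ ?E]
  proof (rule Bochner_Integration.integral_cong_AE)
    show "(\<lambda>z. indicat_real ?E z *\<^sub>R (LINT t:{0..1}|lborel. cnj (circle_point t) / (cnj (circle_point t) * \<zeta> - z)))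
       \<in> borel_measurable lborel"
      using fubini_cauchy_kernel(1)[OF c1 c2 E(1) EM R] unfolding set_integrable_def
      by (rule borel_measurable_integrable)
    have "AE z in lborel. z \<notin> sphere (0::complex) (cmod \<zeta>)" by (rule AE_not_in[OF lborel_sphere_null])
    then show "AE z in lborel. indicat_real ?E z *\<^sub>R (LINT t:{0..1}|lborel. cnj (circle_point t) / (cnj (circle_point t) * \<zeta> - z)) =
        indicat_real (ball 0 (cmod \<zeta>)) z *\<^sub>R (1 / \<zeta>)"
    proof eventually_elim
      case (elim z)
      then have "cmod z \<noteq> cmod \<zeta>" by simp
      from inner[OF this] show ?case using assms by (auto simp: indicator_def)
    qed
  qed measurable
  also have "\<dots> = of_real (measure lborel (ball (0::complex) (cmod \<zeta>))) * (1 / \<zeta>)"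
    by (simp add: scaleR_conv_of_real)
  also have "\<dots> = of_real pi * cnj \<zeta>"
  proof (cases "\<zeta> = 0")
    case False
    have "measure lborel (ball (0::complex) (cmod \<zeta>)) = pi * (cmod \<zeta>)^2"
      by (simp add: measure_def emeasure_ball_complex)
    moreover have "(of_real (cmod \<zeta>))^2 = \<zeta> * cnj \<zeta>" using complex_norm_square[of \<zeta>] by simp
    ultimately show ?thesis using False by simp
  qed simp
  finally show ?thesis by (simp add: cauchy_transform_def)
qed

section \<open>Logarithmic potentials along curves\<close>

lemma abs_ln_le:
  assumes "x > (0::real)"
  shows "\<bar>ln x\<bar> \<le> x + 1 / x"
proof -
  have "1 / x > 0" using assms by simp
  moreover have "ln x \<le> x - 1" "- ln x \<le> 1 / x - 1"
    using ln_le_minus_one[of x] ln_le_minus_one[of "1 / x"] assms by (simp_all add: ln_div)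
  ultimately show ?thesis using assms by linarith
qed

text \<open>\<open>abs_ln_le\<close> dominates the logarithm by the modulus of the Cauchy kernel
  plus the constant \<open>R\<close>.\<close>

lemma set_integrable_ln_dist:
  fixes E :: "complex set"
  assumes "E \<in> sets borel" "bounded E"
  shows "set_integrable lborel E (\<lambda>\<zeta>. ln (cmod (z - \<zeta>)))"
proof -
  have [measurable]: "E \<in> sets borel" by fact
  obtain R where R: "R > 0" "E \<subseteq> ball z R" using assms(2) bounded_subset_ballD by metis
  have e: "emeasure lborel E \<le> ennreal (pi * R^2)"
    using emeasure_mono[OF R(2), of lborel] R(1) by (simp add: emeasure_ball_complex)
  have 1: "integrable lborel (\<lambda>\<zeta>. norm (indicator E \<zeta> *\<^sub>R (1 / (z - \<zeta>))))"
    using set_integrable_cauchy_kernel[OF assms(1) e R(1)] by (intro integrable_norm) (simp add: set_integrable_def)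
  have 2: "integrable lborel (\<lambda>\<zeta>. indicat_real E \<zeta> *\<^sub>R R)"
    using e by (intro integrable_scaleR_left integrable_real_indicator) (auto intro: le_less_trans[OF _ ennreal_less_top])
  show ?thesis unfolding set_integrable_def
  proof (rule Bochner_Integration.integrable_bound[OF Bochner_Integration.integrable_add[OF 1 2]])
    show "(\<lambda>\<zeta>. indicat_real E \<zeta> *\<^sub>R ln (cmod (z - \<zeta>))) \<in> borel_measurable lborel" by measurable
    show "AE \<zeta> in lborel. norm (indicat_real E \<zeta> *\<^sub>R ln (cmod (z - \<zeta>)))
       \<le> norm (norm (indicat_real E \<zeta> *\<^sub>R (1 / (z - \<zeta>))) + indicat_real E \<zeta> *\<^sub>R R)"
      using AE_lborel_singleton[of z]
    proof eventually_elim
      case (elim \<zeta>)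
      then have 0: "cmod (z - \<zeta>) > 0" by simp
      show ?case
      proof (cases "\<zeta> \<in> E")
        case True
        then have "cmod (z - \<zeta>) < R" using R by (auto simp: dist_norm)
        then have "\<bar>ln (cmod (z - \<zeta>))\<bar> \<le> 1 / cmod (z - \<zeta>) + R" using abs_ln_le[OF 0] by linarith
        also have "\<dots> \<le> \<bar>1 / cmod (z - \<zeta>) + R\<bar>" by (rule abs_ge_self)
        finally show ?thesis using True by (simp add: norm_divide)
      qed simp
    qed
  qed
qed

lemma ln_norm_has_derivative:
  assumes "(q has_vector_derivative q') (at t within A)" "q t \<noteq> (0::complex)"
  shows "((\<lambda>t. ln (cmod (q t))) has_vector_derivative Re (q' / q t)) (at t within A)"
proof -
  have q: "(q has_derivative (\<lambda>x. x *\<^sub>R q')) (at t within A)"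
    using assms(1) by (simp add: has_vector_derivative_def)
  have "((\<lambda>t. ln (norm (q t))) has_derivative (\<lambda>x. inverse (norm (q t)) * ((x *\<^sub>R q') \<bullet> sgn (q t)))) (at t within A)"
    using assms(2) q by (auto intro!: derivative_eq_intros has_derivative_compose[OF q has_derivative_norm] simp: divide_inverse)
  moreover have eq: "inverse (norm (q t)) * ((x *\<^sub>R q') \<bullet> sgn (q t)) = x *\<^sub>R Re (q' / q t)" for x
    using assms(2) cmod_power2[of "q t"]
    by (simp add: sgn_div_norm inner_complex_def Re_divide power2_eq_square field_simps)
  ultimately show ?thesis unfolding has_vector_derivative_def by (simp only: eq)
qed

lemma c1_image_null:
  fixes p :: "real \<Rightarrow> complex"
  assumes "\<And>t. (p has_vector_derivative p' t) (at t)"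
  shows "p ` {a..b} \<in> null_sets lborel"
proof -
  have "negligible (p ` {a..b})"
    by (rule negligible_differentiable_image_lowdim)
       (use assms in \<open>auto simp: differentiable_on_def has_vector_derivative_def intro!: differentiableI intro: has_derivative_at_withinI\<close>)
  moreover have "continuous_on {a..b} p"
    using assms by (meson continuous_at_imp_continuous_on has_vector_derivative_continuous)
  then have "compact (p ` {a..b})" by (intro compact_continuous_image) auto
  then have "p ` {a..b} \<in> sets borel" by (intro borel_closed compact_imp_closed)
  ultimately show ?thesis
    unfolding negligible_iff_null_sets by (auto simp: null_sets_def)
qed

text \<open>For \<open>\<zeta>\<close> off the curve, \<open>Re (p' t / (p t - \<zeta>))\<close> is
  the derivative of \<open>ln (cmod (p t - \<zeta>))\<close>, and the curve itself is a null set.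
  Fubini's theorem then gives the increment of the potential without any differentiation under the
  integral sign.\<close>

lemma log_potential_along_curve:
  fixes p :: "real \<Rightarrow> complex"
  assumes p: "\<And>t. (p has_vector_derivative p' t) (at t)" and p': "continuous_on UNIV p'"
    and E: "E \<in> sets borel" "bounded E" and "a \<le> b"
  shows "(LINT \<zeta>:E|lborel. ln (cmod (p b - \<zeta>))) - (LINT \<zeta>:E|lborel. ln (cmod (p a - \<zeta>))) =
     pi * Re (LINT t:{a..b}|lborel. p' t * cauchy_transform E (p t))"
proof -
  obtain R where R: "R > 0" "E \<subseteq> ball 0 R" using E(2) bounded_subset_ballD by metis
  have e: "emeasure lborel E \<le> ennreal (pi * R^2)"
    using emeasure_mono[OF R(2), of lborel] R(1) by (simp add: emeasure_ball_complex)
  have pc: "continuous_on UNIV p"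
    using p by (meson continuous_at_imp_continuous_on has_vector_derivative_continuous)
  note F = fubini_cauchy_kernel[OF pc p' E(1) e R(1), of a b]
  have "of_real pi * (LINT t:{a..b}|lborel. p' t * cauchy_transform E (p t)) =
     (LINT t:{a..b}|lborel. p' t * (LINT \<zeta>:E|lborel. 1 / (p t - \<zeta>)))"
    unfolding cauchy_transform_def by (subst set_integral_mult_right[symmetric]) (simp add: field_simps)
  also note F(2)
  finally have "Re (of_real pi * (LINT t:{a..b}|lborel. p' t * cauchy_transform E (p t))) =
     Re (LINT \<zeta>:E|lborel. (LINT t:{a..b}|lborel. p' t / (p t - \<zeta>)))"
    by (rule arg_cong)
  then have "pi * Re (LINT t:{a..b}|lborel. p' t * cauchy_transform E (p t)) =
     Re (LINT \<zeta>:E|lborel. (LINT t:{a..b}|lborel. p' t / (p t - \<zeta>)))"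
    by simp
  also have "\<dots> = (LINT \<zeta>|lborel. Re (indicator E \<zeta> *\<^sub>R (LINT t:{a..b}|lborel. p' t / (p t - \<zeta>))))"
    unfolding set_lebesgue_integral_def[of _ E]
    using F(1) by (subst integral_Re) (auto simp: set_integrable_def)
  also have "\<dots> = (LINT \<zeta>|lborel. indicator E \<zeta> *\<^sub>R (ln (cmod (p b - \<zeta>)) - ln (cmod (p a - \<zeta>))))"
  proof (rule Bochner_Integration.integral_cong_AE)
    show "(\<lambda>\<zeta>. Re (indicat_real E \<zeta> *\<^sub>R (LINT t:{a..b}|lborel. p' t / (p t - \<zeta>)))) \<in> borel_measurable lborel"
      by (rule borel_measurable_integrable[OF integrable_Re[OF F(1)[unfolded set_integrable_def]]])
    have [measurable]: "E \<in> sets borel" by fact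
    show "(\<lambda>\<zeta>. indicat_real E \<zeta> *\<^sub>R (ln (cmod (p b - \<zeta>)) - ln (cmod (p a - \<zeta>)))) \<in> borel_measurable lborel"
      by measurable
    show "AE \<zeta> in lborel. Re (indicat_real E \<zeta> *\<^sub>R (LINT t:{a..b}|lborel. p' t / (p t - \<zeta>))) =
       indicat_real E \<zeta> *\<^sub>R (ln (cmod (p b - \<zeta>)) - ln (cmod (p a - \<zeta>)))"
      using AE_not_in[OF c1_image_null[OF p, of a b]]
    proof eventually_elim
      case (elim \<zeta>)
      then have nz: "p t - \<zeta> \<noteq> 0" if "t \<in> {a..b}" for t using that by auto
      have "((\<lambda>t. Re (p' t / (p t - \<zeta>))) has_integral (ln (cmod (p b - \<zeta>)) - ln (cmod (p a - \<zeta>)))) {a..b}"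
        by (rule fundamental_theorem_of_calculus[OF \<open>a \<le> b\<close>], rule ln_norm_has_derivative)
           (use nz in \<open>auto intro!: derivative_eq_intros has_vector_derivative_at_within[OF p]\<close>)
      moreover have c: "continuous_on {a..b} (\<lambda>t. p' t / (p t - \<zeta>))"
        using nz by (intro continuous_intros continuous_on_subset[OF p'] continuous_on_subset[OF pc]) auto
      then have "(LINT t:{a..b}|lborel. p' t / (p t - \<zeta>)) = integral {a..b} (\<lambda>t. p' t / (p t - \<zeta>))"
        by (rule set_borel_integral_eq_integral(2)[OF borel_integrable_atLeastAtMost'])
      moreover have "Re (integral {a..b} (\<lambda>t. p' t / (p t - \<zeta>))) = integral {a..b} (\<lambda>t. Re (p' t / (p t - \<zeta>)))"
        using integral_linear[OF integrable_continuous_interval[OF c] bounded_linear_Re] by (simp add: o_def)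
      ultimately show ?case by (simp add: integral_unique)
    qed
  qed
  also have "\<dots> = (LINT \<zeta>:E|lborel. ln (cmod (p b - \<zeta>))) - (LINT \<zeta>:E|lborel. ln (cmod (p a - \<zeta>)))"
    using set_integral_diff(2)[OF set_integrable_ln_dist[OF E] set_integrable_ln_dist[OF E], of "p b" "p a"]
    by (simp add: set_lebesgue_integral_def)
  finally show ?thesis ..
qed

section \<open>Jordan curves and the Cauchy--Pompeiu formula\<close>

lemma set_lebesgue_integral_continuous:
  fixes f :: "real \<Rightarrow> complex"
  assumes "continuous_on {a..b} f"
  shows "(LINT t:{a..b}|lborel. f t) = integral {a..b} f"
  by (rule set_borel_integral_eq_integral(2)[OF borel_integrable_atLeastAtMost'[OF assms]])

text \<open>The parametrisation lives on the whole real line and \<open>range_path\<close> confines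
  it to the curve, as for 1-periodic parametrisations. Derivatives at 0 and 1 are therefore
  two-sided, and bounds valid on the curve hold for every parameter.\<close>

locale smooth_jordan_curve =
  fixes p p' :: "real \<Rightarrow> complex"
  assumes deriv: "(p has_vector_derivative p' t) (at t)"
    and cont_deriv: "continuous_on UNIV p'"
    and range_path: "range p = path_image p"
    and simple: "simple_path p"
    and closed: "pathfinish p = pathstart p"
    and positive: "positively_oriented p"
begin

abbreviation "\<Omega> \<equiv> inside (path_image p)"

lemma cont: "continuous_on A p"
  using deriv by (meson continuous_at_imp_continuous_on has_vector_derivative_continuous)

lemmas jordan = Jordan_inside_outside[OF simple closed]

lemma open_inside: "open \<Omega>" and connected_inside: "connected \<Omega>" and bounded_inside: "bounded \<Omega>"
  using jordan by auto

lemma borel_inside [measurable]: "\<Omega> \<in> sets borel"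
  using open_inside by auto

lemma valid: "valid_path p"
  unfolding valid_path_def
  by (rule C1_differentiable_imp_piecewise)
     (use deriv cont_deriv in \<open>auto simp: C1_differentiable_on_def intro: continuous_on_subset\<close>)

lemma in_path: "p t \<in> path_image p"
  using range_path by blast

lemma path_null: "path_image p \<in> null_sets lborel"
  unfolding path_image_def by (rule c1_image_null[OF deriv])

lemma contour_integral_eq:
  assumes "continuous_on (path_image p) f"
  shows "contour_integral p f = (LINT t:{0..1}|lborel. p' t * f (p t))"
proof -
  have "continuous_on {0..1} (\<lambda>t. p' t * f (p t))"
    by (intro continuous_intros continuous_on_subset[OF cont_deriv] continuous_on_compose2[OF assms cont])
       (auto simp: path_image_def)
  moreover have "vector_derivative p (at t) = p' t" for t
    using deriv vector_derivative_at by blast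
  ultimately show ?thesis
    by (simp add: contour_integral_integral set_lebesgue_integral_continuous mult.commute)
qed

lemma winding_eq:
  assumes "z \<notin> path_image p"
  shows "(LINT t:{0..1}|lborel. p' t / (p t - z)) = 2 * of_real pi * \<i> * winding_number p z"
proof -
  have "winding_number p z = 1 / (2 * pi * \<i>) * contour_integral p (\<lambda>w. 1 / (w - z))"
    by (rule winding_number_valid_path[OF valid assms])
  also have "contour_integral p (\<lambda>w. 1 / (w - z)) = (LINT t:{0..1}|lborel. p' t * (1 / (p t - z)))"
    using assms by (intro contour_integral_eq continuous_intros) auto
  finally show ?thesis by simp
qed

lemma winding_off:
  assumes "z \<notin> path_image p"
  shows "winding_number p z = indicator \<Omega> z"
proof (cases "z \<in> \<Omega>")
  case True
  then show ?thesis using positive by (simp add: positively_oriented_def)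
next
  case False
  then have "z \<in> outside (path_image p)" using assms jordan by blast
  then show ?thesis using False winding_number_zero_in_outside[of p z] valid closed
    by (simp add: valid_path_imp_path)
qed

lemma conjugate_integral:
  assumes "continuous_on UNIV \<phi>" "\<And>t. cmod (p t) < R"
  shows "(LINT t:{0..1}|lborel. \<phi> t * cnj (p t)) =
     of_real (1 / pi) * (LINT z:ball 0 R|lborel. (LINT t:{0..1}|lborel. \<phi> t / (p t - z)))"
proof -
  have R: "R > 0" using assms(2)[of 0] norm_ge_zero[of "p 0"] by linarith
  have "(LINT t:{0..1}|lborel. \<phi> t * cnj (p t)) = (LINT t:{0..1}|lborel. \<phi> t * cauchy_transform (ball 0 R) (p t))"
    using assms(2) by (simp add: cauchy_transform_ball)
  also have "\<dots> = (LINT t:{0..1}|lborel. of_real (1 / pi) * (\<phi> t * (LINT z:ball 0 R|lborel. 1 / (p t - z))))"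
    unfolding cauchy_transform_def by (simp add: mult_ac)
  also have "\<dots> = of_real (1 / pi) * (LINT t:{0..1}|lborel. \<phi> t * (LINT z:ball 0 R|lborel. 1 / (p t - z)))"
    by (rule set_integral_mult_right)
  also have "(LINT t:{0..1}|lborel. \<phi> t * (LINT z:ball 0 R|lborel. 1 / (p t - z))) =
     (LINT z:ball 0 R|lborel. (LINT t:{0..1}|lborel. \<phi> t / (p t - z)))"
    by (rule fubini_cauchy_kernel(2)[OF cont assms(1) _ _ R]) (use R in \<open>auto simp: emeasure_ball_complex\<close>)
  finally show ?thesis .
qed

lemma obtain_radius:
  obtains R where "R > 0" "\<And>t. cmod (p t) < R" "\<Omega> \<subseteq> ball 0 R" "cmod z < R"
proof -
  have "compact (path_image p)" using simple by (simp add: compact_path_image simple_path_imp_path)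
  then have "bounded (insert z (\<Omega> \<union> path_image p))" using bounded_inside compact_imp_bounded by auto
  then obtain R where R: "R > 0" "insert z (\<Omega> \<union> path_image p) \<subseteq> ball 0 R"
    using bounded_subset_ballD by metis
  moreover have "cmod (p t) < R" for t using R(2) in_path[of t] by auto
  ultimately show ?thesis by (intro that[of R]) auto
qed

lemma area_formula:
  "contour_integral p cnj = 2 * \<i> * of_real (measure lborel \<Omega>)"
proof -
  obtain R where R: "R > 0" "\<And>t. cmod (p t) < R" "\<Omega> \<subseteq> ball 0 R"
    using obtain_radius[of 0] by metis
  have "emeasure lborel \<Omega> < \<infinity>" by (rule emeasure_bounded_finite[OF bounded_inside])
  have "contour_integral p cnj = (LINT t:{0..1}|lborel. p' t * cnj (p t))"
    by (rule contour_integral_eq) (intro continuous_intros)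
  also have "\<dots> = of_real (1 / pi) * (LINT z:ball 0 R|lborel. (LINT t:{0..1}|lborel. p' t / (p t - z)))"
    by (rule conjugate_integral[OF cont_deriv R(2)])
  also have "(LINT z:ball 0 R|lborel. (LINT t:{0..1}|lborel. p' t / (p t - z))) =
      (LINT z|lborel. indicator \<Omega> z *\<^sub>R (2 * of_real pi * \<i>))"
    unfolding set_lebesgue_integral_def[of _ "ball 0 R"]
  proof (rule Bochner_Integration.integral_cong_AE)
    show "(\<lambda>z. indicat_real (ball 0 R) z *\<^sub>R (LINT t:{0..1}|lborel. p' t / (p t - z))) \<in> borel_measurable lborel"
      using fubini_cauchy_kernel(1)[OF cont cont_deriv _ _ R(1), of "ball 0 R"] R(1)
      by (intro borel_measurable_integrable) (simp add: set_integrable_def emeasure_ball_complex)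
    show "(\<lambda>z. indicat_real \<Omega> z *\<^sub>R (2 * of_real pi * \<i>)) \<in> borel_measurable lborel" by measurable
    show "AE z in lborel. indicat_real (ball 0 R) z *\<^sub>R (LINT t:{0..1}|lborel. p' t / (p t - z)) =
        indicat_real \<Omega> z *\<^sub>R (2 * of_real pi * \<i>)"
      using AE_not_in[OF path_null]
    proof eventually_elim
      case (elim z)
      show ?case using R(3) unfolding winding_eq[OF elim] winding_off[OF elim]
        by (auto simp: indicator_def)
    qed
  qed
  also have "\<dots> = of_real (measure lborel \<Omega>) * (2 * of_real pi * \<i>)"
    by (simp add: scaleR_conv_of_real)
  finally show ?thesis by simp
qed

text \<open>Partial fractions split the integrand \<open>1 / ((p t - z0) * (p t - z))\<close> into
  \<open>1 / (z0 - z)\<close> times a difference of two winding integrals. The first is constant in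
  \<open>z\<close> and gives the transform of the large disc, which is \<open>cnj z0\<close>. The
  second is the indicator of \<open>\<Omega>\<close> off the curve and gives the transform of
  \<open>\<Omega>\<close>.\<close>

lemma cauchy_pompeiu:
  assumes z0: "z0 \<notin> path_image p"
  shows "contour_integral p (\<lambda>\<zeta>. cnj \<zeta> / (\<zeta> - z0)) =
    2 * of_real pi * \<i> * (winding_number p z0 * cnj z0 - cauchy_transform \<Omega> z0)"
proof -
  obtain R where R: "R > 0" "\<And>t. cmod (p t) < R" "\<Omega> \<subseteq> ball 0 R" "cmod z0 < R"
    using obtain_radius[of z0] by metis
  let ?B = "ball (0::complex) R"
  have nz: "p t \<noteq> z0" for t using in_path[of t] z0 by auto
  have cd: "continuous_on UNIV (\<lambda>t. p' t / (p t - z0))"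
    using nz by (intro continuous_intros cont_deriv cont) auto
  have eB: "emeasure lborel ?B \<le> ennreal (pi * R^2)" using R(1) by (simp add: emeasure_ball_complex)
  have e\<Omega>: "emeasure lborel \<Omega> \<le> ennreal (pi * R^2)"
    using emeasure_mono[OF R(3), of lborel] eB by simp
  note iB = set_integrable_cauchy_kernel[OF borel_open[OF open_ball] eB R(1), of z0]
  note i\<Omega> = set_integrable_cauchy_kernel[OF borel_inside e\<Omega> R(1), of z0]
  have "contour_integral p (\<lambda>\<zeta>. cnj \<zeta> / (\<zeta> - z0)) = (LINT t:{0..1}|lborel. p' t * (cnj (p t) / (p t - z0)))"
    using z0 by (intro contour_integral_eq continuous_intros) auto
  also have "\<dots> = (LINT t:{0..1}|lborel. p' t / (p t - z0) * cnj (p t))" by simp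
  also have "\<dots> = of_real (1 / pi) * (LINT z:?B|lborel. (LINT t:{0..1}|lborel. p' t / (p t - z0) / (p t - z)))"
    by (rule conjugate_integral[OF cd R(2)])
  also have "(LINT z:?B|lborel. (LINT t:{0..1}|lborel. p' t / (p t - z0) / (p t - z))) =
      (LINT z|lborel. (2 * of_real pi * \<i> * winding_number p z0) * (indicator ?B z *\<^sub>R (1 / (z0 - z)))
         - (2 * of_real pi * \<i>) * (indicator \<Omega> z *\<^sub>R (1 / (z0 - z))))"
    unfolding set_lebesgue_integral_def[of _ ?B]
  proof (rule Bochner_Integration.integral_cong_AE)
    show "(\<lambda>z. indicat_real ?B z *\<^sub>R (LINT t:{0..1}|lborel. p' t / (p t - z0) / (p t - z))) \<in> borel_measurable lborel"
      using fubini_cauchy_kernel(1)[OF cont cd _ eB R(1)]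
      by (intro borel_measurable_integrable) (simp add: set_integrable_def)
    show "(\<lambda>z. (2 * of_real pi * \<i> * winding_number p z0) * (indicat_real ?B z *\<^sub>R (1 / (z0 - z)))
         - (2 * of_real pi * \<i>) * (indicat_real \<Omega> z *\<^sub>R (1 / (z0 - z)))) \<in> borel_measurable lborel"
      using iB i\<Omega> unfolding set_integrable_def
      by (intro borel_measurable_integrable Bochner_Integration.integrable_diff integrable_mult_right)
    show "AE z in lborel. indicat_real ?B z *\<^sub>R (LINT t:{0..1}|lborel. p' t / (p t - z0) / (p t - z)) =
       (2 * of_real pi * \<i> * winding_number p z0) * (indicator ?B z *\<^sub>R (1 / (z0 - z)))
         - (2 * of_real pi * \<i>) * (indicator \<Omega> z *\<^sub>R (1 / (z0 - z)))"
      using AE_not_in[OF path_null] AE_lborel_singleton[of z0]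
    proof eventually_elim
      case (elim z)
      have nz': "p t \<noteq> z" for t using in_path[of t] elim by auto
      have c: "continuous_on A (\<lambda>t. p' t / (p t - w))" if "w \<notin> path_image p" for w and A :: "real set"
        using that in_path by (intro continuous_intros continuous_on_subset[OF cont_deriv] cont) auto
      have "(LINT t:{0..1}|lborel. p' t / (p t - z0) / (p t - z)) =
        (LINT t:{0..1}|lborel. (1 / (z0 - z)) * (p' t / (p t - z0) - p' t / (p t - z)))"
      proof (rule set_lebesgue_integral_cong)
        show "\<forall>t. t \<in> {0..1} \<longrightarrow> p' t / (p t - z0) / (p t - z) = (1 / (z0 - z)) * (p' t / (p t - z0) - p' t / (p t - z))"
        proof (intro allI impI)
          fix t
          have "p t - z0 \<noteq> 0" "p t - z \<noteq> 0" "z0 - z \<noteq> 0" using nz nz' elim by auto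
          then show "p' t / (p t - z0) / (p t - z) = (1 / (z0 - z)) * (p' t / (p t - z0) - p' t / (p t - z))"
            by (simp add: divide_simps) (simp add: algebra_simps)
        qed
      qed simp
      also have "\<dots> = (1 / (z0 - z)) * (LINT t:{0..1}|lborel. p' t / (p t - z0) - p' t / (p t - z))"
        by (rule set_integral_mult_right)
      also have "(LINT t:{0..1}|lborel. p' t / (p t - z0) - p' t / (p t - z)) =
         2 * of_real pi * \<i> * winding_number p z0 - 2 * of_real pi * \<i> * winding_number p z"
        by (subst set_integral_diff(2)) (use c z0 elim in \<open>auto intro!: borel_integrable_atLeastAtMost' simp: winding_eq\<close>)
      finally show ?case
        using R(3) unfolding winding_off[OF elim(1)] by (auto simp: indicator_def field_simps diff_divide_distrib)
    qed
  qed
  also have "\<dots> = (2 * of_real pi * \<i> * winding_number p z0) * (LINT z:?B|lborel. 1 / (z0 - z))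
         - (2 * of_real pi * \<i>) * (LINT z:\<Omega>|lborel. 1 / (z0 - z))"
    using iB i\<Omega> unfolding set_integrable_def set_lebesgue_integral_def
    by (subst Bochner_Integration.integral_diff)
       (intro integrable_mult_right, assumption, intro integrable_mult_right, assumption,
        simp only: integral_mult_right_zero)
  finally have "contour_integral p (\<lambda>\<zeta>. cnj \<zeta> / (\<zeta> - z0)) =
     (2 * of_real pi * \<i> * winding_number p z0) * cauchy_transform ?B z0 - (2 * of_real pi * \<i>) * cauchy_transform \<Omega> z0"
    by (simp add: cauchy_transform_def algebra_simps)
  then show ?thesis using R(4) by (simp add: cauchy_transform_ball algebra_simps)
qed

end

text \<open>This is the derivative P' of the overview. The sum starts at 1, so \<open>k - 1\<close>
  is an honest subtraction.\<close>

definition moment_poly :: "nat \<Rightarrow> (nat \<Rightarrow> complex) \<Rightarrow> complex \<Rightarrow> complex"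
  where "moment_poly d t z = (\<Sum>k=1..d+1. of_nat k * t k * z ^ (k - 1))"

lemma holomorphic_moment_poly [holomorphic_intros]:
  "f holomorphic_on A \<Longrightarrow> (\<lambda>z. moment_poly d t (f z)) holomorphic_on A"
  unfolding moment_poly_def by (intro holomorphic_intros)

lemma continuous_moment_poly [continuous_intros]:
  "continuous_on A f \<Longrightarrow> continuous_on A (\<lambda>z. moment_poly d t (f z))"
  unfolding moment_poly_def by (intro continuous_intros)

lemma moment_poly_sum_lessThan:
  assumes "\<forall>k>d+1. t k = 0" "n \<ge> d + 1"
  shows "(\<Sum>i<n. of_nat (Suc i) * t (Suc i) * z ^ i) = moment_poly d t z"
proof -
  have "moment_poly d t z = (\<Sum>i<d+1. of_nat (Suc i) * t (Suc i) * z ^ i)"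
    unfolding moment_poly_def
    by (rule sum.reindex_bij_witness[of _ Suc "\<lambda>k. k - 1"]) auto
  also have "\<dots> = (\<Sum>i<n. of_nat (Suc i) * t (Suc i) * z ^ i)"
    using assms by (intro sum.mono_neutral_left) auto
  finally show ?thesis ..
qed

section \<open>Exterior moments and the Schwarz function inside the curve\<close>

context smooth_jordan_curve
begin

lemma contour_integrable:
  assumes "continuous_on (path_image p) f"
  shows "f contour_integrable_on p"
proof -
  have "continuous_on {0..1} (\<lambda>t. f (p t) * p' t)"
    by (intro continuous_intros continuous_on_subset[OF cont_deriv] continuous_on_compose2[OF assms cont])
       (auto simp: path_image_def)
  moreover have "vector_derivative p (at t) = p' t" for t
    using deriv vector_derivative_at by blast
  ultimately show ?thesis
    by (simp add: contour_integrable_on integrable_continuous_interval)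
qed

lemma deriv_bound:
  obtains B where "B > 0" "\<And>t. t \<in> {0..1} \<Longrightarrow> norm (vector_derivative p (at t)) \<le> B"
proof -
  have "compact (p' ` {0..1})"
    by (intro compact_continuous_image continuous_on_subset[OF cont_deriv]) auto
  then obtain B where "B > 0" "\<forall>x\<in>p' ` {0..1}. norm x \<le> B"
    using compact_imp_bounded bounded_pos by metis
  moreover have "vector_derivative p (at t) = p' t" for t
    using deriv vector_derivative_at by blast
  ultimately show ?thesis by (intro that[of B]) auto
qed

lemma inside_off_path: "z \<in> \<Omega> \<Longrightarrow> z \<notin> path_image p"
  using inside_no_overlap[of "path_image p"] by blast

text \<open>By \<open>cauchy_pompeiu\<close> the left side is the Cauchy integral of
  \<open>cnj\<close> over the curve, hence holomorphic on \<open>\<Omega>\<close>. In a disc about 0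
  that misses the curve the geometric series identifies its Taylor coefficients with the moments, of
  which finitely many are non-zero. Connectedness of \<open>\<Omega>\<close> extends the
  identity.\<close>

lemma schwarz_inside:
  assumes m: "\<forall>k\<ge>1. exterior_moment p k = t k" and t: "\<forall>k>d+1. t k = 0"
    and 0: "0 \<in> \<Omega>" and z: "z \<in> \<Omega>"
  shows "cnj z - cauchy_transform \<Omega> z = moment_poly d t z"
proof -
  define Q where "Q = (\<lambda>z. contour_integral p (\<lambda>\<zeta>. cnj \<zeta> / (\<zeta> - z)) / (2 * of_real pi * \<i>))"
  have Q: "Q w = cnj w - cauchy_transform \<Omega> w" if "w \<in> \<Omega>" for w
    using cauchy_pompeiu[OF inside_off_path[OF that]] winding_off[OF inside_off_path[OF that]] that
    by (simp add: Q_def)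
  obtain B where B: "B > 0" "\<And>t. t \<in> {0..1} \<Longrightarrow> norm (vector_derivative p (at t)) \<le> B"
    by (rule deriv_bound) blast
  have "(\<lambda>z. contour_integral p (\<lambda>\<zeta>. cnj \<zeta> / (\<zeta> - z))) holomorphic_on \<Omega>"
  proof (rule holomorphic_onI)
    fix w assume "w \<in> \<Omega>"
    then have w: "w \<in> UNIV - path_image p" using inside_off_path by auto
    have "((\<lambda>z. contour_integral p (\<lambda>\<zeta>. cnj \<zeta> / (\<zeta> - z))) has_field_derivative
       (of_nat 1 * contour_integral p (\<lambda>u. cnj u / (u - w) ^ Suc 1))) (at w)"
    \<comment> \<open>Differentiation of a Cauchy-type integral in its parameter; of the density
      \<open>cnj\<close> it uses continuity on the curve.\<close>
    proof (rule Cauchy_next_derivative(2)[OF _ B(2) _ _ open_UNIV valid w])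
      fix w assume "w \<in> UNIV - path_image p"
      then have "continuous_on (path_image p) (\<lambda>u. cnj u / (u - w))"
        by (intro continuous_intros) auto
      then show "((\<lambda>u. cnj u / (u - w) ^ 1) has_contour_integral contour_integral p (\<lambda>\<zeta>. cnj \<zeta> / (\<zeta> - w))) p"
        using has_contour_integral_integral[OF contour_integrable] by simp
    qed (auto intro: continuous_intros)
    then show "(\<lambda>z. contour_integral p (\<lambda>\<zeta>. cnj \<zeta> / (\<zeta> - z))) field_differentiable at w within \<Omega>"
      using field_differentiable_at_within field_differentiable_def by blast
  qed
  then have holQ: "Q holomorphic_on \<Omega>"
    unfolding Q_def by (intro holomorphic_intros) auto
  obtain \<rho> where \<rho>: "\<rho> > 0" "cball 0 \<rho> \<subseteq> \<Omega>"
    using open_inside 0 open_contains_cball by blast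
  have far: "cmod \<zeta> > \<rho>" if "\<zeta> \<in> path_image p" for \<zeta>
  proof -
    have "\<zeta> \<notin> cball 0 \<rho>" using that inside_off_path \<rho>(2) by blast
    then show ?thesis by simp
  qed
  have near: "Q w = moment_poly d t w" if w: "w \<in> ball 0 \<rho>" for w
  proof -
    let ?f = "\<lambda>i \<zeta>. cnj \<zeta> * w ^ i / \<zeta> ^ Suc i"
    have "uniform_limit (path_image p) (\<lambda>n \<zeta>. \<Sum>i<n. ?f i \<zeta>) (\<lambda>\<zeta>. \<Sum>i. ?f i \<zeta>) sequentially"
    proof (rule Weierstrass_m_test)
      show "summable (\<lambda>i. (cmod w / \<rho>) ^ i)" using w \<rho> by (intro summable_geometric) auto
      fix n \<zeta> assume "\<zeta> \<in> path_image p"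
      then have \<zeta>: "cmod \<zeta> > \<rho>" by (rule far)
      have "norm (?f n \<zeta>) = cmod w ^ n / cmod \<zeta> ^ n"
      proof -
        have "\<zeta> \<noteq> 0" using \<zeta> \<rho>(1) by auto
        then show ?thesis by (simp add: norm_mult norm_divide norm_power)
      qed
      also have "\<dots> \<le> cmod w ^ n / \<rho> ^ n"
        using \<zeta> \<rho> by (intro divide_left_mono power_mono mult_pos_pos zero_less_power) auto
      finally show "norm (?f n \<zeta>) \<le> (cmod w / \<rho>) ^ n" by (simp add: power_divide)
    qed
    moreover have "(\<Sum>i. ?f i \<zeta>) = cnj \<zeta> / (\<zeta> - w)" if "\<zeta> \<in> path_image p" for \<zeta>
    proof -
      have \<zeta>: "cmod \<zeta> > \<rho>" "\<zeta> \<noteq> 0" using far[OF that] \<rho> by auto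
      then have "norm (w / \<zeta>) < 1" using w \<rho> by (simp add: norm_divide)
      then have "(\<lambda>i. cnj \<zeta> / \<zeta> * (w / \<zeta>) ^ i) sums (cnj \<zeta> / \<zeta> * (1 / (1 - w / \<zeta>)))"
        by (intro sums_mult geometric_sums)
      moreover have "cnj \<zeta> / \<zeta> * (1 / (1 - w / \<zeta>)) = cnj \<zeta> / (\<zeta> - w)"
        using \<zeta>(2) by (simp add: field_simps)
      moreover have "cnj \<zeta> / \<zeta> * (w / \<zeta>) ^ i = ?f i \<zeta>" for i by (simp add: power_divide)
      ultimately show ?thesis by (simp add: sums_iff)
    qed
    ultimately have ul: "uniform_limit (path_image p) (\<lambda>n \<zeta>. \<Sum>i<n. ?f i \<zeta>) (\<lambda>\<zeta>. cnj \<zeta> / (\<zeta> - w)) sequentially"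
      by (subst uniform_limit_cong'[where g = "\<lambda>n \<zeta>. \<Sum>i<n. ?f i \<zeta>" and i = "\<lambda>\<zeta>. \<Sum>i. ?f i \<zeta>"]) auto
    have cf: "continuous_on (path_image p) (?f i)" for i
      using far \<rho> by (intro continuous_intros) force
    have "(\<lambda>n. contour_integral p (\<lambda>\<zeta>. \<Sum>i<n. ?f i \<zeta>)) \<longlonglongrightarrow> contour_integral p (\<lambda>\<zeta>. cnj \<zeta> / (\<zeta> - w))"
      by (rule contour_integral_uniform_limit(2)[OF _ ul B(2) valid])
         (auto intro!: always_eventually contour_integrable continuous_on_sum cf simp del: power_Suc)
    moreover have "contour_integral p (\<lambda>\<zeta>. \<Sum>i<n. ?f i \<zeta>) = 2 * of_real pi * \<i> * moment_poly d t w" if "n \<ge> d + 1" for n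
    proof -
      have "contour_integral p (\<lambda>\<zeta>. \<Sum>i<n. ?f i \<zeta>) = (\<Sum>i<n. contour_integral p (?f i))"
        by (intro contour_integral_sum contour_integrable cf) auto
      also have "\<dots> = (\<Sum>i<n. 2 * of_real pi * \<i> * (of_nat (Suc i) * t (Suc i) * w ^ i))"
      proof (intro sum.cong refl)
        fix i
        have "contour_integral p (?f i) = contour_integral p (\<lambda>\<zeta>. w ^ i * (cnj \<zeta> / \<zeta> ^ Suc i))" by (simp add: mult_ac)
        also have "\<dots> = w ^ i * contour_integral p (\<lambda>\<zeta>. cnj \<zeta> / \<zeta> ^ Suc i)"
          using far \<rho> by (intro contour_integral_lmul contour_integrable continuous_intros) force
        also have "contour_integral p (\<lambda>\<zeta>. cnj \<zeta> / \<zeta> ^ Suc i) = 2 * of_real pi * \<i> * of_nat (Suc i) * t (Suc i)"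
        proof -
          have "exterior_moment p (Suc i) = t (Suc i)" using m by auto
          then show ?thesis unfolding exterior_moment_def by (simp add: field_simps del: of_nat_Suc power_Suc)
        qed
        finally show "contour_integral p (?f i) = 2 * of_real pi * \<i> * (of_nat (Suc i) * t (Suc i) * w ^ i)"
          by (simp add: mult_ac)
      qed
      also have "\<dots> = 2 * of_real pi * \<i> * moment_poly d t w"
        by (simp only: sum_distrib_left[symmetric] moment_poly_sum_lessThan[OF t that])
      finally show ?thesis .
    qed
    then have "(\<lambda>n. contour_integral p (\<lambda>\<zeta>. \<Sum>i<n. ?f i \<zeta>)) \<longlonglongrightarrow> 2 * of_real pi * \<i> * moment_poly d t w"
      by (intro tendsto_eventually eventually_sequentiallyI[of "d + 1"])
    ultimately have "contour_integral p (\<lambda>\<zeta>. cnj \<zeta> / (\<zeta> - w)) = 2 * of_real pi * \<i> * moment_poly d t w"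
      by (rule LIMSEQ_unique)
    then show ?thesis by (simp add: Q_def)
  qed
  have "Q z = moment_poly d t z"
    by (rule analytic_continuation_open[of "ball 0 \<rho>" \<Omega>])
       (use \<rho> open_inside connected_inside holQ near z in \<open>auto intro!: holomorphic_intros\<close>)
  then show ?thesis using Q[OF z] by simp
qed

end

text \<open>The hypothesis \<open>gap\<close> says that \<open>S\<close> misses the annulus between
  \<open>a\<close> and \<open>\<rho>\<close>, so a connected \<open>S\<close> through 0 cannot reach
  beyond it. This turns an estimate valid only near the origin into a global one.\<close>

lemma connected_subset_cball:
  fixes S :: "complex set"
  assumes "connected S" "0 \<in> S" "a < \<rho>" "0 \<le> a"
    and gap: "\<And>z. z \<in> S \<Longrightarrow> cmod z < \<rho> \<Longrightarrow> cmod z \<le> a"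
  shows "S \<subseteq> cball 0 a"
proof (rule ccontr)
  assume n: "\<not> S \<subseteq> cball 0 a"
  have "\<not> connected S"
    unfolding connected_def not_not
  proof (intro exI conjI)
    show "open (ball (0::complex) \<rho>)" "open (- cball (0::complex) a)" by auto
    show "S \<subseteq> ball 0 \<rho> \<union> - cball 0 a" using assms(3) by (auto simp: not_le)
    show "ball 0 \<rho> \<inter> - cball 0 a \<inter> S = {}" using gap by fastforce
    have "0 \<in> ball 0 \<rho> \<inter> S" using assms by simp
    then show "ball 0 \<rho> \<inter> S \<noteq> {}" by blast
    show "- cball 0 a \<inter> S \<noteq> {}" using n by auto
  qed
  then show False using assms(1) by simp
qed

section \<open>Laurent polynomials on the unit circle\<close>

lemma circle_mean_power_div:
  "circle_mean (\<lambda>w. w ^ m / w ^ n) = (if m = n then 1 else 0)"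
proof (cases "n \<le> m")
  case True
  have "circle_mean (\<lambda>w. w ^ m / w ^ n) = circle_mean (\<lambda>w. w ^ (m - n))"
  proof (rule circle_mean_cong)
    fix w :: complex assume w: "cmod w = 1"
    then have "w \<noteq> 0" by auto
    moreover have "w ^ m = w ^ (m - n) * w ^ n" using True by (simp flip: power_add)
    ultimately show "w ^ m / w ^ n = w ^ (m - n)" by simp
  qed
  then show ?thesis using True by simp
next
  case False
  have "circle_mean (\<lambda>w. w ^ m / w ^ n) = circle_mean (\<lambda>w. (1 / w) ^ (n - m))"
  proof (rule circle_mean_cong)
    fix w :: complex assume w: "cmod w = 1"
    then have "w \<noteq> 0" by auto
    moreover have "w ^ n = w ^ (n - m) * w ^ m" using False by (simp flip: power_add)
    ultimately show "w ^ m / w ^ n = (1 / w) ^ (n - m)" by (simp add: power_one_over)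
  qed
  also have "\<dots> = circle_mean (\<lambda>w. w ^ (n - m))"
    by (rule circle_mean_inverse_arg[of "\<lambda>w. w ^ (n - m)"])
  finally show ?thesis using False by simp
qed

text \<open>Argument principle for polynomials, by induction on the degree. Splitting off a root
  \<open>c\<close> of the open disc adds the mean of \<open>s / (s - c)\<close>, which is 1; when no
  root is left, the integrand is holomorphic on the disc and vanishes at 0.\<close>

lemma circle_mean_log_derivative:
  fixes q :: "complex poly"
  assumes "\<And>s. cmod s = 1 \<Longrightarrow> poly q s \<noteq> 0"
  shows "\<exists>n::nat. circle_mean (\<lambda>s. s * poly (pderiv q) s / poly q s) = of_nat n \<and>
    (n = 0 \<longleftrightarrow> (\<forall>s. cmod s \<le> 1 \<longrightarrow> poly q s \<noteq> 0))"
  using assms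
proof (induction "degree q" arbitrary: q rule: less_induct)
  case less
  show ?case
  proof (cases "\<forall>s. cmod s \<le> 1 \<longrightarrow> poly q s \<noteq> 0")
    case True
    then have "circle_mean (\<lambda>s. s * poly (pderiv q) s / poly q s) = 0"
      by (subst circle_mean_Cauchy_0) (auto intro!: continuous_intros holomorphic_intros)
    with True show ?thesis by (intro exI[of _ 0]) auto
  next
    case False
    then obtain c where c: "cmod c \<le> 1" "poly q c = 0" by auto
    with less.prems have c1: "cmod c < 1" by (metis order_le_less)
    obtain q1 where q: "q = [:- c, 1:] * q1" using c(2) poly_eq_0_iff_dvd[of q c] by (auto elim: dvdE)
    have "q1 \<noteq> 0" using less.prems[of 1] q by auto
    then have "degree q1 < degree q" unfolding q by (subst degree_mult_eq) auto
    moreover have q1: "poly q1 s \<noteq> 0" if "cmod s = 1" for s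
      using less.prems[OF that] by (simp add: q)
    ultimately obtain n where n: "circle_mean (\<lambda>s. s * poly (pderiv q1) s / poly q1 s) = of_nat n"
      using less.hyps by blast
    have q': "pderiv q = q1 + [:- c, 1:] * pderiv q1"
      unfolding q pderiv_mult by (simp add: pderiv_pCons)
    have "circle_mean (\<lambda>s. s * poly (pderiv q) s / poly q s) =
        circle_mean (\<lambda>s. 1 * s / (s - c) + s * poly (pderiv q1) s / poly q1 s)"
    proof (rule circle_mean_cong)
      fix s :: complex assume s: "cmod s = 1"
      have "s - c \<noteq> 0" using c1 s by auto
      then show "s * poly (pderiv q) s / poly q s = 1 * s / (s - c) + s * poly (pderiv q1) s / poly q1 s"
        using q1[OF s] unfolding q' by (simp add: q divide_simps) (simp add: algebra_simps)
    qed
    also have "\<dots> = circle_mean (\<lambda>s. 1 * s / (s - c)) + of_nat n"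
      unfolding n[symmetric]
      by (rule circle_mean_add) (use q1 c1 in \<open>auto intro!: continuous_intros\<close>)
    also have "circle_mean (\<lambda>s. 1 * s / (s - c)) = 1"
      by (rule circle_mean_Cauchy) (use c1 in auto)
    finally show ?thesis using c by (intro exI[of _ "Suc n"]) auto
  qed
qed

definition laurent_deriv :: "nat \<Rightarrow> real \<Rightarrow> (nat \<Rightarrow> complex) \<Rightarrow> complex \<Rightarrow> complex"
  where "laurent_deriv d r a w = of_real r - (\<Sum>j=0..d. of_nat j * a j / w ^ (j + 1))"

text \<open>The polynomial \<open>s * (h (1 / s) - z)\<close>, where \<open>h\<close> is the Laurent
  map. Its non-zero roots in the closed unit disc are the reciprocals of the preimages of
  \<open>z\<close> with modulus at least 1, and its value at 0 is \<open>r\<close>.\<close>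

definition laurent_reversed :: "nat \<Rightarrow> real \<Rightarrow> (nat \<Rightarrow> complex) \<Rightarrow> complex \<Rightarrow> complex poly"
  where "laurent_reversed d r a z = [:of_real r, - z:] + (\<Sum>j=0..d. monom (a j) (j + 1))"

lemma poly_laurent_reversed:
  "poly (laurent_reversed d r a z) s = of_real r - z * s + (\<Sum>j=0..d. a j * s ^ (j + 1))"
  by (simp add: laurent_reversed_def poly_sum poly_monom algebra_simps)

lemma poly_laurent_reversed_eq:
  "s \<noteq> 0 \<Longrightarrow> poly (laurent_reversed d r a z) s = s * (laurent_map d r a (1 / s) - z)"
  by (simp add: poly_laurent_reversed laurent_map_def power_one_over algebra_simps sum_distrib_left)

lemma laurent_map_has_derivative:
  assumes "w \<noteq> 0"
  shows "(laurent_map d r a has_field_derivative laurent_deriv d r a w) (at w within A)"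
proof -
  have "((\<lambda>w. a j / w ^ j) has_field_derivative - (of_nat j * a j / w ^ (j + 1))) (at w within A)" for j
  proof (cases j)
    case (Suc n)
    have "((\<lambda>w. w ^ Suc n) has_field_derivative of_nat (Suc n) * w ^ n) (at w within A)"
      using DERIV_power[OF DERIV_ident, where n = "Suc n" and x = w and s = A] by simp
    from DERIV_divide[OF DERIV_const this, of "a (Suc n)"] show ?thesis
      unfolding Suc using assms by (auto elim!: DERIV_cong simp: field_simps)
  qed auto
  then have "((\<lambda>w. of_real r * w + (\<Sum>j=0..d. a j / w ^ j)) has_field_derivative
      (of_real r * 1 + (\<Sum>j=0..d. - (of_nat j * a j / w ^ (j + 1))))) (at w within A)"
    by (intro DERIV_add DERIV_cmult DERIV_ident DERIV_sum)
  then show ?thesis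
    unfolding laurent_map_def[abs_def] laurent_deriv_def by (simp add: sum_negf)
qed

lemma continuous_laurent_map [continuous_intros]:
  "continuous_on A f \<Longrightarrow> (\<And>x. x \<in> A \<Longrightarrow> f x \<noteq> 0) \<Longrightarrow> continuous_on A (\<lambda>x. laurent_map d r a (f x))"
  unfolding laurent_map_def by (intro continuous_intros) auto

lemma continuous_laurent_deriv [continuous_intros]:
  "continuous_on A f \<Longrightarrow> (\<And>x. x \<in> A \<Longrightarrow> f x \<noteq> 0) \<Longrightarrow> continuous_on A (\<lambda>x. laurent_deriv d r a (f x))"
  unfolding laurent_deriv_def by (intro continuous_intros) auto

text \<open>Logarithmic differentiation of \<open>laurent_map d r a w - z = w * q (1 / w)\<close>,
  where \<open>q\<close> is the reversed polynomial.\<close>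

lemma laurent_reversed_log_derivative:
  assumes "w \<noteq> 0" "laurent_map d r a w \<noteq> z"
  shows "w * laurent_deriv d r a w / (laurent_map d r a w - z) =
    1 - (1 / w) * poly (pderiv (laurent_reversed d r a z)) (1 / w) / poly (laurent_reversed d r a z) (1 / w)"
proof -
  let ?q = "laurent_reversed d r a z"
  have 1: "poly ?q (1 / w) = (laurent_map d r a w - z) / w"
    using poly_laurent_reversed_eq[of "1 / w" d r a z] assms(1) by simp
  have pderiv_sum: "pderiv (\<Sum>j=0..d. monom (a j) (j + 1)) = (\<Sum>j=0..d. pderiv (monom (a j) (j + 1)))"
    by (induction d) (simp_all add: pderiv_add)
  have "(1 / w) * poly (pderiv ?q) (1 / w) = (\<Sum>j=0..d. (of_nat j + 1) * (a j / w ^ (j + 1))) - z / w"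
    unfolding laurent_reversed_def pderiv_add pderiv_sum pderiv_monom
    by (simp add: poly_sum poly_monom pderiv_pCons sum_distrib_left power_one_over
        algebra_simps add_divide_distrib)
  also have "\<dots> = (laurent_map d r a w - z) / w - laurent_deriv d r a w"
    using assms(1) by (simp add: laurent_map_def laurent_deriv_def add_divide_distrib diff_divide_distrib
      sum_divide_distrib sum.distrib algebra_simps)
  finally have 2: "(1 / w) * poly (pderiv ?q) (1 / w) = (laurent_map d r a w - z) / w - laurent_deriv d r a w" .
  show ?thesis unfolding 1 2 using assms by (simp add: field_simps)
qed

definition laurent_velocity :: "nat \<Rightarrow> real \<Rightarrow> (nat \<Rightarrow> complex) \<Rightarrow> real \<Rightarrow> complex"
  where "laurent_velocity d r a x =
    2 * of_real pi * \<i> * circle_point x * laurent_deriv d r a (circle_point x)"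

lemma laurent_path_deriv:
  "((laurent_map d r a \<circ> circle_point) has_vector_derivative laurent_velocity d r a x) (at x)"
  unfolding laurent_velocity_def
  by (rule field_vector_diff_chain_at[OF circle_point_has_vector_derivative laurent_map_has_derivative]) simp

lemma continuous_laurent_velocity: "continuous_on A (laurent_velocity d r a)"
  unfolding laurent_velocity_def by (intro continuous_intros) auto

lemma path_image_laurent:
  "path_image (laurent_map d r a \<circ> circle_point) = laurent_map d r a ` sphere 0 1"
proof
  show "path_image (laurent_map d r a \<circ> circle_point) \<subseteq> laurent_map d r a ` sphere 0 1"
    by (auto simp: path_image_def)
  show "laurent_map d r a ` sphere 0 1 \<subseteq> path_image (laurent_map d r a \<circ> circle_point)"
  proof
    fix z assume "z \<in> laurent_map d r a ` sphere 0 1"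
    then obtain w where w: "cmod w = 1" "z = laurent_map d r a w" by auto
    obtain x where "0 \<le> x" "x < 1" "w = circle_point x" by (rule circle_point_surj[OF w(1)])
    then show "z \<in> path_image (laurent_map d r a \<circ> circle_point)"
      using w(2) by (auto simp: path_image_def intro!: image_eqI[of _ _ x])
  qed
qed

lemma range_laurent:
  "range (laurent_map d r a \<circ> circle_point) = path_image (laurent_map d r a \<circ> circle_point)"
proof
  show "range (laurent_map d r a \<circ> circle_point) \<subseteq> path_image (laurent_map d r a \<circ> circle_point)"
    unfolding path_image_laurent by auto
qed (auto simp: path_image_def)

lemma closed_laurent:
  "pathfinish (laurent_map d r a \<circ> circle_point) = pathstart (laurent_map d r a \<circ> circle_point)"
  by (simp add: pathfinish_def pathstart_def circle_point_def exp_eq_1)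

lemma valid_laurent: "valid_path (laurent_map d r a \<circ> circle_point)"
  unfolding valid_path_def
  by (rule C1_differentiable_imp_piecewise)
     (use laurent_path_deriv continuous_laurent_velocity in
       \<open>auto simp: C1_differentiable_on_def simp del: comp_apply intro!: exI[of _ "laurent_velocity d r a"]\<close>)

lemma contour_integral_laurent:
  assumes "continuous_on (laurent_map d r a ` sphere 0 1) f"
  shows "contour_integral (laurent_map d r a \<circ> circle_point) f =
    2 * of_real pi * \<i> * circle_mean (\<lambda>w. f (laurent_map d r a w) * laurent_deriv d r a w * w)"
proof -
  let ?h = "laurent_map d r a"
  have "contour_integral (?h \<circ> circle_point) f =
     integral {0..1} (\<lambda>x. f (?h (circle_point x)) * laurent_velocity d r a x)"
    unfolding contour_integral_integral
    by (simp add: vector_derivative_at[OF laurent_path_deriv])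
  also have "\<dots> = integral {0..1} (\<lambda>x. (2 * of_real pi * \<i>) * (f (?h (circle_point x)) * laurent_deriv d r a (circle_point x) * circle_point x))"
    by (simp add: laurent_velocity_def mult_ac)
  also have "\<dots> = 2 * of_real pi * \<i> * integral {0..1} (\<lambda>x. f (?h (circle_point x)) * laurent_deriv d r a (circle_point x) * circle_point x)"
    by (rule integral_mult_right)
  also have "integral {0..1} (\<lambda>x. f (?h (circle_point x)) * laurent_deriv d r a (circle_point x) * circle_point x) =
     circle_mean (\<lambda>w. f (?h w) * laurent_deriv d r a w * w)"
    by (rule circle_mean_eq_integral[symmetric])
       (intro continuous_intros continuous_on_compose2[OF assms], auto)
  finally show ?thesis .
qed

text \<open>The mean of \<open>laurent_reversed_log_derivative\<close> is 1 minus the count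
  \<open>n\<close> of \<open>circle_mean_log_derivative\<close>. Thus winding number 1 means that
  \<open>q\<close> has no root in the disc, and winding number 0 forces one.\<close>

lemma winding_number_laurent:
  assumes z: "z \<notin> laurent_map d r a ` sphere 0 1"
  obtains n :: nat where "winding_number (laurent_map d r a \<circ> circle_point) z = 1 - of_nat n"
    "n = 0 \<longleftrightarrow> (\<forall>s. cmod s \<le> 1 \<longrightarrow> poly (laurent_reversed d r a z) s \<noteq> 0)"
proof -
  let ?h = "laurent_map d r a" and ?q = "laurent_reversed d r a z"
  have nz: "poly ?q s \<noteq> 0" if "cmod s = 1" for s
  proof -
    have "s \<noteq> 0" "cmod (1 / s) = 1" using that by (auto simp: norm_divide)
    then show ?thesis using z poly_laurent_reversed_eq[of s d r a z] by (auto simp: image_iff)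
  qed
  obtain n :: nat where n: "circle_mean (\<lambda>s. s * poly (pderiv ?q) s / poly ?q s) = of_nat n"
    "n = 0 \<longleftrightarrow> (\<forall>s. cmod s \<le> 1 \<longrightarrow> poly ?q s \<noteq> 0)"
    using circle_mean_log_derivative[OF nz] by blast
  have "winding_number (?h \<circ> circle_point) z =
      1 / (2 * pi * \<i>) * contour_integral (?h \<circ> circle_point) (\<lambda>w. 1 / (w - z))"
    by (rule winding_number_valid_path[OF valid_laurent]) (use z path_image_laurent in auto)
  also have "contour_integral (?h \<circ> circle_point) (\<lambda>w. 1 / (w - z)) =
     2 * of_real pi * \<i> * circle_mean (\<lambda>w. 1 / (?h w - z) * laurent_deriv d r a w * w)"
    by (rule contour_integral_laurent) (use z in \<open>auto intro!: continuous_intros\<close>)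
  also have "circle_mean (\<lambda>w. 1 / (?h w - z) * laurent_deriv d r a w * w) =
     circle_mean (\<lambda>w. 1 - (1 / w) * poly (pderiv ?q) (1 / w) / poly ?q (1 / w))"
  proof (rule circle_mean_cong)
    fix w :: complex assume "cmod w = 1"
    then have "w \<noteq> 0" "?h w \<noteq> z" using z by auto
    from laurent_reversed_log_derivative[OF this]
    show "1 / (?h w - z) * laurent_deriv d r a w * w = 1 - (1 / w) * poly (pderiv ?q) (1 / w) / poly ?q (1 / w)"
      by (simp add: mult_ac)
  qed
  also have "\<dots> = circle_mean (\<lambda>s. 1 - s * poly (pderiv ?q) s / poly ?q s)"
    by (rule circle_mean_inverse_arg[of "\<lambda>s. 1 - s * poly (pderiv ?q) s / poly ?q s"])
  also have "\<dots> = circle_mean (\<lambda>s. s ^ 0) - of_nat n"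
    unfolding n(1)[symmetric] power_0 using nz by (intro circle_mean_diff continuous_intros) auto
  finally have W: "winding_number (?h \<circ> circle_point) z =
     1 / (2 * pi * \<i>) * (2 * of_real pi * \<i> * (circle_mean (\<lambda>s. s ^ 0) - of_nat n))" .
  show ?thesis by (rule that[OF _ n(2)], subst W) (simp only: circle_mean_power, simp)
qed

lemma laurent_coefficient:
  assumes "j \<le> d"
  shows "circle_mean (\<lambda>w. laurent_map d r a w * w ^ j) = a j"
proof -
  have "circle_mean (\<lambda>w. laurent_map d r a w * w ^ j) =
     circle_mean (\<lambda>w. of_real r * w ^ (Suc j) + (\<Sum>i=0..d. a i * (w ^ j / w ^ i)))"
    by (intro circle_mean_cong) (simp add: laurent_map_def distrib_left sum_distrib_left mult_ac)
  also have "\<dots> = of_real r * circle_mean (\<lambda>w. w ^ Suc j) + (\<Sum>i=0..d. a i * circle_mean (\<lambda>w. w ^ j / w ^ i))"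
    unfolding circle_mean_mult_left[symmetric]
    by (subst circle_mean_sum[symmetric], simp, (auto intro!: continuous_intros simp del: power_Suc)[1],
        rule circle_mean_add) (auto intro!: continuous_intros simp del: power_Suc)
  also have "\<dots> = a j"
    using assms by (simp add: circle_mean_power_div if_distrib[of "\<lambda>x. _ * x"] cong: if_cong del: power_Suc)
  finally show ?thesis .
qed

lemma laurent_leading_coefficient:
  "circle_mean (\<lambda>w. laurent_map d r a w / w) = of_real r"
proof -
  have "circle_mean (\<lambda>w. laurent_map d r a w / w) =
     circle_mean (\<lambda>w. of_real r * w ^ 0 + (\<Sum>i=0..d. a i * (w ^ 0 / w ^ Suc i)))"
    by (intro circle_mean_cong) (auto simp add: laurent_map_def add_divide_distrib sum_divide_distrib mult.commute)
  also have "\<dots> = of_real r * circle_mean (\<lambda>w. w ^ 0) + (\<Sum>i=0..d. a i * circle_mean (\<lambda>w. w ^ 0 / w ^ Suc i))"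
    unfolding circle_mean_mult_left[symmetric]
    by (subst circle_mean_sum[symmetric], simp, (auto intro!: continuous_intros simp del: power_Suc)[1],
        rule circle_mean_add) (auto intro!: continuous_intros simp del: power_Suc)
  also have "\<dots> = of_real r"
    by (simp only: circle_mean_power_div circle_mean_power) simp
  finally show ?thesis .
qed

lemma cnj_eq_inverse_unit:
  assumes "cmod w = 1"
  shows "cnj w = 1 / w"
proof -
  have "w \<noteq> 0" "w * cnj w = 1" using assms complex_norm_square[of w] by auto
  then show ?thesis by (simp add: eq_divide_eq mult.commute)
qed

section \<open>The exterior map of a polynomial curve\<close>

locale polynomial_curve =
  smooth_jordan_curve "laurent_map d r a \<circ> circle_point" "laurent_velocity d r a"
  for d :: nat and r :: real and a :: "nat \<Rightarrow> complex" +
  assumes r_pos: "r > 0"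
begin

abbreviation "h \<equiv> laurent_map d r a"

lemma path_image_eq: "path_image (h \<circ> circle_point) = h ` sphere 0 1"
  by (rule path_image_laurent)

text \<open>Winding number 1 leaves \<open>n = 0\<close>. For a point of \<open>\<Omega>\<close> the
  reciprocal of the reversed polynomial is therefore holomorphic near the closed disc, which is what
  the later uses of Cauchy's theorem rest on.\<close>

lemma inside_no_zero:
  assumes "\<zeta> \<in> \<Omega>" "cmod s \<le> 1"
  shows "poly (laurent_reversed d r a \<zeta>) s \<noteq> 0"
proof -
  have n: "\<zeta> \<notin> h ` sphere 0 1" using inside_off_path[OF assms(1)] by (simp add: path_image_eq)
  obtain n :: nat where W: "winding_number (h \<circ> circle_point) \<zeta> = 1 - of_nat n"
    and 1: "n = 0 \<longleftrightarrow> (\<forall>s. cmod s \<le> 1 \<longrightarrow> poly (laurent_reversed d r a \<zeta>) s \<noteq> 0)"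
    by (rule winding_number_laurent[OF n])
  have "of_nat n = (0 :: complex)"
    using winding_off[OF inside_off_path[OF assms(1)]] assms(1) unfolding W by simp
  then show ?thesis using 1 assms(2) by simp
qed

text \<open>Winding number 0 forces a root \<open>s\<close> in the closed disc. It is not 0, since
  the value there is \<open>r\<close>, and not on the circle, since \<open>z\<close> is off the
  curve; so \<open>1 / s\<close> is an exterior preimage.\<close>

lemma outside_preimage:
  assumes "z \<notin> \<Omega>" "z \<notin> path_image (h \<circ> circle_point)"
  obtains v where "cmod v > 1" "h v = z"
proof -
  have n: "z \<notin> h ` sphere 0 1" using assms(2) by (simp add: path_image_eq)
  obtain n :: nat where W: "winding_number (h \<circ> circle_point) z = 1 - of_nat n"
    and 1: "n = 0 \<longleftrightarrow> (\<forall>s. cmod s \<le> 1 \<longrightarrow> poly (laurent_reversed d r a z) s \<noteq> 0)"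
    by (rule winding_number_laurent[OF n])
  have "of_nat n = (1 :: complex)"
    using winding_off[OF assms(2)] assms(1) unfolding W by simp
  then have "n \<noteq> 0" by auto
  then obtain s where s: "cmod s \<le> 1" "poly (laurent_reversed d r a z) s = 0" using 1 by auto
  have "s \<noteq> 0" using s(2) r_pos by (auto simp: poly_laurent_reversed)
  then have hz: "h (1 / s) = z" using s(2) poly_laurent_reversed_eq[of s d r a z] by simp
  have "cmod s \<noteq> 1"
  proof
    assume "cmod s = 1"
    then have "1 / s \<in> sphere 0 1" by (simp add: norm_divide)
    then show False using n hz by blast
  qed
  then show ?thesis using s \<open>s \<noteq> 0\<close> hz by (intro that[of "1 / s"]) (auto simp: norm_divide)
qed

lemma finite_area:
  obtains \<epsilon> where "\<epsilon> > 0" "emeasure lborel \<Omega> \<le> ennreal (pi * \<epsilon>^2)"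
proof -
  obtain R where "R > 0" "\<Omega> \<subseteq> ball 0 R" using obtain_radius[of 0] by metis
  then show ?thesis
    using emeasure_mono[of \<Omega> "ball 0 R" lborel] by (intro that[of R]) (auto simp: emeasure_ball_complex)
qed

text \<open>Fubini's theorem, with \<open>1 / (h (1 / \<sigma>) - \<zeta>)\<close> rewritten as
  \<open>\<sigma>\<close> over the reversed polynomial, a function holomorphic in the disc for every
  \<open>\<zeta>\<close> in \<open>\<Omega>\<close>.\<close>

lemma circle_mean_cauchy_transform:
  assumes \<phi>: "continuous_on (sphere 0 1) \<phi>"
  shows "circle_mean (\<lambda>\<sigma>. \<phi> \<sigma> * cauchy_transform \<Omega> (h (1 / \<sigma>))) =
    of_real (1 / pi) * (LINT \<zeta>:\<Omega>|lborel. circle_mean (\<lambda>\<sigma>. \<phi> \<sigma> * \<sigma> / poly (laurent_reversed d r a \<zeta>) \<sigma>))"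
proof -
  obtain \<epsilon> where e: "\<epsilon> > 0" "emeasure lborel \<Omega> \<le> ennreal (pi * \<epsilon>^2)" by (rule finite_area)
  have c1: "continuous_on UNIV (\<lambda>t. h (1 / circle_point t))" by (intro continuous_intros) auto
  have c2: "continuous_on UNIV (\<lambda>t. \<phi> (circle_point t))"
    by (rule continuous_on_compose2[OF \<phi>]) (auto intro: continuous_intros)
  have "circle_mean (\<lambda>\<sigma>. \<phi> \<sigma> * cauchy_transform \<Omega> (h (1 / \<sigma>))) =
     (LINT t:{0..1}|lborel. of_real (1 / pi) * (\<phi> (circle_point t) * (LINT \<zeta>:\<Omega>|lborel. 1 / (h (1 / circle_point t) - \<zeta>))))"
    unfolding circle_mean_def cauchy_transform_def by (simp add: mult_ac)
  also have "\<dots> = of_real (1 / pi) * (LINT t:{0..1}|lborel. \<phi> (circle_point t) * (LINT \<zeta>:\<Omega>|lborel. 1 / (h (1 / circle_point t) - \<zeta>)))"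
    by (rule set_integral_mult_right)
  also note fubini_cauchy_kernel(2)[OF c1 c2 borel_inside e(2) e(1)]
  also have "(LINT \<zeta>:\<Omega>|lborel. LINT t:{0..1}|lborel. \<phi> (circle_point t) / (h (1 / circle_point t) - \<zeta>)) =
     (LINT \<zeta>:\<Omega>|lborel. circle_mean (\<lambda>\<sigma>. \<phi> \<sigma> * \<sigma> / poly (laurent_reversed d r a \<zeta>) \<sigma>))"
    unfolding circle_mean_def
  proof (intro set_lebesgue_integral_cong allI impI)
    fix \<zeta> t
    show "\<phi> (circle_point t) / (h (1 / circle_point t) - \<zeta>) =
      \<phi> (circle_point t) * circle_point t / poly (laurent_reversed d r a \<zeta>) (circle_point t)"
      by (subst poly_laurent_reversed_eq) auto
  qed auto
  finally show ?thesis .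
qed

end

section \<open>The coefficient equations and the Schwarz function outside the curve\<close>

lemma cnj_laurent_map:
  "cnj (laurent_map d r a (cnj s)) = of_real r * s + (\<Sum>j=0..d. cnj (a j) / s ^ j)"
  by (simp add: laurent_map_def)

text \<open>On the unit circle \<open>cnj s = 1 / s\<close>, so this is \<open>s ^ d\<close> times
  cnj z - P'(z) at the curve point \<open>z = h (1 / s)\<close>. The power clears all denominators:
  \<open>h (1 / s)\<close> has at most a simple pole at 0 and P' has degree at most
  \<open>d\<close>. Being a polynomial, it extends that function off the circle.\<close>

definition schwarz_numerator :: "nat \<Rightarrow> real \<Rightarrow> (nat \<Rightarrow> complex) \<Rightarrow> (nat \<Rightarrow> complex) \<Rightarrow> complex poly"
  where "schwarz_numerator d r a t = monom (of_real r) (d + 1) + (\<Sum>j=0..d. monom (cnj (a j)) (d - j)) -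
    (\<Sum>k=1..d+1. monom (of_nat k * t k) (d + 1 - k) * laurent_reversed d r a 0 ^ (k - 1))"

lemma poly_schwarz_numerator:
  assumes "s \<noteq> 0"
  shows "poly (schwarz_numerator d r a t) s =
    s ^ d * (cnj (laurent_map d r a (cnj s)) - moment_poly d t (laurent_map d r a (1 / s)))"
proof -
  have 1: "s ^ d * (\<Sum>j=0..d. cnj (a j) / s ^ j) = (\<Sum>j=0..d. cnj (a j) * s ^ (d - j))"
    unfolding sum_distrib_left
  proof (intro sum.cong refl)
    fix j assume "j \<in> {0..d}"
    then have "s ^ d = s ^ (d - j) * s ^ j" by (simp flip: power_add)
    then show "s ^ d * (cnj (a j) / s ^ j) = cnj (a j) * s ^ (d - j)" using assms by simp
  qed
  have 2: "s ^ d * moment_poly d t (laurent_map d r a (1 / s)) =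
     (\<Sum>k=1..d+1. of_nat k * t k * s ^ (d + 1 - k) * poly (laurent_reversed d r a 0) s ^ (k - 1))"
    unfolding moment_poly_def sum_distrib_left
  proof (intro sum.cong refl)
    fix k assume "k \<in> {1..d+1}"
    then have "s ^ d = s ^ (d + 1 - k) * s ^ (k - 1)" by (simp flip: power_add)
    then show "s ^ d * (of_nat k * t k * laurent_map d r a (1 / s) ^ (k - 1)) =
      of_nat k * t k * s ^ (d + 1 - k) * poly (laurent_reversed d r a 0) s ^ (k - 1)"
      using poly_laurent_reversed_eq[OF assms, of d r a 0] by (simp add: power_mult_distrib)
  qed
  show ?thesis
    unfolding cnj_laurent_map right_diff_distrib 2 distrib_left 1
    by (simp add: schwarz_numerator_def poly_sum poly_monom)
qed

locale moment_curve = polynomial_curve +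
  fixes t :: "nat \<Rightarrow> complex"
  assumes moments: "\<forall>k\<ge>1. exterior_moment (laurent_map d r a \<circ> circle_point) k = t k"
    and moments_above: "\<forall>k>d+1. t k = 0"
    and zero_inside: "0 \<in> inside (path_image (laurent_map d r a \<circ> circle_point))"
begin

text \<open>The Cauchy transform is continuous on the plane, so \<open>schwarz_inside\<close>
  persists on the closure of \<open>\<Omega>\<close>, whose frontier is the curve.\<close>

lemma schwarz_on_curve:
  assumes "cmod w = 1"
  shows "cauchy_transform \<Omega> (h w) = cnj (h w) - moment_poly d t (h w)"
proof -
  obtain \<epsilon> where e: "\<epsilon> > 0" "emeasure lborel \<Omega> \<le> ennreal (pi * \<epsilon>^2)" by (rule finite_area)
  let ?S = "{z. cauchy_transform \<Omega> z = cnj z - moment_poly d t z}"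
  have "closed ?S"
    by (intro closed_Collect_eq continuous_cauchy_transform[OF borel_inside e(2) e(1)] continuous_intros)
  moreover have "\<Omega> \<subseteq> ?S"
    using schwarz_inside[OF moments moments_above zero_inside] by (auto simp: algebra_simps)
  ultimately have "closure \<Omega> \<subseteq> ?S" by (rule closure_minimal[rotated])
  moreover have "h w \<in> frontier \<Omega>"
    using jordan assms by (simp add: path_image_eq)
  then have "h w \<in> closure \<Omega>" by (simp add: frontier_def)
  ultimately show ?thesis by auto
qed

text \<open>For \<open>\<zeta>\<close> in \<open>\<Omega>\<close> the function
  \<open>\<sigma> ^ j * \<sigma> / q\<close> with the reversed polynomial \<open>q\<close> is
  holomorphic on the disc and vanishes at 0, so the transform contributes nothing to these Fourier
  coefficients. What remains of \<open>schwarz_on_curve\<close> equates coefficients of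
  \<open>cnj h\<close> and P'(h).\<close>

lemma coefficient_equation:
  assumes "j \<le> d"
  shows "cnj (a j) = circle_mean (\<lambda>\<sigma>. moment_poly d t (h (1 / \<sigma>)) * \<sigma> ^ j)"
proof -
  have "circle_mean (\<lambda>\<sigma>. \<sigma> ^ j * cauchy_transform \<Omega> (h (1 / \<sigma>))) = 
    of_real (1 / pi) * (LINT \<zeta>:\<Omega>|lborel. circle_mean (\<lambda>\<sigma>. \<sigma> ^ j * \<sigma> / poly (laurent_reversed d r a \<zeta>) \<sigma>))"
    by (rule circle_mean_cauchy_transform) (intro continuous_intros)
  also have "(LINT \<zeta>:\<Omega>|lborel. circle_mean (\<lambda>\<sigma>. \<sigma> ^ j * \<sigma> / poly (laurent_reversed d r a \<zeta>) \<sigma>)) =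
    (LINT \<zeta>:\<Omega>|lborel. 0)"
  proof (intro set_lebesgue_integral_cong allI impI)
    fix \<zeta> assume "\<zeta> \<in> \<Omega>"
    then show "circle_mean (\<lambda>\<sigma>. \<sigma> ^ j * \<sigma> / poly (laurent_reversed d r a \<zeta>) \<sigma>) = 0"
      by (subst circle_mean_Cauchy_0) (auto intro!: continuous_intros holomorphic_intros simp: inside_no_zero)
  qed auto
  also have "(LINT \<zeta>:\<Omega>|lborel. 0 :: complex) = 0" by (simp add: set_lebesgue_integral_def)
  finally have "0 = circle_mean (\<lambda>\<sigma>. \<sigma> ^ j * cauchy_transform \<Omega> (h (1 / \<sigma>)))" by (simp only: mult_zero_right)
  also have "\<dots> = circle_mean (\<lambda>\<sigma>. cnj (h (1 / \<sigma>) * (1 / \<sigma>) ^ j) - moment_poly d t (h (1 / \<sigma>)) * \<sigma> ^ j)"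
  proof (rule circle_mean_cong)
    fix \<sigma> :: complex assume \<sigma>: "cmod \<sigma> = 1"
    then have "cmod (1 / \<sigma>) = 1" by (simp add: norm_divide)
    moreover have "cnj (1 / \<sigma>) = \<sigma>"
      using cnj_eq_inverse_unit[OF \<open>cmod (1 / \<sigma>) = 1\<close>] by simp
    ultimately show "\<sigma> ^ j * cauchy_transform \<Omega> (h (1 / \<sigma>)) =
       cnj (h (1 / \<sigma>) * (1 / \<sigma>) ^ j) - moment_poly d t (h (1 / \<sigma>)) * \<sigma> ^ j"
      by (simp only: schwarz_on_curve complex_cnj_mult complex_cnj_power) (simp add: algebra_simps)
  qed
  also have "\<dots> = circle_mean (\<lambda>\<sigma>. cnj (h (1 / \<sigma>) * (1 / \<sigma>) ^ j)) - circle_mean (\<lambda>\<sigma>. moment_poly d t (h (1 / \<sigma>)) * \<sigma> ^ j)"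
    by (rule circle_mean_diff) (auto intro!: continuous_intros)
  also have "circle_mean (\<lambda>\<sigma>. cnj (h (1 / \<sigma>) * (1 / \<sigma>) ^ j)) = cnj (circle_mean (\<lambda>\<sigma>. h \<sigma> * \<sigma> ^ j))"
    unfolding circle_mean_cnj by (subst circle_mean_inverse_arg[symmetric]) simp
  also have "\<dots> = cnj (a j)" by (simp add: laurent_coefficient[OF assms])
  finally show ?thesis by simp
qed

text \<open>The same mean is evaluated twice by Cauchy's formula at \<open>s = 1 / v\<close>:
  through the area integral it gives the transform at \<open>h v\<close>, through
  \<open>schwarz_on_curve\<close> the polynomial \<open>schwarz_numerator\<close> at
  \<open>s\<close>. Here \<open>h (1 / cnj v)\<close> is the Schwarz reflection of
  \<open>h v\<close> in the curve.\<close>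

lemma schwarz_outside:
  assumes "cmod v > 1"
  shows "cauchy_transform \<Omega> (h v) = cnj (h (1 / cnj v)) - moment_poly d t (h v)"
proof -
  define s where "s = 1 / v"
  have s: "cmod s < 1" "s \<noteq> 0" "h (1 / s) = h v" "cnj s = 1 / cnj v"
    using assms by (auto simp: s_def norm_divide divide_less_eq_1)
  \<comment> \<open>One factor \<open>\<sigma>\<close> completes the Cauchy kernel, the other
    \<open>d\<close> clear the denominators in \<open>schwarz_numerator\<close>.\<close>
  let ?\<phi> = "\<lambda>\<sigma>. \<sigma> ^ (d + 1) / (\<sigma> - s)"
  have "circle_mean (\<lambda>\<sigma>. ?\<phi> \<sigma> * cauchy_transform \<Omega> (h (1 / \<sigma>))) =
    of_real (1 / pi) * (LINT \<zeta>:\<Omega>|lborel. circle_mean (\<lambda>\<sigma>. ?\<phi> \<sigma> * \<sigma> / poly (laurent_reversed d r a \<zeta>) \<sigma>))"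
    by (rule circle_mean_cauchy_transform) (use s(1) in \<open>auto intro!: continuous_intros\<close>)
  also have "(LINT \<zeta>:\<Omega>|lborel. circle_mean (\<lambda>\<sigma>. ?\<phi> \<sigma> * \<sigma> / poly (laurent_reversed d r a \<zeta>) \<sigma>)) =
    (LINT \<zeta>:\<Omega>|lborel. s ^ d * (1 / (h v - \<zeta>)))"
  proof (intro set_lebesgue_integral_cong allI impI)
    fix \<zeta> assume \<zeta>: "\<zeta> \<in> \<Omega>"
    let ?F = "\<lambda>\<sigma>. \<sigma> ^ (d + 1) / poly (laurent_reversed d r a \<zeta>) \<sigma>"
    have "circle_mean (\<lambda>\<sigma>. ?\<phi> \<sigma> * \<sigma> / poly (laurent_reversed d r a \<zeta>) \<sigma>) = circle_mean (\<lambda>\<sigma>. ?F \<sigma> * \<sigma> / (\<sigma> - s))"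
      by (rule circle_mean_cong) simp
    also have "\<dots> = ?F s"
      by (rule circle_mean_Cauchy) (use s \<zeta> in \<open>auto intro!: continuous_intros holomorphic_intros simp: inside_no_zero\<close>)
    also have "\<dots> = s ^ d * (1 / (h v - \<zeta>))"
      using s poly_laurent_reversed_eq[of s d r a \<zeta>] by simp
    finally show "circle_mean (\<lambda>\<sigma>. ?\<phi> \<sigma> * \<sigma> / poly (laurent_reversed d r a \<zeta>) \<sigma>) = s ^ d * (1 / (h v - \<zeta>))" .
  qed auto
  also have "of_real (1 / pi) * \<dots> = s ^ d * cauchy_transform \<Omega> (h v)"
    unfolding cauchy_transform_def by (subst set_integral_mult_right) (simp add: mult_ac)
  finally have "s ^ d * cauchy_transform \<Omega> (h v) = circle_mean (\<lambda>\<sigma>. ?\<phi> \<sigma> * cauchy_transform \<Omega> (h (1 / \<sigma>)))" ..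
  also have "\<dots> = circle_mean (\<lambda>\<sigma>. poly (schwarz_numerator d r a t) \<sigma> * \<sigma> / (\<sigma> - s))"
  proof (rule circle_mean_cong)
    fix \<sigma> :: complex assume \<sigma>: "cmod \<sigma> = 1"
    then have c1: "cmod (1 / \<sigma>) = 1" by (simp add: norm_divide)
    have c2: "cnj \<sigma> = 1 / \<sigma>" "\<sigma> \<noteq> 0"
      using \<sigma> cnj_eq_inverse_unit[OF \<sigma>] by auto
    show "?\<phi> \<sigma> * cauchy_transform \<Omega> (h (1 / \<sigma>)) = poly (schwarz_numerator d r a t) \<sigma> * \<sigma> / (\<sigma> - s)"
      unfolding schwarz_on_curve[OF c1] poly_schwarz_numerator[OF c2(2)] c2(1) by simp
  qed
  also have "\<dots> = poly (schwarz_numerator d r a t) s"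
    by (rule circle_mean_Cauchy) (use s in \<open>auto intro!: continuous_intros holomorphic_intros\<close>)
  also have "\<dots> = s ^ d * (cnj (h (1 / cnj v)) - moment_poly d t (h v))"
    unfolding poly_schwarz_numerator[OF s(2)] s(3) s(4) ..
  finally show ?thesis using s(2) by simp
qed

end

section \<open>Solving the coefficient equations\<close>

lemma norm_power_diff_le:
  fixes z w :: complex
  assumes "cmod z \<le> R" "cmod w \<le> R"
  shows "cmod (z ^ n - w ^ n) \<le> of_nat n * R ^ (n - 1) * cmod (z - w)"
proof (induction n)
  case (Suc n)
  have R: "R \<ge> 0" using assms(1) norm_ge_zero order_trans by blast
  have "z ^ Suc n - w ^ Suc n = z * (z ^ n - w ^ n) + (z - w) * w ^ n" by (simp add: algebra_simps)
  also have "cmod \<dots> \<le> cmod z * cmod (z ^ n - w ^ n) + cmod (z - w) * cmod w ^ n"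
    by (rule norm_triangle_le) (simp add: norm_mult norm_power)
  also have "\<dots> \<le> R * (of_nat n * R ^ (n - 1) * cmod (z - w)) + cmod (z - w) * R ^ n"
    using assms R by (intro add_mono mult_mono Suc.IH power_mono) auto
  also have "\<dots> = of_nat (Suc n) * R ^ (Suc n - 1) * cmod (z - w)"
    by (cases n) (auto simp: algebra_simps)
  finally show ?case .
qed simp

locale moment_data =
  fixes d :: nat and t :: "nat \<Rightarrow> complex"
  assumes t1: "t 1 = 0" and t2: "cmod (t 2) < 1 / 2" and above: "\<forall>k>d+1. t k = 0"
begin

definition "\<beta> = 2 * cmod (t 2)"

lemma beta: "0 \<le> \<beta>" "\<beta> < 1"
  using t2 by (auto simp: \<beta>_def)

definition Q :: "complex \<Rightarrow> complex"
  where "Q z = (\<Sum>k=3..d+1. of_nat k * t k * z ^ (k - 1))"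

text \<open>\<open>k * k\<close> dominates the factor \<open>k * (k - 1)\<close> that arises from
  the powers; \<open>\<kappa> * R\<close> becomes a Lipschitz constant of \<open>Q\<close> on the
  disc of radius \<open>R\<close>, for \<open>R\<close> at most 1.\<close>

definition "\<kappa> = (\<Sum>k=3..d+1. of_nat (k * k) * cmod (t k))"

lemma kappa: "0 \<le> \<kappa>"
  unfolding \<kappa>_def by (intro sum_nonneg) auto

lemma moment_poly_split: "moment_poly d t z = 2 * t 2 * z + Q z"
\<comment> \<open>For \<open>d = 0\<close> the index 2 exceeds \<open>d + 1\<close>, so
  \<open>t 2\<close> vanishes and with it the separated term.\<close>
proof (cases "d = 0")
  case True
  then have "t 2 = 0" "t 1 = 0" using above t1 by auto
  then show ?thesis unfolding moment_poly_def Q_def using True by simp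
next
  case False
  then have "{1..d+1} = insert 1 (insert 2 {3..d+1})" by auto
  then show ?thesis using t1 by (simp add: moment_poly_def Q_def)
qed

lemma Q_0 [simp]: "Q 0 = 0"
  unfolding Q_def by (intro sum.neutral) auto

lemma continuous_Q [continuous_intros]: "continuous_on A f \<Longrightarrow> continuous_on A (\<lambda>x. Q (f x))"
  unfolding Q_def by (intro continuous_intros)

lemma Q_lipschitz:
  assumes "cmod z \<le> R" "cmod w \<le> R" "R \<le> 1"
  shows "cmod (Q z - Q w) \<le> \<kappa> * R * cmod (z - w)"
proof -
  have R: "R \<ge> 0" using assms(1) norm_ge_zero order_trans by blast
  have "cmod (Q z - Q w) = cmod (\<Sum>k=3..d+1. of_nat k * t k * (z ^ (k - 1) - w ^ (k - 1)))"
    by (simp add: Q_def sum_subtractf right_diff_distrib)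
  also have "\<dots> \<le> (\<Sum>k=3..d+1. of_nat (k * k) * cmod (t k) * (R * cmod (z - w)))"
  proof (rule sum_norm_le)
    fix k assume k: "k \<in> {3..d+1}"
    have "cmod (of_nat k * t k * (z ^ (k - 1) - w ^ (k - 1))) \<le>
        of_nat k * cmod (t k) * (of_nat (k - 1) * R ^ (k - 1 - 1) * cmod (z - w))"
      unfolding norm_mult norm_of_nat by (intro mult_left_mono norm_power_diff_le assms) auto
    also have "\<dots> \<le> of_nat k * cmod (t k) * (of_nat k * R * cmod (z - w))"
    proof (intro mult_left_mono mult_right_mono mult_mono)
      have "R ^ (k - 1 - 1) \<le> R ^ 1" using k R assms(3) by (intro power_decreasing) auto
      then show "R ^ (k - 1 - 1) \<le> R" by simp
    qed (use R in auto)
    finally show "cmod (of_nat k * t k * (z ^ (k - 1) - w ^ (k - 1))) \<le>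
      of_nat (k * k) * cmod (t k) * (R * cmod (z - w))" by (simp add: mult_ac)
  qed
  also have "\<dots> = \<kappa> * R * cmod (z - w)" by (simp only: \<kappa>_def sum_distrib_right mult.assoc)
  finally show ?thesis .
qed

text \<open>Coefficient of \<open>1 / \<sigma> ^ j\<close> in \<open>h (1 / \<sigma>)\<close>, which
  is \<open>r / \<sigma>\<close> plus non-negative powers. So the linear part of P' enters only the
  equations for \<open>j = 0\<close> and \<open>j = 1\<close>.\<close>

definition lin :: "real \<Rightarrow> (nat \<Rightarrow> complex) \<Rightarrow> nat \<Rightarrow> complex"
  where "lin r a j = (if j = 0 then a 0 else if j = 1 then of_real r else 0)"

text \<open>The conjugated right side of \<open>coefficient_equation\<close>, with \<open>r\<close>
  as a parameter and the coefficients as the unknown of the fixed point problem.\<close>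

definition \<Phi> :: "real \<Rightarrow> (nat \<Rightarrow> complex) \<Rightarrow> nat \<Rightarrow> complex"
  where "\<Phi> r a j = cnj (circle_mean (\<lambda>\<sigma>. moment_poly d t (laurent_map d r a (1 / \<sigma>)) * \<sigma> ^ j))"

definition solves :: "real \<Rightarrow> (nat \<Rightarrow> complex) \<Rightarrow> bool"
  where "solves r a \<longleftrightarrow> (\<forall>j\<le>d. a j = \<Phi> r a j)"

lemma circle_mean_lin:
  assumes "j \<le> d"
  shows "circle_mean (\<lambda>\<sigma>. laurent_map d r a (1 / \<sigma>) * \<sigma> ^ j) = lin r a j"
proof -
  have "circle_mean (\<lambda>\<sigma>. laurent_map d r a (1 / \<sigma>) * \<sigma> ^ j) =
     circle_mean (\<lambda>\<sigma>. of_real r * (\<sigma> ^ j / \<sigma> ^ 1) + (\<Sum>i=0..d. a i * \<sigma> ^ (i + j)))"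
    by (intro circle_mean_cong)
       (simp add: laurent_map_def distrib_left sum_distrib_left power_add power_one_over mult_ac)
  also have "\<dots> = of_real r * circle_mean (\<lambda>\<sigma>. \<sigma> ^ j / \<sigma> ^ 1) + (\<Sum>i=0..d. a i * circle_mean (\<lambda>\<sigma>. \<sigma> ^ (i + j)))"
    unfolding circle_mean_mult_left[symmetric]
    by (subst circle_mean_sum[symmetric], simp, (auto intro!: continuous_intros)[1],
        rule circle_mean_add) (auto intro!: continuous_intros)
  also have "\<dots> = (if j = 1 then of_real r else 0) + (\<Sum>i=0..d. if i = 0 \<and> j = 0 then a i else 0)"
    by (simp only: circle_mean_power_div circle_mean_power) (auto intro!: sum.cong)
  also have "(\<Sum>i=0..d. if i = 0 \<and> j = 0 then a i else 0) = (if j = 0 then a 0 else 0)"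
    by (cases "j = 0") auto
  finally show ?thesis by (auto simp: lin_def)
qed

lemma \<Phi>_eq:
  assumes "j \<le> d"
  shows "\<Phi> r a j = cnj (2 * t 2 * lin r a j + circle_mean (\<lambda>\<sigma>. Q (laurent_map d r a (1 / \<sigma>)) * \<sigma> ^ j))"
proof -
  have "circle_mean (\<lambda>\<sigma>. moment_poly d t (laurent_map d r a (1 / \<sigma>)) * \<sigma> ^ j) =
     circle_mean (\<lambda>\<sigma>. 2 * t 2 * (laurent_map d r a (1 / \<sigma>) * \<sigma> ^ j) + Q (laurent_map d r a (1 / \<sigma>)) * \<sigma> ^ j)"
    by (intro circle_mean_cong) (simp add: moment_poly_split algebra_simps)
  also have "\<dots> = 2 * t 2 * circle_mean (\<lambda>\<sigma>. laurent_map d r a (1 / \<sigma>) * \<sigma> ^ j)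
      + circle_mean (\<lambda>\<sigma>. Q (laurent_map d r a (1 / \<sigma>)) * \<sigma> ^ j)"
    unfolding circle_mean_mult_left[symmetric]
    by (rule circle_mean_add) (auto intro!: continuous_intros)
  finally show ?thesis unfolding \<Phi>_def circle_mean_lin[OF assms] by simp
qed

lemma norm_laurent_map_diff:
  assumes "cmod w = 1" "\<And>j. j \<le> d \<Longrightarrow> cmod (a j - b j) \<le> \<delta>" "\<bar>r - s\<bar> \<le> \<delta>"
  shows "cmod (laurent_map d r a w - laurent_map d s b w) \<le> (real d + 2) * \<delta>"
proof -
  have "laurent_map d r a w - laurent_map d s b w = of_real (r - s) * w + (\<Sum>j=0..d. (a j - b j) / w ^ j)"
    by (simp add: laurent_map_def algebra_simps sum_subtractf diff_divide_distrib)
  also have "cmod \<dots> \<le> \<bar>r - s\<bar> + (\<Sum>j=0..d. \<delta>)"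
    using assms by (intro norm_triangle_mono sum_norm_le) (auto simp: norm_mult norm_divide norm_power)
  also have "\<dots> \<le> \<delta> + real (d + 1) * \<delta>" using assms(3) by simp
  finally show ?thesis by (simp add: algebra_simps)
qed

lemma norm_laurent_map:
  assumes "cmod w = 1" "\<And>j. j \<le> d \<Longrightarrow> cmod (a j) \<le> \<rho>" "0 \<le> r" "r \<le> \<rho>"
  shows "cmod (laurent_map d r a w) \<le> (real d + 2) * \<rho>"
  using norm_laurent_map_diff[of w a "\<lambda>_. 0" \<rho> r 0] assms by (simp add: laurent_map_def)

text \<open>The linear contribution is kept in terms of \<open>lin\<close> instead of being
  estimated by \<open>\<delta>\<close>: it vanishes for \<open>j\<close> at least 2 and involves
  only the leading coefficients for \<open>j = 1\<close>, which \<open>solves_tame\<close>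
  exploits.\<close>

lemma \<Phi>_diff:
  assumes "j \<le> d" and \<rho>: "(real d + 2) * \<rho> \<le> 1" "0 \<le> r" "r \<le> \<rho>" "0 \<le> s" "s \<le> \<rho>"
    and ab: "\<And>j. j \<le> d \<Longrightarrow> cmod (a j) \<le> \<rho>" "\<And>j. j \<le> d \<Longrightarrow> cmod (b j) \<le> \<rho>"
    and \<delta>: "\<And>j. j \<le> d \<Longrightarrow> cmod (a j - b j) \<le> \<delta>" "\<bar>r - s\<bar> \<le> \<delta>"
  shows "cmod (\<Phi> r a j - \<Phi> s b j) \<le> \<beta> * cmod (lin r a j - lin s b j) + \<kappa> * (real d + 2)^2 * \<rho> * \<delta>"
proof -
  let ?Qa = "\<lambda>\<sigma>. Q (laurent_map d r a (1 / \<sigma>))" and ?Qb = "\<lambda>\<sigma>. Q (laurent_map d s b (1 / \<sigma>))"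
  have "\<Phi> r a j - \<Phi> s b j = cnj (2 * t 2 * (lin r a j - lin s b j) + (circle_mean (\<lambda>\<sigma>. ?Qa \<sigma> * \<sigma> ^ j) - circle_mean (\<lambda>\<sigma>. ?Qb \<sigma> * \<sigma> ^ j)))"
    by (simp add: \<Phi>_eq[OF assms(1)] algebra_simps)
  also have "circle_mean (\<lambda>\<sigma>. ?Qa \<sigma> * \<sigma> ^ j) - circle_mean (\<lambda>\<sigma>. ?Qb \<sigma> * \<sigma> ^ j) = circle_mean (\<lambda>\<sigma>. ?Qa \<sigma> * \<sigma> ^ j - ?Qb \<sigma> * \<sigma> ^ j)"
    by (rule circle_mean_diff[symmetric]) (auto intro!: continuous_intros)
  finally have "cmod (\<Phi> r a j - \<Phi> s b j) =
    cmod (cnj (2 * t 2 * (lin r a j - lin s b j) + circle_mean (\<lambda>\<sigma>. ?Qa \<sigma> * \<sigma> ^ j - ?Qb \<sigma> * \<sigma> ^ j)))"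
    by (rule arg_cong)
  then have 1: "cmod (\<Phi> r a j - \<Phi> s b j) =
    cmod (2 * t 2 * (lin r a j - lin s b j) + circle_mean (\<lambda>\<sigma>. ?Qa \<sigma> * \<sigma> ^ j - ?Qb \<sigma> * \<sigma> ^ j))"
    unfolding complex_mod_cnj .
  have "cmod (circle_mean (\<lambda>\<sigma>. ?Qa \<sigma> * \<sigma> ^ j - ?Qb \<sigma> * \<sigma> ^ j)) \<le> \<kappa> * ((real d + 2) * \<rho>) * ((real d + 2) * \<delta>)"
  proof (rule norm_circle_mean_le)
    fix \<sigma> :: complex assume "cmod \<sigma> = 1"
    then have s: "cmod (1 / \<sigma>) = 1" by (simp add: norm_divide)
    have r0: "0 \<le> \<rho>" using \<rho> by linarith
    have "cmod (?Qa \<sigma> * \<sigma> ^ j - ?Qb \<sigma> * \<sigma> ^ j) = cmod (?Qa \<sigma> - ?Qb \<sigma>)"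
      using \<open>cmod \<sigma> = 1\<close> by (simp add: left_diff_distrib[symmetric] norm_mult norm_power)
    also have "\<dots> \<le> \<kappa> * ((real d + 2) * \<rho>) * cmod (laurent_map d r a (1 / \<sigma>) - laurent_map d s b (1 / \<sigma>))"
      using \<rho> ab s by (intro Q_lipschitz norm_laurent_map)
    also have "\<dots> \<le> \<kappa> * ((real d + 2) * \<rho>) * ((real d + 2) * \<delta>)"
      using kappa r0 by (intro mult_left_mono norm_laurent_map_diff s \<delta>) auto
    finally show "cmod (?Qa \<sigma> * \<sigma> ^ j - ?Qb \<sigma> * \<sigma> ^ j) \<le> \<kappa> * ((real d + 2) * \<rho>) * ((real d + 2) * \<delta>)" .
  qed (auto intro!: continuous_intros)
  then show ?thesis
    unfolding 1 by (intro norm_triangle_le add_mono) (simp_all add: norm_mult \<beta>_def power2_eq_square mult_ac)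
qed

lemma lin_diff:
  assumes "\<And>j. j \<le> d \<Longrightarrow> cmod (a j - b j) \<le> \<delta>" "\<bar>r - s\<bar> \<le> \<delta>"
  shows "cmod (lin r a j - lin s b j) \<le> \<delta>"
proof -
  have "0 \<le> \<delta>" using assms(2) by linarith
  then show ?thesis using assms by (auto simp: lin_def simp flip: of_real_diff)
qed

lemma \<Phi>_contraction:
  assumes "j \<le> d" and \<rho>: "(real d + 2) * \<rho> \<le> 1" "0 \<le> r" "r \<le> \<rho>" "0 \<le> s" "s \<le> \<rho>"
    and ab: "\<And>j. j \<le> d \<Longrightarrow> cmod (a j) \<le> \<rho>" "\<And>j. j \<le> d \<Longrightarrow> cmod (b j) \<le> \<rho>"
    and \<delta>: "\<And>j. j \<le> d \<Longrightarrow> cmod (a j - b j) \<le> \<delta>" "\<bar>r - s\<bar> \<le> \<delta>"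
  shows "cmod (\<Phi> r a j - \<Phi> s b j) \<le> (\<beta> + \<kappa> * (real d + 2)^2 * \<rho>) * \<delta>"
proof -
  have "\<beta> * cmod (lin r a j - lin s b j) \<le> \<beta> * \<delta>"
    by (intro mult_left_mono lin_diff \<delta> beta)
  moreover have "cmod (\<Phi> r a j - \<Phi> s b j) \<le> \<beta> * cmod (lin r a j - lin s b j) + \<kappa> * (real d + 2)^2 * \<rho> * \<delta>"
    by (rule \<Phi>_diff) (use assms in auto)
  ultimately show ?thesis by (simp add: distrib_right)
qed

lemma \<Phi>_zero: "j \<le> d \<Longrightarrow> \<Phi> 0 (\<lambda>_. 0) j = 0"
  by (simp add: \<Phi>_eq lin_def laurent_map_def)

text \<open>If the largest coefficient difference exceeded the difference of the parameters, the
  contraction estimate with \<open>\<delta>\<close> equal to it would make it smaller than itself.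
  For \<open>r = s\<close> this is uniqueness; with the zero solution at \<open>s = 0\<close> it
  bounds the coefficients by \<open>r\<close>; in general it gives continuity in
  \<open>r\<close>.\<close>

lemma solves_lipschitz:
  assumes \<rho>: "(real d + 2) * \<rho> \<le> 1" "0 \<le> r" "r \<le> \<rho>" "0 \<le> s" "s \<le> \<rho>"
    and ab: "\<And>j. j \<le> d \<Longrightarrow> cmod (a j) \<le> \<rho>" "\<And>j. j \<le> d \<Longrightarrow> cmod (b j) \<le> \<rho>"
    and q: "\<beta> + \<kappa> * (real d + 2)^2 * \<rho> < 1"
    and sol: "solves r a" "solves s b" and "j \<le> d"
  shows "cmod (a j - b j) \<le> \<bar>r - s\<bar>"
proof -
  define M where "M = Max ((\<lambda>j. cmod (a j - b j)) ` {..d})"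
  have M: "cmod (a j - b j) \<le> M" if "j \<le> d" for j
    unfolding M_def using that by (intro Max_ge) auto
  have "M \<in> (\<lambda>j. cmod (a j - b j)) ` {..d}" unfolding M_def by (rule Max_in) auto
  then obtain i where i: "i \<le> d" "M = cmod (a i - b i)" by auto
  have "M \<le> \<bar>r - s\<bar>"
  proof (rule ccontr)
    assume n: "\<not> M \<le> \<bar>r - s\<bar>"
    have "M = cmod (\<Phi> r a i - \<Phi> s b i)" using sol i by (simp add: solves_def)
    also have "\<dots> \<le> (\<beta> + \<kappa> * (real d + 2)^2 * \<rho>) * M"
      by (rule \<Phi>_contraction) (use i \<rho> ab M n in auto)
    also have "\<dots> < 1 * M" using n q by (intro mult_strict_right_mono) auto
    finally show False by simp
  qed
  then show ?thesis using M[OF \<open>j \<le> d\<close>] by linarith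
qed

text \<open>Banach's iteration started at 0, carried out coefficientwise because only the indices up
  to \<open>d\<close> are constrained.\<close>

lemma solution_exists:
  assumes \<rho>: "(real d + 2) * \<rho> \<le> 1" "0 \<le> r" "r \<le> \<rho>"
    and q: "\<beta> + \<kappa> * (real d + 2)^2 * \<rho> < 1"
  shows "\<exists>a. solves r a \<and> (\<forall>j\<le>d. cmod (a j) \<le> \<rho>)"
proof -
  define q where "q = \<beta> + \<kappa> * (real d + 2)^2 * \<rho>"
  have q1: "0 \<le> q" "q < 1" using q beta kappa \<rho> by (auto simp: q_def)
  define X where "X = rec_nat (\<lambda>_. 0) (\<lambda>n a. \<Phi> r a)"
  have X0: "X 0 = (\<lambda>_. 0)" and XS: "X (Suc n) = \<Phi> r (X n)" for n by (auto simp: X_def)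
  have X: "cmod (X n j) \<le> r" if "j \<le> d" for n j
    using that
  proof (induction n arbitrary: j)
    case (Suc n)
    \<comment> \<open>Comparison with the zero solution at parameter 0, with
      \<open>\<delta> = r\<close>, keeps all iterates in the ball of radius
      \<open>r\<close>.\<close>
    have "cmod (\<Phi> r (X n) j - \<Phi> 0 (\<lambda>_. 0) j) \<le> q * r"
      unfolding q_def by (rule \<Phi>_contraction) (use Suc \<rho> in \<open>auto intro: order.trans\<close>)
    also have "\<dots> \<le> 1 * r" using q1 \<rho> by (intro mult_right_mono) auto
    finally show ?case using Suc.prems by (simp add: XS \<Phi>_zero)
  qed (use \<rho> in \<open>auto simp: X0\<close>)
  have X\<rho>: "cmod (X n j) \<le> \<rho>" if "j \<le> d" for n j using X[OF that, of n] \<rho> by linarith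
  have D: "cmod (X (Suc n) j - X n j) \<le> q ^ n * r" if "j \<le> d" for n j
    using that
  proof (induction n arbitrary: j)
    case 0
    then show ?case using X[of j "Suc 0"] by (simp add: X0)
  next
    case (Suc n)
    have "cmod (\<Phi> r (X (Suc n)) j - \<Phi> r (X n) j) \<le> q * (q ^ n * r)"
      unfolding q_def
      by (rule \<Phi>_contraction) (use Suc \<rho> X\<rho> q1 in \<open>auto simp: q_def[symmetric]\<close>)
    then show ?case by (simp add: XS mult_ac)
  qed
  have "\<exists>l. (\<lambda>n. X n j) \<longlonglongrightarrow> l" if "j \<le> d" for j
  proof -
    have "summable (\<lambda>n. X (Suc n) j - X n j)"
      by (rule summable_comparison_test'[of "\<lambda>n. q ^ n * r" 0])
         (use D[OF that] q1 in \<open>auto intro!: summable_mult2 summable_geometric\<close>)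
    then have "(\<lambda>n. \<Sum>k<n. X (Suc k) j - X k j) \<longlonglongrightarrow> (\<Sum>n. X (Suc n) j - X n j)"
      by (rule summable_LIMSEQ)
    moreover have "(\<Sum>k<n. X (Suc k) j - X k j) = X n j" for n
      using sum_lessThan_telescope[of "\<lambda>k. X k j" n] by (simp add: X0)
    ultimately show ?thesis by auto
  qed
  then obtain a where a: "\<And>j. j \<le> d \<Longrightarrow> (\<lambda>n. X n j) \<longlonglongrightarrow> a j" by metis
  have a\<rho>: "cmod (a j) \<le> \<rho>" if "j \<le> d" for j
    by (rule LIMSEQ_le_const2[OF tendsto_norm[OF a[OF that]]]) (use X\<rho>[OF that] in auto)
  have "a j = \<Phi> r a j" if j: "j \<le> d" for j
  proof (rule LIMSEQ_unique)
    show "(\<lambda>n. X (Suc n) j) \<longlonglongrightarrow> a j" by (rule LIMSEQ_Suc[OF a[OF j]])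
    \<comment> \<open>The sum of all coefficient errors dominates each of them and so can serve as
      the common \<open>\<delta>\<close> in \<open>\<Phi>_contraction\<close>.\<close>
    define e where "e = (\<lambda>n. \<Sum>i=0..d. cmod (X n i - a i))"
    have "e \<longlonglongrightarrow> (\<Sum>i=0..d. cmod (a i - a i))"
      unfolding e_def by (intro tendsto_sum tendsto_norm tendsto_diff a tendsto_const) auto
    then have e: "e \<longlonglongrightarrow> 0" by simp
    have "cmod (\<Phi> r (X n) j - \<Phi> r a j) \<le> q * e n" for n
      unfolding q_def
    proof (rule \<Phi>_contraction)
      show "cmod (X n i - a i) \<le> e n" if "i \<le> d" for i
        unfolding e_def using that by (intro member_le_sum) auto
      show "\<bar>r - r\<bar> \<le> e n" unfolding e_def by (simp add: sum_nonneg)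
    qed (use j \<rho> X\<rho> a\<rho> in auto)
    then have "(\<lambda>n. \<Phi> r (X n) j - \<Phi> r a j) \<longlonglongrightarrow> 0"
      by (intro Lim_null_comparison[OF _ tendsto_mult_right_zero[OF e, of q]] always_eventually) auto
    then show "(\<lambda>n. X (Suc n) j) \<longlonglongrightarrow> \<Phi> r a j" by (simp add: XS LIM_zero_iff)
  qed
  with a\<rho> show ?thesis unfolding solves_def by blast
qed

text \<open>Solutions are near-ellipses: since the coefficients are at most \<open>r\<close>, the
  non-linear part of the equation is of order \<open>\<rho> * r\<close>, and \<open>lin\<close>
  leaves \<open>\<beta> * r\<close> for \<open>j = 1\<close>, the absorbable
  \<open>\<beta> * cmod (a 0)\<close> for \<open>j = 0\<close>, and nothing for the other
  indices.\<close>

lemma solves_tame: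
  assumes "\<eta> > 0"
  obtains \<rho> where "\<rho> > 0" "\<And>r a j. 0 < r \<Longrightarrow> r \<le> \<rho> \<Longrightarrow> (\<And>j. j \<le> d \<Longrightarrow> cmod (a j) \<le> \<rho>) \<Longrightarrow>
    solves r a \<Longrightarrow> j \<le> d \<Longrightarrow> cmod (a j) \<le> (if j = 1 then \<beta> + \<eta> else \<eta>) * r"
proof -
  \<comment> \<open>The first bound pays for the division by \<open>1 - \<beta>\<close> when
    \<open>a 0\<close> is absorbed; the second keeps the contraction constant below 1.\<close>
  define \<eta>' where "\<eta>' = min (\<eta> * (1 - \<beta>)) ((1 - \<beta>) / 2)"
  have \<eta>': "\<eta>' > 0" "\<eta>' \<le> \<eta> * (1 - \<beta>)" "\<beta> + \<eta>' < 1" using assms beta by (auto simp: \<eta>'_def min_def field_simps)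
  have "\<eta> * (1 - \<beta>) \<le> \<eta> * 1" using assms beta by (intro mult_left_mono) auto
  then have \<eta>'': "\<eta>' \<le> \<eta>" using \<eta>' by linarith
  define K where "K = (real d + 2) + \<kappa> * (real d + 2)^2"
  have K: "K > 0" using kappa by (simp add: K_def add_pos_nonneg)
  \<comment> \<open>As \<open>K\<close> is a sum of two non-negative terms,
    \<open>K * \<rho>\<close> bounds both \<open>(real d + 2) * \<rho>\<close> and the contraction
    error.\<close>
  define \<rho> where "\<rho> = min 1 \<eta>' / K"
  have \<rho>: "\<rho> > 0" "K * \<rho> \<le> 1" "K * \<rho> \<le> \<eta>'" using K \<eta>' by (auto simp: \<rho>_def)
  have k0: "0 \<le> (real d + 2) * \<rho>" "0 \<le> \<kappa> * (real d + 2)^2 * \<rho>" using kappa \<rho>(1) by auto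
  then have \<rho>': "(real d + 2) * \<rho> \<le> 1" "\<kappa> * (real d + 2)^2 * \<rho> \<le> \<eta>'"
    using \<rho> unfolding K_def distrib_right[of _ _ \<rho>] by linarith+
  show ?thesis
  proof (rule that[OF \<rho>(1)])
    fix r a j
    assume r: "0 < r" "r \<le> \<rho>" and a: "\<And>j. j \<le> d \<Longrightarrow> cmod (a j) \<le> \<rho>" and sol: "solves r a" and j: "j \<le> d"
    have z: "solves 0 (\<lambda>_. 0)" by (auto simp: solves_def \<Phi>_zero)
    have ar: "cmod (a i) \<le> r" if "i \<le> d" for i
      using solves_lipschitz[OF \<rho>'(1) _ r(2) _ _ a _ _ sol z that] r \<rho>' \<eta>'(3) \<rho>(1) by simp
    have "cmod (\<Phi> r a j - \<Phi> 0 (\<lambda>_. 0) j) \<le> \<beta> * cmod (lin r a j - lin 0 (\<lambda>_. 0) j) + \<kappa> * (real d + 2)^2 * \<rho> * r"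
      by (rule \<Phi>_diff[OF j \<rho>'(1)]) (use r a ar \<rho>(1) in auto)
    moreover have "\<kappa> * (real d + 2)^2 * \<rho> * r \<le> \<eta>' * r" using \<rho>'(2) r by (intro mult_right_mono) auto
    ultimately have f1: "cmod (a j) \<le> \<beta> * cmod (lin r a j - lin 0 (\<lambda>_. 0) j) + \<eta>' * r"
      using sol j by (simp add: solves_def \<Phi>_zero)
    have f2: "\<eta>' * r \<le> \<eta> * r" using \<eta>'' r by (intro mult_right_mono) auto
    consider "j = 0" | "j = 1" | "j \<ge> 2" by linarith
    then show "cmod (a j) \<le> (if j = 1 then \<beta> + \<eta> else \<eta>) * r"
    proof cases
      case 1
      then have "(1 - \<beta>) * cmod (a 0) \<le> \<eta>' * r" using \<open>cmod (a j) \<le> _\<close> by (simp add: lin_def algebra_simps)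
      also have "\<dots> \<le> \<eta> * (1 - \<beta>) * r" using \<eta>'(2) r by (intro mult_right_mono) auto
      finally have "(1 - \<beta>) * cmod (a 0) \<le> (1 - \<beta>) * (\<eta> * r)" by (simp add: mult_ac)
      then show ?thesis using beta 1 by (simp add: mult_le_cancel_left)
    next
      case 2
      then have "cmod (a j) \<le> \<beta> * r + \<eta>' * r" using f1 r by (simp add: lin_def)
      then show ?thesis using 2 f2 by (simp add: distrib_right)
    next
      case 3
      then have "cmod (a j) \<le> \<eta>' * r" using f1 by (simp add: lin_def)
      then show ?thesis using 3 f2 by simp
    qed
  qed
qed

text \<open>The expression of the area theorem: the enclosed area divided by pi, as
  \<open>area_eq\<close> confirms for actual curves.\<close>

definition curve_area :: "real \<Rightarrow> (nat \<Rightarrow> complex) \<Rightarrow> real"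
  where "curve_area r a = r\<^sup>2 - (\<Sum>j=0..d. real j * (cmod (a j))\<^sup>2)"

text \<open>The coefficient \<open>a 1\<close> subtracts at most
  \<open>(\<beta> + \<eta>)^2 * r^2\<close> and the others at most
  \<open>((real d + 1) * \<eta>)^2 * r^2\<close>; together they stay below the square of
  \<open>(\<beta> + (real d + 2) * \<eta>) * r\<close>, which is less than
  \<open>r^2\<close>.\<close>

lemma curve_area_pos:
  assumes "\<eta> > 0" "(real d + 2) * \<eta> < 1 - \<beta>" "r > 0"
    and a: "\<And>j. j \<le> d \<Longrightarrow> cmod (a j) \<le> (if j = 1 then \<beta> + \<eta> else \<eta>) * r"
  shows "curve_area r a > 0"
proof -
  have "(\<Sum>j=0..d. real j * (cmod (a j))\<^sup>2) \<le> (\<Sum>j=0..d. (if j = 1 then (\<beta> + \<eta>)\<^sup>2 * r\<^sup>2 else 0) + real d * (\<eta> * r)\<^sup>2)"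
  proof (rule sum_mono)
    fix j assume j: "j \<in> {0..d}"
    then have "(cmod (a j))\<^sup>2 \<le> ((if j = 1 then \<beta> + \<eta> else \<eta>) * r)\<^sup>2"
      by (intro power_mono a) auto
    then have "real j * (cmod (a j))\<^sup>2 \<le> real j * ((if j = 1 then \<beta> + \<eta> else \<eta>) * r)\<^sup>2"
      by (intro mult_left_mono) auto
    also have "\<dots> \<le> (if j = 1 then (\<beta> + \<eta>)\<^sup>2 * r\<^sup>2 else 0) + real d * (\<eta> * r)\<^sup>2"
      using j by (auto simp: power_mult_distrib intro!: mult_right_mono)
    finally show "real j * (cmod (a j))\<^sup>2 \<le> (if j = 1 then (\<beta> + \<eta>)\<^sup>2 * r\<^sup>2 else 0) + real d * (\<eta> * r)\<^sup>2" .
  qed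
  also have "\<dots> \<le> (\<beta> + \<eta>)\<^sup>2 * r\<^sup>2 + (real d + 1) * (real d * (\<eta> * r)\<^sup>2)"
    by (simp add: sum.distrib algebra_simps)
  also have "\<dots> \<le> (\<beta> + \<eta>)\<^sup>2 * r\<^sup>2 + (real d + 1) * ((real d + 1) * (\<eta> * r)\<^sup>2)"
    by (intro add_left_mono mult_left_mono mult_right_mono) auto
  also have "\<dots> = ((\<beta> + \<eta>)\<^sup>2 + ((real d + 1) * \<eta>)\<^sup>2) * r\<^sup>2" by (simp add: power2_eq_square algebra_simps)
  also have "\<dots> \<le> (\<beta> + (real d + 2) * \<eta>)\<^sup>2 * r\<^sup>2"
  proof (intro mult_right_mono)
    have "0 \<le> 2 * (\<beta> + \<eta>) * ((real d + 1) * \<eta>)" using beta assms by auto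
    then have "(\<beta> + \<eta>)\<^sup>2 + ((real d + 1) * \<eta>)\<^sup>2 \<le> ((\<beta> + \<eta>) + (real d + 1) * \<eta>)\<^sup>2"
      by (simp only: power2_sum)
    then show "(\<beta> + \<eta>)\<^sup>2 + ((real d + 1) * \<eta>)\<^sup>2 \<le> (\<beta> + (real d + 2) * \<eta>)\<^sup>2"
      by (simp add: algebra_simps)
  qed simp
  also have "\<dots> < 1 * r\<^sup>2"
  proof (rule mult_strict_right_mono)
    have "(\<beta> + (real d + 2) * \<eta>)\<^sup>2 < 1\<^sup>2"
      using assms beta by (intro power_strict_mono) auto
    then show "(\<beta> + (real d + 2) * \<eta>)\<^sup>2 < 1" by simp
  qed (use assms in auto)
  finally show ?thesis by (simp add: curve_area_def)
qed

text \<open>The solution depends continuously on \<open>r\<close> by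
  \<open>solves_lipschitz\<close>, and so does its area, which is 0 at \<open>r = 0\<close> and
  positive at \<open>r = \<rho>\<close>. The intermediate value theorem yields every area below the
  value at \<open>\<rho>\<close>, which serves as \<open>\<delta>\<close>.\<close>

lemma solution_with_area:
  assumes "\<rho>0 > 0"
  obtains \<delta> where "\<delta> > 0" "\<And>t0. 0 < t0 \<Longrightarrow> t0 < \<delta> \<Longrightarrow>
    \<exists>r a. 0 < r \<and> r \<le> \<rho>0 \<and> (\<forall>j\<le>d. cmod (a j) \<le> \<rho>0) \<and> solves r a \<and> curve_area r a = t0"
proof -
  define \<eta> where "\<eta> = (1 - \<beta>) / (2 * (real d + 2))"
  have \<eta>2: "(real d + 2) * \<eta> = (1 - \<beta>) / 2" by (simp add: \<eta>_def field_simps)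
  have \<eta>: "\<eta> > 0" "(real d + 2) * \<eta> < 1 - \<beta>"
    using beta unfolding \<eta>2 by (auto simp: \<eta>_def)
  obtain \<rho>1 where \<rho>1: "\<rho>1 > 0" "\<And>r a j. 0 < r \<Longrightarrow> r \<le> \<rho>1 \<Longrightarrow> (\<And>j. j \<le> d \<Longrightarrow> cmod (a j) \<le> \<rho>1) \<Longrightarrow>
    solves r a \<Longrightarrow> j \<le> d \<Longrightarrow> cmod (a j) \<le> (if j = 1 then \<beta> + \<eta> else \<eta>) * r"
    using solves_tame[OF \<eta>(1)] by metis
  define K where "K = (real d + 2) + \<kappa> * (real d + 2)^2"
  have K: "K > 0" using kappa by (simp add: K_def add_pos_nonneg)
  define \<rho> where "\<rho> = min (min \<rho>0 \<rho>1) (min 1 ((1 - \<beta>) / 2) / K)"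
  have \<rho>: "\<rho> > 0" "\<rho> \<le> \<rho>0" "\<rho> \<le> \<rho>1" using assms \<rho>1(1) K beta by (auto simp: \<rho>_def)
  have "K * \<rho> \<le> K * (min 1 ((1 - \<beta>) / 2) / K)" using K by (intro mult_left_mono) (auto simp: \<rho>_def)
  then have K\<rho>: "K * \<rho> \<le> 1" "K * \<rho> \<le> (1 - \<beta>) / 2" using K by auto
  have k0: "0 \<le> (real d + 2) * \<rho>" "0 \<le> \<kappa> * (real d + 2)^2 * \<rho>" using kappa \<rho>(1) by auto
  then have \<rho>': "(real d + 2) * \<rho> \<le> 1" "\<beta> + \<kappa> * (real d + 2)^2 * \<rho> < 1"
  proof -
    have e: "K * \<rho> = (real d + 2) * \<rho> + \<kappa> * (real d + 2)^2 * \<rho>" by (simp add: K_def distrib_right)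
    show "(real d + 2) * \<rho> \<le> 1" using e K\<rho>(1) k0 by linarith
    have "\<kappa> * (real d + 2)^2 * \<rho> \<le> (1 - \<beta>) / 2" using e K\<rho>(2) k0 by linarith
    then show "\<beta> + \<kappa> * (real d + 2)^2 * \<rho> < 1" using beta(2) by (simp add: field_simps)
  qed
  obtain A where A: "\<And>r. 0 \<le> r \<Longrightarrow> r \<le> \<rho> \<Longrightarrow> solves r (A r)"
    "\<And>r j. 0 \<le> r \<Longrightarrow> r \<le> \<rho> \<Longrightarrow> j \<le> d \<Longrightarrow> cmod (A r j) \<le> \<rho>"
    using solution_exists[OF \<rho>'(1) _ _ \<rho>'(2)] by metis
  have lip: "cmod (A r j - A s j) \<le> \<bar>r - s\<bar>" if "0 \<le> r" "r \<le> \<rho>" "0 \<le> s" "s \<le> \<rho>" "j \<le> d" for r s j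
    by (rule solves_lipschitz[OF \<rho>'(1)]) (use that A \<rho>' in auto)
  have cA: "continuous_on {0..\<rho>} (\<lambda>r. A r j)" if "j \<le> d" for j
    unfolding continuous_on_iff
  proof (intro ballI allI impI)
    fix x e :: real assume x: "x \<in> {0..\<rho>}" and e: "0 < e"
    show "\<exists>d>0. \<forall>y\<in>{0..\<rho>}. dist y x < d \<longrightarrow> dist (A y j) (A x j) < e"
    proof (intro exI[of _ e] conjI ballI impI e)
      fix y assume *: "y \<in> {0..\<rho>}" "dist y x < e"
      have "dist (A y j) (A x j) \<le> \<bar>y - x\<bar>"
        unfolding dist_norm by (rule lip) (use * x that in auto)
      then show "dist (A y j) (A x j) < e" using *(2) by (simp add: dist_real_def)
    qed
  qed
  have c: "continuous_on {0..\<rho>} (\<lambda>r. curve_area r (A r))"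
    unfolding curve_area_def by (intro continuous_intros cA) auto
  have A\<rho>: "cmod (A r j) \<le> \<rho>1" "cmod (A r j) \<le> \<rho>0" if "0 \<le> r" "r \<le> \<rho>" "j \<le> d" for r j
    using A(2)[OF that] \<rho> by linarith+
  have pos: "curve_area \<rho> (A \<rho>) > 0"
    by (rule curve_area_pos[OF \<eta> \<rho>(1)], rule \<rho>1(2)) (use \<rho> A A\<rho> in auto)
  have z: "curve_area 0 (A 0) = 0"
  proof -
    have "A 0 j = 0" if "j \<le> d" for j
      using solves_lipschitz[of \<rho> 0 0 "A 0" "\<lambda>_. 0" j] \<rho> \<rho>' A[of 0] that by (simp add: solves_def \<Phi>_zero)
    then show ?thesis by (simp add: curve_area_def)
  qed
  show ?thesis
  proof (rule that[OF pos])
    fix t0 assume t0: "0 < t0" "t0 < curve_area \<rho> (A \<rho>)"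
    have "\<exists>r. 0 \<le> r \<and> r \<le> \<rho> \<and> curve_area r (A r) = t0"
      by (rule IVT') (use t0 z \<rho> c in auto)
    then obtain r where r: "0 \<le> r" "r \<le> \<rho>" "curve_area r (A r) = t0" by blast
    have "r \<noteq> 0" using r z t0 by auto
    then show "\<exists>r a. 0 < r \<and> r \<le> \<rho>0 \<and> (\<forall>j\<le>d. cmod (a j) \<le> \<rho>0) \<and> solves r a \<and> curve_area r a = t0"
      using r A[of r] A\<rho>[of r] \<rho> by (intro exI[of _ r] exI[of _ "A r"]) auto
  qed
qed

end

section \<open>From coefficients to Jordan curves\<close>

lemma laurent_map_dist_ge:
  assumes "cmod w \<ge> 1" "cmod v \<ge> 1"
  shows "(r - (\<Sum>j=0..d. real j * cmod (a j))) * cmod (w - v) \<le> cmod (laurent_map d r a w - laurent_map d r a v)"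
proof (cases "r < 0")
  case True
  have "(r - (\<Sum>j=0..d. real j * cmod (a j))) * cmod (w - v) \<le> 0"
    using True by (intro mult_nonpos_nonneg) (auto simp: sum_nonneg intro: order.trans[of r 0])
  then show ?thesis using norm_ge_zero order.trans by blast
next
  case False
  have nz: "w \<noteq> 0" "v \<noteq> 0" using assms by auto
  \<comment> \<open>Outside the unit disc inversion does not increase distances, so the negative
    powers change distances by at most the sum of the \<open>real j * cmod (a j)\<close>. When this
    is below \<open>r\<close>, the map is injective there.\<close>
  have inv: "cmod (1 / w - 1 / v) \<le> cmod (w - v)"
  proof -
    have "1 / w - 1 / v = (v - w) / (w * v)" using nz by (simp add: field_simps)
    then have "cmod (1 / w - 1 / v) = cmod (w - v) / (cmod w * cmod v)"
      by (simp add: norm_divide norm_mult norm_minus_commute)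
    also have "\<dots> \<le> cmod (w - v) / 1"
      using assms mult_mono[of 1 "cmod w" 1 "cmod v"] nz by (intro divide_left_mono) auto
    finally show ?thesis by simp
  qed
  have "cmod (\<Sum>j=0..d. a j * ((1 / w) ^ j - (1 / v) ^ j)) \<le> (\<Sum>j=0..d. real j * cmod (a j) * cmod (w - v))"
  proof (rule sum_norm_le)
    fix j
    have "cmod ((1 / w) ^ j - (1 / v) ^ j) \<le> real j * 1 ^ (j - 1) * cmod (1 / w - 1 / v)"
      by (rule norm_power_diff_le) (use assms in \<open>auto simp: norm_divide divide_le_eq_1\<close>)
    also have "\<dots> \<le> real j * cmod (w - v)" using inv by (auto intro: mult_left_mono)
    finally have "cmod ((1 / w) ^ j - (1 / v) ^ j) \<le> real j * cmod (w - v)" .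
    from mult_left_mono[OF this norm_ge_zero[of "a j"]]
    show "cmod (a j * ((1 / w) ^ j - (1 / v) ^ j)) \<le> real j * cmod (a j) * cmod (w - v)"
      by (simp add: norm_mult mult_ac)
  qed
  moreover have "laurent_map d r a w - laurent_map d r a v =
      of_real r * (w - v) + (\<Sum>j=0..d. a j * ((1 / w) ^ j - (1 / v) ^ j))"
    by (simp add: laurent_map_def algebra_simps sum_subtractf power_one_over)
  moreover have "cmod (of_real r * (w - v)) = r * cmod (w - v)" using False by (simp add: norm_mult)
  ultimately show ?thesis
    using norm_diff_ineq[of "of_real r * (w - v)" "\<Sum>j=0..d. a j * ((1 / w) ^ j - (1 / v) ^ j)"]
    by (simp add: left_diff_distrib sum_distrib_right)
qed

lemma laurent_map_norm_ge:
  assumes "cmod w \<ge> 1" "r > 0"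
  shows "r * cmod w - (\<Sum>j=0..d. cmod (a j)) \<le> cmod (laurent_map d r a w)"
proof -
  have "cmod (\<Sum>j=0..d. a j / w ^ j) \<le> (\<Sum>j=0..d. cmod (a j))"
  proof (rule sum_norm_le)
    fix j
    have "1 \<le> cmod w ^ j" using assms by (simp add: one_le_power)
    then have "cmod (a j) / cmod w ^ j \<le> cmod (a j) / 1"
      by (intro divide_left_mono) (auto intro: mult_pos_pos)
    then show "cmod (a j / w ^ j) \<le> cmod (a j)" by (simp add: norm_divide norm_power)
  qed
  then show ?thesis
    using norm_diff_ineq[of "of_real r * w" "\<Sum>j=0..d. a j / w ^ j"] assms
    by (simp add: laurent_map_def norm_mult)
qed

lemma laurent_deriv_nonzero:
  assumes "cmod w = 1" "(\<Sum>j=0..d. real j * cmod (a j)) < r"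
  shows "laurent_deriv d r a w \<noteq> 0"
proof
  assume "laurent_deriv d r a w = 0"
  then have "of_real r = (\<Sum>j=0..d. of_nat j * a j / w ^ (j + 1))" by (simp add: laurent_deriv_def)
  then have "\<bar>r\<bar> = cmod (\<Sum>j=0..d. of_nat j * a j / w ^ (j + 1))" by (metis norm_of_real)
  also have "\<dots> \<le> (\<Sum>j=0..d. real j * cmod (a j))"
    by (rule sum_norm_le) (use assms(1) in \<open>simp add: norm_divide norm_mult norm_power\<close>)
  finally show False using assms(2) by linarith
qed

text \<open>\<open>S1\<close> makes the map injective on the circle. \<open>S2\<close> keeps it away
  from 0 outside the disc, so the reversed polynomial at 0 has no root in the disc and the winding
  number about 0 is 1. Hence 0 is inside, and constancy of the winding number on the interior gives
  the orientation.\<close>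

lemma polynomial_curve_intro:
  assumes r: "r > 0" and S1: "(\<Sum>j=0..d. real j * cmod (a j)) < r" and S2: "(\<Sum>j=0..d. cmod (a j)) < r"
  shows "polynomial_curve d r a" "0 \<in> inside (path_image (laurent_map d r a \<circ> circle_point))"
proof -
  let ?h = "laurent_map d r a" and ?p = "laurent_map d r a \<circ> circle_point"
  have inj: "inj_on ?h (sphere 0 1)"
  proof (rule inj_onI)
    fix w v assume "w \<in> sphere 0 1" "v \<in> sphere 0 1" "?h w = ?h v"
    then have "(r - (\<Sum>j=0..d. real j * cmod (a j))) * cmod (w - v) \<le> 0"
      using laurent_map_dist_ge[of w v, where r = r and d = d and a = a] by simp
    then show "w = v" using S1 by (simp add: mult_le_0_iff)
  qed
  have simple: "simple_path ?p"
  proof (rule simple_path_continuous_image)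
    show "simple_path circle_point"
      unfolding circlepath_eq_circle_point[symmetric] by (simp add: simple_path_circlepath)
    have "path_image circle_point \<subseteq> sphere 0 1" by (auto simp: path_image_def)
    then show "continuous_on (path_image circle_point) ?h" "inj_on ?h (path_image circle_point)"
      using inj by (auto intro!: continuous_intros intro: inj_on_subset)
  qed
  have nz: "?h w \<noteq> 0" if "cmod w \<ge> 1" for w
  proof -
    have "r * 1 \<le> r * cmod w" using that r by (intro mult_left_mono) auto
    then show ?thesis using laurent_map_norm_ge[OF that r, where d = d and a = a] S2 by auto
  qed
  have n0: "0 \<notin> ?h ` sphere 0 1" using nz by force
  obtain n :: nat where W: "winding_number ?p 0 = 1 - of_nat n"
    and n: "n = 0 \<longleftrightarrow> (\<forall>s. cmod s \<le> 1 \<longrightarrow> poly (laurent_reversed d r a 0) s \<noteq> 0)"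
    by (rule winding_number_laurent[OF n0])
  have "poly (laurent_reversed d r a 0) s \<noteq> 0" if "cmod s \<le> 1" for s
  proof (cases "s = 0")
    case True
    then show ?thesis using r by (simp add: poly_laurent_reversed)
  next
    case False
    then have "cmod (1 / s) \<ge> 1" using that by (simp add: norm_divide le_divide_eq_1)
    from nz[OF this] show ?thesis using False by (simp add: poly_laurent_reversed_eq)
  qed
  then have W: "winding_number ?p 0 = 1" using W n by simp
  have path: "path ?p" using simple by (rule simple_path_imp_path)
  note J = Jordan_inside_outside[OF simple closed_laurent]
  have "0 \<notin> outside (path_image ?p)"
    using winding_number_zero_in_outside[OF path closed_laurent, of 0] W by auto
  then show 0: "0 \<in> inside (path_image ?p)"
    using n0 J unfolding path_image_laurent by blast
  have "positively_oriented ?p"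
    unfolding positively_oriented_def
  proof
    fix z assume z: "z \<in> inside (path_image ?p)"
    have "winding_number ?p z = winding_number ?p 0"
      by (rule winding_number_eq[OF path closed_laurent z 0]) (use J inside_no_overlap in auto)
    then show "winding_number ?p z = 1" using W by simp
  qed
  then show "polynomial_curve d r a"
    by unfold_locales (use r simple laurent_path_deriv continuous_laurent_velocity range_laurent closed_laurent in auto)
qed

lemma circle_mean_cnj_laurent:
  assumes "j \<le> d"
  shows "circle_mean (\<lambda>w. cnj (laurent_map d r a w) / w ^ j) = cnj (a j)"
proof -
  have "circle_mean (\<lambda>w. cnj (laurent_map d r a w) / w ^ j) = circle_mean (\<lambda>w. cnj (laurent_map d r a w * w ^ j))"
    by (rule circle_mean_cong) (simp add: cnj_eq_inverse_unit power_one_over)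
  then show ?thesis unfolding circle_mean_cnj laurent_coefficient[OF assms] .
qed

text \<open>\<open>area_formula\<close> pulled back to the circle is the mean of
  \<open>cnj h * h' * w\<close>; expanding \<open>h' * w\<close> leaves only the known Fourier
  coefficients of \<open>cnj h\<close>.\<close>

lemma (in polynomial_curve) area_eq:
  "measure lborel \<Omega> = pi * (r\<^sup>2 - (\<Sum>j=0..d. real j * (cmod (a j))\<^sup>2))"
proof -
  have "2 * \<i> * of_real (measure lborel \<Omega>) = contour_integral (h \<circ> circle_point) cnj"
    by (rule area_formula[symmetric])
  also have "\<dots> = 2 * of_real pi * \<i> * circle_mean (\<lambda>w. cnj (h w) * laurent_deriv d r a w * w)"
    by (rule contour_integral_laurent) (intro continuous_intros)
  also have "circle_mean (\<lambda>w. cnj (h w) * laurent_deriv d r a w * w) =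
    circle_mean (\<lambda>w. of_real r * cnj (h w / w) - (\<Sum>j=0..d. of_nat j * a j * (cnj (h w) / w ^ j)))"
  proof (rule circle_mean_cong)
    fix w :: complex assume w: "cmod w = 1"
    then have "w \<noteq> 0" by auto
    then have *: "laurent_deriv d r a w * w = of_real r * w - (\<Sum>j=0..d. of_nat j * a j / w ^ j)"
      by (simp add: laurent_deriv_def algebra_simps sum_distrib_left)
    then show "cnj (h w) * laurent_deriv d r a w * w =
      of_real r * cnj (h w / w) - (\<Sum>j=0..d. of_nat j * a j * (cnj (h w) / w ^ j))"
      using \<open>w \<noteq> 0\<close> cnj_eq_inverse_unit[OF w] unfolding mult.assoc *
      by (simp add: right_diff_distrib sum_distrib_left mult_ac)
  qed
  also have "\<dots> = of_real r * circle_mean (\<lambda>w. cnj (h w / w)) - (\<Sum>j=0..d. of_nat j * a j * circle_mean (\<lambda>w. cnj (h w) / w ^ j))"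
    unfolding circle_mean_mult_left[symmetric]
    by (subst circle_mean_sum[symmetric], simp, (auto intro!: continuous_intros)[1],
        rule circle_mean_diff) (auto intro!: continuous_intros)
  also have "circle_mean (\<lambda>w. cnj (h w / w)) = of_real r"
    unfolding circle_mean_cnj laurent_leading_coefficient by simp
  also have "(\<Sum>j=0..d. of_nat j * a j * circle_mean (\<lambda>w. cnj (h w) / w ^ j)) = (\<Sum>j=0..d. of_real (real j * (cmod (a j))\<^sup>2))"
    by (intro sum.cong refl) (simp add: circle_mean_cnj_laurent complex_norm_square mult.assoc del: of_real_power)
  finally have *: "2 * \<i> * of_real (measure lborel \<Omega>) =
    2 * of_real pi * \<i> * (of_real r * of_real r - (\<Sum>j=0..d. of_real (real j * (cmod (a j))\<^sup>2)))" .
  have "x = of_real pi * y" if "2 * \<i> * x = 2 * of_real pi * \<i> * y" for x y :: complex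
    using that by simp
  from this[OF *] have "of_real (measure lborel \<Omega>) =
    (of_real pi * (of_real r * of_real r - (\<Sum>j=0..d. of_real (real j * (cmod (a j))\<^sup>2))) :: complex)" .
  also have "\<dots> = of_real (pi * (r\<^sup>2 - (\<Sum>j=0..d. real j * (cmod (a j))\<^sup>2)))"
    by (simp add: power2_eq_square)
  finally show ?thesis by (simp only: of_real_eq_iff)
qed

section \<open>The moments of the constructed curve\<close>

lemma circle_mean_poly_coeff:
  "circle_mean (\<lambda>w. poly p w / w ^ i) = coeff p i"
proof -
  have "circle_mean (\<lambda>w. poly p w / w ^ i) = circle_mean (\<lambda>w. \<Sum>j\<le>degree p. coeff p j * (w ^ j / w ^ i))"
    by (simp add: poly_altdef sum_divide_distrib)
  also have "\<dots> = (\<Sum>j\<le>degree p. coeff p j * circle_mean (\<lambda>w. w ^ j / w ^ i))"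
    unfolding circle_mean_mult_left[symmetric]
    by (rule circle_mean_sum) (auto intro!: continuous_intros)
  also have "\<dots> = (\<Sum>j\<le>degree p. if j = i then coeff p j else 0)"
    by (simp add: circle_mean_power_div if_distrib cong: if_cong)
  also have "\<dots> = coeff p i" by (auto simp: coeff_eq_0)
  finally show ?thesis .
qed

text \<open>Every integer power other than \<open>1 / z\<close> has a primitive away from 0, and
  \<open>1 / z\<close> gives the winding number 1.\<close>

lemma (in smooth_jordan_curve) contour_integral_power_div:
  assumes 0: "0 \<in> \<Omega>"
  shows "contour_integral p (\<lambda>z. z ^ m / z ^ n) = (if n = Suc m then 2 * of_real pi * \<i> else 0)"
proof -
  have nz: "z \<noteq> 0" if "z \<in> path_image p" for z using that inside_off_path[OF 0] by auto
  have cong: "contour_integral p (\<lambda>z. z ^ m / z ^ n) = contour_integral p f" if "\<And>z. z \<noteq> 0 \<Longrightarrow> z ^ m / z ^ n = f z" for f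
    by (rule contour_integral_cong) (use that nz in auto)
  consider "n = Suc m" | "n \<le> m" | "n \<ge> m + 2" by linarith
  then show ?thesis
  proof cases
    case 1
    have "contour_integral p (\<lambda>z. z ^ m / z ^ n) = contour_integral p (\<lambda>z. 1 / (z - 0))"
      by (rule cong) (use 1 in auto)
    also have "\<dots> = 2 * of_real pi * \<i> * winding_number p 0"
      using winding_number_valid_path[OF valid inside_off_path[OF 0]] by simp
    finally show ?thesis using 1 winding_off[OF inside_off_path[OF 0]] 0 by simp
  next
    case 2
    define k where "k = m - n"
    have m: "m = k + n" using 2 by (simp add: k_def)
    have "contour_integral p (\<lambda>z. z ^ m / z ^ n) = contour_integral p (\<lambda>z. z ^ k)"
      by (rule cong) (simp add: m power_add)
    moreover have "((\<lambda>z. z ^ k) has_contour_integral (pathfinish p ^ Suc k / of_nat (Suc k) - pathstart p ^ Suc k / of_nat (Suc k))) p"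
      by (rule contour_integral_primitive[of UNIV _ _ p])
         (auto intro!: derivative_eq_intros valid simp del: of_nat_Suc power_Suc)
    ultimately show ?thesis using 2 closed by (simp add: contour_integral_unique)
  next
    case 3
    define k where "k = n - m - 2"
    have n: "n = m + (k + 2)" using 3 by (simp add: k_def)
    have "contour_integral p (\<lambda>z. z ^ m / z ^ n) = contour_integral p (\<lambda>z. 1 / z ^ (k + 2))"
      by (rule cong) (simp add: n power_add)
    moreover have "((\<lambda>z. 1 / z ^ (k + 2)) has_contour_integral
        (- 1 / (of_nat (Suc k) * pathfinish p ^ Suc k) - - 1 / (of_nat (Suc k) * pathstart p ^ Suc k))) p"
    proof (rule contour_integral_primitive[of "- {0}" "\<lambda>z. - 1 / (of_nat (Suc k) * z ^ Suc k)" _ p])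
      fix z :: complex assume "z \<in> - {0}"
      then have z: "z \<noteq> 0" by simp
      have "((\<lambda>z. z ^ Suc k) has_field_derivative of_nat (Suc k) * z ^ k) (at z within - {0})"
        using DERIV_power[OF DERIV_ident, where n = "Suc k" and x = z and s = "- {0}"] by simp
      from DERIV_divide[OF DERIV_const DERIV_cmult[OF this, of "of_nat (Suc k)"], of "- 1"]
      show "((\<lambda>z. - 1 / (of_nat (Suc k) * z ^ Suc k)) has_field_derivative 1 / z ^ (k + 2)) (at z within - {0})"
        using z by (auto elim!: DERIV_cong simp: field_simps power2_eq_square simp del: of_nat_Suc)
    qed (use valid nz in auto)
    ultimately show ?thesis using 3 closed by (simp add: contour_integral_unique)
  qed
qed

context moment_data
begin

text \<open>Converse of \<open>coefficient_equation\<close>: for \<open>i\<close> at most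
  \<open>d\<close>, coefficient \<open>i\<close> of the numerator is the conjugated fixed point
  equation for the index \<open>d - i\<close>. Divisibility means that cnj h - P'(h), in the
  variable \<open>s = 1 / w\<close>, extends from the circle to a polynomial vanishing at 0.\<close>

lemma schwarz_numerator_dvd:
  assumes "solves r a"
  shows "monom 1 (d + 1) dvd schwarz_numerator d r a t"
  unfolding monom_1_dvd_iff'
proof (intro allI impI)
  fix i assume "i < d + 1"
  then have j: "d - i \<le> d" "d = d - i + i" by auto
  let ?j = "d - i"
  have "coeff (schwarz_numerator d r a t) i = circle_mean (\<lambda>w. poly (schwarz_numerator d r a t) w / w ^ i)"
    by (rule circle_mean_poly_coeff[symmetric])
  also have "\<dots> = circle_mean (\<lambda>w. cnj (laurent_map d r a (1 / w)) / (1 / w) ^ ?j - moment_poly d t (laurent_map d r a (1 / w)) * w ^ ?j)"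
  proof (rule circle_mean_cong)
    fix w :: complex assume w: "cmod w = 1"
    then have nz: "w \<noteq> 0" by auto
    have "w ^ d = w ^ ?j * w ^ i" using j(2) by (metis power_add)
    then have *: "w ^ d * Z / w ^ i = w ^ ?j * Z" for Z using nz by simp
    then show "poly (schwarz_numerator d r a t) w / w ^ i =
      cnj (laurent_map d r a (1 / w)) / (1 / w) ^ ?j - moment_poly d t (laurent_map d r a (1 / w)) * w ^ ?j"
      unfolding poly_schwarz_numerator[OF nz] cnj_eq_inverse_unit[OF w] * using nz
      by (simp add: power_one_over algebra_simps)
  qed
  also have "\<dots> = circle_mean (\<lambda>w. cnj (laurent_map d r a (1 / w)) / (1 / w) ^ ?j) -
      circle_mean (\<lambda>w. moment_poly d t (laurent_map d r a (1 / w)) * w ^ ?j)"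
    by (rule circle_mean_diff) (auto intro!: continuous_intros)
  also have "circle_mean (\<lambda>w. cnj (laurent_map d r a (1 / w)) / (1 / w) ^ ?j) = cnj (a ?j)"
    by (subst circle_mean_inverse_arg[of "\<lambda>w. cnj (laurent_map d r a w) / w ^ ?j"])
       (rule circle_mean_cnj_laurent[OF j(1)])
  also have "circle_mean (\<lambda>w. moment_poly d t (laurent_map d r a (1 / w)) * w ^ ?j) = cnj (a ?j)"
    using assms j(1) by (simp add: solves_def \<Phi>_def)
  finally show "coeff (schwarz_numerator d r a t) i = 0" by simp
qed

text \<open>The moments split along cnj z = P'(z) + (cnj z - P'(z)). The polynomial gives the
  \<open>t k\<close> by residues. In the variable \<open>s = 1 / w\<close> the rest is the mean of
  \<open>g s * s ^ k * ?D s / q s ^ k\<close>, with \<open>q\<close> free of roots in the disc; this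
  is holomorphic there and vanishes at 0 because \<open>k\<close> is at least 1.\<close>

lemma moment_curve_intro:
  assumes r: "r > 0" and S1: "(\<Sum>j=0..d. real j * cmod (a j)) < r" and S2: "(\<Sum>j=0..d. cmod (a j)) < r"
    and sol: "solves r a"
  shows "moment_curve d r a t"
proof -
  interpret polynomial_curve d r a by (rule polynomial_curve_intro(1)[OF r S1 S2])
  note 0 = polynomial_curve_intro(2)[OF r S1 S2]
  let ?p = "h \<circ> circle_point"
  obtain g where g: "schwarz_numerator d r a t = monom 1 (d + 1) * g"
    using schwarz_numerator_dvd[OF sol] by (elim dvdE)
  let ?q = "laurent_reversed d r a 0"
  \<comment> \<open>The derivative of \<open>h\<close> at \<open>1 / s\<close>, a polynomial in
    \<open>s\<close>.\<close>
  let ?D = "\<lambda>s. of_real r - (\<Sum>j=0..d. of_nat j * a j * s ^ (j + 1))"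
  have nz: "z \<noteq> 0" if "z \<in> h ` sphere 0 1" for z
    using that inside_off_path[OF 0] by (auto simp: path_image_eq)
  have "exterior_moment ?p k = t k" if k: "k \<ge> 1" for k
  proof -
    have "contour_integral ?p (\<lambda>z. moment_poly d t z / z ^ k) =
        contour_integral ?p (\<lambda>z. \<Sum>m=1..d+1. of_nat m * t m * (z ^ (m - 1) / z ^ k))"
      by (simp only: moment_poly_def sum_divide_distrib times_divide_eq_right)
    also have "\<dots> = (\<Sum>m=1..d+1. contour_integral ?p (\<lambda>z. of_nat m * t m * (z ^ (m - 1) / z ^ k)))"
      using nz by (intro contour_integral_sum contour_integrable continuous_intros) (auto simp: path_image_eq)
    also have "\<dots> = (\<Sum>m=1..d+1. of_nat m * t m * contour_integral ?p (\<lambda>z. z ^ (m - 1) / z ^ k))"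
      using nz by (intro sum.cong refl contour_integral_lmul contour_integrable continuous_intros) (auto simp: path_image_eq)
    also have "\<dots> = (\<Sum>m=1..d+1. if m = k then of_nat k * t k * (2 * of_real pi * \<i>) else 0)"
      by (intro sum.cong refl) (auto simp: contour_integral_power_div[OF 0])
    also have "\<dots> = of_nat k * t k * (2 * of_real pi * \<i>)"
      using k above by auto
    finally have main: "contour_integral ?p (\<lambda>z. moment_poly d t z / z ^ k) = of_nat k * t k * (2 * of_real pi * \<i>)" .
    have "contour_integral ?p (\<lambda>z. cnj z / z ^ k - moment_poly d t z / z ^ k) =
       2 * of_real pi * \<i> * circle_mean (\<lambda>w. (cnj (h w) / h w ^ k - moment_poly d t (h w) / h w ^ k) * laurent_deriv d r a w * w)"
      by (rule contour_integral_laurent) (use nz in \<open>auto intro!: continuous_intros\<close>)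
    also have "circle_mean (\<lambda>w. (cnj (h w) / h w ^ k - moment_poly d t (h w) / h w ^ k) * laurent_deriv d r a w * w) =
       circle_mean (\<lambda>s. (cnj (h (1 / s)) / h (1 / s) ^ k - moment_poly d t (h (1 / s)) / h (1 / s) ^ k) * laurent_deriv d r a (1 / s) * (1 / s))"
      by (rule circle_mean_inverse_arg[symmetric, where f = "\<lambda>w. (cnj (h w) / h w ^ k - moment_poly d t (h w) / h w ^ k) * laurent_deriv d r a w * w"])
    also have "\<dots> = circle_mean (\<lambda>s. poly g s * s ^ k * ?D s / poly ?q s ^ k)"
    proof (rule circle_mean_cong)
      fix s :: complex assume s: "cmod s = 1"
      then have s0: "s \<noteq> 0" by auto
      have "1 / s \<in> sphere 0 1" using s by (simp add: norm_divide)
      then have h0: "h (1 / s) \<noteq> 0" using nz by blast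
      have D: "laurent_deriv d r a (1 / s) = ?D s"
        using s0 by (simp add: laurent_deriv_def power_one_over)
      have "s ^ (d + 1) * poly g s = s ^ d * (cnj (h (1 / s)) - moment_poly d t (h (1 / s)))"
        using poly_schwarz_numerator[OF s0, of d r a t] unfolding g cnj_eq_inverse_unit[OF s]
        by (simp only: poly_mult poly_monom mult_1)
      then have "s ^ d * (cnj (h (1 / s)) - moment_poly d t (h (1 / s))) = s ^ d * (s * poly g s)"
        by (simp only: power_add power_one_right mult.assoc)
      then have G: "cnj (h (1 / s)) - moment_poly d t (h (1 / s)) = s * poly g s"
        by (rule mult_left_cancel[THEN iffD1, rotated]) (use s0 in simp)
      have q: "poly ?q s = s * h (1 / s)" using s0 by (simp add: poly_laurent_reversed_eq)
      have "(cnj (h (1 / s)) / h (1 / s) ^ k - moment_poly d t (h (1 / s)) / h (1 / s) ^ k) * laurent_deriv d r a (1 / s) * (1 / s) =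
         (cnj (h (1 / s)) - moment_poly d t (h (1 / s))) / h (1 / s) ^ k * ?D s * (1 / s)"
        unfolding D by (simp add: diff_divide_distrib)
      also have "\<dots> = poly g s * s ^ k * ?D s / poly ?q s ^ k"
        unfolding G q power_mult_distrib using s0 h0 by simp
      finally show "(cnj (h (1 / s)) / h (1 / s) ^ k - moment_poly d t (h (1 / s)) / h (1 / s) ^ k) * laurent_deriv d r a (1 / s) * (1 / s) =
        poly g s * s ^ k * ?D s / poly ?q s ^ k" .
    qed
    also have "\<dots> = 0"
      by (subst circle_mean_Cauchy_0)
         (use inside_no_zero[OF 0] k in \<open>auto intro!: continuous_intros holomorphic_intros\<close>)
    finally have "contour_integral ?p (\<lambda>z. cnj z / z ^ k - moment_poly d t z / z ^ k) = 0"
      by (simp only: mult_zero_right)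
    moreover have "contour_integral ?p (\<lambda>z. cnj z / z ^ k - moment_poly d t z / z ^ k) =
      contour_integral ?p (\<lambda>z. cnj z / z ^ k) - contour_integral ?p (\<lambda>z. moment_poly d t z / z ^ k)"
      using nz by (intro contour_integral_diff contour_integrable continuous_intros) (auto simp: path_image_eq)
    ultimately show ?thesis using main k by (simp add: exterior_moment_def)
  qed
  then show ?thesis using above 0 by unfold_locales auto
qed

end

section \<open>The effective potential\<close>

lemma polynomial_curve_with_moments_imp:
  assumes "polynomial_curve_with_moments d t0 t \<gamma>" "\<forall>k>d+1. t k = 0"
  obtains r a where "moment_curve d r a t" "\<gamma> = path_image (laurent_map d r a \<circ> circle_point)"
    "measure lborel (inside \<gamma>) = pi * t0"
proof -
  obtain p r a where p: "r > 0" "p = laurent_map d r a \<circ> circlepath 0 1" "simple_path p"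
    "path_image p = \<gamma>" "positively_oriented p" "0 \<in> inside \<gamma>" "measure lebesgue (inside \<gamma>) = pi * t0"
    "\<forall>k\<ge>1. exterior_moment p k = t k"
    using assms(1) unfolding polynomial_curve_with_moments_def polynomial_parametrisation_def by blast
  have p2: "p = laurent_map d r a \<circ> circle_point" using p(2) by (simp add: circlepath_eq_circle_point)
  have simple: "simple_path (laurent_map d r a \<circ> circle_point)"
    and pos: "positively_oriented (laurent_map d r a \<circ> circle_point)"
    and mom: "\<forall>k\<ge>1. exterior_moment (laurent_map d r a \<circ> circle_point) k = t k"
    and zero: "0 \<in> inside (path_image (laurent_map d r a \<circ> circle_point))"
    using p by (simp_all only: p2[symmetric])
  have "polynomial_curve d r a"
    by unfold_locales (fact laurent_path_deriv continuous_laurent_velocity range_laurent simple closed_laurent pos p(1))+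
  then interpret polynomial_curve d r a .
  have mc: "moment_curve d r a t"
    by unfold_locales (fact mom assms(2) zero)+
  have "measure lborel (inside \<gamma>) = pi * t0"
    using p(7) borel_inside unfolding p(4)[symmetric] p2 by (simp add: measure_completion)
  then show ?thesis using mc p(4) p2 by (intro that[of r a]) auto
qed

lemma (in moment_curve) curve_with_moments:
  assumes "(\<Sum>j=0..d. real j * cmod (a j)) < r" "measure lborel \<Omega> = pi * t0"
  shows "polynomial_curve_with_moments d t0 t (path_image (h \<circ> circle_point))"
  unfolding polynomial_curve_with_moments_def polynomial_parametrisation_def
proof (intro exI[of _ "h \<circ> circle_point"] conjI ballI)
  show "\<exists>r' a'. r' > 0 \<and> h \<circ> circle_point = laurent_map d r' a' \<circ> circlepath 0 1"
    using r_pos by (auto simp: circlepath_eq_circle_point)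
  fix s
  have "vector_derivative (h \<circ> circle_point) (at s) = laurent_velocity d r a s"
    by (rule vector_derivative_at[OF laurent_path_deriv])
  then show "vector_derivative (h \<circ> circle_point) (at s) \<noteq> 0"
    using laurent_deriv_nonzero[OF norm_circle_point assms(1), of s] by (simp add: laurent_velocity_def)
next
  show "measure lebesgue \<Omega> = pi * t0" using assms(2) borel_inside by (simp add: measure_completion)
qed (use simple positive zero_inside moments in auto)

text \<open>\<open>r\<close> and the \<open>a j\<close> are means of \<open>h\<close> against
  unimodular functions, and the curve lies in the closure of its interior.\<close>

lemma (in moment_curve) coefficients_le:
  assumes "\<Omega> \<subseteq> cball 0 R"
  shows "r \<le> R" "j \<le> d \<Longrightarrow> cmod (a j) \<le> R"
proof -
  have hR: "cmod (h w) \<le> R" if "cmod w = 1" for w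
  proof -
    have "h w \<in> frontier \<Omega>" using jordan that by (simp add: path_image_eq)
    then have "h w \<in> closure \<Omega>" by (simp add: frontier_def)
    then have "h w \<in> cball 0 R" using closure_minimal[OF assms] by auto
    then show ?thesis by simp
  qed
  have "cmod (circle_mean (\<lambda>w. h w / w)) \<le> R"
    by (rule norm_circle_mean_le) (use hR in \<open>auto intro!: continuous_intros simp: norm_divide\<close>)
  then show "r \<le> R" using r_pos by (simp add: laurent_leading_coefficient)
  assume j: "j \<le> d"
  have "cmod (circle_mean (\<lambda>w. h w * w ^ j)) \<le> R"
    by (rule norm_circle_mean_le) (use hR in \<open>auto intro!: continuous_intros simp: norm_mult norm_power\<close>)
  then show "cmod (a j) \<le> R" by (simp add: laurent_coefficient[OF j])
qed

locale moment_curve_data = moment_data d t + moment_curve d r a t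
  for d :: nat and t :: "nat \<Rightarrow> complex" and r :: real and a :: "nat \<Rightarrow> complex"
begin

lemma solves: "solves r a"
  unfolding solves_def \<Phi>_def
proof (intro allI impI)
  fix j assume "j \<le> d"
  from coefficient_equation[OF this, symmetric]
  show "a j = cnj (circle_mean (\<lambda>\<sigma>. moment_poly d t (h (1 / \<sigma>)) * \<sigma> ^ j))" by simp
qed

lemma area: "measure lborel \<Omega> = pi * curve_area r a"
  by (simp add: area_eq curve_area_def)

lemma emeasure_area:
  assumes "measure lborel \<Omega> = pi * t0" "t0 > 0"
  shows "emeasure lborel \<Omega> = ennreal (pi * (sqrt t0)\<^sup>2)"
proof -
  have "emeasure lborel \<Omega> \<noteq> \<infinity>" using emeasure_bounded_finite[OF bounded_inside] by simp
  then show ?thesis using assms by (simp add: emeasure_eq_ennreal_measure)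
qed

text \<open>The estimate of P' requires \<open>cmod z\<close> below the threshold in
  \<open>small\<close>, where \<open>Q\<close> takes at most half of the margin
  \<open>1 - \<beta>\<close>. It therefore excludes only an annulus; \<open>\<Omega>\<close> is
  confined because it is connected and contains 0.\<close>

lemma inside_subset:
  assumes "measure lborel \<Omega> = pi * t0" "t0 > 0"
    and small: "4 * sqrt t0 / (1 - \<beta>) < min 1 ((1 - \<beta>) / (2 * (\<kappa> + 1)))"
  shows "\<Omega> \<subseteq> cball 0 (4 * sqrt t0 / (1 - \<beta>))"
proof (rule connected_subset_cball[OF connected_inside zero_inside small])
  show "0 \<le> 4 * sqrt t0 / (1 - \<beta>)" using beta assms(2) by auto
  fix z assume z: "z \<in> \<Omega>" and lt: "cmod z < min 1 ((1 - \<beta>) / (2 * (\<kappa> + 1)))"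
  have "cmod (cauchy_transform \<Omega> z) \<le> 2 * sqrt t0"
    by (rule norm_cauchy_transform_le) (use emeasure_area[OF assms(1,2)] assms(2) in auto)
  then have 1: "cmod (cnj z - moment_poly d t z) \<le> 2 * sqrt t0"
    using schwarz_inside[OF moments moments_above zero_inside z] by (simp add: algebra_simps)
  have "cmod (Q z - Q 0) \<le> \<kappa> * cmod z * cmod (z - 0)"
    by (rule Q_lipschitz) (use lt in auto)
  also have "\<dots> \<le> (\<kappa> + 1) * cmod z * cmod z" by (simp add: mult_right_mono)
  also have "\<dots> \<le> (1 - \<beta>) / 2 * cmod z"
  proof (rule mult_right_mono)
    have "cmod z * (2 * (\<kappa> + 1)) \<le> 1 - \<beta>"
      using lt kappa by (simp add: less_divide_eq)
    then show "(\<kappa> + 1) * cmod z \<le> (1 - \<beta>) / 2" by (simp add: field_simps)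
  qed simp
  finally have 2: "cmod (Q z) \<le> (1 - \<beta>) / 2 * cmod z" by simp
  have "cmod (2 * t 2 * z + Q z) \<le> \<beta> * cmod z + (1 - \<beta>) / 2 * cmod z"
    by (intro norm_triangle_mono 2) (simp add: norm_mult \<beta>_def)
  then have "cmod (cnj z) - (\<beta> * cmod z + (1 - \<beta>) / 2 * cmod z) \<le> cmod (cnj z - moment_poly d t z)"
    using norm_triangle_ineq2[of "cnj z" "moment_poly d t z"] by (simp add: moment_poly_split)
  then have "(1 - \<beta>) / 2 * cmod z \<le> 2 * sqrt t0" using 1 by (simp add: field_simps)
  then show "cmod z \<le> 4 * sqrt t0 / (1 - \<beta>)" using beta by (simp add: field_simps)
qed

definition u :: "complex \<Rightarrow> real"
  where "u z = (LINT \<zeta>:\<Omega>|lborel. ln (cmod (z - \<zeta>)))"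

text \<open>\<open>t0\<close> times the sum of the external potential \<open>V\<close> and twice the
  logarithmic potential of Lebesgue measure on \<open>\<Omega>\<close> divided by
  \<open>pi * t0\<close>.\<close>

definition f :: "complex \<Rightarrow> real"
  where "f z = moment_potential d t z - 2 / pi * u z"

lemma moment_potential_derivative:
  assumes "(q has_vector_derivative q') (at x within A)"
  shows "((\<lambda>x. moment_potential d t (q x)) has_vector_derivative
    2 * Re (q' * (cnj (q x) - moment_poly d t (q x)))) (at x within A)"
proof -
  have qd: "(q has_derivative (\<lambda>y. y *\<^sub>R q')) (at x within A)"
    using assms by (simp add: has_vector_derivative_def)
  have "((\<lambda>z. \<Sum>k=2..d+1. t k * z ^ k) has_field_derivative (\<Sum>k=2..d+1. t k * (of_nat k * z ^ (k - 1)))) (at z)" for z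
    by (intro DERIV_sum DERIV_cmult DERIV_power[OF DERIV_ident, THEN DERIV_cong]) simp
  moreover have "(\<Sum>k=2..d+1. t k * (of_nat k * z ^ (k - 1))) = moment_poly d t z" for z
  proof -
    have "moment_poly d t z = (\<Sum>k\<in>insert 1 {2..d+1}. of_nat k * t k * z ^ (k - 1))"
      unfolding moment_poly_def by (rule sum.cong) auto
    then show ?thesis using t1 by (simp add: mult_ac)
  qed
  ultimately have P: "((\<lambda>z. \<Sum>k=2..d+1. t k * z ^ k) has_field_derivative moment_poly d t z) (at z)" for z by simp
  have "((\<lambda>x. \<Sum>k=2..d+1. t k * q x ^ k) has_vector_derivative q' * moment_poly d t (q x)) (at x within A)"
    using field_vector_diff_chain_within[OF assms, of "\<lambda>z. \<Sum>k=2..d+1. t k * z ^ k"]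
      DERIV_subset[OF P subset_UNIV] by (simp add: o_def)
  then have "((\<lambda>x. Re (\<Sum>k=2..d+1. t k * q x ^ k)) has_vector_derivative Re (q' * moment_poly d t (q x))) (at x within A)"
    by (rule bounded_linear.has_vector_derivative[OF bounded_linear_Re])
  moreover have "((\<lambda>x. (cmod (q x))\<^sup>2) has_vector_derivative 2 * Re (q' * cnj (q x))) (at x within A)"
  proof -
    have "((\<lambda>x. q x \<bullet> q x) has_derivative (\<lambda>y. q x \<bullet> (y *\<^sub>R q') + (y *\<^sub>R q') \<bullet> q x)) (at x within A)"
      by (rule has_derivative_inner[OF qd qd])
    moreover have "q x \<bullet> (y *\<^sub>R q') + (y *\<^sub>R q') \<bullet> q x = y *\<^sub>R (2 * Re (q' * cnj (q x)))" for y
      by (simp add: inner_complex_def algebra_simps)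
    ultimately show ?thesis by (simp only: has_vector_derivative_def power2_norm_eq_inner)
  qed
  ultimately have "((\<lambda>x. (cmod (q x))\<^sup>2 - 2 * Re (\<Sum>k=2..d+1. t k * q x ^ k)) has_vector_derivative
      (2 * Re (q' * cnj (q x)) - 2 * Re (q' * moment_poly d t (q x)))) (at x within A)"
    by (intro has_vector_derivative_diff bounded_linear.has_vector_derivative[OF bounded_linear_mult_right])
  then show ?thesis by (simp add: moment_potential_def right_diff_distrib)
qed

lemma continuous_C: "continuous_on A (cauchy_transform \<Omega>)"
proof -
  obtain \<epsilon> where e: "\<epsilon> > 0" "emeasure lborel \<Omega> \<le> ennreal (pi * \<epsilon>^2)" by (rule finite_area)
  show ?thesis by (rule continuous_cauchy_transform[OF borel_inside e(2) e(1)])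
qed

text \<open>The gradient of \<open>f\<close> in integrated form: for the logarithmic part this is
  \<open>log_potential_along_curve\<close>, so differentiability of \<open>u\<close> is never
  discussed.\<close>

lemma f_along_curve:
  fixes q :: "real \<Rightarrow> complex"
  assumes q: "\<And>x. (q has_vector_derivative q' x) (at x)" and q': "continuous_on UNIV q'" and "x1 \<le> x2"
  shows "f (q x2) - f (q x1) =
    integral {x1..x2} (\<lambda>x. 2 * Re (q' x * (cnj (q x) - moment_poly d t (q x) - cauchy_transform \<Omega> (q x))))"
    and "(\<lambda>x. 2 * Re (q' x * (cnj (q x) - moment_poly d t (q x) - cauchy_transform \<Omega> (q x)))) integrable_on {x1..x2}"
proof -
  have qc: "continuous_on A q" for A
    using q by (meson continuous_at_imp_continuous_on has_vector_derivative_continuous)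
  have qc': "continuous_on A q'" for A by (rule continuous_on_subset[OF q']) auto
  have cC: "continuous_on A (\<lambda>x. cauchy_transform \<Omega> (q x))" for A
    by (rule continuous_on_compose2[OF continuous_C[of UNIV] qc]) auto
  have "((\<lambda>x. 2 * Re (q' x * (cnj (q x) - moment_poly d t (q x)))) has_integral
      (moment_potential d t (q x2) - moment_potential d t (q x1))) {x1..x2}"
    by (rule fundamental_theorem_of_calculus[OF \<open>x1 \<le> x2\<close>])
       (rule moment_potential_derivative[OF has_vector_derivative_at_within[OF q]])
  moreover have "((\<lambda>x. Re (q' x * cauchy_transform \<Omega> (q x))) has_integral (u (q x2) - u (q x1)) / pi) {x1..x2}"
  proof -
    have c: "continuous_on {x1..x2} (\<lambda>x. q' x * cauchy_transform \<Omega> (q x))" by (intro continuous_intros qc' cC)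
    have "u (q x2) - u (q x1) = pi * Re (LINT x:{x1..x2}|lborel. q' x * cauchy_transform \<Omega> (q x))"
      unfolding u_def by (rule log_potential_along_curve[OF q q' borel_inside bounded_inside \<open>x1 \<le> x2\<close>])
    also have "(LINT x:{x1..x2}|lborel. q' x * cauchy_transform \<Omega> (q x)) = integral {x1..x2} (\<lambda>x. q' x * cauchy_transform \<Omega> (q x))"
      by (rule set_lebesgue_integral_continuous[OF c])
    finally have "(u (q x2) - u (q x1)) / pi = Re (integral {x1..x2} (\<lambda>x. q' x * cauchy_transform \<Omega> (q x)))" by simp
    then show ?thesis
      using has_integral_linear[OF integrable_integral[OF integrable_continuous_interval[OF c]] bounded_linear_Re]
      by (simp add: o_def)
  qed
  ultimately have "((\<lambda>x. 2 * Re (q' x * (cnj (q x) - moment_poly d t (q x))) - 2 * Re (q' x * cauchy_transform \<Omega> (q x))) has_integral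
     (moment_potential d t (q x2) - moment_potential d t (q x1) - 2 * ((u (q x2) - u (q x1)) / pi))) {x1..x2}"
    by (intro has_integral_diff has_integral_mult_right)
  then have "((\<lambda>x. 2 * Re (q' x * (cnj (q x) - moment_poly d t (q x) - cauchy_transform \<Omega> (q x)))) has_integral (f (q x2) - f (q x1))) {x1..x2}"
    by (simp add: f_def right_diff_distrib diff_divide_distrib algebra_simps)
  then show "f (q x2) - f (q x1) =
    integral {x1..x2} (\<lambda>x. 2 * Re (q' x * (cnj (q x) - moment_poly d t (q x) - cauchy_transform \<Omega> (q x))))"
    and "(\<lambda>x. 2 * Re (q' x * (cnj (q x) - moment_poly d t (q x) - cauchy_transform \<Omega> (q x)))) integrable_on {x1..x2}"
    by (auto simp: integral_unique)
qed

lemma f_segment: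
  shows "f w - f z = integral {0..1} (\<lambda>x. 2 * Re ((w - z) * (cnj (z + of_real x * (w - z)) -
    moment_poly d t (z + of_real x * (w - z)) - cauchy_transform \<Omega> (z + of_real x * (w - z)))))"
proof -
  have "((\<lambda>x. z + of_real x * (w - z)) has_vector_derivative (w - z)) (at x)" for x
    unfolding has_vector_derivative_def
    by (auto intro!: derivative_eq_intros simp: scaleR_conv_of_real)
  from f_along_curve(1)[OF this, of 0 1] show ?thesis by simp
qed

text \<open>On a segment inside \<open>\<Omega>\<close> the integrand of \<open>f_segment\<close>
  vanishes by \<open>schwarz_inside\<close>. Segments are at hand only within discs, so
  \<open>f\<close> is first seen to be locally constant; connectedness does the rest.\<close>

lemma f_inside: "z \<in> \<Omega> \<Longrightarrow> f z = f 0"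
proof -
  assume z: "z \<in> \<Omega>"
  have zero: "cnj y - moment_poly d t y - cauchy_transform \<Omega> y = 0" if "y \<in> \<Omega>" for y
    using schwarz_inside[OF moments moments_above zero_inside that] by (simp add: algebra_simps)
  have loc: "f w = f z" if "ball z e \<subseteq> \<Omega>" "w \<in> ball z e" for z w e
  proof -
    have "z + of_real x * (w - z) \<in> \<Omega>" if "x \<in> {0..1}" for x
    proof -
      have "cmod (of_real x * (w - z)) \<le> 1 * cmod (w - z)"
        unfolding norm_mult using that by (intro mult_right_mono) auto
      then show ?thesis using \<open>ball z e \<subseteq> \<Omega>\<close> \<open>w \<in> ball z e\<close>
        by (auto simp: dist_norm norm_minus_commute subset_iff)
    qed
    then have "cnj (z + of_real x * (w - z)) - moment_poly d t (z + of_real x * (w - z)) -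
        cauchy_transform \<Omega> (z + of_real x * (w - z)) = 0" if "x \<in> {0..1}" for x
      using that zero by blast
    then have "integral {0..1} (\<lambda>x. 2 * Re ((w - z) * (cnj (z + of_real x * (w - z)) -
       moment_poly d t (z + of_real x * (w - z)) - cauchy_transform \<Omega> (z + of_real x * (w - z))))) = integral {0..1} (\<lambda>x::real. 0)"
      by (intro Henstock_Kurzweil_Integration.integral_cong) (simp only: mult_zero_right zero_complex.sel)
    then show ?thesis using f_segment[of w z] by simp
  qed
  have D: "(f has_derivative (\<lambda>_. 0)) (at x)" if "x \<in> \<Omega>" for x
  proof -
    obtain e where e: "e > 0" "ball x e \<subseteq> \<Omega>" using open_inside \<open>x \<in> \<Omega>\<close> open_contains_ball by blast
    show ?thesis
      by (rule has_derivative_transform_within_open[OF has_derivative_const[of "f x"] open_ball[of x e]])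
         (use e(1) in simp, rule loc[OF e(2), symmetric])
  qed
  show "f z = f 0"
    by (rule has_derivative_zero_unique_connected[OF open_inside connected_inside D z zero_inside])
qed

text \<open>The uniform bound on the Cauchy transform, integrated along segments, makes
  \<open>u\<close> Lipschitz.\<close>

lemma f_lipschitz_continuous: "continuous_on UNIV f"
proof -
  have "isCont u z" for z
  proof -
    obtain \<epsilon> where e: "\<epsilon> > 0" "emeasure lborel \<Omega> \<le> ennreal (pi * \<epsilon>^2)" by (rule finite_area)
    have "\<bar>u w - u z\<bar> \<le> pi * (2 * \<epsilon>) * cmod (w - z)" for w
    proof -
      have d: "((\<lambda>x. z + of_real x * (w - z)) has_vector_derivative (w - z)) (at x)" for x
        unfolding has_vector_derivative_def
        by (auto intro!: derivative_eq_intros simp: scaleR_conv_of_real)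
      have c: "continuous_on {0..1} (\<lambda>x. (w - z) * cauchy_transform \<Omega> (z + of_real x * (w - z)))"
        by (intro continuous_intros continuous_on_compose2[OF continuous_C[of UNIV]]) auto
      have "u w - u z = pi * Re (LINT x:{0..1}|lborel. (w - z) * cauchy_transform \<Omega> (z + of_real x * (w - z)))"
        using log_potential_along_curve[OF d _ borel_inside bounded_inside, of 0 1] by (simp add: u_def)
      also have "\<dots> = pi * Re (integral {0..1} (\<lambda>x. (w - z) * cauchy_transform \<Omega> (z + of_real x * (w - z))))"
        by (simp only: set_lebesgue_integral_continuous[OF c])
      also have "\<bar>\<dots>\<bar> \<le> pi * cmod (integral {0..1} (\<lambda>x. (w - z) * cauchy_transform \<Omega> (z + of_real x * (w - z))))"
        by (simp only: abs_mult abs_of_pos[OF pi_gt_zero]) (intro mult_left_mono abs_Re_le_cmod pi_ge_zero)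
      also have "\<dots> \<le> pi * (cmod (w - z) * (2 * \<epsilon>) * (1 - 0))"
        by (intro mult_left_mono integral_bound c)
           (auto simp: norm_mult intro!: mult_left_mono norm_cauchy_transform_le[OF borel_inside e(2) e(1)])
      finally show ?thesis by (simp add: mult_ac)
    qed
    then have "eventually (\<lambda>w. norm (u w - u z) \<le> pi * (2 * \<epsilon>) * cmod (w - z)) (at z)" by simp
    moreover have "((\<lambda>w. pi * (2 * \<epsilon>) * cmod (w - z)) \<longlongrightarrow> 0) (at z)"
      by (auto intro!: tendsto_eq_intros)
    ultimately have "((\<lambda>w. u w - u z) \<longlongrightarrow> 0) (at z)"
      by (rule Lim_null_comparison)
    then show ?thesis by (simp add: isCont_def LIM_zero_iff)
  qed
  then have "continuous_on UNIV u" by (simp add: continuous_at_imp_continuous_on)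
  then show ?thesis
    unfolding f_def[abs_def] moment_potential_def by (intro continuous_intros)
qed

lemma f_closure: "z \<in> closure \<Omega> \<Longrightarrow> f z = f 0"
proof -
  assume z: "z \<in> closure \<Omega>"
  have "closed {z. f z = f 0}"
    by (intro closed_Collect_eq f_lipschitz_continuous continuous_intros)
  moreover have "\<Omega> \<subseteq> {z. f z = f 0}" using f_inside by blast
  ultimately show "f z = f 0" using closure_minimal z by blast
qed

text \<open>Starting on the curve, where \<open>f\<close> equals \<open>f 0\<close>, the derivative
  of \<open>f\<close> along the image of the ray is twice the expression in \<open>mono\<close>:
  \<open>schwarz_outside\<close> replaces the transform, so that P' cancels and only the reflected
  point remains.\<close>

lemma f_radial:
  assumes v: "cmod v > 1"
    and mono: "\<And>w. 1 \<le> cmod w \<Longrightarrow> cmod w \<le> cmod v \<Longrightarrow>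
      0 \<le> Re (w * laurent_deriv d r a w * cnj (h w - h (1 / cnj w)))"
  shows "f 0 \<le> f (h v)"
proof -
  define \<omega> where "\<omega> = v / of_real (cmod v)"
  have v0: "cmod v > 0" using v by linarith
  have \<omega>: "cmod \<omega> = 1" "\<omega> \<noteq> 0" using v0 by (auto simp: \<omega>_def norm_divide)
  \<comment> \<open>With the exponential parametrisation of the ray, \<open>W\<close> is its own
    derivative, and the modulus runs from 1 to \<open>cmod v\<close>.\<close>
  define W where "W = (\<lambda>x. of_real (exp x) * \<omega>)"
  have W0: "W x \<noteq> 0" "cmod (W x) = exp x" for x using \<omega> by (auto simp: W_def norm_mult)
  have Wd: "(W has_vector_derivative W x) (at x)" for x
    unfolding W_def has_vector_derivative_def
    by (auto intro!: derivative_eq_intros simp: scaleR_conv_of_real)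
  have qd: "((h \<circ> W) has_vector_derivative W x * laurent_deriv d r a (W x)) (at x)" for x
    by (rule field_vector_diff_chain_at[OF Wd laurent_map_has_derivative[OF W0(1)]])
  have cW: "continuous_on UNIV W" unfolding W_def by (intro continuous_intros)
  have cq: "continuous_on UNIV (\<lambda>x. W x * laurent_deriv d r a (W x))"
    by (intro continuous_intros cW) (rule W0)
  define L where "L = ln (cmod v)"
  have L: "0 \<le> L" using v by (simp add: L_def)
  have WL: "W L = v" using v0 by (simp add: W_def L_def \<omega>_def)
  have "h (W 0) \<in> frontier \<Omega>" using jordan W0(2)[of 0] by (simp add: path_image_eq)
  then have f0: "f (h (W 0)) = f 0" by (intro f_closure) (simp add: frontier_def)
  have "0 \<le> f ((h \<circ> W) L) - f ((h \<circ> W) 0)"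
    unfolding f_along_curve(1)[OF qd cq L]
  proof (rule integral_nonneg[OF f_along_curve(2)[OF qd cq L]])
    fix x assume x: "x \<in> {0..L}"
    let ?w = "W x"
    have w: "1 \<le> cmod ?w" "cmod ?w \<le> cmod v"
      using x v0 unfolding W0(2) L_def by (auto simp: ln_ge_iff)
    have "cauchy_transform \<Omega> (h ?w) = cnj (h (1 / cnj ?w)) - moment_poly d t (h ?w)"
    proof (cases "cmod ?w = 1")
      case True
      then show ?thesis using schwarz_on_curve[OF True] cnj_eq_inverse_unit[OF True] by simp
    next
      case False
      then show ?thesis using w by (intro schwarz_outside) auto
    qed
    then show "0 \<le> 2 * Re (?w * laurent_deriv d r a ?w * (cnj ((h \<circ> W) x) - moment_poly d t ((h \<circ> W) x) - cauchy_transform \<Omega> ((h \<circ> W) x)))"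
      using mono[OF w] by simp
  qed
  then show ?thesis using f0 WL by simp
qed

end

text \<open>Perturbation of the ellipse \<open>r * w + c / w\<close>. For it the expression is
  \<open>1 - 1 / m\<close> times \<open>Re (A * cnj B)\<close>, at least
  \<open>(r - cmod c) * (r * m - cmod c)\<close>, hence at least \<open>(1 - b)^2 * r^2 * m\<close>.
  The other coefficients enter through \<open>E1\<close> and \<open>E2\<close>, each at most
  \<open>\<epsilon> * r\<close>. The error
  \<open>(4 * \<epsilon> * cmod w + \<epsilon> * \<epsilon>) * r^2\<close> is at most
  \<open>5 * \<epsilon> * cmod w * r^2\<close>, which explains the 5.\<close>

lemma radial_positive:
  fixes a :: "nat \<Rightarrow> complex"
  assumes r: "r > 0" and b: "0 \<le> b" "b < 1" and \<eta>: "0 \<le> \<eta>"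
    and a1: "1 \<le> d \<Longrightarrow> cmod (a 1) \<le> b * r" and aj: "\<And>j. j \<le> d \<Longrightarrow> j \<noteq> 1 \<Longrightarrow> cmod (a j) \<le> \<eta> * r"
    and w: "1 \<le> cmod w" "cmod w \<le> K"
    and e: "5 * (\<eta> * (\<Sum>j=0..d. real j * K ^ (2 * j))) \<le> (1 - b)\<^sup>2"
  shows "0 \<le> Re (w * laurent_deriv d r a w * cnj (laurent_map d r a w - laurent_map d r a (1 / cnj w)))"
proof -
  \<comment> \<open>For \<open>d = 0\<close> the value \<open>a 1\<close> does not belong to the
    map.\<close>
  define c where "c = (if d \<ge> 1 then a 1 else 0)"
  define J where "J = {0..d} - {1}"
  have J: "finite J" "J \<subseteq> {0..d}" by (auto simp: J_def)
  have sum_split: "(\<Sum>j=0..d. g j (a j)) = g 1 c + (\<Sum>j\<in>J. g j (a j))" if "g 1 0 = 0" for g :: "nat \<Rightarrow> complex \<Rightarrow> complex"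
  proof (cases "d \<ge> 1")
    case True
    then show ?thesis by (simp add: J_def c_def sum.remove[of "{0..d}" 1])
  next
    case False
    then have "J = {0..d}" by (auto simp: J_def)
    then show ?thesis using False that by (simp add: c_def)
  qed
  define m where "m = (cmod w)\<^sup>2"
  have m: "m \<ge> 1" using w by (simp add: m_def)
  have w0: "w \<noteq> 0" using w by auto
  have mw: "of_real m = w * cnj w" by (simp only: m_def complex_norm_square)
  define E1 where "E1 = (\<Sum>j\<in>J. a j * of_real (\<Sum>i=1..j. m ^ i) / w ^ j)"
  define E2 where "E2 = (\<Sum>j\<in>J. of_nat j * a j / w ^ j)"
  define A where "A = of_real r * w - c / w"
  define B where "B = of_real r * w - c * cnj w"
  define S where "S = (\<Sum>j=0..d. real j * K ^ (2 * j))"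
  define \<epsilon> where "\<epsilon> = \<eta> * S"
  have K: "1 \<le> K" using w by linarith
  have S: "0 \<le> S" unfolding S_def using K by (intro sum_nonneg) auto
  have \<epsilon>: "0 \<le> \<epsilon>" "5 * \<epsilon> \<le> (1 - b)\<^sup>2" using \<eta> S e by (auto simp: \<epsilon>_def S_def)
  have "(1 - b)\<^sup>2 \<le> 1" using b by (simp add: power_le_one)
  then have \<epsilon>1: "\<epsilon> \<le> 1" using \<epsilon> by linarith
  have D: "w * laurent_deriv d r a w = A - E2"
  proof -
    have "w * laurent_deriv d r a w = of_real r * w - (\<Sum>j=0..d. of_nat j * a j / w ^ j)"
      using w0 by (simp add: laurent_deriv_def algebra_simps sum_distrib_left)
    also have "(\<Sum>j=0..d. of_nat j * a j / w ^ j) = c / w + E2"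
      using sum_split[of "\<lambda>j x. of_nat j * x / w ^ j"] by (simp add: E2_def)
    finally show ?thesis by (simp add: A_def)
  qed
  have X: "laurent_map d r a w - laurent_map d r a (1 / cnj w) = of_real (1 - 1 / m) * (B - E1)"
  proof -
    have inv: "1 / cnj w = w / of_real m" using w0 unfolding mw by simp
    have t: "a j / w ^ j - a j / (w / of_real m) ^ j = - (of_real (1 - 1 / m) * (a j * of_real (\<Sum>i=1..j. m ^ i) / w ^ j))" for j a
    proof -
      \<comment> \<open>The difference \<open>h w - h (1 / cnj w)\<close> vanishes on the unit
        circle. The geometric sum extracts the common factor \<open>1 - 1 / m\<close> from every
        term, so that the estimate of what is left does not degenerate there.\<close>
      have "(1 - 1 / m) * (\<Sum>i=1..j. m ^ i) = m ^ j - 1"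
      proof (induction j)
        case (Suc j)
        have "(1 - 1 / m) * (\<Sum>i=1..Suc j. m ^ i) = (1 - 1 / m) * (\<Sum>i=1..j. m ^ i) + (1 - 1 / m) * m ^ Suc j"
          by (simp add: distrib_left)
        also have "\<dots> = m ^ Suc j - 1" unfolding Suc.IH using m by (simp add: algebra_simps)
        finally show ?case .
      qed simp
      then have "complex_of_real (1 - 1 / m) * of_real (\<Sum>i=1..j. m ^ i) = of_real (m ^ j - 1)"
        by (simp only: of_real_mult[symmetric])
      then have "of_real (1 - 1 / m) * (a j * of_real (\<Sum>i=1..j. m ^ i) / w ^ j) = a j * of_real (m ^ j - 1) / w ^ j"
        by (simp only: mult.left_commute[of _ "a j"] times_divide_eq_right)
      then show ?thesis by (simp add: power_divide diff_divide_distrib algebra_simps)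
    qed
    have "laurent_map d r a w - laurent_map d r a (w / of_real m) =
        of_real r * w * of_real (1 - 1 / m) + (\<Sum>j=0..d. a j / w ^ j - a j / (w / of_real m) ^ j)"
      by (simp add: laurent_map_def sum_subtractf algebra_simps)
    also have "\<dots> = of_real r * w * of_real (1 - 1 / m) - of_real (1 - 1 / m) * (\<Sum>j=0..d. a j * of_real (\<Sum>i=1..j. m ^ i) / w ^ j)"
      unfolding t sum_negf sum_distrib_left by simp
    also have "(\<Sum>j=0..d. a j * of_real (\<Sum>i=1..j. m ^ i) / w ^ j) = c * of_real m / w + E1"
      using sum_split[of "\<lambda>j x. x * of_real (\<Sum>i=1..j. m ^ i) / w ^ j"] by (simp add: E1_def)
    also have "c * of_real m / w = c * cnj w" using w0 by (simp add: mw)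
    finally show ?thesis unfolding inv by (simp add: B_def algebra_simps)
  qed
  have E1: "cmod E1 \<le> \<epsilon> * r"
  proof -
    have "cmod E1 \<le> (\<Sum>j\<in>J. \<eta> * r * (real j * K ^ (2 * j)))"
      unfolding E1_def
    proof (rule sum_norm_le)
      fix j assume j: "j \<in> J"
      have "(\<Sum>i=1..j. m ^ i) \<le> (\<Sum>i=1..j. m ^ j)" using m by (intro sum_mono power_increasing) auto
      also have "\<dots> = real j * (cmod w) ^ (2 * j)" by (simp add: m_def power_mult)
      also have "\<dots> \<le> real j * K ^ (2 * j)" using w by (intro mult_left_mono power_mono) auto
      finally have s: "(\<Sum>i=1..j. m ^ i) \<le> real j * K ^ (2 * j)" .
      have s0: "0 \<le> (\<Sum>i=1..j. m ^ i)" using m by (intro sum_nonneg) auto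
      have "1 \<le> cmod w ^ j" using w by (simp add: one_le_power)
      then have "cmod (a j) * (\<Sum>i=1..j. m ^ i) / cmod w ^ j \<le> cmod (a j) * (\<Sum>i=1..j. m ^ i) / 1"
        using s0 by (intro divide_left_mono) (auto intro: mult_pos_pos)
      also have "\<dots> \<le> (\<eta> * r) * (real j * K ^ (2 * j))"
        using aj[of j] j s s0 \<eta> r unfolding div_by_1 J_def by (intro mult_mono) auto
      finally show "cmod (a j * of_real (\<Sum>i=1..j. m ^ i) / w ^ j) \<le> \<eta> * r * (real j * K ^ (2 * j))"
        unfolding norm_divide norm_mult norm_power norm_of_real abs_of_nonneg[OF s0] .
    qed
    also have "\<dots> \<le> (\<Sum>j=0..d. \<eta> * r * (real j * K ^ (2 * j)))"
      using J \<eta> r K by (intro sum_mono2) auto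
    also have "\<dots> = \<epsilon> * r" by (simp only: \<epsilon>_def S_def sum_distrib_left[symmetric] mult_ac)
    finally show ?thesis .
  qed
  have E2: "cmod E2 \<le> \<epsilon> * r"
  proof -
    have "cmod E2 \<le> (\<Sum>j\<in>J. \<eta> * r * (real j * K ^ (2 * j)))"
      unfolding E2_def
    proof (rule sum_norm_le)
      fix j assume j: "j \<in> J"
      have "1 \<le> cmod w ^ j" using w by (simp add: one_le_power)
      then have "real j * cmod (a j) / cmod w ^ j \<le> real j * cmod (a j) / 1"
        by (intro divide_left_mono) (auto intro: mult_pos_pos)
      also have "\<dots> \<le> real j * (\<eta> * r)" using aj[of j] j unfolding J_def by (auto intro: mult_left_mono)
      also have "\<dots> \<le> real j * (\<eta> * r) * K ^ (2 * j)"
        using K \<eta> r mult_left_mono[of 1 "K ^ (2 * j)" "real j * (\<eta> * r)"] by (simp add: one_le_power)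
      finally show "cmod (of_nat j * a j / w ^ j) \<le> \<eta> * r * (real j * K ^ (2 * j))"
        by (simp add: norm_divide norm_mult norm_power mult_ac)
    qed
    also have "\<dots> \<le> (\<Sum>j=0..d. \<eta> * r * (real j * K ^ (2 * j)))"
      using J \<eta> r K by (intro sum_mono2) auto
    also have "\<dots> = \<epsilon> * r" by (simp only: \<epsilon>_def S_def sum_distrib_left[symmetric] mult_ac)
    finally show ?thesis .
  qed
  have c: "cmod c \<le> b * r" using a1 b r by (auto simp: c_def)
  have br: "b * r \<le> r" using b r by simp
  have cr: "cmod c \<le> r * cmod w"
  proof -
    have "r * 1 \<le> r * cmod w" using w r by (intro mult_left_mono) auto
    then show ?thesis using c br by linarith
  qed
  have A: "cmod A \<le> 2 * r * cmod w"
  proof -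
    have "cmod c / cmod w \<le> cmod c / 1" using w by (intro divide_left_mono) auto
    then show ?thesis using norm_triangle_ineq4[of "of_real r * w" "c / w"] cr r
      by (simp add: A_def norm_mult norm_divide)
  qed
  have B: "cmod B \<le> 2 * r * cmod w"
  proof -
    have "cmod c * cmod w \<le> r * cmod w" using c br by (intro mult_right_mono) auto
    then show ?thesis using norm_triangle_ineq4[of "of_real r * w" "c * cnj w"] r
      by (simp add: B_def norm_mult)
  qed
  have R': "Re (x * cnj (of_real q * y)) = q * Re (x * cnj y)" for x y q by (simp add: algebra_simps)
  have R: "Re (of_real x * y) = x * Re y" for x y by simp
  have AB: "(1 - b)\<^sup>2 * r\<^sup>2 * (cmod w)\<^sup>2 \<le> Re (A * cnj B)"
  proof -
    have "A * cnj B = of_real (r\<^sup>2 * m) + c * cnj c - (of_real r * (cnj c * w\<^sup>2) + of_real r * (c * cnj w / w))"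
      using w0 unfolding A_def B_def of_real_mult mw by (simp add: power2_eq_square algebra_simps)
    then have "Re (A * cnj B) = r\<^sup>2 * m + (cmod c)\<^sup>2 - r * (Re (cnj c * w\<^sup>2) + Re (c * cnj w / w))"
      by (simp only: minus_complex.sel plus_complex.sel Re_complex_of_real complex_norm_square[symmetric] R distrib_left)
    moreover have "Re (cnj c * w\<^sup>2) \<le> cmod c * m" "Re (c * cnj w / w) \<le> cmod c"
      using complex_Re_le_cmod[of "cnj c * w\<^sup>2"] complex_Re_le_cmod[of "c * cnj w / w"] w0
      by (simp_all add: norm_mult norm_divide norm_power m_def)
    then have "r * (Re (cnj c * w\<^sup>2) + Re (c * cnj w / w)) \<le> r * (cmod c * m + cmod c)"
      using r by (intro mult_left_mono add_mono) auto
    ultimately have "r\<^sup>2 * m + (cmod c)\<^sup>2 - r * (cmod c * m + cmod c) \<le> Re (A * cnj B)" by linarith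
    moreover have "r\<^sup>2 * m + (cmod c)\<^sup>2 - r * (cmod c * m + cmod c) = (r - cmod c) * (r * m - cmod c)"
      by (simp add: power2_eq_square algebra_simps)
    moreover have "(r - b * r) * ((r - b * r) * m) \<le> (r - cmod c) * (r * m - cmod c)"
    proof (rule mult_mono)
      have "cmod c * 1 \<le> b * r * m" using c m b r by (intro mult_mono) auto
      then show "(r - b * r) * m \<le> r * m - cmod c" by (simp add: algebra_simps)
    qed (use c br m in auto)
    ultimately show ?thesis by (simp add: m_def power2_eq_square algebra_simps)
  qed
  have err: "Re (A * cnj B) - (cmod A * cmod E1 + cmod E2 * cmod B + cmod E2 * cmod E1) \<le> Re ((A - E2) * cnj (B - E1))"
  proof -
    have "Re ((A - E2) * cnj (B - E1)) = Re (A * cnj B) - Re (A * cnj E1) - Re (E2 * cnj B) + Re (E2 * cnj E1)"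
      by (simp add: algebra_simps)
    moreover have "Re (A * cnj E1) \<le> cmod A * cmod E1" "Re (E2 * cnj B) \<le> cmod E2 * cmod B"
      using complex_Re_le_cmod[of "A * cnj E1"] complex_Re_le_cmod[of "E2 * cnj B"] by (simp_all only: norm_mult complex_mod_cnj)
    moreover have "- (cmod E2 * cmod E1) \<le> Re (E2 * cnj E1)"
      using abs_Re_le_cmod[of "E2 * cnj E1"] by (simp only: norm_mult complex_mod_cnj)
    ultimately show ?thesis by linarith
  qed
  have "cmod A * cmod E1 + cmod E2 * cmod B + cmod E2 * cmod E1 \<le>
      (2 * r * cmod w) * (\<epsilon> * r) + (\<epsilon> * r) * (2 * r * cmod w) + (\<epsilon> * r) * (\<epsilon> * r)"
    using A B E1 E2 r \<epsilon>(1) by (intro add_mono mult_mono) auto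
  also have "\<dots> = (4 * \<epsilon> * cmod w + \<epsilon> * \<epsilon>) * r\<^sup>2" by (simp add: power2_eq_square algebra_simps)
  also have "\<dots> \<le> ((1 - b)\<^sup>2 * (cmod w)\<^sup>2) * r\<^sup>2"
  proof (rule mult_right_mono)
    have "\<epsilon> * \<epsilon> \<le> \<epsilon> * cmod w" using \<epsilon> \<epsilon>1 w by (intro mult_left_mono) auto
    then have "4 * \<epsilon> * cmod w + \<epsilon> * \<epsilon> \<le> 5 * \<epsilon> * cmod w" by linarith
    also have "\<dots> \<le> (1 - b)\<^sup>2 * cmod w" using \<epsilon> by (intro mult_right_mono) auto
    also have "\<dots> \<le> (1 - b)\<^sup>2 * (cmod w)\<^sup>2"
      using w mult_left_mono[of 1 "cmod w" "cmod w"] by (intro mult_left_mono) (auto simp: power2_eq_square)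
    finally show "4 * \<epsilon> * cmod w + \<epsilon> * \<epsilon> \<le> (1 - b)\<^sup>2 * (cmod w)\<^sup>2" .
  qed simp
  finally have "0 \<le> Re ((A - E2) * cnj (B - E1))" using AB err by (simp add: mult_ac)
  then have "0 \<le> (1 - 1 / m) * Re ((A - E2) * cnj (B - E1))" using m by (intro mult_nonneg_nonneg) auto
  moreover have "Re ((A - E2) * cnj (of_real (1 - 1 / m) * (B - E1))) = (1 - 1 / m) * Re ((A - E2) * cnj (B - E1))"
    using R' by blast
  ultimately show ?thesis unfolding D X by linarith
qed

context moment_curve_data
begin

text \<open>In units of \<open>\<epsilon> = sqrt t0\<close>, with
  \<open>x = cmod z / \<epsilon>\<close>, the logarithmic term grows at most linearly in
  \<open>x\<close>: integrating \<open>2 * x + \<epsilon> / cmod \<zeta>\<close> over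
  \<open>\<Omega>\<close> gives \<open>\<epsilon>^2 * (4 * x + 4)\<close> after the factor
  \<open>2 / pi\<close>. The potential is at least \<open>c0 * \<epsilon>^2 * x^2\<close>, which
  wins for \<open>x\<close> at least 1 and \<open>8 / c0\<close>. The condition on \<open>C\<close>
  gives \<open>cmod (z - \<zeta>)\<close> at most \<open>2 * cmod z\<close>.\<close>

lemma f_far:
  assumes t0: "measure lborel \<Omega> = pi * t0" "t0 > 0"
    and sub: "\<Omega> \<subseteq> cball 0 (C * sqrt t0)"
    and c0: "c0 > 0" and K: "1 \<le> K" "8 / c0 \<le> K" "C \<le> K"
    and z: "K * sqrt t0 \<le> cmod z" "c0 * (cmod z)\<^sup>2 \<le> moment_potential d t z"
  shows "f 0 \<le> f z"
proof -
  define \<epsilon> where "\<epsilon> = sqrt t0"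
  have \<epsilon>: "\<epsilon> > 0" "\<epsilon>\<^sup>2 = t0" using t0 by (auto simp: \<epsilon>_def)
  define x where "x = cmod z / \<epsilon>"
  have x: "K \<le> x" "cmod z = x * \<epsilon>" using z \<epsilon> by (auto simp: x_def \<epsilon>_def[symmetric] field_simps)
  have eA: "emeasure lborel \<Omega> \<le> ennreal (pi * \<epsilon>\<^sup>2)" using emeasure_area[OF t0] by (simp add: \<epsilon>_def)
  note ik = set_integrable_cauchy_kernel[OF borel_inside eA \<epsilon>(1), of 0]
  have in1: "integrable lborel (\<lambda>\<zeta>. indicat_real \<Omega> \<zeta> *\<^sub>R (2 * x))"
    using eA by (intro integrable_scaleR_left integrable_real_indicator) (auto intro: le_less_trans[OF _ ennreal_less_top])
  have in2: "integrable lborel (\<lambda>\<zeta>. \<epsilon> * cmod (indicat_real \<Omega> \<zeta> *\<^sub>R (1 / (0 - \<zeta>))))"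
    by (intro integrable_mult_right integrable_norm) (use ik in \<open>simp only: set_integrable_def\<close>)
  have i2: "(LINT \<zeta>|lborel. cmod (indicat_real \<Omega> \<zeta> *\<^sub>R (1 / (0 - \<zeta>)))) \<le> 2 * pi * \<epsilon>"
  proof -
    have "ennreal (LINT \<zeta>|lborel. cmod (indicat_real \<Omega> \<zeta> *\<^sub>R (1 / (0 - \<zeta>)))) =
      (\<integral>\<^sup>+\<zeta>. ennreal (cmod (indicat_real \<Omega> \<zeta> *\<^sub>R (1 / (0 - \<zeta>)))) \<partial>lborel)"
      by (rule nn_integral_eq_integral[symmetric]) (use ik in \<open>auto simp only: set_integrable_def intro!: integrable_norm\<close>, simp)
    also have "\<dots> = (\<integral>\<^sup>+\<zeta>. ennreal (indicator \<Omega> \<zeta> / cmod (0 - \<zeta>)) \<partial>lborel)"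
      by (intro nn_integral_cong) (simp add: norm_divide)
    also have "\<dots> \<le> ennreal (2 * pi * \<epsilon>)" by (rule nn_integral_inverse_dist_le[OF borel_inside eA \<epsilon>(1)])
    finally show ?thesis using \<epsilon> by simp
  qed
  note il = set_integrable_ln_dist[OF borel_inside bounded_inside]
  have "u z - u 0 = (LINT \<zeta>|lborel. indicat_real \<Omega> \<zeta> *\<^sub>R (ln (cmod (z - \<zeta>)) - ln (cmod (0 - \<zeta>))))"
    unfolding u_def set_integral_diff(2)[OF il il, symmetric] by (simp add: set_lebesgue_integral_def)
  also have "\<dots> \<le> (LINT \<zeta>|lborel. indicat_real \<Omega> \<zeta> *\<^sub>R (2 * x) + \<epsilon> * cmod (indicat_real \<Omega> \<zeta> *\<^sub>R (1 / (0 - \<zeta>))))"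
  proof (rule integral_mono_AE)
    show "integrable lborel (\<lambda>\<zeta>. indicat_real \<Omega> \<zeta> *\<^sub>R (ln (cmod (z - \<zeta>)) - ln (cmod (0 - \<zeta>))))"
      using set_integral_diff(1)[OF il il, of z 0] by (simp add: set_integrable_def)
    show "integrable lborel (\<lambda>\<zeta>. indicat_real \<Omega> \<zeta> *\<^sub>R (2 * x) + \<epsilon> * cmod (indicat_real \<Omega> \<zeta> *\<^sub>R (1 / (0 - \<zeta>))))"
      by (rule Bochner_Integration.integrable_add[OF in1 in2])
    show "AE \<zeta> in lborel. indicat_real \<Omega> \<zeta> *\<^sub>R (ln (cmod (z - \<zeta>)) - ln (cmod (0 - \<zeta>))) \<le>
       indicat_real \<Omega> \<zeta> *\<^sub>R (2 * x) + \<epsilon> * cmod (indicat_real \<Omega> \<zeta> *\<^sub>R (1 / (0 - \<zeta>)))"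
      using AE_lborel_singleton[of z] AE_lborel_singleton[of 0]
    proof eventually_elim
      case (elim \<zeta>)
      show ?case
      proof (cases "\<zeta> \<in> \<Omega>")
        case True
        have "cmod \<zeta> \<le> C * \<epsilon>" using sub True by (auto simp: \<epsilon>_def)
        also have "\<dots> \<le> K * \<epsilon>" using K \<epsilon> by (intro mult_right_mono) auto
        also have "\<dots> \<le> cmod z" using z by (simp add: \<epsilon>_def)
        finally have "cmod (z - \<zeta>) \<le> 2 * cmod z" using norm_triangle_ineq4[of z \<zeta>] by linarith
        then have 1: "cmod (z - \<zeta>) / \<epsilon> \<le> 2 * x" using \<epsilon> by (simp add: x_def divide_right_mono)
        have p: "cmod (z - \<zeta>) / \<epsilon> > 0" "\<epsilon> / cmod \<zeta> > 0" using elim \<epsilon> by auto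
        have "ln (cmod (z - \<zeta>)) - ln (cmod \<zeta>) = ln (cmod (z - \<zeta>) / \<epsilon>) + ln (\<epsilon> / cmod \<zeta>)"
          using elim \<epsilon> by (simp add: ln_div)
        also have "\<dots> \<le> 2 * x + \<epsilon> / cmod \<zeta>"
          using 1 ln_le_minus_one[OF p(1)] ln_le_minus_one[OF p(2)] by linarith
        finally show ?thesis using True by (simp add: norm_divide)
      qed simp
    qed
  qed
  also have "\<dots> = (LINT \<zeta>|lborel. indicat_real \<Omega> \<zeta> *\<^sub>R (2 * x)) + (LINT \<zeta>|lborel. \<epsilon> * cmod (indicat_real \<Omega> \<zeta> *\<^sub>R (1 / (0 - \<zeta>))))"
    by (rule Bochner_Integration.integral_add[OF in1 in2])
  also have "(LINT \<zeta>|lborel. indicat_real \<Omega> \<zeta> *\<^sub>R (2 * x)) = pi * \<epsilon>\<^sup>2 * (2 * x)"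
    using t0 \<epsilon> by simp
  also have "(LINT \<zeta>|lborel. \<epsilon> * cmod (indicat_real \<Omega> \<zeta> *\<^sub>R (1 / (0 - \<zeta>)))) = \<epsilon> * (LINT \<zeta>|lborel. cmod (indicat_real \<Omega> \<zeta> *\<^sub>R (1 / (0 - \<zeta>))))"
    by (rule integral_mult_right_zero)
  also have "\<dots> \<le> \<epsilon> * (2 * pi * \<epsilon>)" using i2 \<epsilon> by (intro mult_left_mono) auto
  finally have "u z - u 0 \<le> pi * (\<epsilon>\<^sup>2 * (2 * x + 2))" by (simp add: power2_eq_square algebra_simps)
  then have "2 / pi * (u z - u 0) \<le> 2 / pi * (pi * (\<epsilon>\<^sup>2 * (2 * x + 2)))" by (intro mult_left_mono) auto
  also have "2 / pi * (pi * (\<epsilon>\<^sup>2 * (2 * x + 2))) = \<epsilon>\<^sup>2 * (4 * x + 4)" by (simp add: algebra_simps)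
  finally have 2: "2 / pi * (u z - u 0) \<le> \<epsilon>\<^sup>2 * (4 * x + 4)" .
  have "4 * x + 4 \<le> 8 * x" using x K by linarith
  also have "\<dots> \<le> c0 * x\<^sup>2"
  proof -
    have "8 / c0 \<le> x" using x K by linarith
    then have "8 \<le> c0 * x" using c0 by (simp add: pos_divide_le_eq mult.commute)
    then have "8 * x \<le> (c0 * x) * x" using x K by (intro mult_right_mono) auto
    then show ?thesis by (simp add: power2_eq_square mult_ac)
  qed
  finally have "\<epsilon>\<^sup>2 * (4 * x + 4) \<le> \<epsilon>\<^sup>2 * (c0 * x\<^sup>2)" by (intro mult_left_mono) auto
  also have "\<dots> = c0 * (cmod z)\<^sup>2" unfolding x(2) by (simp add: power_mult_distrib mult_ac)
  finally have "2 / pi * (u z - u 0) \<le> moment_potential d t z" using z(2) 2 by linarith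
  moreover have "moment_potential d t 0 = 0" by (simp add: moment_potential_def)
  ultimately show ?thesis by (simp add: f_def right_diff_distrib)
qed

end

section \<open>Existence of the curve and minimality of the effective potential\<close>

context moment_data
begin

text \<open>Supplies the two conditions of \<open>polynomial_curve_intro\<close>: both sums are at
  most \<open>(\<beta> + (real d + 1)^2 * \<eta>) * r\<close>.\<close>

lemma tame_sums:
  assumes \<eta>: "\<eta> > 0" "(real d + 1)\<^sup>2 * \<eta> < 1 - \<beta>" and r: "r > 0"
    and a: "\<And>j. j \<le> d \<Longrightarrow> cmod (a j) \<le> (if j = 1 then \<beta> + \<eta> else \<eta>) * r"
  shows "(\<Sum>j=0..d. real j * cmod (a j)) < r" "(\<Sum>j=0..d. cmod (a j)) < r"
proof -
  have bound: "cmod (a j) \<le> (if j = 1 then \<beta> * r else 0) + \<eta> * r" if "j \<le> d" for j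
    using a[OF that] by (auto simp: distrib_right split: if_splits)
  have s1: "(\<Sum>j=0..d. if j = 1 then \<beta> * r else 0) \<le> \<beta> * r" using beta r by simp
  have s2: "(\<Sum>j=0..d. x) = (real d + 1) * x" for x :: real by (simp add: add.commute)
  have "(\<Sum>j=0..d. real j * cmod (a j)) \<le> (\<Sum>j=0..d. (if j = 1 then \<beta> * r else 0) + (real d + 1) * (\<eta> * r))"
  proof (rule sum_mono)
    fix j assume j: "j \<in> {0..d}"
    then have "real j * cmod (a j) \<le> real j * ((if j = 1 then \<beta> * r else 0) + \<eta> * r)"
      by (intro mult_left_mono bound) auto
    also have "\<dots> = (if j = 1 then \<beta> * r else 0) + real j * (\<eta> * r)" by (simp add: distrib_left)
    also have "\<dots> \<le> (if j = 1 then \<beta> * r else 0) + (real d + 1) * (\<eta> * r)"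
      using j \<eta> r by (intro add_left_mono mult_right_mono) auto
    finally show "real j * cmod (a j) \<le> (if j = 1 then \<beta> * r else 0) + (real d + 1) * (\<eta> * r)" .
  qed
  also have "\<dots> \<le> \<beta> * r + (real d + 1) * ((real d + 1) * (\<eta> * r))"
    unfolding sum.distrib s2 using s1 by simp
  also have "\<dots> = (\<beta> + (real d + 1)\<^sup>2 * \<eta>) * r" by (simp add: power2_eq_square algebra_simps)
  also have "\<dots> < 1 * r" using \<eta> r by (intro mult_strict_right_mono) auto
  finally show "(\<Sum>j=0..d. real j * cmod (a j)) < r" by simp
  have "(\<Sum>j=0..d. cmod (a j)) \<le> (\<Sum>j=0..d. (if j = 1 then \<beta> * r else 0) + \<eta> * r)"
    by (intro sum_mono bound) auto
  also have "\<dots> \<le> \<beta> * r + (real d + 1) * (\<eta> * r)"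
    unfolding sum.distrib s2 using s1 by simp
  also have "\<dots> \<le> \<beta> * r + (real d + 1)\<^sup>2 * (\<eta> * r)"
    using \<eta> r by (intro add_left_mono mult_right_mono) (auto simp: power2_eq_square)
  also have "\<dots> = (\<beta> + (real d + 1)\<^sup>2 * \<eta>) * r" by (simp add: algebra_simps)
  also have "\<dots> < 1 * r" using \<eta> r by (intro mult_strict_right_mono) auto
  finally show "(\<Sum>j=0..d. cmod (a j)) < r" by simp
qed

lemma curve_exists:
  obtains \<delta> where "\<delta> > 0" "\<And>t0. 0 < t0 \<Longrightarrow> t0 < \<delta> \<Longrightarrow> \<exists>\<gamma>. polynomial_curve_with_moments d t0 t \<gamma>"
proof -
  define \<eta> where "\<eta> = (1 - \<beta>) / (2 * (real d + 1)\<^sup>2)"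
  have \<eta>2: "(real d + 1)\<^sup>2 * \<eta> = (1 - \<beta>) / 2" by (simp add: \<eta>_def)
  have \<eta>: "\<eta> > 0" "(real d + 1)\<^sup>2 * \<eta> < 1 - \<beta>"
    using beta unfolding \<eta>2 by (auto simp: \<eta>_def)
  obtain \<rho> where \<rho>: "\<rho> > 0" "\<And>r a j. 0 < r \<Longrightarrow> r \<le> \<rho> \<Longrightarrow> (\<And>j. j \<le> d \<Longrightarrow> cmod (a j) \<le> \<rho>) \<Longrightarrow>
    solves r a \<Longrightarrow> j \<le> d \<Longrightarrow> cmod (a j) \<le> (if j = 1 then \<beta> + \<eta> else \<eta>) * r"
    using solves_tame[OF \<eta>(1)] by metis
  obtain \<delta> where \<delta>: "\<delta> > 0" "\<And>t0. 0 < t0 \<Longrightarrow> t0 < \<delta> \<Longrightarrow>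
    \<exists>r a. 0 < r \<and> r \<le> \<rho> \<and> (\<forall>j\<le>d. cmod (a j) \<le> \<rho>) \<and> solves r a \<and> curve_area r a = t0"
    using solution_with_area[OF \<rho>(1)] by metis
  show ?thesis
  proof (rule that[OF \<delta>(1)])
    fix t0 :: real assume t0: "0 < t0" "t0 < \<delta>"
    obtain r a where ra: "0 < r" "r \<le> \<rho>" "\<forall>j\<le>d. cmod (a j) \<le> \<rho>" "solves r a" "curve_area r a = t0"
      using \<delta>(2)[OF t0] by blast
    have "cmod (a j) \<le> (if j = 1 then \<beta> + \<eta> else \<eta>) * r" if "j \<le> d" for j
      by (rule \<rho>(2)) (use ra that in auto)
    note S = tame_sums[OF \<eta> ra(1) this]
    have "moment_curve d r a t" by (rule moment_curve_intro[OF ra(1) S ra(4)])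
    then interpret moment_curve d r a t .
    have "measure lborel \<Omega> = pi * t0" using area_eq ra(5) by (simp add: curve_area_def)
    from curve_with_moments[OF S(1) this] show "\<exists>\<gamma>. polynomial_curve_with_moments d t0 t \<gamma>" by blast
  qed
qed

text \<open>\<open>\<delta>\<close> and \<open>C\<close> are fixed before the curve, which is not
  yet known to be unique. Three zones cover the points in question: beyond
  \<open>K * sqrt t0\<close> there is \<open>f_far\<close>, on the closure of
  \<open>\<Omega>\<close> the function \<open>f\<close> is constant, and any other point is
  \<open>h v\<close> with \<open>cmod v\<close> at most \<open>K + 1\<close>, where
  \<open>f_radial\<close> applies.\<close>

lemma effective_potential_min:
  assumes c0: "c0 > 0"
  obtains \<delta> C where "\<delta> > 0" "\<And>t0 r a. 0 < t0 \<Longrightarrow> t0 < \<delta> \<Longrightarrow> moment_curve d r a t \<Longrightarrow>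
    measure lborel (inside (path_image (laurent_map d r a \<circ> circle_point))) = pi * t0 \<Longrightarrow>
    inside (path_image (laurent_map d r a \<circ> circle_point)) \<subseteq> cball 0 (C * sqrt t0) \<and>
    (\<forall>z. c0 * (cmod z)\<^sup>2 \<le> moment_potential d t z \<longrightarrow>
      moment_curve_data.f d t r a 0 \<le> moment_curve_data.f d t r a z)"
proof -
  define C where "C = 4 / (1 - \<beta>)"
  have C: "C > 0" using beta by (simp add: C_def)
  define K where "K = max 1 (max (8 / c0) C)"
  have K: "1 \<le> K" "8 / c0 \<le> K" "C \<le> K" by (auto simp: K_def)
  define S where "S = (\<Sum>j=0..d. real j * (K + 1) ^ (2 * j))"
  have S: "0 \<le> S" unfolding S_def using K by (intro sum_nonneg) auto
  \<comment> \<open>The first term serves \<open>tame_sums\<close> and leaves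
    \<open>1 - (\<beta> + \<eta>)\<close> at least \<open>(1 - \<beta>) / 2\<close>; the second
    makes \<open>5 * (\<eta> * S)\<close> at most the square of that half, as
    \<open>radial_positive\<close> demands for \<open>b = \<beta> + \<eta>\<close>.\<close>
  define \<eta> where "\<eta> = min ((1 - \<beta>) / (2 * (real d + 1)\<^sup>2)) ((1 - \<beta>)\<^sup>2 / (20 * (S + 1)))"
  have \<eta>0: "\<eta> > 0" using beta S by (auto simp: \<eta>_def)
  have d1: "1 \<le> (real d + 1)\<^sup>2" by (simp add: one_le_power)
  have "(real d + 1)\<^sup>2 * \<eta> \<le> (real d + 1)\<^sup>2 * ((1 - \<beta>) / (2 * (real d + 1)\<^sup>2))"
    by (intro mult_left_mono) (auto simp: \<eta>_def)
  also have "\<dots> = (1 - \<beta>) / 2" by simp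
  finally have \<eta>1: "(real d + 1)\<^sup>2 * \<eta> \<le> (1 - \<beta>) / 2" .
  have \<eta>2: "(real d + 1)\<^sup>2 * \<eta> < 1 - \<beta>"
    by (rule le_less_trans[OF \<eta>1]) (use beta in simp)
  have "1 * \<eta> \<le> (real d + 1)\<^sup>2 * \<eta>" using d1 \<eta>0 by (intro mult_right_mono) auto
  then have \<eta>3: "\<eta> \<le> (1 - \<beta>) / 2" using order.trans[OF _ \<eta>1] by simp
  have \<eta>4: "5 * (\<eta> * S) \<le> (1 - (\<beta> + \<eta>))\<^sup>2"
  proof -
    have "\<eta> * S \<le> (1 - \<beta>)\<^sup>2 / (20 * (S + 1)) * (S + 1)"
      using S by (intro mult_mono) (auto simp: \<eta>_def)
    also have "\<dots> = (1 - \<beta>)\<^sup>2 / 20"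
    proof -
      have "x / (20 * T) * T = x / 20" if "T > 0" for x T :: real using that by simp
      from this[of "S + 1"] show ?thesis using S by simp
    qed
    finally have "5 * (\<eta> * S) \<le> ((1 - \<beta>) / 2)\<^sup>2" by (simp add: power_divide)
    also have "\<dots> \<le> (1 - (\<beta> + \<eta>))\<^sup>2" using \<eta>3 beta by (intro power_mono) auto
    finally show ?thesis .
  qed
  obtain \<rho> where \<rho>: "\<rho> > 0" "\<And>r a j. 0 < r \<Longrightarrow> r \<le> \<rho> \<Longrightarrow> (\<And>j. j \<le> d \<Longrightarrow> cmod (a j) \<le> \<rho>) \<Longrightarrow>
    solves r a \<Longrightarrow> j \<le> d \<Longrightarrow> cmod (a j) \<le> (if j = 1 then \<beta> + \<eta> else \<eta>) * r"
    using solves_tame[OF \<eta>0] by metis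
  \<comment> \<open>Bound for \<open>C * sqrt t0\<close>, the radius of \<open>\<Omega>\<close>:
    below \<open>\<rho>\<close> the coefficients are small enough for \<open>solves_tame\<close>,
    below the rest \<open>inside_subset\<close> applies.\<close>
  define m where "m = min \<rho> (min 1 ((1 - \<beta>) / (2 * (\<kappa> + 1))))"
  have m: "m > 0" using \<rho> beta kappa by (auto simp: m_def intro!: divide_pos_pos)
  show ?thesis
  proof (rule that[of "(m / C)\<^sup>2" C])
    show "(m / C)\<^sup>2 > 0" using m C by simp
    fix t0 r a
    assume t0: "0 < t0" "t0 < (m / C)\<^sup>2" and mc: "moment_curve d r a t"
      and ar: "measure lborel (inside (path_image (laurent_map d r a \<circ> circle_point))) = pi * t0"
    interpret moment_curve d r a t by fact
    interpret moment_curve_data d t r a ..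
    have "sqrt t0 < m / C" using t0 m C by (intro real_less_lsqrt) auto
    then have Cm: "C * sqrt t0 < m" using C by (simp add: field_simps)
    have sub: "\<Omega> \<subseteq> cball 0 (C * sqrt t0)"
      using inside_subset[OF ar t0(1)] Cm by (simp add: C_def m_def)
    have small: "r \<le> \<rho>" "\<And>j. j \<le> d \<Longrightarrow> cmod (a j) \<le> \<rho>"
      using coefficients_le[OF sub] Cm by (fastforce simp: m_def)+
    have tame: "cmod (a j) \<le> (if j = 1 then \<beta> + \<eta> else \<eta>) * r" if "j \<le> d" for j
      by (rule \<rho>(2)[OF r_pos small(1) small(2) solves that])
    note sums = tame_sums[OF \<eta>0 \<eta>2 r_pos tame]
    \<comment> \<open>The area formula gives \<open>sqrt t0\<close> at most \<open>r\<close>, so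
      that a point within \<open>K * sqrt t0\<close> has a preimage whose bound no longer depends on
      \<open>t0\<close>.\<close>
    have "t0 = curve_area r a" using ar area by simp
    also have "\<dots> \<le> r\<^sup>2" unfolding curve_area_def by (simp add: sum_nonneg)
    finally have tr: "sqrt t0 \<le> r" using r_pos by (simp add: real_le_lsqrt)
    have "f 0 \<le> f z" if z: "c0 * (cmod z)\<^sup>2 \<le> moment_potential d t z" for z
    proof (cases "K * sqrt t0 \<le> cmod z")
      case True
      then show ?thesis by (rule f_far[OF ar t0(1) sub c0 K _ z])
    next
      case False
      show ?thesis
      proof (cases "z \<in> \<Omega> \<or> z \<in> path_image (h \<circ> circle_point)")
        case True
        then have "z \<in> closure \<Omega>" using closure_subset[of \<Omega>] jordan by (auto simp: frontier_def)
        then show ?thesis using f_closure by simp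
      next
        case out: False
        then obtain v where v: "cmod v > 1" "h v = z" using outside_preimage by blast
        have "r * cmod v - r \<le> cmod z"
          using laurent_map_norm_ge[of v r, where d = d and a = a] v r_pos sums(2) by simp
        also have "\<dots> \<le> K * r"
          using False mult_left_mono[OF tr, of K] K by linarith
        finally have "r * cmod v \<le> r * (K + 1)" by (simp add: algebra_simps)
        then have vK: "cmod v \<le> K + 1" using r_pos by simp
        show ?thesis
        proof (subst v(2)[symmetric], rule f_radial[OF v(1)])
          fix w assume w: "1 \<le> cmod w" "cmod w \<le> cmod v"
          show "0 \<le> Re (w * laurent_deriv d r a w * cnj (h w - h (1 / cnj w)))"
          proof (rule radial_positive[where b = "\<beta> + \<eta>" and \<eta> = \<eta> and K = "K + 1"])
            show "cmod (a j) \<le> \<eta> * r" if "j \<le> d" "j \<noteq> 1" for j using tame[OF that(1)] that(2) by simp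
            show "cmod (a 1) \<le> (\<beta> + \<eta>) * r" if "1 \<le> d" using tame[OF that] by simp
            show "5 * (\<eta> * (\<Sum>j=0..d. real j * (K + 1) ^ (2 * j))) \<le> (1 - (\<beta> + \<eta>))\<^sup>2"
              using \<eta>4 by (simp add: S_def)
          qed (use r_pos beta \<eta>0 \<eta>3 w vK in auto)
        qed
      qed
    qed
    then show "\<Omega> \<subseteq> cball 0 (C * sqrt t0) \<and> (\<forall>z. c0 * (cmod z)\<^sup>2 \<le> moment_potential d t z \<longrightarrow> f 0 \<le> f z)"
      using sub by blast
  qed
qed

end

section \<open>Gaussian superposition of the logarithmic kernel\<close>

lemma nn_integral_swap_borel:
  fixes f :: "'a::second_countable_topology \<Rightarrow> 'b::second_countable_topology \<Rightarrow> ennreal"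
  assumes "sigma_finite_measure M" "sigma_finite_measure N" and s: "sets M = sets borel" "sets N = sets borel"
    and f: "case_prod f \<in> borel_measurable (borel \<Otimes>\<^sub>M borel)"
  shows "(\<integral>\<^sup>+y. (\<integral>\<^sup>+x. f x y \<partial>M) \<partial>N) = (\<integral>\<^sup>+x. (\<integral>\<^sup>+y. f x y \<partial>N) \<partial>M)"
proof -
  interpret pair_sigma_finite M N using assms by (simp add: pair_sigma_finite_def)
  have "case_prod f \<in> borel_measurable (M \<Otimes>\<^sub>M N)"
    using f measurable_cong_sets[OF sets_pair_measure_cong[OF s] refl] by blast
  then show ?thesis by (rule Fubini')
qed

lemma borel_measurable_nn_integral_param:
  fixes f :: "'a::second_countable_topology \<Rightarrow> 'b::second_countable_topology \<Rightarrow> ennreal"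
  assumes "sigma_finite_measure N" "sets N = sets borel"
    and f: "case_prod f \<in> borel_measurable (borel \<Otimes>\<^sub>M borel)"
  shows "(\<lambda>x. \<integral>\<^sup>+y. f x y \<partial>N) \<in> borel_measurable borel"
proof -
  interpret sigma_finite_measure N by fact
  have "case_prod f \<in> borel_measurable (borel \<Otimes>\<^sub>M N)"
    using f measurable_cong_sets[OF sets_pair_measure_cong[OF refl assms(2)] refl] by blast
  then show ?thesis by (rule borel_measurable_nn_integral)
qed

lemma nn_integral_eq_imp_AE_eq:
  assumes [measurable]: "f \<in> borel_measurable M" "g \<in> borel_measurable M"
    and le: "AE x in M. f x \<le> g x" and eq: "(\<integral>\<^sup>+x. g x \<partial>M) \<le> (\<integral>\<^sup>+x. f x \<partial>M)" and fin: "(\<integral>\<^sup>+x. f x \<partial>M) < \<infinity>"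
  shows "AE x in M. f x = g x"
proof -
  have "(\<integral>\<^sup>+x. g x - f x \<partial>M) = (\<integral>\<^sup>+x. g x \<partial>M) - (\<integral>\<^sup>+x. f x \<partial>M)"
    using fin le by (intro nn_integral_diff) auto
  also have "\<dots> = 0" using eq fin by (simp add: diff_eq_0_iff_ennreal le_less_trans)
  finally have "AE x in M. g x - f x = 0" by (subst (asm) nn_integral_0_iff_AE) auto
  moreover have "AE x in M. f x \<noteq> \<infinity>" using fin by (intro nn_integral_PInf_AE) auto
  ultimately show ?thesis
    using le
  proof eventually_elim
    case (elim x)
    then have "g x \<le> f x" by (simp add: ennreal_minus_eq_0 diff_eq_0_iff_ennreal split: if_splits)
    then show ?case using elim by auto
  qed
qed

text \<open>Layer cake again: \<open>exp (- y)\<close> is the integral of \<open>exp (- t)\<close>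
  over \<open>t\<close> from \<open>y\<close> on, and the level sets are discs of area
  \<open>pi * t / s\<close>. What remains is the Gamma integral of \<open>t * exp (- t)\<close>,
  which is 1.\<close>

lemma nn_integral_gaussian:
  assumes "s > 0"
  shows "(\<integral>\<^sup>+v. ennreal (exp (- s * (cmod (z - v))\<^sup>2)) \<partial>lborel) = ennreal (pi / s)"
proof -
  have e: "ennreal (exp (- y)) = (\<integral>\<^sup>+t. ennreal (exp (- t)) * indicator {y..} t \<partial>lborel)" for y :: real
  proof -
    have "(\<integral>\<^sup>+t. ennreal (exp (- t)) * indicator {y..} t \<partial>lborel) = ennreal (0 - (- exp (- y)))"
    proof (rule nn_integral_FTC_atLeast)
      show "((\<lambda>t. - exp (- t)) \<longlongrightarrow> (0::real)) at_top" by real_asymp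
    qed (auto intro!: derivative_eq_intros)
    then show ?thesis by simp
  qed
  have "(\<integral>\<^sup>+v. ennreal (exp (- s * (cmod (z - v))\<^sup>2)) \<partial>lborel) =
     (\<integral>\<^sup>+v. (\<integral>\<^sup>+t. ennreal (exp (- t)) * indicator {(v, t). s * (cmod (z - v))\<^sup>2 \<le> t} (v, t) \<partial>lborel) \<partial>lborel)"
  proof (rule nn_integral_cong)
    fix v
    have "- s * (cmod (z - v))\<^sup>2 = - (s * (cmod (z - v))\<^sup>2)" by simp
    then have "ennreal (exp (- s * (cmod (z - v))\<^sup>2)) =
        (\<integral>\<^sup>+t. ennreal (exp (- t)) * indicator {s * (cmod (z - v))\<^sup>2..} t \<partial>lborel)"
      by (simp only: e[of "s * (cmod (z - v))\<^sup>2"])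
    also have "\<dots> = (\<integral>\<^sup>+t. ennreal (exp (- t)) * indicator {(v, t). s * (cmod (z - v))\<^sup>2 \<le> t} (v, t) \<partial>lborel)"
      by (rule nn_integral_cong) (simp add: indicator_def)
    finally show "ennreal (exp (- s * (cmod (z - v))\<^sup>2)) =
        (\<integral>\<^sup>+t. ennreal (exp (- t)) * indicator {(v, t). s * (cmod (z - v))\<^sup>2 \<le> t} (v, t) \<partial>lborel)" .
  qed
  also have "\<dots> = (\<integral>\<^sup>+t. (\<integral>\<^sup>+v. ennreal (exp (- t)) * indicator {(v, t). s * (cmod (z - v))\<^sup>2 \<le> t} (v, t) \<partial>lborel) \<partial>lborel)"
    by (rule lborel_pair.Fubini'[symmetric]) measurable
  also have "\<dots> = (\<integral>\<^sup>+t. ennreal (pi / s) * (ennreal (t ^ 1 * exp (- t)) * indicator {0..} t) \<partial>lborel)"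
  proof (intro nn_integral_cong)
    fix t :: real
    show "(\<integral>\<^sup>+v. ennreal (exp (- t)) * indicator {(v, t). s * (cmod (z - v))\<^sup>2 \<le> t} (v, t) \<partial>lborel) =
       ennreal (pi / s) * (ennreal (t ^ 1 * exp (- t)) * indicator {0..} t)"
    proof (cases "t \<ge> 0")
      case True
      have "s * (cmod (z - v))\<^sup>2 \<le> t \<longleftrightarrow> v \<in> cball z (sqrt (t / s))" for v
      proof -
        have "s * (cmod (z - v))\<^sup>2 \<le> t \<longleftrightarrow> (cmod (z - v))\<^sup>2 \<le> t / s" using assms by (simp add: pos_le_divide_eq mult.commute)
        also have "\<dots> \<longleftrightarrow> cmod (z - v) \<le> sqrt (t / s)"
        proof
          assume "cmod (z - v) \<le> sqrt (t / s)"
          then have "(cmod (z - v))\<^sup>2 \<le> (sqrt (t / s))\<^sup>2" by (rule power_mono) simp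
          then show "(cmod (z - v))\<^sup>2 \<le> t / s" using True assms by simp
        qed (rule real_le_rsqrt)
        finally show ?thesis by (simp add: dist_norm)
      qed
      then have "(\<integral>\<^sup>+v. ennreal (exp (- t)) * indicator {(v, t). s * (cmod (z - v))\<^sup>2 \<le> t} (v, t) \<partial>lborel) =
        (\<integral>\<^sup>+v. ennreal (exp (- t)) * indicator (cball z (sqrt (t / s))) v \<partial>lborel)"
        by (intro nn_integral_cong) (simp add: indicator_def)
      also have "\<dots> = ennreal (exp (- t)) * ennreal (pi * (t / s))"
        using assms True by (subst nn_integral_cmult_indicator) (auto simp: emeasure_cball unit_ball_vol_2)
      finally show ?thesis using True assms by (simp add: ennreal_mult'[symmetric] mult_ac)
    next
      case False
      have "\<not> s * (cmod (z - v))\<^sup>2 \<le> t" for v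
        using False assms by (smt (verit) mult_nonneg_nonneg zero_le_power2)
      then show ?thesis using False by simp
    qed
  qed
  also have "\<dots> = ennreal (pi / s) * (\<integral>\<^sup>+t. ennreal (t ^ 1 * exp (- t)) * indicator {0..} t \<partial>lborel)"
    by (rule nn_integral_cmult) auto
  also have "(\<integral>\<^sup>+t. ennreal (t ^ 1 * exp (- t)) * indicator {0..} t \<partial>lborel) = 1"
    by (subst nn_intergal_power_times_exp_Ici) simp
  finally show ?thesis by simp
qed

text \<open>Frullani's integral: the logarithm is a superposition of Gaussians.\<close>

lemma nn_integral_frullani:
  assumes "0 < x" "x \<le> M"
  shows "(\<integral>\<^sup>+s. ennreal ((exp (- s * x\<^sup>2) - exp (- s * M\<^sup>2)) / s) * indicator {0<..} s \<partial>lborel) =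
    ennreal (2 * ln (M / x))"
proof -
  have xM: "x\<^sup>2 \<le> M\<^sup>2" "0 < x\<^sup>2" using assms by (auto intro: power_mono)
  \<comment> \<open>The quotient is the integral of \<open>exp (- s * y)\<close> over squared
    distances \<open>y\<close>; integrating over \<open>s\<close> first leaves
    \<open>1 / y\<close>.\<close>
  have 1: "ennreal ((exp (- s * x\<^sup>2) - exp (- s * M\<^sup>2)) / s) * indicator {0<..} s =
     (\<integral>\<^sup>+y. ennreal (exp (- s * y)) * indicator {x\<^sup>2..M\<^sup>2} y * indicator {0<..} s \<partial>lborel)" for s :: real
  proof (cases "s > 0")
    case True
    have "(\<integral>\<^sup>+y. ennreal (exp (- s * y)) * indicator {x\<^sup>2..M\<^sup>2} y \<partial>lborel) =
        ennreal (- exp (- s * M\<^sup>2) / s - (- exp (- s * x\<^sup>2) / s))"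
      using True xM(1) by (intro nn_integral_FTC_Icc) (auto intro!: derivative_eq_intros)
    also have "- exp (- s * M\<^sup>2) / s - (- exp (- s * x\<^sup>2) / s) = (exp (- s * x\<^sup>2) - exp (- s * M\<^sup>2)) / s"
      by (simp add: diff_divide_distrib)
    finally show ?thesis using True by simp
  qed simp
  have "(\<integral>\<^sup>+s. ennreal ((exp (- s * x\<^sup>2) - exp (- s * M\<^sup>2)) / s) * indicator {0<..} s \<partial>lborel) =
    (\<integral>\<^sup>+y. (\<integral>\<^sup>+s. ennreal (exp (- s * y)) * indicator {x\<^sup>2..M\<^sup>2} y * indicator {0<..} s \<partial>lborel) \<partial>lborel)"
    unfolding 1 by (rule lborel_pair.Fubini') measurable
  also have "\<dots> = (\<integral>\<^sup>+y. ennreal (1 / y) * indicator {x\<^sup>2..M\<^sup>2} y \<partial>lborel)"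
  proof (intro nn_integral_cong)
    fix y :: real
    show "(\<integral>\<^sup>+s. ennreal (exp (- s * y)) * indicator {x\<^sup>2..M\<^sup>2} y * indicator {0<..} s \<partial>lborel) =
      ennreal (1 / y) * indicator {x\<^sup>2..M\<^sup>2} y"
    proof (cases "y \<in> {x\<^sup>2..M\<^sup>2}")
      case True
      then have y: "y > 0" using xM(2) by (simp only: atLeastAtMost_iff) linarith
      have "(\<integral>\<^sup>+s. ennreal (exp (- s * y)) * indicator {x\<^sup>2..M\<^sup>2} y * indicator {0<..} s \<partial>lborel) =
         (\<integral>\<^sup>+s. ennreal (exp (- s * y)) * indicator {0..} s \<partial>lborel)"
        using True by (intro nn_integral_cong_AE)
          (use AE_lborel_singleton[of "0::real"] in \<open>auto elim!: eventually_mono simp: indicator_def\<close>)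
      also have "\<dots> = ennreal (0 - (- exp (- 0 * y) / y))"
      proof (rule nn_integral_FTC_atLeast)
        show "((\<lambda>s. - exp (- s * y) / y) \<longlongrightarrow> 0) at_top" using y by real_asymp
      qed (use y in \<open>auto intro!: derivative_eq_intros\<close>)
      finally show ?thesis using True by simp
    qed simp
  qed
  also have "\<dots> = ennreal (ln (M\<^sup>2) - ln (x\<^sup>2))"
  proof (rule nn_integral_FTC_Icc)
    fix y assume "y \<in> {x\<^sup>2..M\<^sup>2}"
    then have "y > 0" using xM(2) by (simp only: atLeastAtMost_iff) linarith
    then show "(ln has_real_derivative 1 / y) (at y)" "0 \<le> 1 / y"
      by (auto intro!: derivative_eq_intros)
  qed (use xM in auto)
  also have "ln (M\<^sup>2) - ln (x\<^sup>2) = 2 * ln (M / x)"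
    using assms by (simp add: ln_div ln_realpow)
  finally show ?thesis .
qed

section \<open>Positive definiteness of the Gaussian kernel\<close>

definition borel_prob :: "complex measure \<Rightarrow> bool"
  where "borel_prob \<mu> \<longleftrightarrow> prob_space \<mu> \<and> sets \<mu> = sets borel"

lemma borel_prob_sigma_finite: "borel_prob \<mu> \<Longrightarrow> sigma_finite_measure \<mu>"
  unfolding borel_prob_def by (metis prob_space_imp_sigma_finite)

lemma borel_prob_space: "borel_prob \<mu> \<Longrightarrow> emeasure \<mu> (space \<mu>) = 1"
  unfolding borel_prob_def by (simp add: prob_space.emeasure_space_1)

lemma borel_prob_sets: "borel_prob \<mu> \<Longrightarrow> sets \<mu> = sets borel"
  unfolding borel_prob_def by simp

definition gauss_mean :: "real \<Rightarrow> complex measure \<Rightarrow> complex \<Rightarrow> ennreal"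
  where "gauss_mean s \<mu> u = (\<integral>\<^sup>+z. ennreal (exp (- s * (cmod (z - u))\<^sup>2)) \<partial>\<mu>)"

definition gauss_energy :: "real \<Rightarrow> complex measure \<Rightarrow> complex measure \<Rightarrow> ennreal"
  where "gauss_energy s \<mu> \<nu> = (\<integral>\<^sup>+z. gauss_mean s \<nu> z \<partial>\<mu>)"

lemma gauss_mean_le_1:
  assumes "borel_prob \<mu>" "s \<ge> 0"
  shows "gauss_mean s \<mu> u \<le> 1"
proof -
  have "gauss_mean s \<mu> u \<le> (\<integral>\<^sup>+z. 1 \<partial>\<mu>)"
    unfolding gauss_mean_def using assms(2) by (intro nn_integral_mono) simp
  then show ?thesis using borel_prob_space[OF assms(1)] by simp
qed

lemma gauss_mean_measurable:
  assumes "borel_prob \<mu>"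
  shows "gauss_mean s \<mu> \<in> borel_measurable borel"
  unfolding gauss_mean_def
  by (rule borel_measurable_nn_integral_param[OF borel_prob_sigma_finite[OF assms] borel_prob_sets[OF assms]]) measurable

lemma gauss_energy_le_1:
  assumes "borel_prob \<mu>" "borel_prob \<nu>" "s \<ge> 0"
  shows "gauss_energy s \<mu> \<nu> \<le> 1"
proof -
  have "gauss_energy s \<mu> \<nu> \<le> (\<integral>\<^sup>+z. 1 \<partial>\<mu>)"
    unfolding gauss_energy_def by (intro nn_integral_mono gauss_mean_le_1 assms)
  then show ?thesis using borel_prob_space[OF assms(1)] by simp
qed

text \<open>Parallelogram identity: the exponents at parameter \<open>2 * s\<close> centred at
  \<open>z\<close> and \<open>\<zeta>\<close> add up to \<open>s\<close> times the squared distance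
  of \<open>z\<close> and \<open>\<zeta>\<close> plus \<open>4 * s\<close> times the squared
  distance of \<open>u\<close> from their midpoint. Integrating over \<open>u\<close> leaves
  \<open>pi / (4 * s)\<close>, so the Gaussian kernel is a convolution square and energies become
  integrals of products of means.\<close>

lemma gauss_energy_factor:
  assumes \<mu>: "borel_prob \<mu>" and \<nu>: "borel_prob \<nu>" and s: "s > 0"
  shows "(\<integral>\<^sup>+u. gauss_mean (2 * s) \<mu> u * gauss_mean (2 * s) \<nu> u \<partial>lborel) = ennreal (pi / (4 * s)) * gauss_energy s \<mu> \<nu>"
proof -
  let ?e = "\<lambda>z u. ennreal (exp (- (2 * s) * (cmod (z - u))\<^sup>2))"
  note sm = borel_prob_sigma_finite[OF \<mu>] borel_prob_sets[OF \<mu>] and sn = borel_prob_sigma_finite[OF \<nu>] borel_prob_sets[OF \<nu>]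
  have ls: "sigma_finite_measure (lborel :: complex measure)" by (rule sigma_finite_lborel)
  have mm: "f \<in> borel_measurable borel \<Longrightarrow> f \<in> borel_measurable \<mu>" "f \<in> borel_measurable borel \<Longrightarrow> f \<in> borel_measurable \<nu>"
    for f :: "complex \<Rightarrow> ennreal"
    using measurable_cong_sets[OF sm(2) refl] measurable_cong_sets[OF sn(2) refl] by blast+
  have kernel: "(\<integral>\<^sup>+u. ?e z u * ?e \<zeta> u \<partial>lborel) = ennreal (exp (- s * (cmod (\<zeta> - z))\<^sup>2)) * ennreal (pi / (4 * s))" for z \<zeta>
  proof -
    have "?e z u * ?e \<zeta> u = ennreal (exp (- s * (cmod (\<zeta> - z))\<^sup>2)) * ennreal (exp (- (4 * s) * (cmod ((z + \<zeta>) / 2 - u))\<^sup>2))" for u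
    proof -
      have "2 * ((cmod (z - u))\<^sup>2 + (cmod (\<zeta> - u))\<^sup>2) = (cmod (\<zeta> - z))\<^sup>2 + 4 * (cmod ((z + \<zeta>) / 2 - u))\<^sup>2"
        unfolding cmod_power2 by (simp add: power2_eq_square field_simps)
      then have "s * (2 * ((cmod (z - u))\<^sup>2 + (cmod (\<zeta> - u))\<^sup>2)) = s * ((cmod (\<zeta> - z))\<^sup>2 + 4 * (cmod ((z + \<zeta>) / 2 - u))\<^sup>2)"
        by simp
      then have "- (2 * s) * (cmod (z - u))\<^sup>2 + - (2 * s) * (cmod (\<zeta> - u))\<^sup>2 =
         - s * (cmod (\<zeta> - z))\<^sup>2 + - (4 * s) * (cmod ((z + \<zeta>) / 2 - u))\<^sup>2" by (simp add: algebra_simps)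
      then show ?thesis by (simp add: ennreal_mult'[symmetric] exp_add[symmetric])
    qed
    then have "(\<integral>\<^sup>+u. ?e z u * ?e \<zeta> u \<partial>lborel) =
      (\<integral>\<^sup>+u. ennreal (exp (- s * (cmod (\<zeta> - z))\<^sup>2)) * ennreal (exp (- (4 * s) * (cmod ((z + \<zeta>) / 2 - u))\<^sup>2)) \<partial>lborel)" by simp
    also have "\<dots> = ennreal (exp (- s * (cmod (\<zeta> - z))\<^sup>2)) * (\<integral>\<^sup>+u. ennreal (exp (- (4 * s) * (cmod ((z + \<zeta>) / 2 - u))\<^sup>2)) \<partial>lborel)"
      by (rule nn_integral_cmult) measurable
    also have "(\<integral>\<^sup>+u. ennreal (exp (- (4 * s) * (cmod ((z + \<zeta>) / 2 - u))\<^sup>2)) \<partial>lborel) = ennreal (pi / (4 * s))"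
      by (rule nn_integral_gaussian) (use s in simp)
    finally show ?thesis .
  qed
  have "(\<integral>\<^sup>+u. gauss_mean (2 * s) \<mu> u * gauss_mean (2 * s) \<nu> u \<partial>lborel) =
     (\<integral>\<^sup>+u. (\<integral>\<^sup>+z. ?e z u * gauss_mean (2 * s) \<nu> u \<partial>\<mu>) \<partial>lborel)"
    unfolding gauss_mean_def[of _ \<mu>] by (intro nn_integral_cong nn_integral_multc[symmetric] mm) measurable
  also have "\<dots> = (\<integral>\<^sup>+z. (\<integral>\<^sup>+u. ?e z u * gauss_mean (2 * s) \<nu> u \<partial>lborel) \<partial>\<mu>)"
  proof (rule nn_integral_swap_borel[OF sm(1) ls sm(2) sets_lborel])
    note [measurable] = gauss_mean_measurable[OF \<nu>]
    show "(\<lambda>(z, u). ?e z u * gauss_mean (2 * s) \<nu> u) \<in> borel_measurable (borel \<Otimes>\<^sub>M borel)" by measurable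
  qed
  also have "\<dots> = (\<integral>\<^sup>+z. (\<integral>\<^sup>+u. (\<integral>\<^sup>+\<zeta>. ?e z u * ?e \<zeta> u \<partial>\<nu>) \<partial>lborel) \<partial>\<mu>)"
    unfolding gauss_mean_def by (intro nn_integral_cong nn_integral_cmult[symmetric] mm) measurable
  also have "\<dots> = (\<integral>\<^sup>+z. (\<integral>\<^sup>+\<zeta>. (\<integral>\<^sup>+u. ?e z u * ?e \<zeta> u \<partial>lborel) \<partial>\<nu>) \<partial>\<mu>)"
    by (intro nn_integral_cong nn_integral_swap_borel[OF sn(1) ls sn(2) sets_lborel]) measurable
  also have "\<dots> = (\<integral>\<^sup>+z. (\<integral>\<^sup>+\<zeta>. ennreal (exp (- s * (cmod (\<zeta> - z))\<^sup>2)) * ennreal (pi / (4 * s)) \<partial>\<nu>) \<partial>\<mu>)"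
    by (simp only: kernel)
  also have "\<dots> = (\<integral>\<^sup>+z. gauss_mean s \<nu> z * ennreal (pi / (4 * s)) \<partial>\<mu>)"
    unfolding gauss_mean_def by (intro nn_integral_cong nn_integral_multc mm) measurable
  also have "\<dots> = gauss_energy s \<mu> \<nu> * ennreal (pi / (4 * s))"
    unfolding gauss_energy_def by (intro nn_integral_multc mm gauss_mean_measurable \<nu>)
  finally show ?thesis by (simp add: mult.commute)
qed

lemma ennreal_two_mult_le_squares:
  fixes x y :: ennreal
  assumes "x < \<infinity>" "y < \<infinity>"
  shows "2 * (x * y) \<le> x * x + y * y" and "x * x + y * y \<le> 2 * (x * y) \<Longrightarrow> x = y"
proof -
  obtain a b where ab: "x = ennreal a" "y = ennreal b" "a \<ge> 0" "b \<ge> 0"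
    using assms by (metis ennreal_cases less_irrefl infinity_ennreal_def)
  have e: "2 * (x * y) = ennreal (2 * (a * b))" "x * x + y * y = ennreal (a * a + b * b)"
    using ab by (simp_all add: ennreal_mult'[symmetric] ennreal_plus[symmetric] ennreal_numeral[symmetric] del: ennreal_plus ennreal_numeral)
  have sq: "a * a + b * b - 2 * (a * b) = (a - b)\<^sup>2" by (simp add: power2_eq_square algebra_simps)
  show "2 * (x * y) \<le> x * x + y * y"
    unfolding e using sq zero_le_power2[of "a - b"] by (intro ennreal_leI) linarith
  assume "x * x + y * y \<le> 2 * (x * y)"
  then have "a * a + b * b \<le> 2 * (a * b)" unfolding e using ab by (simp add: ennreal_le_iff del: ennreal_plus)
  then have "(a - b)\<^sup>2 \<le> 0" using sq by linarith
  then show "x = y" using ab by simp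
qed

text \<open>The inequality 2 x y <= x^2 + y^2 for the two means at parameter \<open>2 * s\<close>,
  integrated. It expresses that the signed measure mu - nu has non-negative energy, but additively,
  so that it carries over to possibly infinite logarithmic energies.\<close>

lemma gauss_energy_convex:
  assumes \<mu>: "borel_prob \<mu>" and \<nu>: "borel_prob \<nu>" and s: "s > 0"
  shows "2 * gauss_energy s \<mu> \<nu> \<le> gauss_energy s \<mu> \<mu> + gauss_energy s \<nu> \<nu>"
    and "gauss_energy s \<mu> \<mu> + gauss_energy s \<nu> \<nu> \<le> 2 * gauss_energy s \<mu> \<nu> \<Longrightarrow>
      AE u in lborel. gauss_mean (2 * s) \<mu> u = gauss_mean (2 * s) \<nu> u"
proof -
  let ?P = "gauss_mean (2 * s) \<mu>" and ?R = "gauss_mean (2 * s) \<nu>"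
  let ?c = "ennreal (pi / (4 * s))"
  note [measurable] = gauss_mean_measurable[OF \<nu>] gauss_mean_measurable[OF \<mu>]
  have fin: "?P u < \<infinity>" "?R u < \<infinity>" for u
    using gauss_mean_le_1[OF \<mu>, of "2 * s" u] gauss_mean_le_1[OF \<nu>, of "2 * s" u] s
    by (auto intro: le_less_trans)
  have c: "0 < ?c" "?c < \<infinity>" using s by auto
  have l: "(\<integral>\<^sup>+u. 2 * (?P u * ?R u) \<partial>lborel) = ?c * (2 * gauss_energy s \<mu> \<nu>)"
  proof -
    have "(\<integral>\<^sup>+u. 2 * (?P u * ?R u) \<partial>lborel) = 2 * (\<integral>\<^sup>+u. ?P u * ?R u \<partial>lborel)"
      by (rule nn_integral_cmult) measurable
    then show ?thesis unfolding gauss_energy_factor[OF \<mu> \<nu> s] by (simp only: mult.left_commute)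
  qed
  have r: "(\<integral>\<^sup>+u. ?P u * ?P u + ?R u * ?R u \<partial>lborel) = ?c * (gauss_energy s \<mu> \<mu> + gauss_energy s \<nu> \<nu>)"
    by (subst nn_integral_add) (auto simp: gauss_energy_factor[OF \<mu> \<mu> s] gauss_energy_factor[OF \<nu> \<nu> s] distrib_left)
  have "?c * (2 * gauss_energy s \<mu> \<nu>) \<le> ?c * (gauss_energy s \<mu> \<mu> + gauss_energy s \<nu> \<nu>)"
    unfolding l[symmetric] r[symmetric] by (intro nn_integral_mono ennreal_two_mult_le_squares fin)
  then show "2 * gauss_energy s \<mu> \<nu> \<le> gauss_energy s \<mu> \<mu> + gauss_energy s \<nu> \<nu>"
    using c by (subst (asm) ennreal_mult_le_mult_iff) auto
  assume le: "gauss_energy s \<mu> \<mu> + gauss_energy s \<nu> \<nu> \<le> 2 * gauss_energy s \<mu> \<nu>"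
  have "AE u in lborel. 2 * (?P u * ?R u) = ?P u * ?P u + ?R u * ?R u"
  proof (rule nn_integral_eq_imp_AE_eq)
    show "AE u in lborel. 2 * (?P u * ?R u) \<le> ?P u * ?P u + ?R u * ?R u"
      by (intro AE_I2 ennreal_two_mult_le_squares fin)
    show "(\<integral>\<^sup>+u. ?P u * ?P u + ?R u * ?R u \<partial>lborel) \<le> (\<integral>\<^sup>+u. 2 * (?P u * ?R u) \<partial>lborel)"
      unfolding l r using le by (rule mult_left_mono) simp
    have "gauss_energy s \<mu> \<nu> < \<infinity>" using gauss_energy_le_1[OF \<mu> \<nu>, of s] s by (auto intro: le_less_trans)
    then show "(\<integral>\<^sup>+u. 2 * (?P u * ?R u) \<partial>lborel) < \<infinity>"
      unfolding l using c by (simp add: ennreal_mult_less_top)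
  qed auto
  then show "AE u in lborel. ?P u = ?R u"
    by eventually_elim (rule ennreal_two_mult_le_squares(2)[OF fin], simp)
qed

text \<open>Gaussians of parameter \<open>s n\<close> form an approximate identity. The substitution
  \<open>u = z + v / sqrt (s n)\<close>, with Jacobian \<open>1 / s n\<close> in two real
  dimensions, turns them into a fixed probability density and moves the limit into
  \<open>\<psi>\<close>.\<close>

lemma gauss_average_tendsto:
  fixes \<psi> :: "complex \<Rightarrow> real"
  assumes c: "continuous_on UNIV \<psi>" and b: "\<And>u. 0 \<le> \<psi> u" "\<And>u. \<psi> u \<le> 1"
    and s: "\<And>n. s n > real n"
  shows "(\<lambda>n. \<integral>\<^sup>+u. ennreal (\<psi> u) * (ennreal (s n / pi) * ennreal (exp (- s n * (cmod (z - u))\<^sup>2))) \<partial>lborel) \<longlonglongrightarrow> ennreal (\<psi> z)"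
proof -
  have [measurable]: "\<psi> \<in> borel_measurable borel" by (rule borel_measurable_continuous_onI[OF c])
  have s0: "s n > 0" for n using s[of n] by (smt (verit) of_nat_0_le_iff)
  let ?c = "\<lambda>n. 1 / sqrt (s n)"
  let ?g = "\<lambda>v. ennreal (1 / pi * exp (- (cmod v)\<^sup>2))"
  have scale: "(\<integral>\<^sup>+u. ennreal (\<psi> u) * (ennreal (s n / pi) * ennreal (exp (- s n * (cmod (z - u))\<^sup>2))) \<partial>lborel) =
     (\<integral>\<^sup>+v. ennreal (\<psi> (z + ?c n *\<^sub>R v)) * ?g v \<partial>lborel)" for n
  proof -
    have c0: "?c n \<noteq> 0" using s0[of n] by simp
    have "(\<integral>\<^sup>+u. ennreal (\<psi> u) * (ennreal (s n / pi) * ennreal (exp (- s n * (cmod (z - u))\<^sup>2))) \<partial>lborel) =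
       (\<integral>\<^sup>+v. ennreal (\<bar>?c n\<bar> ^ DIM(complex)) * (ennreal (\<psi> (z + ?c n *\<^sub>R v)) *
          (ennreal (s n / pi) * ennreal (exp (- s n * (cmod (z - (z + ?c n *\<^sub>R v)))\<^sup>2)))) \<partial>lborel)"
      by (subst lborel_affine[OF c0, of z]) (simp add: nn_integral_density nn_integral_distr)
    also have "\<dots> = (\<integral>\<^sup>+v. ennreal (\<psi> (z + ?c n *\<^sub>R v)) * ?g v \<partial>lborel)"
    proof (rule nn_integral_cong)
      fix v
      have 1: "(cmod (z - (z + ?c n *\<^sub>R v)))\<^sup>2 = (cmod v)\<^sup>2 / s n"
        using s0[of n] by (simp add: power_divide power_mult_distrib)
      have 2: "\<bar>?c n\<bar> ^ DIM(complex) = 1 / s n" using s0[of n] by (simp add: power_divide abs_of_pos)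
      have "ennreal (1 / s n) * (ennreal (\<psi> (z + ?c n *\<^sub>R v)) * (ennreal (s n / pi) * ennreal (exp (- (cmod v)\<^sup>2)))) =
        ennreal (\<psi> (z + ?c n *\<^sub>R v)) * (ennreal (1 / s n) * ennreal (s n / pi) * ennreal (exp (- (cmod v)\<^sup>2)))"
        by (simp only: mult_ac)
      also have "ennreal (1 / s n) * ennreal (s n / pi) * ennreal (exp (- (cmod v)\<^sup>2)) = ?g v"
        using s0[of n] by (simp add: ennreal_mult'[symmetric])
      finally show "ennreal (\<bar>?c n\<bar> ^ DIM(complex)) * (ennreal (\<psi> (z + ?c n *\<^sub>R v)) *
          (ennreal (s n / pi) * ennreal (exp (- s n * (cmod (z - (z + ?c n *\<^sub>R v)))\<^sup>2)))) =
        ennreal (\<psi> (z + ?c n *\<^sub>R v)) * ?g v"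
        unfolding 1 2 using s0[of n] by simp
    qed
    finally show ?thesis .
  qed
  have g1: "(\<integral>\<^sup>+v. ?g v \<partial>lborel) = 1"
  proof -
    have "(\<integral>\<^sup>+v. ?g v \<partial>lborel) = (\<integral>\<^sup>+v. ennreal (1 / pi) * ennreal (exp (- 1 * (cmod (0 - v))\<^sup>2)) \<partial>lborel)"
      by (intro nn_integral_cong) (simp add: ennreal_mult'[symmetric])
    also have "\<dots> = ennreal (1 / pi) * ennreal (pi / 1)"
      by (subst nn_integral_cmult) (auto simp only: nn_integral_gaussian zero_less_one, measurable)
    finally show ?thesis by (simp add: ennreal_mult'[symmetric])
  qed
  have c0: "?c \<longlonglongrightarrow> 0"
  proof -
    have "filterlim s at_top sequentially"
      by (rule filterlim_at_top_mono[OF filterlim_real_sequentially]) (use s in \<open>auto intro!: always_eventually less_imp_le\<close>)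
    then have "filterlim (\<lambda>n. sqrt (s n)) at_top sequentially"
      by (rule filterlim_compose[OF sqrt_at_top])
    then show ?thesis by (rule tendsto_divide_0[OF tendsto_const filterlim_at_top_imp_at_infinity])
  qed
  have "(\<lambda>n. \<integral>\<^sup>+v. ennreal (\<psi> (z + ?c n *\<^sub>R v)) * ?g v \<partial>lborel) \<longlonglongrightarrow> (\<integral>\<^sup>+v. ennreal (\<psi> z) * ?g v \<partial>lborel)"
  proof (rule nn_integral_dominated_convergence[where w = ?g])
    show "AE v in lborel. ennreal (\<psi> (z + ?c n *\<^sub>R v)) * ?g v \<le> ?g v" for n
    proof (rule AE_I2)
      fix v
      have "ennreal (\<psi> (z + ?c n *\<^sub>R v)) * ?g v \<le> 1 * ?g v" using b by (intro mult_right_mono) auto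
      then show "ennreal (\<psi> (z + ?c n *\<^sub>R v)) * ?g v \<le> ?g v" by simp
    qed
    show "AE v in lborel. (\<lambda>n. ennreal (\<psi> (z + ?c n *\<^sub>R v)) * ?g v) \<longlonglongrightarrow> ennreal (\<psi> z) * ?g v"
    proof (rule AE_I2)
      fix v
      have "(\<lambda>n. z + ?c n *\<^sub>R v) \<longlonglongrightarrow> z + 0 *\<^sub>R v" by (intro tendsto_intros c0)
      then have "(\<lambda>n. \<psi> (z + ?c n *\<^sub>R v)) \<longlonglongrightarrow> \<psi> z"
        using c by (intro continuous_on_tendsto_compose[OF c]) auto
      then have "(\<lambda>n. \<psi> (z + ?c n *\<^sub>R v) * (1 / pi * exp (- (cmod v)\<^sup>2))) \<longlonglongrightarrow> \<psi> z * (1 / pi * exp (- (cmod v)\<^sup>2))"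
        by (intro tendsto_intros)
      moreover have "ennreal (\<psi> y) * ?g v = ennreal (\<psi> y * (1 / pi * exp (- (cmod v)\<^sup>2)))" for y
        by (rule ennreal_mult[OF b(1), symmetric]) simp
      ultimately show "(\<lambda>n. ennreal (\<psi> (z + ?c n *\<^sub>R v)) * ?g v) \<longlonglongrightarrow> ennreal (\<psi> z) * ?g v"
        by (simp only: tendsto_ennrealI)
    qed
    show "(\<integral>\<^sup>+v. ?g v \<partial>lborel) < \<infinity>" unfolding g1 by simp
  qed measurable
  also have "(\<integral>\<^sup>+v. ennreal (\<psi> z) * ?g v \<partial>lborel) = ennreal (\<psi> z)"
    by (subst nn_integral_cmult) (measurable, simp only: g1 mult_1_right)
  finally show ?thesis unfolding scale .
qed

text \<open>By Fubini, integrating the smoothed \<open>\<psi>\<close> against a measure only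
  involves the Gaussian means of that measure. Agreement along parameters tending to infinity
  suffices, since the smoothing then disappears in the limit.\<close>

lemma gauss_mean_determines_integral:
  fixes \<psi> :: "complex \<Rightarrow> real"
  assumes \<mu>: "borel_prob \<mu>" and \<nu>: "borel_prob \<nu>"
    and eq: "\<And>n::nat. \<exists>s>real n. AE u in lborel. gauss_mean s \<mu> u = gauss_mean s \<nu> u"
    and c: "continuous_on UNIV \<psi>" and b: "\<And>u. 0 \<le> \<psi> u" "\<And>u. \<psi> u \<le> 1"
  shows "(\<integral>\<^sup>+z. ennreal (\<psi> z) \<partial>\<mu>) = (\<integral>\<^sup>+z. ennreal (\<psi> z) \<partial>\<nu>)"
proof -
  have [measurable]: "\<psi> \<in> borel_measurable borel" by (rule borel_measurable_continuous_onI[OF c])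
  obtain s where s: "\<And>n::nat. s n > real n" "\<And>n. AE u in lborel. gauss_mean (s n) \<mu> u = gauss_mean (s n) \<nu> u"
    using eq by metis
  have s0: "s n > 0" for n using s(1)[of n] by (smt (verit) of_nat_0_le_iff)
  let ?k = "\<lambda>n z u. ennreal (\<psi> u) * (ennreal (s n / pi) * ennreal (exp (- s n * (cmod (z - u))\<^sup>2)))"
  have swap: "(\<integral>\<^sup>+z. (\<integral>\<^sup>+u. ?k n z u \<partial>lborel) \<partial>\<rho>) =
      (\<integral>\<^sup>+u. ennreal (\<psi> u) * (ennreal (s n / pi) * gauss_mean (s n) \<rho> u) \<partial>lborel)" if \<rho>: "borel_prob \<rho>" for \<rho> n
  proof -
    have m: "f \<in> borel_measurable borel \<Longrightarrow> f \<in> borel_measurable \<rho>" for f :: "complex \<Rightarrow> ennreal"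
      using measurable_cong_sets[OF borel_prob_sets[OF \<rho>] refl] by blast
    have "(\<integral>\<^sup>+z. (\<integral>\<^sup>+u. ?k n z u \<partial>lborel) \<partial>\<rho>) = (\<integral>\<^sup>+u. (\<integral>\<^sup>+z. ?k n z u \<partial>\<rho>) \<partial>lborel)"
      by (rule nn_integral_swap_borel[OF borel_prob_sigma_finite[OF \<rho>] sigma_finite_lborel borel_prob_sets[OF \<rho>] sets_lborel, symmetric]) measurable
    also have "\<dots> = (\<integral>\<^sup>+u. ennreal (\<psi> u) * (\<integral>\<^sup>+z. ennreal (s n / pi) * ennreal (exp (- s n * (cmod (z - u))\<^sup>2)) \<partial>\<rho>) \<partial>lborel)"
      by (intro nn_integral_cong nn_integral_cmult m) measurable
    also have "\<dots> = (\<integral>\<^sup>+u. ennreal (\<psi> u) * (ennreal (s n / pi) * gauss_mean (s n) \<rho> u) \<partial>lborel)"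
      unfolding gauss_mean_def
      by (intro nn_integral_cong arg_cong2[where f = "(*)"] refl nn_integral_cmult m) measurable
    finally show ?thesis .
  qed
  have same: "(\<integral>\<^sup>+z. (\<integral>\<^sup>+u. ?k n z u \<partial>lborel) \<partial>\<mu>) = (\<integral>\<^sup>+z. (\<integral>\<^sup>+u. ?k n z u \<partial>lborel) \<partial>\<nu>)" for n
    unfolding swap[OF \<mu>] swap[OF \<nu>]
    by (intro nn_integral_cong_AE) (use s(2)[of n] in eventually_elim, simp)
  have lim: "(\<lambda>n. \<integral>\<^sup>+z. (\<integral>\<^sup>+u. ?k n z u \<partial>lborel) \<partial>\<rho>) \<longlonglongrightarrow> (\<integral>\<^sup>+z. ennreal (\<psi> z) \<partial>\<rho>)" if \<rho>: "borel_prob \<rho>" for \<rho>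
  proof (rule nn_integral_dominated_convergence[where w = "\<lambda>_. 1"])
    have m: "f \<in> borel_measurable borel \<Longrightarrow> f \<in> borel_measurable \<rho>" for f :: "complex \<Rightarrow> ennreal"
      using measurable_cong_sets[OF borel_prob_sets[OF \<rho>] refl] by blast
    show "(\<lambda>z. \<integral>\<^sup>+u. ?k n z u \<partial>lborel) \<in> borel_measurable \<rho>" for n
      by (intro m borel_measurable_nn_integral_param[OF sigma_finite_lborel sets_lborel]) measurable
    show "(\<lambda>z. ennreal (\<psi> z)) \<in> borel_measurable \<rho>" by (intro m) measurable
    show "AE z in \<rho>. (\<integral>\<^sup>+u. ?k n z u \<partial>lborel) \<le> 1" for n
    proof (rule AE_I2)
      fix z
      have "(\<integral>\<^sup>+u. ?k n z u \<partial>lborel) \<le> (\<integral>\<^sup>+u. ennreal (s n / pi) * ennreal (exp (- s n * (cmod (z - u))\<^sup>2)) \<partial>lborel)"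
      proof (rule nn_integral_mono)
        fix u
        have "?k n z u \<le> 1 * (ennreal (s n / pi) * ennreal (exp (- s n * (cmod (z - u))\<^sup>2)))"
          using b by (intro mult_right_mono) auto
        then show "?k n z u \<le> ennreal (s n / pi) * ennreal (exp (- s n * (cmod (z - u))\<^sup>2))" by simp
      qed
      also have "\<dots> = ennreal (s n / pi) * ennreal (pi / s n)"
        by (subst nn_integral_cmult) (measurable, simp only: nn_integral_gaussian[OF s0])
      also have "\<dots> = 1" using s0[of n] by (simp add: ennreal_mult'[symmetric])
      finally show "(\<integral>\<^sup>+u. ?k n z u \<partial>lborel) \<le> 1" .
    qed
    show "AE z in \<rho>. (\<lambda>n. \<integral>\<^sup>+u. ?k n z u \<partial>lborel) \<longlonglongrightarrow> ennreal (\<psi> z)"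
      by (intro AE_I2 gauss_average_tendsto c b s)
    show "(\<integral>\<^sup>+z. 1 \<partial>\<rho>) < \<infinity>" using borel_prob_space[OF \<rho>] by simp
  qed simp
  show ?thesis
    by (rule LIMSEQ_unique[OF lim[OF \<mu>]]) (use lim[OF \<nu>] same in simp)
qed

text \<open>Closed sets generate the Borel sets and are stable under intersection; the indicator of
  a closed set is the limit of continuous functions of the distance to it.\<close>

lemma gauss_mean_determines:
  assumes \<mu>: "borel_prob \<mu>" and \<nu>: "borel_prob \<nu>"
    and eq: "\<And>n::nat. \<exists>s>real n. AE u in lborel. gauss_mean s \<mu> u = gauss_mean s \<nu> u"
  shows "\<mu> = \<nu>"
proof (rule measure_eqI_generator_eq[where E = "Collect closed" and \<Omega> = UNIV and A = "\<lambda>_. UNIV"])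
  show "Int_stable (Collect closed :: complex set set)" by (auto simp: Int_stable_def)
  have "sets (borel :: complex measure) = sigma_sets UNIV (Collect closed)"
    unfolding borel_eq_closed by (rule sets_measure_of) simp
  then show "sets \<mu> = sigma_sets UNIV (Collect closed)" "sets \<nu> = sigma_sets UNIV (Collect closed)"
    using borel_prob_sets[OF \<mu>] borel_prob_sets[OF \<nu>] by auto
  have "space \<mu> = UNIV" using sets_eq_imp_space_eq[OF borel_prob_sets[OF \<mu>]] by simp
  then show "emeasure \<mu> UNIV \<noteq> \<infinity>" using borel_prob_space[OF \<mu>] by simp
  fix F :: "complex set" assume "F \<in> Collect closed"
  then have F: "closed F" by simp
  show "emeasure \<mu> F = emeasure \<nu> F"
  \<comment> \<open>\<open>infdist\<close> to the empty set is 0 by convention, which would make the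
    approximating functions constantly 1.\<close>
  proof (cases "F = {}")
    case False
    define \<psi> where "\<psi> = (\<lambda>n::nat. \<lambda>u. max 0 (1 - real n * infdist u F))"
    have c: "continuous_on UNIV (\<psi> n)" for n
      unfolding \<psi>_def by (intro continuous_intros)
    have b: "0 \<le> \<psi> n u" "\<psi> n u \<le> 1" for n u by (auto simp: \<psi>_def infdist_nonneg)
    have lim: "(\<lambda>n. \<integral>\<^sup>+z. ennreal (\<psi> n z) \<partial>\<rho>) \<longlonglongrightarrow> emeasure \<rho> F" if \<rho>: "borel_prob \<rho>" for \<rho>
    proof -
      have Fs: "F \<in> sets \<rho>" using F borel_prob_sets[OF \<rho>] by auto
      have m: "f \<in> borel_measurable borel \<Longrightarrow> f \<in> borel_measurable \<rho>" for f :: "complex \<Rightarrow> ennreal"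
        using measurable_cong_sets[OF borel_prob_sets[OF \<rho>] refl] by blast
      have "(\<lambda>n. \<integral>\<^sup>+z. ennreal (\<psi> n z) \<partial>\<rho>) \<longlonglongrightarrow> (\<integral>\<^sup>+z. indicator F z \<partial>\<rho>)"
      proof (rule nn_integral_dominated_convergence[where w = "\<lambda>_. 1"])
        show "(\<lambda>z. ennreal (\<psi> n z)) \<in> borel_measurable \<rho>" for n
          by (intro m measurable_compose[OF borel_measurable_continuous_onI[OF c] measurable_ennreal])
        show "AE z in \<rho>. ennreal (\<psi> n z) \<le> 1" for n using b by (intro AE_I2) simp
        show "(\<integral>\<^sup>+z. 1 \<partial>\<rho>) < \<infinity>" using borel_prob_space[OF \<rho>] by simp
        show "AE z in \<rho>. (\<lambda>n. ennreal (\<psi> n z)) \<longlonglongrightarrow> indicator F z"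
        proof (rule AE_I2)
          fix z
          show "(\<lambda>n. ennreal (\<psi> n z)) \<longlonglongrightarrow> indicator F z"
          proof (cases "z \<in> F")
            case True
            then show ?thesis by (simp add: \<psi>_def)
          next
            case nz: False
            then have p: "infdist z F > 0"
              using in_closed_iff_infdist_zero[OF F False] infdist_nonneg[of z F] by (simp add: less_le)
            obtain N :: nat where N: "1 / infdist z F < real N" using reals_Archimedean2 by blast
            have "ennreal (\<psi> n z) = 0" if "n \<ge> N" for n
            proof -
              have "1 / infdist z F \<le> real n" using N that by linarith
              then have "1 \<le> real n * infdist z F" using p by (simp add: pos_divide_le_eq)
              then show ?thesis by (simp add: \<psi>_def)
            qed
            then have "eventually (\<lambda>n. ennreal (\<psi> n z) = 0) sequentially"
              by (rule eventually_sequentiallyI)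
            then show ?thesis using nz by (simp add: tendsto_eventually)
          qed
        qed
      qed (use Fs in auto)
      then show ?thesis using Fs by simp
    qed
    have "(\<lambda>n. \<integral>\<^sup>+z. ennreal (\<psi> n z) \<partial>\<nu>) = (\<lambda>n. \<integral>\<^sup>+z. ennreal (\<psi> n z) \<partial>\<mu>)"
      using gauss_mean_determines_integral[OF \<mu> \<nu> eq c b] by auto
    then show ?thesis using LIMSEQ_unique[OF lim[OF \<mu>]] lim[OF \<nu>] by simp
  qed simp
qed auto

section \<open>Equilibrium measures\<close>

text \<open>With \<open>M\<close> bounding the diameter of the support, the shifted kernel is
  non-negative there and \<open>ennreal\<close> truncates nothing. The conventional value on the
  diagonal is immaterial for measures without point masses.\<close>

definition log_mutual :: "real \<Rightarrow> complex measure \<Rightarrow> complex measure \<Rightarrow> ennreal"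
  where "log_mutual M \<mu> \<nu> = (\<integral>\<^sup>+z. (\<integral>\<^sup>+\<zeta>. ennreal (ln (M / cmod (z - \<zeta>))) \<partial>\<nu>) \<partial>\<mu>)"

text \<open>The integrand of Frullani's formula at \<open>s\<close>. Subtracting the value at
  distance \<open>M\<close> makes the integral over \<open>s\<close> converge at 0 and keeps the
  kernel non-negative at distances up to \<open>M\<close>.\<close>

definition gauss_mutual :: "real \<Rightarrow> real \<Rightarrow> complex measure \<Rightarrow> complex measure \<Rightarrow> ennreal"
  where "gauss_mutual M s \<mu> \<nu> =
    (\<integral>\<^sup>+z. (\<integral>\<^sup>+\<zeta>. ennreal ((exp (- s * (cmod (z - \<zeta>))\<^sup>2) - exp (- s * M\<^sup>2)) / s) \<partial>\<nu>) \<partial>\<mu>)"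

locale bounded_support =
  fixes D :: "complex set" and M :: real
  assumes M: "M \<ge> 1" and diam: "\<And>z \<zeta>. z \<in> D \<Longrightarrow> \<zeta> \<in> D \<Longrightarrow> cmod (z - \<zeta>) \<le> M"
begin

definition supported :: "complex measure \<Rightarrow> bool"
  where "supported \<mu> \<longleftrightarrow> borel_prob \<mu> \<and> (AE z in \<mu>. z \<in> D) \<and> (\<forall>z. emeasure \<mu> {z} = 0)"

lemma supported_meas:
  assumes "supported \<mu>" "f \<in> borel_measurable borel"
  shows "f \<in> borel_measurable \<mu>"
  using assms measurable_cong_sets[OF borel_prob_sets refl] unfolding supported_def by blast

lemma supported_neq:
  assumes "supported \<mu>"
  shows "AE \<zeta> in \<mu>. z \<noteq> \<zeta>"
proof (rule AE_I[where N = "{z}"])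
  show "emeasure \<mu> {z} = 0" using assms by (simp add: supported_def)
  show "{z} \<in> sets \<mu>" using assms borel_prob_sets by (auto simp: supported_def)
qed auto

lemma supported_measurable_inner:
  fixes f :: "'a::second_countable_topology \<Rightarrow> complex \<Rightarrow> ennreal"
  assumes "supported \<nu>" "case_prod f \<in> borel_measurable (borel \<Otimes>\<^sub>M borel)"
  shows "(\<lambda>x. \<integral>\<^sup>+y. f x y \<partial>\<nu>) \<in> borel_measurable borel"
  using assms by (intro borel_measurable_nn_integral_param borel_prob_sigma_finite borel_prob_sets) (auto simp: supported_def)

text \<open>Absence of point masses makes the diagonal negligible, so kernels are compared only
  where the logarithm is genuine.\<close>

lemma double_integral_cong:
  assumes \<mu>: "supported \<mu>" and \<nu>: "supported \<nu>"
    and eq: "\<And>z \<zeta>. z \<in> D \<Longrightarrow> \<zeta> \<in> D \<Longrightarrow> z \<noteq> \<zeta> \<Longrightarrow> f z \<zeta> = g z \<zeta>"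
  shows "(\<integral>\<^sup>+z. (\<integral>\<^sup>+\<zeta>. f z \<zeta> \<partial>\<nu>) \<partial>\<mu>) = (\<integral>\<^sup>+z. (\<integral>\<^sup>+\<zeta>. g z \<zeta> \<partial>\<nu>) \<partial>\<mu>)"
proof (rule nn_integral_cong_AE)
  have "AE z in \<mu>. z \<in> D" using \<mu> by (simp add: supported_def)
  then show "AE z in \<mu>. (\<integral>\<^sup>+\<zeta>. f z \<zeta> \<partial>\<nu>) = (\<integral>\<^sup>+\<zeta>. g z \<zeta> \<partial>\<nu>)"
  proof eventually_elim
    case (elim z)
    have "AE \<zeta> in \<nu>. \<zeta> \<in> D" using \<nu> by (simp add: supported_def)
    then have "AE \<zeta> in \<nu>. f z \<zeta> = g z \<zeta>"
      using supported_neq[OF \<nu>, of z] by eventually_elim (rule eq[OF elim])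
    then show ?case by (rule nn_integral_cong_AE)
  qed
qed

lemma double_integral_add:
  fixes f g :: "complex \<Rightarrow> complex \<Rightarrow> ennreal"
  assumes \<mu>: "supported \<mu>" and \<nu>: "supported \<nu>"
    and f: "case_prod f \<in> borel_measurable (borel \<Otimes>\<^sub>M borel)" and g: "case_prod g \<in> borel_measurable (borel \<Otimes>\<^sub>M borel)"
  shows "(\<integral>\<^sup>+z. (\<integral>\<^sup>+\<zeta>. f z \<zeta> + g z \<zeta> \<partial>\<nu>) \<partial>\<mu>) =
    (\<integral>\<^sup>+z. (\<integral>\<^sup>+\<zeta>. f z \<zeta> \<partial>\<nu>) \<partial>\<mu>) + (\<integral>\<^sup>+z. (\<integral>\<^sup>+\<zeta>. g z \<zeta> \<partial>\<nu>) \<partial>\<mu>)"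
proof -
  have [measurable]: "case_prod f \<in> borel_measurable (borel \<Otimes>\<^sub>M borel)" "case_prod g \<in> borel_measurable (borel \<Otimes>\<^sub>M borel)"
    by fact+
  have "(\<integral>\<^sup>+\<zeta>. f z \<zeta> + g z \<zeta> \<partial>\<nu>) = (\<integral>\<^sup>+\<zeta>. f z \<zeta> \<partial>\<nu>) + (\<integral>\<^sup>+\<zeta>. g z \<zeta> \<partial>\<nu>)" for z
    by (intro nn_integral_add supported_meas[OF \<nu>]) measurable
  then show ?thesis
    using nn_integral_add[OF supported_meas[OF \<mu> supported_measurable_inner[OF \<nu> f]] supported_meas[OF \<mu> supported_measurable_inner[OF \<nu> g]]]
    by simp
qed

lemma double_integral_const:
  assumes "supported \<mu>" "supported \<nu>"
  shows "(\<integral>\<^sup>+z. (\<integral>\<^sup>+\<zeta>. c \<partial>\<nu>) \<partial>\<mu>) = c"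
  using assms borel_prob_space[of \<mu>] borel_prob_space[of \<nu>] by (simp add: supported_def)

text \<open>\<open>nn_integral_frullani\<close> under the double integral, followed by two exchanges
  of order. The factor 2 stems from the squared distance in the Gaussian.\<close>

lemma log_mutual_eq_gauss:
  assumes \<mu>: "supported \<mu>" and \<nu>: "supported \<nu>"
  shows "2 * log_mutual M \<mu> \<nu> = (\<integral>\<^sup>+s. gauss_mutual M s \<mu> \<nu> * indicator {0<..} s \<partial>lborel)"
    and "(\<lambda>s. gauss_mutual M s \<mu> \<nu>) \<in> borel_measurable borel"
proof -
  let ?k = "\<lambda>s z \<zeta>. ennreal ((exp (- s * (cmod (z - \<zeta>))\<^sup>2) - exp (- s * M\<^sup>2)) / s)"
  have pm: "borel_prob \<mu>" "borel_prob \<nu>" using \<mu> \<nu> by (auto simp: supported_def)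
  have l: "(\<lambda>(z, \<zeta>). ennreal (ln (M / cmod (z - \<zeta>)))) \<in> borel_measurable (borel \<Otimes>\<^sub>M borel)" by measurable
  have inner: "(\<lambda>(s, z). \<integral>\<^sup>+\<zeta>. ?k s z \<zeta> \<partial>\<nu>) \<in> borel_measurable (borel \<Otimes>\<^sub>M borel)"
  proof -
    have "(\<lambda>x :: real \<times> complex. \<integral>\<^sup>+\<zeta>. ?k (fst x) (snd x) \<zeta> \<partial>\<nu>) \<in> borel_measurable borel"
    proof (rule supported_measurable_inner[OF \<nu>])
      show "(\<lambda>(x :: real \<times> complex, \<zeta>). ?k (fst x) (snd x) \<zeta>) \<in> borel_measurable (borel \<Otimes>\<^sub>M borel)"
        unfolding borel_prod[symmetric, where 'a = real and 'b = complex] by measurable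
    qed
    then show ?thesis by (simp add: borel_prod[symmetric] case_prod_beta')
  qed
  show meas: "(\<lambda>s. gauss_mutual M s \<mu> \<nu>) \<in> borel_measurable borel"
    unfolding gauss_mutual_def by (rule supported_measurable_inner[OF \<mu> inner])
  have mul: "2 * log_mutual M \<mu> \<nu> = (\<integral>\<^sup>+z. (\<integral>\<^sup>+\<zeta>. 2 * ennreal (ln (M / cmod (z - \<zeta>))) \<partial>\<nu>) \<partial>\<mu>)"
  proof -
    have "2 * log_mutual M \<mu> \<nu> = (\<integral>\<^sup>+z. 2 * (\<integral>\<^sup>+\<zeta>. ennreal (ln (M / cmod (z - \<zeta>))) \<partial>\<nu>) \<partial>\<mu>)"
      unfolding log_mutual_def
      by (intro nn_integral_cmult[symmetric] supported_meas[OF \<mu>] supported_measurable_inner[OF \<nu> l])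
    also have "\<dots> = (\<integral>\<^sup>+z. (\<integral>\<^sup>+\<zeta>. 2 * ennreal (ln (M / cmod (z - \<zeta>))) \<partial>\<nu>) \<partial>\<mu>)"
      by (intro nn_integral_cong nn_integral_cmult[symmetric] supported_meas[OF \<nu>]) measurable
    finally show ?thesis .
  qed
  also have "\<dots> = (\<integral>\<^sup>+z. (\<integral>\<^sup>+\<zeta>. (\<integral>\<^sup>+s. ?k s z \<zeta> * indicator {0<..} s \<partial>lborel) \<partial>\<nu>) \<partial>\<mu>)"
  proof (rule double_integral_cong[OF \<mu> \<nu>])
    fix z \<zeta> assume "z \<in> D" "\<zeta> \<in> D" "z \<noteq> \<zeta>"
    then have "0 < cmod (z - \<zeta>)" "cmod (z - \<zeta>) \<le> M" using diam by auto
    from nn_integral_frullani[OF this]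
    show "2 * ennreal (ln (M / cmod (z - \<zeta>))) = (\<integral>\<^sup>+s. ?k s z \<zeta> * indicator {0<..} s \<partial>lborel)"
      by (simp add: ennreal_mult')
  qed
  also have "\<dots> = (\<integral>\<^sup>+z. (\<integral>\<^sup>+s. (\<integral>\<^sup>+\<zeta>. ?k s z \<zeta> * indicator {0<..} s \<partial>\<nu>) \<partial>lborel) \<partial>\<mu>)"
    by (intro nn_integral_cong nn_integral_swap_borel sigma_finite_lborel borel_prob_sigma_finite pm borel_prob_sets sets_lborel) measurable
  also have "\<dots> = (\<integral>\<^sup>+z. (\<integral>\<^sup>+s. (\<integral>\<^sup>+\<zeta>. ?k s z \<zeta> \<partial>\<nu>) * indicator {0<..} s \<partial>lborel) \<partial>\<mu>)"
    by (intro nn_integral_cong nn_integral_multc supported_meas[OF \<nu>]) measurable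
  also have "\<dots> = (\<integral>\<^sup>+s. (\<integral>\<^sup>+z. (\<integral>\<^sup>+\<zeta>. ?k s z \<zeta> \<partial>\<nu>) * indicator {0<..} s \<partial>\<mu>) \<partial>lborel)"
  proof (rule nn_integral_swap_borel[OF sigma_finite_lborel borel_prob_sigma_finite[OF pm(1)] sets_lborel borel_prob_sets[OF pm(1)]])
    note [measurable] = inner
    show "(\<lambda>(s, z). (\<integral>\<^sup>+\<zeta>. ?k s z \<zeta> \<partial>\<nu>) * indicator {0<..} s) \<in> borel_measurable (borel \<Otimes>\<^sub>M borel)"
      using borel_measurable_times_ennreal[OF inner, of "\<lambda>x. indicator {0<..} (fst x)"] by (simp add: case_prod_beta')
  qed
  also have "\<dots> = (\<integral>\<^sup>+s. (\<integral>\<^sup>+z. (\<integral>\<^sup>+\<zeta>. ?k s z \<zeta> \<partial>\<nu>) \<partial>\<mu>) * indicator {0<..} s \<partial>lborel)"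
    by (intro nn_integral_cong nn_integral_multc supported_meas[OF \<mu>] supported_measurable_inner[OF \<nu>]) measurable
  finally show "2 * log_mutual M \<mu> \<nu> = (\<integral>\<^sup>+s. gauss_mutual M s \<mu> \<nu> * indicator {0<..} s \<partial>lborel)"
    by (simp only: gauss_mutual_def)
qed

text \<open>Both measures have mass 1, so the subtracted constant integrates to itself. It is
  restored on the left rather than subtracted on the right, to stay within extended non-negative
  reals.\<close>

lemma gauss_mutual_eq_energy:
  assumes \<mu>: "supported \<mu>" and \<nu>: "supported \<nu>" and s: "s > 0"
  shows "gauss_mutual M s \<mu> \<nu> + ennreal (exp (- s * M\<^sup>2) / s) = ennreal (1 / s) * gauss_energy s \<mu> \<nu>"
proof -
  let ?k = "\<lambda>z \<zeta>. ennreal ((exp (- s * (cmod (z - \<zeta>))\<^sup>2) - exp (- s * M\<^sup>2)) / s)"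
  have e: "(\<lambda>(z, \<zeta>). ennreal (exp (- s * (cmod (\<zeta> - z))\<^sup>2))) \<in> borel_measurable (borel \<Otimes>\<^sub>M borel)" by measurable
  have "gauss_mutual M s \<mu> \<nu> + ennreal (exp (- s * M\<^sup>2) / s) =
     (\<integral>\<^sup>+z. (\<integral>\<^sup>+\<zeta>. ?k z \<zeta> \<partial>\<nu>) \<partial>\<mu>) + (\<integral>\<^sup>+z. (\<integral>\<^sup>+\<zeta>. ennreal (exp (- s * M\<^sup>2) / s) \<partial>\<nu>) \<partial>\<mu>)"
    unfolding gauss_mutual_def double_integral_const[OF \<mu> \<nu>] ..
  also have "\<dots> = (\<integral>\<^sup>+z. (\<integral>\<^sup>+\<zeta>. ?k z \<zeta> + ennreal (exp (- s * M\<^sup>2) / s) \<partial>\<nu>) \<partial>\<mu>)"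
    by (rule double_integral_add[OF \<mu> \<nu>, symmetric]) measurable
  also have "\<dots> = (\<integral>\<^sup>+z. (\<integral>\<^sup>+\<zeta>. ennreal (1 / s) * ennreal (exp (- s * (cmod (\<zeta> - z))\<^sup>2)) \<partial>\<nu>) \<partial>\<mu>)"
  proof (rule double_integral_cong[OF \<mu> \<nu>])
    fix z \<zeta> assume "z \<in> D" "\<zeta> \<in> D"
    then have "(cmod (z - \<zeta>))\<^sup>2 \<le> M\<^sup>2" using diam by (intro power_mono) auto
    then have "exp (- s * M\<^sup>2) \<le> exp (- s * (cmod (z - \<zeta>))\<^sup>2)" using s by simp
    then have "0 \<le> (exp (- s * (cmod (z - \<zeta>))\<^sup>2) - exp (- s * M\<^sup>2)) / s" using s by simp
    then show "?k z \<zeta> + ennreal (exp (- s * M\<^sup>2) / s) = ennreal (1 / s) * ennreal (exp (- s * (cmod (\<zeta> - z))\<^sup>2))"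
      using s by (simp add: ennreal_plus[symmetric] ennreal_mult'[symmetric] diff_divide_distrib norm_minus_commute del: ennreal_plus)
  qed
  also have "\<dots> = (\<integral>\<^sup>+z. ennreal (1 / s) * (\<integral>\<^sup>+\<zeta>. ennreal (exp (- s * (cmod (\<zeta> - z))\<^sup>2)) \<partial>\<nu>) \<partial>\<mu>)"
    by (intro nn_integral_cong nn_integral_cmult supported_meas[OF \<nu>]) measurable
  also have "\<dots> = ennreal (1 / s) * gauss_energy s \<mu> \<nu>"
    unfolding gauss_energy_def gauss_mean_def
    by (intro nn_integral_cmult supported_meas[OF \<mu>] supported_measurable_inner[OF \<nu> e])
  finally show ?thesis .
qed

lemma gauss_mutual_convex:
  assumes \<mu>: "supported \<mu>" and \<nu>: "supported \<nu>" and s: "s > 0"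
  shows "2 * gauss_mutual M s \<mu> \<nu> \<le> gauss_mutual M s \<mu> \<mu> + gauss_mutual M s \<nu> \<nu>"
    and "gauss_mutual M s \<mu> \<mu> + gauss_mutual M s \<nu> \<nu> \<le> 2 * gauss_mutual M s \<mu> \<nu> \<Longrightarrow>
      AE u in lborel. gauss_mean (2 * s) \<mu> u = gauss_mean (2 * s) \<nu> u"
proof -
  let ?E = "ennreal (exp (- s * M\<^sup>2) / s)"
  have pm: "borel_prob \<mu>" "borel_prob \<nu>" using \<mu> \<nu> by (auto simp: supported_def)
  have l: "2 * gauss_mutual M s \<mu> \<nu> + 2 * ?E = ennreal (1 / s) * (2 * gauss_energy s \<mu> \<nu>)"
    using gauss_mutual_eq_energy[OF \<mu> \<nu> s] by (simp only: distrib_left[symmetric] mult.left_commute)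
  have r: "gauss_mutual M s \<mu> \<mu> + gauss_mutual M s \<nu> \<nu> + 2 * ?E = ennreal (1 / s) * (gauss_energy s \<mu> \<mu> + gauss_energy s \<nu> \<nu>)"
  proof -
    have "gauss_mutual M s \<mu> \<mu> + gauss_mutual M s \<nu> \<nu> + 2 * ?E = (gauss_mutual M s \<mu> \<mu> + ?E) + (gauss_mutual M s \<nu> \<nu> + ?E)"
      by (simp only: mult_2 ac_simps)
    then show ?thesis
      unfolding gauss_mutual_eq_energy[OF \<mu> \<mu> s] gauss_mutual_eq_energy[OF \<nu> \<nu> s] by (simp only: distrib_left)
  qed
  have "2 * gauss_mutual M s \<mu> \<nu> + 2 * ?E \<le> gauss_mutual M s \<mu> \<mu> + gauss_mutual M s \<nu> \<nu> + 2 * ?E"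
    unfolding l r by (intro mult_left_mono gauss_energy_convex(1)[OF pm s]) simp
  then have "2 * ?E + 2 * gauss_mutual M s \<mu> \<nu> \<le> 2 * ?E + (gauss_mutual M s \<mu> \<mu> + gauss_mutual M s \<nu> \<nu>)"
    by (simp only: add.commute)
  then have "2 * ?E = \<infinity> \<or> 2 * gauss_mutual M s \<mu> \<nu> \<le> gauss_mutual M s \<mu> \<mu> + gauss_mutual M s \<nu> \<nu>"
    by (rule iffD1[OF ennreal_add_left_cancel_le])
  moreover have "2 * ?E \<noteq> \<infinity>" by (simp add: ennreal_mult_eq_top_iff)
  ultimately show "2 * gauss_mutual M s \<mu> \<nu> \<le> gauss_mutual M s \<mu> \<mu> + gauss_mutual M s \<nu> \<nu>"
    by blast
  assume "gauss_mutual M s \<mu> \<mu> + gauss_mutual M s \<nu> \<nu> \<le> 2 * gauss_mutual M s \<mu> \<nu>"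
  then have "gauss_mutual M s \<mu> \<mu> + gauss_mutual M s \<nu> \<nu> + 2 * ?E \<le> 2 * gauss_mutual M s \<mu> \<nu> + 2 * ?E"
    by (rule add_right_mono)
  then have "ennreal (1 / s) * (gauss_energy s \<mu> \<mu> + gauss_energy s \<nu> \<nu>) \<le> ennreal (1 / s) * (2 * gauss_energy s \<mu> \<nu>)"
    unfolding l r .
  then have "gauss_energy s \<mu> \<mu> + gauss_energy s \<nu> \<nu> \<le> 2 * gauss_energy s \<mu> \<nu>"
    using s by (subst (asm) ennreal_mult_le_mult_iff) auto
  then show "AE u in lborel. gauss_mean (2 * s) \<mu> u = gauss_mean (2 * s) \<nu> u"
    by (rule gauss_energy_convex(2)[OF pm s])
qed

text \<open>The Gaussian inequality integrated over \<open>s\<close>. With a finite mutual energy,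
  equality forces equality for almost every \<open>s\<close>, hence equal Gaussian means for
  arbitrarily large parameters, and these determine the measure.\<close>

lemma log_mutual_convex:
  assumes \<mu>: "supported \<mu>" and \<nu>: "supported \<nu>"
  shows "2 * log_mutual M \<mu> \<nu> \<le> log_mutual M \<mu> \<mu> + log_mutual M \<nu> \<nu>"
    and "log_mutual M \<mu> \<mu> + log_mutual M \<nu> \<nu> \<le> 2 * log_mutual M \<mu> \<nu> \<Longrightarrow> log_mutual M \<mu> \<nu> < \<infinity> \<Longrightarrow> \<mu> = \<nu>"
proof -
  let ?K = "\<lambda>\<mu> \<nu> s. gauss_mutual M s \<mu> \<nu> * indicator {0<..} s :: ennreal"
  note [measurable] = log_mutual_eq_gauss(2)[OF \<mu> \<mu>] log_mutual_eq_gauss(2)[OF \<mu> \<nu>] log_mutual_eq_gauss(2)[OF \<nu> \<nu>]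
  have l: "2 * (2 * log_mutual M \<mu> \<nu>) = (\<integral>\<^sup>+s. 2 * ?K \<mu> \<nu> s \<partial>lborel)"
    unfolding log_mutual_eq_gauss(1)[OF \<mu> \<nu>] by (rule nn_integral_cmult[symmetric]) measurable
  have r: "2 * (log_mutual M \<mu> \<mu> + log_mutual M \<nu> \<nu>) = (\<integral>\<^sup>+s. ?K \<mu> \<mu> s + ?K \<nu> \<nu> s \<partial>lborel)"
    unfolding distrib_left log_mutual_eq_gauss(1)[OF \<mu> \<mu>] log_mutual_eq_gauss(1)[OF \<nu> \<nu>]
    by (rule nn_integral_add[symmetric]) measurable
  have le: "2 * ?K \<mu> \<nu> s \<le> ?K \<mu> \<mu> s + ?K \<nu> \<nu> s" for s
    using gauss_mutual_convex(1)[OF \<mu> \<nu>, of s] by (cases "s > 0") auto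
  have "2 * (2 * log_mutual M \<mu> \<nu>) \<le> 2 * (log_mutual M \<mu> \<mu> + log_mutual M \<nu> \<nu>)"
    unfolding l r by (intro nn_integral_mono le)
  then show "2 * log_mutual M \<mu> \<nu> \<le> log_mutual M \<mu> \<mu> + log_mutual M \<nu> \<nu>"
    by (subst (asm) ennreal_mult_le_mult_iff) auto
  assume eq: "log_mutual M \<mu> \<mu> + log_mutual M \<nu> \<nu> \<le> 2 * log_mutual M \<mu> \<nu>" and fin: "log_mutual M \<mu> \<nu> < \<infinity>"
  have "AE s in lborel. 2 * ?K \<mu> \<nu> s = ?K \<mu> \<mu> s + ?K \<nu> \<nu> s"
  proof (rule nn_integral_eq_imp_AE_eq)
    show "(\<integral>\<^sup>+s. ?K \<mu> \<mu> s + ?K \<nu> \<nu> s \<partial>lborel) \<le> (\<integral>\<^sup>+s. 2 * ?K \<mu> \<nu> s \<partial>lborel)"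
      unfolding l[symmetric] r[symmetric] using eq by (rule mult_left_mono) simp
    show "(\<integral>\<^sup>+s. 2 * ?K \<mu> \<nu> s \<partial>lborel) < \<infinity>"
      unfolding l[symmetric] using fin by (simp add: ennreal_mult_less_top)
  qed (use le in auto)
  then have ae: "AE s in lborel. s > 0 \<longrightarrow> (AE u in lborel. gauss_mean (2 * s) \<mu> u = gauss_mean (2 * s) \<nu> u)"
  proof eventually_elim
    case (elim s)
    show ?case
    proof
      assume s: "s > 0"
      then have "gauss_mutual M s \<mu> \<mu> + gauss_mutual M s \<nu> \<nu> \<le> 2 * gauss_mutual M s \<mu> \<nu>" using elim by simp
      then show "AE u in lborel. gauss_mean (2 * s) \<mu> u = gauss_mean (2 * s) \<nu> u"
        by (rule gauss_mutual_convex(2)[OF \<mu> \<nu> s])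
    qed
  qed
  \<comment> \<open>The exceptional parameters form a null set, which cannot contain an interval of
    length 1.\<close>
  have "\<exists>s>real n. AE u in lborel. gauss_mean s \<mu> u = gauss_mean s \<nu> u" for n
  proof (rule ccontr)
    assume n: "\<not> ?thesis"
    have "AE s in lborel. s \<notin> {real n<..<real n + 1}"
      using ae
    proof eventually_elim
      case (elim s)
      show ?case
      proof
        assume "s \<in> {real n<..<real n + 1}"
        then have "s > 0" "2 * s > real n" by auto
        then show False using elim n by blast
      qed
    qed
    then have "{real n<..<real n + 1} \<in> null_sets lborel"
      by (subst AE_iff_null_sets) auto
    then have "emeasure lborel {real n<..<real n + 1} = 0" by (rule null_setsD1)
    then show False by simp
  qed
  then show "\<mu> = \<nu>" using \<mu> \<nu> by (intro gauss_mean_determines) (auto simp: supported_def)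
qed

text \<open>The pointwise relation between the kernel, its shift and its two parts is used in
  additive form to avoid a difference of infinities. The negative part is at most
  \<open>ln M\<close> on the support, so its integral is finite and may be subtracted at the
  end.\<close>

lemma log_energy_eq:
  assumes \<mu>: "supported \<mu>"
  shows "log_energy \<mu> = enn2ereal (log_mutual M \<mu> \<mu>) - ereal (ln M)"
proof -
  let ?A = "\<integral>\<^sup>+z. (\<integral>\<^sup>+\<zeta>. ennreal (log_kernel z \<zeta>) \<partial>\<mu>) \<partial>\<mu>"
  let ?B = "\<integral>\<^sup>+z. (\<integral>\<^sup>+\<zeta>. ennreal (- log_kernel z \<zeta>) \<partial>\<mu>) \<partial>\<mu>"
  have [measurable]: "(\<lambda>(z, \<zeta>). log_kernel z \<zeta>) \<in> borel_measurable (borel \<Otimes>\<^sub>M borel)"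
    unfolding log_kernel_def by measurable
  have lM: "0 \<le> ln M" using M by simp
  have pt: "ennreal (log_kernel z \<zeta>) + ennreal (ln M) = ennreal (ln (M / cmod (z - \<zeta>))) + ennreal (- log_kernel z \<zeta>)"
    "ennreal (- log_kernel z \<zeta>) \<le> ennreal (ln M)"
    if "z \<in> D" "\<zeta> \<in> D" "z \<noteq> \<zeta>" for z \<zeta>
  proof -
    have x: "0 < cmod (z - \<zeta>)" "cmod (z - \<zeta>) \<le> M" using that diam by auto
    have k: "log_kernel z \<zeta> = - ln (cmod (z - \<zeta>))" using that x by (simp add: log_kernel_def ln_inverse)
    have lx: "ln (cmod (z - \<zeta>)) \<le> ln M" by (subst ln_le_cancel_iff) (use x M in auto)
    have d: "ln (M / cmod (z - \<zeta>)) = ln M - ln (cmod (z - \<zeta>))" using x M by (simp add: ln_div)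
    show "ennreal (- log_kernel z \<zeta>) \<le> ennreal (ln M)" unfolding k using lx by (simp add: ennreal_leI)
    show "ennreal (log_kernel z \<zeta>) + ennreal (ln M) = ennreal (ln (M / cmod (z - \<zeta>))) + ennreal (- log_kernel z \<zeta>)"
      unfolding k d using lx lM
      by (cases "0 \<le> ln (cmod (z - \<zeta>))") (simp_all add: ennreal_neg ennreal_plus[symmetric] del: ennreal_plus)
  qed
  have "?A + ennreal (ln M) = ?A + (\<integral>\<^sup>+z. (\<integral>\<^sup>+\<zeta>. ennreal (ln M) \<partial>\<mu>) \<partial>\<mu>)"
    unfolding double_integral_const[OF \<mu> \<mu>] ..
  also have "\<dots> = (\<integral>\<^sup>+z. (\<integral>\<^sup>+\<zeta>. ennreal (log_kernel z \<zeta>) + ennreal (ln M) \<partial>\<mu>) \<partial>\<mu>)"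
    by (rule double_integral_add[OF \<mu> \<mu>, symmetric]) measurable
  also have "\<dots> = (\<integral>\<^sup>+z. (\<integral>\<^sup>+\<zeta>. ennreal (ln (M / cmod (z - \<zeta>))) + ennreal (- log_kernel z \<zeta>) \<partial>\<mu>) \<partial>\<mu>)"
    by (rule double_integral_cong[OF \<mu> \<mu> pt(1)])
  also have "\<dots> = log_mutual M \<mu> \<mu> + ?B"
    unfolding log_mutual_def by (rule double_integral_add[OF \<mu> \<mu>]) measurable
  finally have eq: "?A + ennreal (ln M) = log_mutual M \<mu> \<mu> + ?B" .
  have "?B \<le> (\<integral>\<^sup>+z. (\<integral>\<^sup>+\<zeta>. max (ennreal (ln M)) (ennreal (- log_kernel z \<zeta>)) \<partial>\<mu>) \<partial>\<mu>)"
    by (intro nn_integral_mono) simp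
  also have "\<dots> = (\<integral>\<^sup>+z. (\<integral>\<^sup>+\<zeta>. ennreal (ln M) \<partial>\<mu>) \<partial>\<mu>)"
    by (rule double_integral_cong[OF \<mu> \<mu>]) (simp add: pt(2) max_absorb1)
  also have "\<dots> = ennreal (ln M)" by (rule double_integral_const[OF \<mu> \<mu>])
  finally have "?B < top" by (rule le_less_trans) simp
  then obtain b where b: "?B = ennreal b" "b \<ge> 0" by (cases ?B) auto
  have "enn2ereal ?A + ereal (ln M) = enn2ereal (log_mutual M \<mu> \<mu>) + ereal b"
    using arg_cong[OF eq, of enn2ereal] lM b by (simp add: plus_ennreal.rep_eq enn2ereal_ennreal)
  then show ?thesis
    unfolding log_energy_def b(1) enn2ereal_ennreal[OF b(2)]
    by (cases "enn2ereal ?A"; cases "enn2ereal (log_mutual M \<mu> \<mu>)") auto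
qed

end

context bounded_support
begin

lemma admissible_imp_supported:
  assumes "compact D" "\<nu> \<in> admissible_measures D"
  shows "supported \<nu>" "measure \<nu> D = 1"
proof -
  have s: "sets \<nu> = sets borel" and p: "prob_space \<nu>" and z: "emeasure \<nu> (- D) = 0" and at: "\<forall>z. emeasure \<nu> {z} = 0"
    using assms(2) by (auto simp: admissible_measures_def)
  have D: "D \<in> sets \<nu>" "- D \<in> sets \<nu>" unfolding s using compact_imp_closed[OF assms(1)] by auto
  then have ae: "AE z in \<nu>. z \<in> D"
    using AE_not_in[of "- D" \<nu>] z by (auto simp: null_sets_def)
  then show "supported \<nu>"
    using s p at by (simp add: supported_def borel_prob_def)
  show "measure \<nu> D = 1" using prob_space.prob_eq_1[OF p D(1)] ae by simp
qed

lemma integrable_on_support: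
  fixes g :: "complex \<Rightarrow> real"
  assumes D: "compact D" and \<nu>: "\<nu> \<in> admissible_measures D" and g: "continuous_on D g"
  shows "set_integrable \<nu> D g"
  unfolding set_integrable_def
proof -
  have p: "prob_space \<nu>" and s: "sets \<nu> = sets borel" using \<nu> by (auto simp: admissible_measures_def)
  interpret prob_space \<nu> by fact
  have "compact (g ` D)" by (rule compact_continuous_image[OF g D])
  then obtain B where B: "B > 0" "\<forall>x\<in>g ` D. norm x \<le> B" using compact_imp_bounded bounded_pos by metis
  show "integrable \<nu> (\<lambda>z. indicat_real D z *\<^sub>R g z)"
  proof (rule integrable_const_bound[where B = B])
    show "AE z in \<nu>. norm (indicat_real D z *\<^sub>R g z) \<le> B" using B by (intro AE_I2) (auto simp: indicator_def)
    have "(\<lambda>z. indicat_real D z *\<^sub>R g z) \<in> borel_measurable borel"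
      using compact_imp_closed[OF D] by (intro borel_measurable_continuous_on_indicator g) auto
    then show "(\<lambda>z. indicat_real D z *\<^sub>R g z) \<in> borel_measurable \<nu>"
      using measurable_cong_sets[OF s refl] by blast
  qed
qed

text \<open>Frostman-type sufficiency. Writing I for \<open>log_mutual\<close>, convexity gives
  I(nu,nu) >= 2 I(nu,mu) - I(mu,mu), and I(nu,mu) is the integral of \<open>W\<close> against nu.
  The energy of nu is thus at least the integral of V + 2 W minus I(mu,mu) and \<open>ln M\<close>,
  hence at least \<open>c\<close> minus these, which is the energy of mu. Equality leads to the
  equality case of \<open>log_mutual_convex\<close>.\<close>

lemma equilibrium_criterion:
  fixes V W :: "complex \<Rightarrow> real"
  assumes D: "compact D" and \<mu>: "\<mu> \<in> admissible_measures D"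
    and V: "continuous_on D V" and W: "continuous_on D W" "\<And>z. z \<in> D \<Longrightarrow> 0 \<le> W z"
    and pot: "\<And>z. z \<in> D \<Longrightarrow> (\<integral>\<^sup>+\<zeta>. ennreal (ln (M / cmod (z - \<zeta>))) \<partial>\<mu>) = ennreal (W z)"
    and ge: "\<And>z. z \<in> D \<Longrightarrow> c \<le> V z + 2 * W z" and eq: "AE z in \<mu>. V z + 2 * W z = c"
  shows "is_equilibrium_measure D V \<mu>"
proof -
  let ?EV = "\<lambda>\<nu>. LINT z:D|\<nu>. V z" and ?EW = "\<lambda>\<nu>. LINT z:D|\<nu>. W z"
  note \<mu>s = admissible_imp_supported[OF D \<mu>]
  have mut: "log_mutual M \<nu> \<mu> = ennreal (?EW \<nu>)" if \<nu>: "\<nu> \<in> admissible_measures D" for \<nu>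
  proof -
    have ae: "AE z in \<nu>. z \<in> D" using admissible_imp_supported[OF D \<nu>] by (simp add: supported_def)
    have "log_mutual M \<nu> \<mu> = (\<integral>\<^sup>+z. ennreal (indicat_real D z *\<^sub>R W z) \<partial>\<nu>)"
      unfolding log_mutual_def by (rule nn_integral_cong_AE) (use ae in eventually_elim, simp add: pot)
    also have "\<dots> = ennreal (?EW \<nu>)"
      unfolding set_lebesgue_integral_def
      by (rule nn_integral_eq_integral)
         (use integrable_on_support[OF D \<nu> W(1)] W(2) in \<open>auto simp: set_integrable_def indicator_def\<close>)
    finally show ?thesis .
  qed
  have EW0: "0 \<le> ?EW \<nu>" for \<nu>
    unfolding set_lebesgue_integral_def using W(2) by (intro Bochner_Integration.integral_nonneg) (auto simp: indicator_def)
  have sum: "?EV \<nu> + 2 * ?EW \<nu> = (LINT z:D|\<nu>. V z + 2 * W z)" if \<nu>: "\<nu> \<in> admissible_measures D" for \<nu>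
  proof -
    have "(LINT z:D|\<nu>. V z + 2 * W z) = ?EV \<nu> + (LINT z:D|\<nu>. 2 * W z)"
      by (rule set_integral_add(2)) (intro integrable_on_support D \<nu> V W(1) continuous_intros)+
    then show ?thesis by simp
  qed
  have cD: "(LINT z:D|\<nu>. c) = c" if \<nu>: "\<nu> \<in> admissible_measures D" for \<nu>
  proof -
    have "D \<in> sets \<nu>" using \<nu> compact_imp_closed[OF D] by (auto simp: admissible_measures_def)
    moreover have "emeasure \<nu> D \<noteq> \<infinity>"
      using \<nu> by (auto simp: admissible_measures_def prob_space_def finite_measure.emeasure_finite)
    ultimately show ?thesis
      using admissible_imp_supported(2)[OF D \<nu>] by (simp add: set_lebesgue_integral_def)
  qed
  have lower: "c \<le> ?EV \<nu> + 2 * ?EW \<nu>" if \<nu>: "\<nu> \<in> admissible_measures D" for \<nu>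
  proof -
    have "(LINT z:D|\<nu>. c) \<le> (LINT z:D|\<nu>. V z + 2 * W z)"
      by (rule set_integral_mono) (intro integrable_on_support D \<nu> V W(1) continuous_intros ge | assumption)+
    then show ?thesis unfolding sum[OF \<nu>] cD[OF \<nu>] .
  qed
  have total: "?EV \<mu> + 2 * ?EW \<mu> = c"
  proof -
    have "(LINT z:D|\<mu>. V z + 2 * W z) = (LINT z:D|\<mu>. c)"
      unfolding set_lebesgue_integral_def
    proof (rule Bochner_Integration.integral_cong_AE)
      show "(\<lambda>z. indicat_real D z *\<^sub>R (V z + 2 * W z)) \<in> borel_measurable \<mu>"
        using integrable_on_support[OF D \<mu> continuous_on_add[OF V continuous_on_mult_left[OF W(1), of 2]]]
        unfolding set_integrable_def by (rule borel_measurable_integrable)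
      show "(\<lambda>z. indicat_real D z *\<^sub>R c) \<in> borel_measurable \<mu>"
        using integrable_on_support[OF D \<mu>, of "\<lambda>z. c"]
        by (intro borel_measurable_integrable) (auto simp: set_integrable_def)
      show "AE z in \<mu>. indicat_real D z *\<^sub>R (V z + 2 * W z) = indicat_real D z *\<^sub>R c"
        using eq by eventually_elim simp
    qed
    then show ?thesis unfolding sum[OF \<mu>] cD[OF \<mu>] .
  qed
  have we: "weighted_energy D V \<nu> = ereal (?EV \<nu>) + (enn2ereal (log_mutual M \<nu> \<nu>) - ereal (ln M))"
    if \<nu>: "\<nu> \<in> admissible_measures D" for \<nu>
    unfolding weighted_energy_def log_energy_eq[OF admissible_imp_supported(1)[OF D \<nu>]] ..
  have we\<mu>: "weighted_energy D V \<mu> = ereal (?EV \<mu> + ?EW \<mu> - ln M)"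
    unfolding we[OF \<mu>] mut[OF \<mu>] using EW0[of \<mu>] by (simp add: enn2ereal_ennreal)
  have main: "weighted_energy D V \<mu> \<le> weighted_energy D V \<nu> \<and> (weighted_energy D V \<nu> = weighted_energy D V \<mu> \<longrightarrow> \<nu> = \<mu>)"
    if \<nu>: "\<nu> \<in> admissible_measures D" for \<nu>
  proof (cases "log_mutual M \<nu> \<nu>")
    case (real l)
    note \<nu>s = admissible_imp_supported(1)[OF D \<nu>]
    have "2 * ennreal (?EW \<nu>) \<le> ennreal l + ennreal (?EW \<mu>)"
      using log_mutual_convex(1)[OF \<nu>s \<mu>s(1)] unfolding mut[OF \<nu>] mut[OF \<mu>] real(2) .
    moreover have "2 * ennreal (?EW \<nu>) = ennreal (2 * ?EW \<nu>)" by (simp add: ennreal_mult')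
    ultimately have l: "2 * ?EW \<nu> \<le> l + ?EW \<mu>"
      using real EW0 by (simp add: ennreal_plus[symmetric] ennreal_le_iff del: ennreal_plus)
    have we\<nu>: "weighted_energy D V \<nu> = ereal (?EV \<nu> + l - ln M)"
      unfolding we[OF \<nu>] real(2) using real(1) by (simp add: enn2ereal_ennreal)
    show ?thesis
    proof (intro conjI impI)
      show "weighted_energy D V \<mu> \<le> weighted_energy D V \<nu>"
        unfolding we\<mu> we\<nu> using l lower[OF \<nu>] total by simp
      assume "weighted_energy D V \<nu> = weighted_energy D V \<mu>"
      then have "?EV \<nu> + l = ?EV \<mu> + ?EW \<mu>" unfolding we\<mu> we\<nu> by simp
      then have "l + ?EW \<mu> \<le> 2 * ?EW \<nu>" using lower[OF \<nu>] total by linarith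
      then have "ennreal (l + ?EW \<mu>) \<le> ennreal (2 * ?EW \<nu>)" by (rule ennreal_leI)
      then have "log_mutual M \<nu> \<nu> + log_mutual M \<mu> \<mu> \<le> 2 * log_mutual M \<nu> \<mu>"
        unfolding mut[OF \<nu>] mut[OF \<mu>] real(2) using real(1) EW0 by (simp add: ennreal_mult')
      moreover have "log_mutual M \<nu> \<mu> < \<infinity>" unfolding mut[OF \<nu>] by simp
      ultimately show "\<nu> = \<mu>" by (rule log_mutual_convex(2)[OF \<nu>s \<mu>s(1)])
    qed
  next
    case top
    then have "weighted_energy D V \<nu> = \<infinity>" unfolding we[OF \<nu>] by (simp add: top_ennreal.rep_eq top_ereal_def)
    then show ?thesis unfolding we\<mu> by simp
  qed
  have inf: "weighted_energy D V \<mu> = (INF \<nu>\<in>admissible_measures D. weighted_energy D V \<nu>)"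
    using main \<mu> by (intro antisym INF_greatest INF_lower) auto
  show ?thesis
    unfolding is_equilibrium_measure_def inf[symmetric] using main \<mu> by auto
qed

end

section \<open>The equilibrium measure of a small curve\<close>

lemma moment_potential_continuous: "continuous_on A (moment_potential d t)"
  unfolding moment_potential_def[abs_def] by (intro continuous_intros)

text \<open>Mere positivity is upgraded to the quadratic bound that \<open>f_far\<close> requires.
  Near 0 the form \<open>(cmod z)^2 - 2 * Re (t 2 * z^2)\<close> is at least
  \<open>(1 - \<beta>) * (cmod z)^2\<close>; away from 0 compactness of \<open>D\<close> gives a
  positive minimum.\<close>

lemma (in moment_data) moment_potential_lower_bound:
  assumes D: "compact D" and pos: "\<forall>z\<in>D - {0}. moment_potential d t z > 0"
  obtains c where "c > 0" "\<And>z. z \<in> D \<Longrightarrow> c * (cmod z)\<^sup>2 \<le> moment_potential d t z"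
proof -
  define S where "S = (\<Sum>k=3..d+1. cmod (t k))"
  have S: "0 \<le> S" unfolding S_def by (intro sum_nonneg) auto
  \<comment> \<open>Chosen so that, after doubling, the terms of degree at least 3 consume half of
    the margin \<open>1 - \<beta>\<close>.\<close>
  define \<rho> where "\<rho> = min 1 ((1 - \<beta>) / (4 * (S + 1)))"
  have \<rho>: "\<rho> > 0" using beta S by (auto simp: \<rho>_def intro!: divide_pos_pos)
  have near: "(1 - \<beta>) / 2 * (cmod z)\<^sup>2 \<le> moment_potential d t z" if z: "cmod z \<le> \<rho>" for z
  proof -
    have split: "(\<Sum>k=2..d+1. t k * z ^ k) = t 2 * z\<^sup>2 + (\<Sum>k=3..d+1. t k * z ^ k)"
    proof (cases "d = 0")
      case True
      then have "t 2 = 0" using above by auto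
      then show ?thesis using True by simp
    next
      case False
      then have "{2..d+1} = insert 2 {3..d+1}" by auto
      then show ?thesis by simp
    qed
    have "cmod (\<Sum>k=3..d+1. t k * z ^ k) \<le> (\<Sum>k=3..d+1. cmod (t k) * (cmod z * (cmod z)\<^sup>2))"
    proof (rule sum_norm_le)
      fix k assume k: "k \<in> {3..d+1}"
      have "cmod z ^ k \<le> cmod z ^ 3" using k z by (intro power_decreasing) (auto simp: \<rho>_def)
      then show "cmod (t k * z ^ k) \<le> cmod (t k) * (cmod z * (cmod z)\<^sup>2)"
        unfolding norm_mult norm_power by (intro mult_left_mono) (auto simp: power3_eq_cube power2_eq_square)
    qed
    also have "\<dots> = S * cmod z * (cmod z)\<^sup>2" by (simp only: S_def sum_distrib_right mult.assoc)
    also have "\<dots> \<le> (1 - \<beta>) / 4 * (cmod z)\<^sup>2"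
    proof (rule mult_right_mono)
      have "S * cmod z \<le> (S + 1) * ((1 - \<beta>) / (4 * (S + 1)))" using z S by (intro mult_mono) (auto simp: \<rho>_def)
      also have "\<dots> = (1 - \<beta>) / 4"
      proof -
        have "T * (x / (4 * T)) = x / 4" if "T > 0" for x T :: real using that by simp
        from this[of "S + 1"] show ?thesis using S by simp
      qed
      finally show "S * cmod z \<le> (1 - \<beta>) / 4" .
    qed simp
    finally have "Re (\<Sum>k=3..d+1. t k * z ^ k) \<le> (1 - \<beta>) / 4 * (cmod z)\<^sup>2"
      using complex_Re_le_cmod order.trans by blast
    moreover have "2 * Re (t 2 * z\<^sup>2) \<le> \<beta> * (cmod z)\<^sup>2"
      using complex_Re_le_cmod[of "t 2 * z\<^sup>2"] by (simp add: norm_mult norm_power \<beta>_def)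
    ultimately show ?thesis unfolding moment_potential_def split by (simp add: field_simps)
  qed
  have "compact (D - ball 0 \<rho>)" using D by (intro compact_diff) auto
  show ?thesis
  proof (cases "D - ball 0 \<rho> = {}")
    case True
    show ?thesis
      by (rule that[of "(1 - \<beta>) / 2"]) (use beta True near in auto)
  next
    case False
    obtain x where x: "x \<in> D - ball 0 \<rho>" "\<And>y. y \<in> D - ball 0 \<rho> \<Longrightarrow> moment_potential d t x \<le> moment_potential d t y"
      using continuous_attains_inf[OF \<open>compact (D - ball 0 \<rho>)\<close> False moment_potential_continuous] by blast
    have m: "moment_potential d t x > 0" using x(1) pos \<rho> by auto
    obtain R where R: "R > 0" "\<And>z. z \<in> D \<Longrightarrow> cmod z \<le> R" using compact_imp_bounded[OF D] bounded_pos by metis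
    show ?thesis
    proof (rule that[of "min ((1 - \<beta>) / 2) (moment_potential d t x / R\<^sup>2)"])
      show "0 < min ((1 - \<beta>) / 2) (moment_potential d t x / R\<^sup>2)" using beta m R by simp
      fix z assume z: "z \<in> D"
      show "min ((1 - \<beta>) / 2) (moment_potential d t x / R\<^sup>2) * (cmod z)\<^sup>2 \<le> moment_potential d t z"
      proof (cases "cmod z \<le> \<rho>")
        case True
        have "min ((1 - \<beta>) / 2) (moment_potential d t x / R\<^sup>2) * (cmod z)\<^sup>2 \<le> (1 - \<beta>) / 2 * (cmod z)\<^sup>2"
          by (intro mult_right_mono min.cobounded1 zero_le_power2)
        then show ?thesis using near[OF True] by linarith
      next
        case False
        have "min ((1 - \<beta>) / 2) (moment_potential d t x / R\<^sup>2) * (cmod z)\<^sup>2 \<le> moment_potential d t x / R\<^sup>2 * R\<^sup>2"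
          using R z m by (intro mult_mono power_mono) auto
        also have "\<dots> = moment_potential d t x" using R by simp
        also have "\<dots> \<le> moment_potential d t z" using x(2) z False by simp
        finally show ?thesis .
      qed
    qed
  qed
qed

lemma emeasure_scaled_restriction:
  fixes S :: "'a::euclidean_space set"
  assumes A: "A \<in> sets borel" and S: "S \<in> sets borel"
  shows "emeasure (scale_measure c (density lborel (indicator S))) A = c * emeasure lborel (A \<inter> S)"
proof -
  have "emeasure (density lborel (indicator S)) A = (\<integral>\<^sup>+x. indicator S x * indicator A x \<partial>lborel)"
    by (rule emeasure_density) (use A S in auto)
  also have "\<dots> = (\<integral>\<^sup>+x. indicator (A \<inter> S) x \<partial>lborel)"
    by (intro nn_integral_cong) (auto simp: indicator_def)
  also have "\<dots> = emeasure lborel (A \<inter> S)" using A S by simp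
  finally show ?thesis by (simp only: emeasure_scale_measure)
qed

context moment_curve_data
begin

text \<open>With \<open>W = ln M - u / (pi * t0)\<close> the sum V + 2 W equals
  \<open>f / t0 + 2 * ln M\<close>, so minimality of \<open>f\<close> on \<open>D\<close> and its
  constancy on \<open>\<Omega>\<close> are exactly the hypotheses of
  \<open>equilibrium_criterion\<close>.\<close>

lemma equilibrium_measure:
  assumes D: "compact D" and t0: "t0 > 0" and area: "measure lborel \<Omega> = pi * t0" and sub: "\<Omega> \<subseteq> D"
    and min: "\<And>z. z \<in> D \<Longrightarrow> f 0 \<le> f z"
  shows "is_equilibrium_measure D (\<lambda>z. 1 / t0 * moment_potential d t z)
    (scale_measure (ennreal (1 / (pi * t0))) (density lborel (indicator \<Omega>)))"
proof -
  let ?\<mu> = "scale_measure (ennreal (1 / (pi * t0))) (density lborel (indicator \<Omega>))"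
  let ?c = "ennreal (1 / (pi * t0))"
  obtain R where R: "R > 0" "\<And>z. z \<in> D \<Longrightarrow> cmod z \<le> R" using compact_imp_bounded[OF D] bounded_pos by metis
  \<comment> \<open>\<open>2 * R\<close> bounds the diameter of \<open>D\<close>; the maximum with 1
    keeps \<open>ln M\<close> non-negative.\<close>
  define M where "M = max 1 (2 * R)"
  have M: "M \<ge> 1" "cmod (z - \<zeta>) \<le> M" if "z \<in> D" "\<zeta> \<in> D" for z \<zeta>
    using norm_triangle_ineq4[of z \<zeta>] R(2)[OF that(1)] R(2)[OF that(2)] by (auto simp: M_def)
  have M1: "M \<ge> 1" by (simp add: M_def)
  interpret bounded_support D M by unfold_locales (use M M1 in auto)
  have em\<Omega>: "emeasure lborel \<Omega> = ennreal (pi * t0)" using emeasure_area[OF area t0] t0 by simp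
  have em: "emeasure ?\<mu> A = ?c * emeasure lborel (A \<inter> \<Omega>)" if "A \<in> sets borel" for A
    by (rule emeasure_scaled_restriction[OF that borel_inside])
  have nn: "(\<integral>\<^sup>+\<zeta>. g \<zeta> \<partial>?\<mu>) = ?c * (\<integral>\<^sup>+\<zeta>. g \<zeta> * indicator \<Omega> \<zeta> \<partial>lborel)" if "g \<in> borel_measurable borel" for g
    using that by (simp add: nn_integral_scale_measure nn_integral_density mult.commute)
  have cp: "?c * ennreal (pi * t0) = 1" using t0 by (simp add: ennreal_mult'[symmetric])
  have \<mu>: "?\<mu> \<in> admissible_measures D"
  proof -
    have e: "- D \<inter> \<Omega> = {}" using sub by blast
    have "emeasure ?\<mu> (- D) = ?c * emeasure lborel (- D \<inter> \<Omega>)"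
      by (rule em) (use compact_imp_closed[OF D] in auto)
    then have "emeasure ?\<mu> (- D) = 0" unfolding e by (simp only: emeasure_empty mult_zero_right)
    moreover have "emeasure ?\<mu> {z} = 0" for z
    proof -
      have "emeasure lborel ({z} \<inter> \<Omega>) \<le> emeasure lborel {z}" by (rule emeasure_mono) auto
      then have "emeasure lborel ({z} \<inter> \<Omega>) = 0" by simp
      moreover have "emeasure ?\<mu> {z} = ?c * emeasure lborel ({z} \<inter> \<Omega>)" by (rule em) simp
      ultimately show ?thesis by (simp only: mult_zero_right)
    qed
    moreover have "prob_space ?\<mu>"
    proof (rule prob_spaceI)
      have "emeasure ?\<mu> UNIV = ?c * emeasure lborel (UNIV \<inter> \<Omega>)" by (rule em) simp
      then show "emeasure ?\<mu> (space ?\<mu>) = 1"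
        unfolding space_scale_measure space_density space_lborel space_borel Int_UNIV_left em\<Omega> cp .
    qed
    ultimately show ?thesis by (simp add: admissible_measures_def)
  qed
  define W where "W = (\<lambda>z. ln M - u z / (pi * t0))"
  have fW: "1 / t0 * moment_potential d t z + 2 * W z = f z / t0 + 2 * ln M" for z
    by (simp add: W_def f_def diff_divide_distrib)
  have cu: "continuous_on A u" for A
  proof -
    have "u = (\<lambda>z. pi / 2 * (moment_potential d t z - f z))" by (simp add: f_def fun_eq_iff)
    then show ?thesis
      by (rule ssubst) (intro continuous_intros moment_potential_continuous
        continuous_on_subset[OF f_lipschitz_continuous subset_UNIV])
  qed
  have pot: "(\<integral>\<^sup>+\<zeta>. ennreal (ln (M / cmod (z - \<zeta>))) \<partial>?\<mu>) = ennreal (W z)" and W0: "0 \<le> W z" if z: "z \<in> D" for z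
  proof -
    have i1: "set_integrable lborel \<Omega> (\<lambda>\<zeta>. ln M)"
      unfolding set_integrable_def using em\<Omega> by (intro integrable_scaleR_left integrable_real_indicator) auto
    have i2: "set_integrable lborel \<Omega> (\<lambda>\<zeta>. ln (cmod (z - \<zeta>)))"
      by (rule set_integrable_ln_dist[OF borel_inside bounded_inside])
    \<comment> \<open>At \<open>\<zeta> = z\<close> the logarithm takes its conventional value at 0,
      and the claim reduces to \<open>ln M\<close> being non-negative.\<close>
    have ge: "0 \<le> ln M - ln (cmod (z - \<zeta>))" if "\<zeta> \<in> \<Omega>" for \<zeta>
    proof (cases "z = \<zeta>")
      case False
      have "ln (cmod (z - \<zeta>)) \<le> ln M"
        by (subst ln_le_cancel_iff) (use diam[OF z, of \<zeta>] that sub False M1 in auto)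
      then show ?thesis by simp
    qed (use M1 in simp)
    have val: "(LINT \<zeta>:\<Omega>|lborel. ln M - ln (cmod (z - \<zeta>))) = pi * t0 * ln M - u z"
      using set_integral_diff(2)[OF i1 i2] area em\<Omega> by (simp add: u_def set_lebesgue_integral_def)
    have "0 \<le> (LINT \<zeta>:\<Omega>|lborel. ln M - ln (cmod (z - \<zeta>)))"
      unfolding set_lebesgue_integral_def
      by (rule Bochner_Integration.integral_nonneg) (use ge in \<open>auto simp: indicator_def\<close>)
    then have p0: "0 \<le> pi * t0 * ln M - u z" unfolding val .
    have Wv: "W z = 1 / (pi * t0) * (pi * t0 * ln M - u z)" using t0 by (simp add: W_def field_simps)
    show "0 \<le> W z" unfolding Wv using p0 t0 by (intro mult_nonneg_nonneg) auto
    have "(\<integral>\<^sup>+\<zeta>. ennreal (ln (M / cmod (z - \<zeta>))) \<partial>?\<mu>) =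
        ?c * (\<integral>\<^sup>+\<zeta>. ennreal (ln (M / cmod (z - \<zeta>))) * indicator \<Omega> \<zeta> \<partial>lborel)"
      by (rule nn) measurable
    also have "(\<integral>\<^sup>+\<zeta>. ennreal (ln (M / cmod (z - \<zeta>))) * indicator \<Omega> \<zeta> \<partial>lborel) =
       (\<integral>\<^sup>+\<zeta>. ennreal (indicat_real \<Omega> \<zeta> *\<^sub>R (ln M - ln (cmod (z - \<zeta>)))) \<partial>lborel)"
    proof (rule nn_integral_cong_AE)
      show "AE \<zeta> in lborel. ennreal (ln (M / cmod (z - \<zeta>))) * indicator \<Omega> \<zeta> =
          ennreal (indicat_real \<Omega> \<zeta> *\<^sub>R (ln M - ln (cmod (z - \<zeta>))))"
        using AE_lborel_singleton[of z]
        by eventually_elim (use M1 in \<open>auto simp: indicator_def ln_div\<close>)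
    qed
    also have "\<dots> = ennreal (pi * t0 * ln M - u z)"
      unfolding val[symmetric] set_lebesgue_integral_def
      by (rule nn_integral_eq_integral)
         (use set_integral_diff(1)[OF i1 i2] ge in \<open>auto simp: set_integrable_def indicator_def\<close>)
    also have "?c * ennreal (pi * t0 * ln M - u z) = ennreal (W z)"
      unfolding Wv using t0 by (intro ennreal_mult'[symmetric]) auto
    finally show "(\<integral>\<^sup>+\<zeta>. ennreal (ln (M / cmod (z - \<zeta>))) \<partial>?\<mu>) = ennreal (W z)" .
  qed
  show ?thesis
  proof (rule equilibrium_criterion[OF D \<mu> _ _ W0 pot])
    show "continuous_on D (\<lambda>z. 1 / t0 * moment_potential d t z)"
      by (intro continuous_intros moment_potential_continuous)
    show "continuous_on D W" unfolding W_def using t0 by (intro continuous_intros cu) auto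
    show "f 0 / t0 + 2 * ln M \<le> 1 / t0 * moment_potential d t z + 2 * W z" if "z \<in> D" for z
      unfolding fW using min[OF that] t0 by (simp add: divide_right_mono)
    have "- \<Omega> \<in> null_sets ?\<mu>"
    proof (rule null_setsI)
      have "emeasure ?\<mu> (- \<Omega>) = ?c * emeasure lborel (- \<Omega> \<inter> \<Omega>)" by (rule em) simp
      then show "emeasure ?\<mu> (- \<Omega>) = 0" by (simp only: Compl_disjoint2 emeasure_empty mult_zero_right)
    qed simp
    from AE_not_in[OF this] show "AE z in ?\<mu>. 1 / t0 * moment_potential d t z + 2 * W z = f 0 / t0 + 2 * ln M"
      by eventually_elim (simp only: fW, simp add: f_inside)
  qed
qed

end

text \<open>An open null set is empty, so the first interior lies in the closure of the second. A
  point of it on the second curve would be a limit of exterior points of that curve; the first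
  interior, being open, would contain one of these, outside that closure.\<close>

lemma jordan_inside_subset:
  fixes p q :: "real \<Rightarrow> complex"
  assumes p: "simple_path p" "pathfinish p = pathstart p" and q: "simple_path q" "pathfinish q = pathstart q"
    and null: "emeasure lborel (inside (path_image p) - closure (inside (path_image q))) = 0"
  shows "inside (path_image p) \<subseteq> inside (path_image q)"
proof -
  let ?P = "inside (path_image p)" and ?Q = "inside (path_image q)"
  note Jp = Jordan_inside_outside[OF p] and Jq = Jordan_inside_outside[OF q]
  have op: "open (?P - closure ?Q)" using Jp by (intro open_Diff) auto
  have "?P - closure ?Q = {}"
  proof (rule ccontr)
    assume "?P - closure ?Q \<noteq> {}"
    then obtain x e where "e > 0" "ball x e \<subseteq> ?P - closure ?Q" using op open_contains_ball by blast
    then have "emeasure lborel (ball x e) \<le> 0"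
      using emeasure_mono[of "ball x e" "?P - closure ?Q" lborel] null op by auto
    then show False using \<open>e > 0\<close> by (simp add: emeasure_ball_complex)
  qed
  then have cl: "?P \<subseteq> closure ?Q" by blast
  have fr: "frontier ?Q = path_image q" "frontier (outside (path_image q)) = path_image q" using Jq by auto
  show ?thesis
  proof
    fix x assume x: "x \<in> ?P"
    show "x \<in> ?Q"
    proof (rule ccontr)
      assume "x \<notin> ?Q"
      then have "x \<in> frontier ?Q" using cl x Jq by (auto simp: frontier_def interior_open)
      then have "x \<in> closure (outside (path_image q))" using fr by (auto simp: frontier_def)
      then have "?P \<inter> closure (outside (path_image q)) \<noteq> {}" using x by blast
      then obtain y where y: "y \<in> outside (path_image q)" "y \<in> ?P"
        using open_Int_closure_eq_empty[of ?P "outside (path_image q)"] Jp by blast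
      have "closure ?Q = ?Q \<union> path_image q" using closure_Un_frontier[of ?Q] fr by simp
      then have "y \<in> ?Q \<union> path_image q" using cl y by blast
      then show False using y(1) Jq outside_no_overlap by blast
    qed
  qed
qed

theorem theorem4p1:
  fixes d :: nat and t :: "nat \<Rightarrow> complex" and D :: "complex set"
  assumes "t 1 = 0" and "cmod (t 2) < 1 / 2" and "\<forall>k>d+1. t k = 0"
    and "compact_domain D" and "0 \<in> interior D"
    and "\<forall>z\<in>D - {0}. moment_potential d t z > 0"
  shows "\<exists>\<delta>>0. \<forall>t0::real. 0 < t0 \<and> t0 < \<delta> \<longrightarrow>
    (\<exists>!\<gamma>. polynomial_curve_with_moments d t0 t \<gamma>) \<and>
    (\<forall>\<gamma>. polynomial_curve_with_moments d t0 t \<gamma> \<longrightarrow>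
       is_equilibrium_measure D (\<lambda>z. 1 / t0 * moment_potential d t z)
         (scale_measure (ennreal (1 / (pi * t0))) (density lborel (indicator (inside \<gamma>)))))"
proof -
  interpret moment_data d t by unfold_locales (use assms in auto)
  have D: "compact D" using assms(4) by (simp add: compact_domain_def)
  obtain c where c: "c > 0" "\<And>z. z \<in> D \<Longrightarrow> c * (cmod z)\<^sup>2 \<le> moment_potential d t z"
    using moment_potential_lower_bound[OF D assms(6)] by metis
  obtain \<delta>1 C where \<delta>1: "\<delta>1 > 0" and min: "\<And>t0 r a. 0 < t0 \<Longrightarrow> t0 < \<delta>1 \<Longrightarrow> moment_curve d r a t \<Longrightarrow>
    measure lborel (inside (path_image (laurent_map d r a \<circ> circle_point))) = pi * t0 \<Longrightarrow>
    inside (path_image (laurent_map d r a \<circ> circle_point)) \<subseteq> cball 0 (C * sqrt t0) \<and>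
    (\<forall>z. c * (cmod z)\<^sup>2 \<le> moment_potential d t z \<longrightarrow>
      moment_curve_data.f d t r a 0 \<le> moment_curve_data.f d t r a z)"
    by (rule effective_potential_min[OF c(1)]) blast
  obtain \<delta>2 where \<delta>2: "\<delta>2 > 0" "\<And>t0. 0 < t0 \<Longrightarrow> t0 < \<delta>2 \<Longrightarrow> \<exists>\<gamma>. polynomial_curve_with_moments d t0 t \<gamma>"
    using curve_exists by metis
  obtain \<rho> where \<rho>: "\<rho> > 0" "cball 0 \<rho> \<subseteq> D" using assms(5) mem_interior_cball by blast
  \<comment> \<open>The last term gives \<open>C * sqrt t0\<close> at most \<open>\<rho>\<close>,
    which places the interior of the curve inside \<open>D\<close>; \<open>\<bar>C\<bar> + 1\<close>
    guards against a \<open>C\<close> that is not positive.\<close>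
  define \<delta> where "\<delta> = min (min \<delta>1 \<delta>2) ((\<rho> / (\<bar>C\<bar> + 1))\<^sup>2)"
  have \<delta>: "\<delta> > 0" using \<delta>1 \<delta>2(1) \<rho>(1) by (simp add: \<delta>_def)
  have main: "(\<exists>!\<gamma>. polynomial_curve_with_moments d t0 t \<gamma>) \<and>
    (\<forall>\<gamma>. polynomial_curve_with_moments d t0 t \<gamma> \<longrightarrow>
       is_equilibrium_measure D (\<lambda>z. 1 / t0 * moment_potential d t z)
         (scale_measure (ennreal (1 / (pi * t0))) (density lborel (indicator (inside \<gamma>)))))"
    if t0: "0 < t0" "t0 < \<delta>" for t0
  proof -
    let ?\<mu> = "\<lambda>\<gamma>. scale_measure (ennreal (1 / (pi * t0))) (density lborel (indicator (inside \<gamma>)))"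
    have C: "C * sqrt t0 \<le> \<rho>"
    proof -
      have "sqrt t0 \<le> \<rho> / (\<bar>C\<bar> + 1)" using t0 \<rho>(1) by (intro real_le_lsqrt) (auto simp: \<delta>_def)
      then have "(\<bar>C\<bar> + 1) * sqrt t0 \<le> \<rho>" by (simp add: pos_le_divide_eq mult.commute add_nonneg_pos)
      moreover have "C * sqrt t0 \<le> (\<bar>C\<bar> + 1) * sqrt t0" using t0 by (intro mult_right_mono) auto
      ultimately show ?thesis by linarith
    qed
    have eq: "is_equilibrium_measure D (\<lambda>z. 1 / t0 * moment_potential d t z) (?\<mu> \<gamma>)"
      if \<gamma>: "polynomial_curve_with_moments d t0 t \<gamma>" for \<gamma>
    proof -
      obtain r a where ra: "moment_curve d r a t" "\<gamma> = path_image (laurent_map d r a \<circ> circle_point)"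
        "measure lborel (inside \<gamma>) = pi * t0"
        by (rule polynomial_curve_with_moments_imp[OF \<gamma> assms(3)])
      interpret moment_curve d r a t by fact
      interpret moment_curve_data d t r a ..
      note area = ra(3)[unfolded ra(2)]
      have m: "\<Omega> \<subseteq> cball 0 (C * sqrt t0)" "\<forall>z. c * (cmod z)\<^sup>2 \<le> moment_potential d t z \<longrightarrow> f 0 \<le> f z"
        using min[OF t0(1) _ ra(1) area] t0(2) by (auto simp: \<delta>_def)
      have "\<Omega> \<subseteq> D" using m(1) C \<rho>(2) by fastforce
      then show ?thesis unfolding ra(2)
        by (rule equilibrium_measure[OF D t0(1) area]) (use m(2) c(2) in blast)
    qed
    have "\<gamma>1 = \<gamma>2"
      if \<gamma>: "polynomial_curve_with_moments d t0 t \<gamma>1" "polynomial_curve_with_moments d t0 t \<gamma>2" for \<gamma>1 \<gamma>2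
    proof -
      \<comment> \<open>Both measures are equilibrium measures of the same problem. Their equality
        determines the interiors up to null sets, then exactly because these are Jordan domains, and
        the curves are their frontiers.\<close>
      have \<mu>: "?\<mu> \<gamma>1 = ?\<mu> \<gamma>2"
        using eq[OF \<gamma>(1)] eq[OF \<gamma>(2)] unfolding is_equilibrium_measure_def by blast
      have path: "\<exists>p. simple_path p \<and> pathfinish p = pathstart p \<and> path_image p = \<gamma>"
        if pc: "polynomial_curve_with_moments d t0 t \<gamma>" for \<gamma>
      proof -
        obtain r a where ra: "moment_curve d r a t" "\<gamma> = path_image (laurent_map d r a \<circ> circle_point)"
          by (rule polynomial_curve_with_moments_imp[OF pc assms(3)])
        interpret moment_curve d r a t by fact
        show ?thesis using simple closed ra(2) by blast
      qed
      obtain p1 p2 where p1: "simple_path p1" "pathfinish p1 = pathstart p1" "path_image p1 = \<gamma>1"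
        and p2: "simple_path p2" "pathfinish p2 = pathstart p2" "path_image p2 = \<gamma>2"
        using path[OF \<gamma>(1)] path[OF \<gamma>(2)] by blast
      note J1 = Jordan_inside_outside[OF p1(1,2), unfolded p1(3)]
        and J2 = Jordan_inside_outside[OF p2(1,2), unfolded p2(3)]
      have same: "emeasure lborel (A \<inter> inside \<gamma>1) = emeasure lborel (A \<inter> inside \<gamma>2)" if A: "A \<in> sets borel" for A
      proof -
        have "emeasure (?\<mu> \<gamma>) A = ennreal (1 / (pi * t0)) * emeasure lborel (A \<inter> inside \<gamma>)"
          if "open (inside \<gamma>)" for \<gamma>
          using emeasure_scaled_restriction[OF A borel_open[OF that]] .
        then have "ennreal (1 / (pi * t0)) * emeasure lborel (A \<inter> inside \<gamma>1) =
            ennreal (1 / (pi * t0)) * emeasure lborel (A \<inter> inside \<gamma>2)"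
          using \<mu> J1 J2 by metis
        then show ?thesis using t0(1) by (subst (asm) ennreal_mult_cancel_left) auto
      qed
      have "inside \<gamma>1 \<subseteq> inside \<gamma>2"
      proof (rule jordan_inside_subset[OF p1(1,2) p2(1,2), unfolded p1(3) p2(3)])
        have "emeasure lborel ((- closure (inside \<gamma>2)) \<inter> inside \<gamma>1) = emeasure lborel ((- closure (inside \<gamma>2)) \<inter> inside \<gamma>2)"
          by (rule same) auto
        also have "(- closure (inside \<gamma>2)) \<inter> inside \<gamma>2 = {}" using closure_subset by blast
        finally show "emeasure lborel (inside \<gamma>1 - closure (inside \<gamma>2)) = 0"
          by (simp only: emeasure_empty Diff_eq Int_commute)
      qed
      moreover have "inside \<gamma>2 \<subseteq> inside \<gamma>1"
      proof (rule jordan_inside_subset[OF p2(1,2) p1(1,2), unfolded p1(3) p2(3)])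
        have "emeasure lborel ((- closure (inside \<gamma>1)) \<inter> inside \<gamma>1) = emeasure lborel ((- closure (inside \<gamma>1)) \<inter> inside \<gamma>2)"
          by (rule same) auto
        moreover have "(- closure (inside \<gamma>1)) \<inter> inside \<gamma>1 = {}" using closure_subset by blast
        ultimately show "emeasure lborel (inside \<gamma>2 - closure (inside \<gamma>1)) = 0"
          by (simp only: emeasure_empty Diff_eq Int_commute)
      qed
      ultimately have "inside \<gamma>1 = inside \<gamma>2" by blast
      then show "\<gamma>1 = \<gamma>2" using J1 J2 by metis
    qed
    moreover have "\<exists>\<gamma>. polynomial_curve_with_moments d t0 t \<gamma>"
      by (rule \<delta>2(2)) (use t0 in \<open>auto simp: \<delta>_def\<close>)
    ultimately show ?thesis using eq by blast
  qed
  show ?thesis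
    by (rule exI[of _ \<delta>], rule conjI[OF \<delta>], intro allI impI, rule main) simp_all
qed

end
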